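(* Let $\kappa>0$, let $D$ be a polygon with corners $(p_1,\beta_1),\dots,(p_n,\beta_n)$, let $z_k$ be the image of $p_k$ under a conformal map of $D$ onto the upper half-plane $\mathbb{H}$, with all $z_k$ finite and distinct from $0$, and set $\rho_k=\frac{\kappa}{2}\beta_k$. Let $(W_t,Z^1_t,\dots,Z^n_t)$ solve the $\mathrm{SLE}(\kappa,\rho)$ system started from $(0,z_1,\dots,z_n)$, and let $SC_t$, $f_t$, $\sigma$ be as defined in the context. Then: (i) The process $U_t\equiv f_t(W_t)$ is a martingale for $t<\sigma$. (ii) If $$A_t\equiv\kappa\int_0^t\bigl(SC_s'(W_s)\bigr)^2\,ds$$ and $\tau(t)$ is defined by $A_{\tau(t)}=t$, then $t\mapsto U_{\tau(t)}$ is a standard Brownian motion. (iii) The motion of the corners of the polygon $f_t(\mathbb{H})$ is differentiable. These results still hold if one starts from an arbitrary $\mathrm{SLE}(\kappa,\rho)$, i.e. from an arbitrary choice of points $z_1,\dots,z_n$ and weights $\rho_1,\dots,\rho_n$ (with $\beta_k=2\rho_k/\kappa$). In that case the Schwarz--Christoffel map need no longer be injective, but it still maps the intervals $[z_k,z_{k+1}]$ onto straight line segments, and its image is interpreted as a Riemannian domain via the Riemann surface associated to the analytic function.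
   Context: **Polygons.** A corner $(p_k,\beta_k)$ of a polygon consists of a vertex (prime end) $p_k$ together with its exterior angle $\beta_k\pi$; corners are listed in positive cyclic order, and $\beta_1+\dots+\beta_n=2$. Slits ($\beta_k=-1$) are allowed, and the polygon may be unbounded if angles at $\infty$ are suitably defined. **SLE$(\kappa,\rho)$ system.** With $B$ a one-dimensional standard Brownian motion, $$dW_t=\sqrt{\kappa}\,dB_t+\sum_{k=1}^n\frac{\rho_k}{W_t-Z^k_t}\,dt,\qquad dZ^k_t=\frac{2}{Z^k_t-W_t}\,dt,\qquad W_0=0,\ Z^k_0=z_k .$$ The stopping time $\sigma$ is $\sup\{t: W_s,Z^1_s,\dots,Z^n_s \text{ are all distinct for } 0\le s\le t\}$. **Schwarz--Christoffel maps.** For $z\in\mathbb{H}$, $$SC_t(z)=\int_0^z\prod_{k=1}^n(\zeta-Z^k_t)^{-\beta_k}\,d\zeta ,$$ where the powers denote analytic branches in $\mathbb{H}$. $SC_t$ extends continuously to the real axis with the points $Z^k_t$ removed and is differentiable there as a function of $t$. As long as $W_s\ne Z^1_s,\dots,Z^n_s$ for $s\in[0,t]$, set $$f_t(z)=SC_t(z)-\int_0^t(\partial_sSC_s)(W_s)\,ds ,$$ where $(\partial_sSC_s)(W_s)$ is the $s$-derivative of $SC_s(x)$ at fixed $x$, evaluated at $x=W_s$. The map $f_t$ sends $\mathbb{H}$ onto a polygon.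
   Formalization: Part (ii) is asserted for branches of the powers (up to a unimodular factor) making SC_0'(0) real, since otherwise A_t is not a positive real clock and τ is undefined; the interpretation of the image as a Riemannian domain is not stated. *)

theory Defs
  imports "HOL-Probability.Probability" "HOL-Complex_Analysis.Complex_Analysis"
begin

section \<open>Filtered probability spaces, Brownian motion, martingales\<close>

text \<open>Time is \<open>[0, \<infinity>)\<close> inside \<^typ>\<open>real\<close>; nothing is ever asked of a process at a negative time.\<close>

definition filtered_space :: "'a measure \<Rightarrow> (real \<Rightarrow> 'a measure) \<Rightarrow> bool" where
  "filtered_space M F \<longleftrightarrow>
     prob_space M \<and> filtration (space M) F \<and> (\<forall>t. subalgebra M (F t))"

text \<open>Completeness is needed because path properties are only required almost surely.\<close>

definition complete_filtered_space :: "'a measure \<Rightarrow> (real \<Rightarrow> 'a measure) \<Rightarrow> bool" where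
  "complete_filtered_space M F \<longleftrightarrow>
     filtered_space M F \<and> complete_measure M \<and> null_sets M \<subseteq> sets (F 0)"

definition brownian_motion ::
    "'a measure \<Rightarrow> (real \<Rightarrow> 'a measure) \<Rightarrow> (real \<Rightarrow> 'a \<Rightarrow> real) \<Rightarrow> bool" where
  "brownian_motion M F B \<longleftrightarrow>
     (\<forall>t\<ge>0. B t \<in> borel_measurable (F t)) \<and>
     (AE \<omega> in M. B 0 \<omega> = 0 \<and> continuous_on {0..} (\<lambda>t. B t \<omega>)) \<and>
     (\<forall>s t. 0 \<le> s \<and> s < t \<longrightarrow>
        distributed M lborel (\<lambda>\<omega>. B t \<omega> - B s \<omega>)
          (\<lambda>x. ennreal (normal_density 0 (sqrt (t - s)) x)) \<and>
        prob_space.indep_set M (sets (F s))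
          (sets (vimage_algebra (space M) (\<lambda>\<omega>. B t \<omega> - B s \<omega>) borel)))"

definition martingale ::
    "'a measure \<Rightarrow> (real \<Rightarrow> 'a measure) \<Rightarrow> (real \<Rightarrow> 'a \<Rightarrow> complex) \<Rightarrow> bool" where
  "martingale M F X \<longleftrightarrow>
     (\<forall>t\<ge>0. X t \<in> borel_measurable (F t) \<and> integrable M (X t)) \<and>
     (\<forall>s t. 0 \<le> s \<and> s \<le> t \<longrightarrow>
        (\<forall>E\<in>sets (F s). (LINT \<omega>:E|M. X t \<omega>) = (LINT \<omega>:E|M. X s \<omega>)))"

text \<open>A martingale on the stochastic interval \<open>[0, \<sigma>)\<close>, the process being undefined from \<open>\<sigma>\<close> on:
  stopping it along suitable stopping times that increase to \<open>\<sigma>\<close> gives martingales.\<close>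

definition martingale_before ::
    "'a measure \<Rightarrow> (real \<Rightarrow> 'a measure) \<Rightarrow> ('a \<Rightarrow> ereal) \<Rightarrow> (real \<Rightarrow> 'a \<Rightarrow> complex) \<Rightarrow> bool" where
  "martingale_before M F \<sigma> X \<longleftrightarrow>
     (\<exists>T :: nat \<Rightarrow> 'a \<Rightarrow> real.
        (\<forall>m. stopping_time F (T m) \<and> (\<forall>\<omega>\<in>space M. 0 \<le> T m \<omega>)) \<and>
        (AE \<omega> in M. incseq (\<lambda>m. T m \<omega>) \<and> (\<forall>m. ereal (T m \<omega>) < \<sigma> \<omega>) \<and>
                    (\<lambda>m. ereal (T m \<omega>)) \<longlonglongrightarrow> \<sigma> \<omega>) \<and>
        (\<forall>m. martingale M F (\<lambda>t \<omega>. X (min t (T m \<omega>)) \<omega>)))"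

text \<open>A process that exists only on a random time interval \<open>[0, L)\<close> is a standard Brownian motion
  there: on an extension \<open>N\<close> of the probability space it is the restriction to \<open>[0, L)\<close> of a Brownian
  motion for which \<open>L\<close> is a stopping time. If \<open>L = \<infinity>\<close> almost surely, it is a standard
  Brownian motion outright. The process is complex-valued, and the equation with \<open>of_real\<close> says in
  particular that its values are real.\<close>

definition brownian_motion_before ::
    "'a measure \<Rightarrow> ('a \<Rightarrow> ereal) \<Rightarrow> (real \<Rightarrow> 'a \<Rightarrow> complex) \<Rightarrow> bool" where
  "brownian_motion_before M L X \<longleftrightarrow>
     (\<exists>(N :: ('a \<times> 'a) measure) G b pr.
        filtered_space N G \<and> brownian_motion N G b \<and>
        pr \<in> measurable N M \<and> distr N M pr = M \<and>
        (\<forall>t\<ge>0. {x \<in> space N. L (pr x) \<le> ereal t} \<in> sets (G t)) \<and>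
        (AE x in N. \<forall>t\<ge>0. ereal t < L (pr x) \<longrightarrow> X t (pr x) = complex_of_real (b t x)))"


section \<open>The SLE(kappa, rho) system\<close>

definition all_distinct :: "nat \<Rightarrow> real \<Rightarrow> (nat \<Rightarrow> real) \<Rightarrow> bool" where
  "all_distinct n w zs \<longleftrightarrow> inj_on zs {1..n} \<and> (\<forall>k\<in>{1..n}. zs k \<noteq> w)"

definition collision_time :: "nat \<Rightarrow> (real \<Rightarrow> real) \<Rightarrow> (nat \<Rightarrow> real \<Rightarrow> real) \<Rightarrow> ereal" where
  "collision_time n w Z = Sup {ereal t | t. 0 \<le> t \<and> (\<forall>s\<in>{0..t}. all_distinct n (w s) (\<lambda>k. Z k s))}"

definition interval_before :: "ereal \<Rightarrow> real set" where
  "interval_before \<sigma> = {t. 0 \<le> t \<and> ereal t < \<sigma>}"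

text \<open>The noise of the driving equation is additive, so the integrated equations contain no
  stochastic integral and are imposed path by path.\<close>

definition sle_path ::
    "real \<Rightarrow> nat \<Rightarrow> (nat \<Rightarrow> real) \<Rightarrow> (nat \<Rightarrow> real) \<Rightarrow> (real \<Rightarrow> real) \<Rightarrow>
     (real \<Rightarrow> real) \<Rightarrow> (nat \<Rightarrow> real \<Rightarrow> real) \<Rightarrow> bool" where
  "sle_path \<kappa> n \<rho> z b w Z \<longleftrightarrow>
     w 0 = 0 \<and> (\<forall>k\<in>{1..n}. Z k 0 = z k) \<and>
     continuous_on (interval_before (collision_time n w Z)) w \<and>
     (\<forall>k\<in>{1..n}. continuous_on (interval_before (collision_time n w Z)) (Z k)) \<and>
     (\<forall>t\<in>interval_before (collision_time n w Z).
        w t = sqrt \<kappa> * b t + integral {0..t} (\<lambda>s. \<Sum>k=1..n. \<rho> k / (w s - Z k s)) \<and>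
        (\<forall>k\<in>{1..n}. Z k t = z k + integral {0..t} (\<lambda>s. 2 / (Z k s - w s))))"

text \<open>The values of a path from the collision time on are irrelevant. So that they cannot end the
  solution too early, the path must have no limit with distinct points at a finite collision
  time, i.e. the solution cannot be continued (for a path that is continuous up to and including
  that time, this is automatic). In the degenerate case of collision time \<open>0\<close> the filter below is
  trivial and the condition fails.\<close>

definition not_continuable :: "nat \<Rightarrow> (real \<Rightarrow> real) \<Rightarrow> (nat \<Rightarrow> real \<Rightarrow> real) \<Rightarrow> bool" where
  "not_continuable n w Z \<longleftrightarrow>
     (\<forall>\<sigma>. collision_time n w Z = ereal \<sigma> \<longrightarrow>
        \<not> (\<exists>w' zs. all_distinct n w' zs \<and> (w \<longlongrightarrow> w') (at \<sigma> within {0..<\<sigma>}) \<and>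
                   (\<forall>k\<in>{1..n}. (Z k \<longlongrightarrow> zs k) (at \<sigma> within {0..<\<sigma>}))))"

definition sle_kappa_rho ::
    "'a measure \<Rightarrow> (real \<Rightarrow> 'a measure) \<Rightarrow> (real \<Rightarrow> 'a \<Rightarrow> real) \<Rightarrow> real \<Rightarrow> nat \<Rightarrow>
     (nat \<Rightarrow> real) \<Rightarrow> (nat \<Rightarrow> real) \<Rightarrow> (real \<Rightarrow> 'a \<Rightarrow> real) \<Rightarrow> (nat \<Rightarrow> real \<Rightarrow> 'a \<Rightarrow> real) \<Rightarrow> bool" where
  "sle_kappa_rho M F B \<kappa> n \<rho> z W Z \<longleftrightarrow>
     (\<forall>t\<ge>0. W t \<in> borel_measurable (F t) \<and> (\<forall>k\<in>{1..n}. Z k t \<in> borel_measurable (F t))) \<and>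
     (AE \<omega> in M. sle_path \<kappa> n \<rho> z (\<lambda>t. B t \<omega>) (\<lambda>t. W t \<omega>) (\<lambda>k t. Z k t \<omega>) \<and>
                  not_continuable n (\<lambda>t. W t \<omega>) (\<lambda>k t. Z k t \<omega>))"

definition sle_lifetime ::
    "nat \<Rightarrow> (real \<Rightarrow> 'a \<Rightarrow> real) \<Rightarrow> (nat \<Rightarrow> real \<Rightarrow> 'a \<Rightarrow> real) \<Rightarrow> 'a \<Rightarrow> ereal" where
  "sle_lifetime n W Z \<omega> = collision_time n (\<lambda>t. W t \<omega>) (\<lambda>k t. Z k t \<omega>)"


section \<open>Schwarz--Christoffel maps\<close>

definition upper_half_plane :: "complex set" where
  "upper_half_plane = {z. Im z > 0}"

text \<open>Value at the real point \<open>x\<close> of the continuous extension of a function on the upper half-plane.\<close>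

definition boundary_value :: "(complex \<Rightarrow> complex) \<Rightarrow> real \<Rightarrow> complex" where
  "boundary_value g x = Lim (at (complex_of_real x) within upper_half_plane) g"

text \<open>On the closed upper half-plane without \<open>0\<close>, the principal power is continuous and it is analytic
  in the open half-plane. Two products of analytic branches differ by a unimodular
  constant, and \<open>c\<close> stands for the choice of branches.\<close>

definition sc_integrand ::
    "nat \<Rightarrow> (nat \<Rightarrow> real) \<Rightarrow> complex \<Rightarrow> (nat \<Rightarrow> real) \<Rightarrow> complex \<Rightarrow> complex" where
  "sc_integrand n \<beta> c zs \<zeta> =
     c * (\<Prod>k=1..n. (\<zeta> - complex_of_real (zs k)) powr complex_of_real (- \<beta> k))"

definition SC :: "nat \<Rightarrow> (nat \<Rightarrow> real) \<Rightarrow> complex \<Rightarrow> (nat \<Rightarrow> real) \<Rightarrow> complex \<Rightarrow> complex" where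
  "SC n \<beta> c zs z = contour_integral (linepath 0 z) (sc_integrand n \<beta> c zs)"

definition SC_time_derivative ::
    "nat \<Rightarrow> (nat \<Rightarrow> real) \<Rightarrow> complex \<Rightarrow> (nat \<Rightarrow> real \<Rightarrow> real) \<Rightarrow> real \<Rightarrow> real \<Rightarrow> complex" where
  "SC_time_derivative n \<beta> c Z s x =
     vector_derivative (\<lambda>r. boundary_value (SC n \<beta> c (\<lambda>k. Z k r)) x) (at s within {0..})"

definition f_map ::
    "nat \<Rightarrow> (nat \<Rightarrow> real) \<Rightarrow> complex \<Rightarrow> (real \<Rightarrow> real) \<Rightarrow> (nat \<Rightarrow> real \<Rightarrow> real) \<Rightarrow>
     real \<Rightarrow> complex \<Rightarrow> complex" where
  "f_map n \<beta> c w Z t z =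
     SC n \<beta> c (\<lambda>k. Z k t) z - integral {0..t} (\<lambda>s. SC_time_derivative n \<beta> c Z s (w s))"

definition U_process ::
    "nat \<Rightarrow> (nat \<Rightarrow> real) \<Rightarrow> complex \<Rightarrow> (real \<Rightarrow> 'a \<Rightarrow> real) \<Rightarrow> (nat \<Rightarrow> real \<Rightarrow> 'a \<Rightarrow> real) \<Rightarrow>
     real \<Rightarrow> 'a \<Rightarrow> complex" where
  "U_process n \<beta> c W Z t \<omega> =
     boundary_value (f_map n \<beta> c (\<lambda>t. W t \<omega>) (\<lambda>k t. Z k t \<omega>) t) (W t \<omega>)"


section \<open>The time change\<close>

definition A_process ::
    "real \<Rightarrow> nat \<Rightarrow> (nat \<Rightarrow> real) \<Rightarrow> complex \<Rightarrow> (real \<Rightarrow> 'a \<Rightarrow> real) \<Rightarrow> (nat \<Rightarrow> real \<Rightarrow> 'a \<Rightarrow> real) \<Rightarrow>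
     real \<Rightarrow> 'a \<Rightarrow> complex" where
  "A_process \<kappa> n \<beta> c W Z t \<omega> =
     complex_of_real \<kappa> *
     integral {0..t} (\<lambda>s. (boundary_value (deriv (SC n \<beta> c (\<lambda>k. Z k s \<omega>))) (W s \<omega>))\<^sup>2)"

definition A_total ::
    "real \<Rightarrow> nat \<Rightarrow> (nat \<Rightarrow> real) \<Rightarrow> complex \<Rightarrow> (real \<Rightarrow> 'a \<Rightarrow> real) \<Rightarrow> (nat \<Rightarrow> real \<Rightarrow> 'a \<Rightarrow> real) \<Rightarrow>
     'a \<Rightarrow> ereal" where
  "A_total \<kappa> n \<beta> c W Z \<omega> =
     Sup ((\<lambda>t. ereal (Re (A_process \<kappa> n \<beta> c W Z t \<omega>))) ` interval_before (sle_lifetime n W Z \<omega>))"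

definition tau_process ::
    "real \<Rightarrow> nat \<Rightarrow> (nat \<Rightarrow> real) \<Rightarrow> complex \<Rightarrow> (real \<Rightarrow> 'a \<Rightarrow> real) \<Rightarrow> (nat \<Rightarrow> real \<Rightarrow> 'a \<Rightarrow> real) \<Rightarrow>
     real \<Rightarrow> 'a \<Rightarrow> real" where
  "tau_process \<kappa> n \<beta> c W Z t \<omega> =
     (THE s. s \<in> interval_before (sle_lifetime n W Z \<omega>) \<and>
             A_process \<kappa> n \<beta> c W Z s \<omega> = complex_of_real t)"

text \<open>\<open>SC\<^sub>t'(W\<^sub>t)\<close> has a constant argument, which depends on the branches. So \<open>A\<close> is a real,
  increasing clock only for branches that make \<open>SC\<^sub>0'(0)\<close>, and with it every \<open>SC\<^sub>t'(W\<^sub>t)\<close>, real.\<close>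

definition real_branch :: "nat \<Rightarrow> (nat \<Rightarrow> real) \<Rightarrow> complex \<Rightarrow> (nat \<Rightarrow> real) \<Rightarrow> bool" where
  "real_branch n \<beta> c z \<longleftrightarrow> boundary_value (deriv (SC n \<beta> c z)) 0 \<in> \<real>"


section \<open>Corners and edges of the image\<close>

text \<open>The corner of \<open>f\<^sub>t(\<H>)\<close> that corresponds to the prime end \<open>Z\<^sup>k\<^sub>t\<close> is the boundary value of
  \<open>f\<^sub>t\<close>; this does not need \<open>f\<^sub>t\<close> to be injective. It is a finite point if and only if \<open>\<beta>\<^sub>k < 1\<close>, and
  otherwise it stays at \<open>\<infinity>\<close>.\<close>

definition corner_motion_differentiable ::
    "nat \<Rightarrow> (nat \<Rightarrow> real) \<Rightarrow> complex \<Rightarrow> (real \<Rightarrow> real) \<Rightarrow> (nat \<Rightarrow> real \<Rightarrow> real) \<Rightarrow> nat \<Rightarrow> bool" where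
  "corner_motion_differentiable n \<beta> c w Z k \<longleftrightarrow>
     (\<forall>t\<in>interval_before (collision_time n w Z).
        if \<beta> k < 1
        then (\<exists>l. (f_map n \<beta> c w Z t \<longlongrightarrow> l) (at (complex_of_real (Z k t)) within upper_half_plane)) \<and>
             (\<lambda>r. boundary_value (f_map n \<beta> c w Z r) (Z k r)) differentiable (at t within {0..})
        else filterlim (f_map n \<beta> c w Z t) at_infinity
               (at (complex_of_real (Z k t)) within upper_half_plane))"

text \<open>If the \<open>\<beta>\<^sub>k\<close> do not add up to \<open>2\<close>, the image has one more corner, with exterior
  angle \<open>(2 - \<Sum>\<beta>\<^sub>k)\<pi>\<close>, at the image of \<open>\<infinity>\<close>.\<close>

definition half_plane_infinity :: "complex filter" where
  "half_plane_infinity = inf at_infinity (principal upper_half_plane)"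

definition infinity_corner_motion_differentiable ::
    "nat \<Rightarrow> (nat \<Rightarrow> real) \<Rightarrow> complex \<Rightarrow> (real \<Rightarrow> real) \<Rightarrow> (nat \<Rightarrow> real \<Rightarrow> real) \<Rightarrow> bool" where
  "infinity_corner_motion_differentiable n \<beta> c w Z \<longleftrightarrow>
     (\<forall>t\<in>interval_before (collision_time n w Z).
        if (\<Sum>k=1..n. \<beta> k) > 1
        then (\<exists>l. (f_map n \<beta> c w Z t \<longlongrightarrow> l) half_plane_infinity) \<and>
             (\<lambda>r. Lim half_plane_infinity (f_map n \<beta> c w Z r)) differentiable (at t within {0..})
        else filterlim (f_map n \<beta> c w Z t) at_infinity half_plane_infinity)"

text \<open>The boundary values on \<open>E\<close> trace out a straight line segment, possibly an unbounded one,
  without turning back.\<close>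

definition maps_onto_segment :: "(complex \<Rightarrow> complex) \<Rightarrow> real set \<Rightarrow> bool" where
  "maps_onto_segment g E \<longleftrightarrow>
     (\<forall>x\<in>E. \<exists>l. (g \<longlongrightarrow> l) (at (complex_of_real x) within upper_half_plane)) \<and>
     continuous_on E (boundary_value g) \<and> inj_on (boundary_value g) E \<and>
     convex (boundary_value g ` E) \<and> collinear (boundary_value g ` E)"

text \<open>Endpoints with \<open>\<beta>\<^sub>k \<ge> 1\<close>, which are sent to \<open>\<infinity>\<close>, are left out of the edges. The image of an edge
  between two neighbouring points is closed: a closed segment, a closed half-line or a line.\<close>

definition edges_straight ::
    "nat \<Rightarrow> (nat \<Rightarrow> real) \<Rightarrow> (nat \<Rightarrow> real) \<Rightarrow> (complex \<Rightarrow> complex) \<Rightarrow> bool" where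
  "edges_straight n \<beta> zs g \<longleftrightarrow>
     (let V = zs ` {1..n}; P = zs ` {k \<in> {1..n}. \<beta> k \<ge> 1} in
        (\<forall>x\<in>V. \<forall>y\<in>V. x < y \<and> {x<..<y} \<inter> V = {} \<longrightarrow>
           maps_onto_segment g ({x..y} - P) \<and> closed (boundary_value g ` ({x..y} - P))) \<and>
        (\<forall>x\<in>V. {x<..} \<inter> V = {} \<longrightarrow> maps_onto_segment g ({x..} - P)) \<and>
        (\<forall>x\<in>V. {..<x} \<inter> V = {} \<longrightarrow> maps_onto_segment g ({..x} - P)))"


section \<open>Polygons\<close>

text \<open>The boundary of a polygon is locally connected (in the Riemann sphere), so a prime end is given
  by a boundary point, with \<open>None\<close> for \<open>\<infinity>\<close>, together with a nested choice of components of the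
  intersections of the domain with the disks around that point.\<close>

type_synonym prime_end = "complex option \<times> (real \<Rightarrow> complex set)"

fun sphere_disk :: "complex option \<Rightarrow> real \<Rightarrow> complex set" where
  "sphere_disk (Some a) r = ball a r"
| "sphere_disk None r = {z. norm z > 1 / r}"

definition is_prime_end :: "complex set \<Rightarrow> prime_end \<Rightarrow> bool" where
  "is_prime_end D p \<longleftrightarrow>
     (\<forall>a. fst p = Some a \<longrightarrow> a \<notin> D) \<and>
     (\<forall>r>0. snd p r \<in> components (D \<inter> sphere_disk (fst p) r)) \<and>
     (\<forall>r r'. 0 < r \<and> r \<le> r' \<longrightarrow> snd p r \<subseteq> snd p r') \<and>
     (\<forall>r\<le>0. snd p r = {})"

text \<open>Exterior angle \<open>\<beta>\<pi>\<close>: at a finite vertex, the domain is locally a sector of opening \<open>(1 - \<beta>)\<pi>\<close>, with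
  \<open>\<beta> = -1\<close> at the tip of a slit. At \<open>\<infinity>\<close> the domain lies between two half-lines that open up at the
  asymptotic angle \<open>(\<beta> - 1)\<pi>\<close>, i.e. the interior angle \<open>(1 - \<beta>)\<pi>\<close> is counted as negative; with this
  convention the exterior angles of unbounded polygons add up to \<open>2\<pi>\<close> as well.\<close>

fun exterior_angle :: "prime_end \<Rightarrow> real \<Rightarrow> bool" where
  "exterior_angle (Some a, V) \<beta> \<longleftrightarrow>
     -1 \<le> \<beta> \<and> \<beta> < 1 \<and>
     (\<exists>\<theta>. \<exists>r\<^sub>0>0. \<forall>r\<in>{0<..r\<^sub>0}.
        V r = {a + complex_of_real s * cis t | s t.
                 0 < s \<and> s < r \<and> \<theta> < t \<and> t < \<theta> + (1 - \<beta>) * pi})"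
| "exterior_angle (None, V) \<beta> \<longleftrightarrow>
     1 \<le> \<beta> \<and> \<beta> \<le> 3 \<and>
     (\<exists>(\<theta>\<^sub>1 :: real \<Rightarrow> real) (\<theta>\<^sub>2 :: real \<Rightarrow> real) (a\<^sub>1 :: complex) (u\<^sub>1 :: complex)
        (a\<^sub>2 :: complex) (u\<^sub>2 :: complex). \<exists>r\<^sub>0>0.
        continuous_on {1 / r\<^sub>0<..} \<theta>\<^sub>1 \<and> continuous_on {1 / r\<^sub>0<..} \<theta>\<^sub>2 \<and>
        (\<forall>R>1 / r\<^sub>0. \<theta>\<^sub>1 R < \<theta>\<^sub>2 R \<and> \<theta>\<^sub>2 R \<le> \<theta>\<^sub>1 R + 2 * pi \<and>
           (\<exists>s\<ge>0. complex_of_real R * cis (\<theta>\<^sub>1 R) = a\<^sub>1 + complex_of_real s * u\<^sub>1) \<and>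
           (\<exists>s\<ge>0. complex_of_real R * cis (\<theta>\<^sub>2 R) = a\<^sub>2 + complex_of_real s * u\<^sub>2)) \<and>
        ((\<lambda>R. \<theta>\<^sub>2 R - \<theta>\<^sub>1 R) \<longlongrightarrow> (\<beta> - 1) * pi) at_top \<and>
        (\<forall>r\<in>{0<..r\<^sub>0}.
           V r = {complex_of_real R * cis t | R t. 1 / r < R \<and> \<theta>\<^sub>1 R < t \<and> t < \<theta>\<^sub>2 R}))"

text \<open>A closed convex collinear set is a segment, a half-line or a line. Every prime end that is not
  listed is flat, so it lies at a finite point.\<close>

definition polygon_with_corners ::
    "complex set \<Rightarrow> nat \<Rightarrow> (nat \<Rightarrow> prime_end) \<Rightarrow> (nat \<Rightarrow> real) \<Rightarrow> bool" where
  "polygon_with_corners D n p \<beta> \<longleftrightarrow>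
     open D \<and> D \<noteq> {} \<and> D \<noteq> UNIV \<and> simply_connected D \<and>
     (\<exists>\<S>. finite \<S> \<and> (\<forall>S\<in>\<S>. closed S \<and> convex S \<and> collinear S) \<and> frontier D = \<Union>\<S>) \<and>
     inj_on p {1..n} \<and>
     (\<forall>k\<in>{1..n}. is_prime_end D (p k) \<and> exterior_angle (p k) (\<beta> k)) \<and>
     (\<forall>q. is_prime_end D q \<and> q \<notin> p ` {1..n} \<longrightarrow> exterior_angle q 0) \<and>
     (\<Sum>k=1..n. \<beta> k) = 2"

definition conformal_onto_half_plane :: "complex set \<Rightarrow> (complex \<Rightarrow> complex) \<Rightarrow> bool" where
  "conformal_onto_half_plane D \<phi> \<longleftrightarrow> \<phi> holomorphic_on D \<and> bij_betw \<phi> D upper_half_plane"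

definition prime_end_image :: "(complex \<Rightarrow> complex) \<Rightarrow> prime_end \<Rightarrow> real \<Rightarrow> bool" where
  "prime_end_image \<phi> p x \<longleftrightarrow>
     (\<forall>e>0. \<exists>r>0. \<forall>w\<in>snd p r. dist (\<phi> w) (complex_of_real x) < e)"

text \<open>Positive cyclic order on the extended real line, i.e. increasing up to a rotation of the
  indices. Prime ends are cyclically ordered like their images under a conformal map.\<close>

definition positive_cyclic_order :: "nat \<Rightarrow> (nat \<Rightarrow> real) \<Rightarrow> bool" where
  "positive_cyclic_order n z \<longleftrightarrow>
     (\<exists>m. \<forall>i j. i < j \<and> j < n \<longrightarrow> z (Suc ((m + i) mod n)) < z (Suc ((m + j) mod n)))"

end

theory Submission
 imports Defs "HOL-Real_Asymp.Real_Asymp"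
begin

text \<open>
Up to a constant phase, \<open>SC\<^sub>t\<close> is a real function on the interval around \<open>W\<^sub>t\<close>, with derivative
\<open>g\<^sub>t(x) = \<Prod>\<bar>x - Z\<^sup>k\<^sub>t\<bar> powr (-\<beta>\<^sub>k)\<close>. Because \<open>\<rho>\<^sub>k = \<kappa>\<beta>\<^sub>k / 2\<close>, the drift \<open>d\<close> of \<open>W\<close> satisfies \<open>g d + \<kappa>/2 g' = 0\<close> at \<open>W\<^sub>t\<close>.
Since the noise is additive, a Taylor expansion of second order gives path by path
\<open>U\<^sub>v - U\<^sub>u = h\<^sub>u (B\<^sub>v - B\<^sub>u) + q\<^sub>u ((B\<^sub>v - B\<^sub>u)\<^sup>2 - (v - u)) + o((v - u) + (B\<^sub>v - B\<^sub>u)\<^sup>2)\<close>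
with \<open>h = sqrt \<kappa> g\<close> and \<open>q = \<kappa>/2 g'\<close>, and no stochastic integral is needed. Summed over dyadic partitions, the
expansion shows \<open>E exp (i\<theta>(U\<^sub>T - U\<^sub>S) + \<theta>\<^sup>2/2 (A\<^sub>T - A\<^sub>S)) = 1\<close> for bounded \<open>h\<close>, \<open>q\<close>, also conditionally
on the past of \<open>S\<close>. Its Taylor coefficients in \<open>\<theta>\<close> give the martingale property. After the time change by \<open>A\<close> it gives
independent Gaussian increments; if the clock stops at a finite time, \<open>U\<close> has a limit there and is continued by
an independent Brownian motion on \<open>M \<times> M\<close>. At a corner the substitution \<open>v powr (1 / (1 - \<beta>\<^sub>k))\<close> removes the
singularity of the integrand, so that the corner is an integral that depends differentiably on time.
\<close>

text \<open>The term with \<open>q\<close> is harmless because the centred squares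
  \<open>(B v - B u)^2 - (v - u)\<close> have mean zero given the past: over \<open>2^j\<close>
  dyadic intervals the variance of their weighted sum is of order \<open>2^-j\<close>, which is
  summable, so the sum vanishes almost surely in the limit. Stopping times enter such a sum merely
  as switches on its coefficients. The obstacle that shapes the probabilistic part is that all
  values from \<open>\<sigma>\<close> on are arbitrary, so bounds, continuity and adaptedness have
  to come from the path before \<open>\<sigma>\<close>. There \<open>R\<close> contains the
  reciprocal distances \<open>1 / \<bar>W - Z k\<bar>\<close>: if they stayed bounded up to a finite
  \<open>\<sigma>\<close>, all paths would have limits with distinct points, which
  \<open>not_continuable\<close> excludes. On the complex side, the base point \<open>0\<close> of
  the integral must not be separated from \<open>W\<close> by a vertex. It never is, because the
  vertices are repelled by \<open>W\<close>, those on its right to the right and those on its left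
  to the left. So the interval around \<open>0\<close> only grows, and earlier values of
  \<open>W\<close> remain in it.\<close>

abbreviation \<H> where "\<H> \<equiv> upper_half_plane"

section \<open>Sums of Brownian increments\<close>

lemma abs_le_imp_sq_le: "\<bar>x\<bar> \<le> C ==> x\<^sup>2 \<le> (C::real)\<^sup>2"
 by (metis abs_ge_zero power2_abs power_mono)

locale filtered_brownian_motion =
 fixes M :: "'a measure" and F :: "real => 'a measure" and B :: "real => 'a => real"
 assumes cfs: "complete_filtered_space M F" and bm: "brownian_motion M F B"
begin

lemma fs: "filtered_space M F" and complete_M: "complete_measure M"
 and null_F0: "null_sets M \<subseteq> sets (F 0)"
 using cfs unfolding complete_filtered_space_def by auto

sublocale prob_space M
 using fs unfolding filtered_space_def by auto

sublocale filtration "space M" F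
 using fs unfolding filtered_space_def by auto

lemma subalg: "subalgebra M (F t)"
 using fs unfolding filtered_space_def by auto

lemma sets_F_M: "A \<in> sets (F t) ==> A \<in> sets M"
 using subalg[of t] unfolding subalgebra_def by auto

lemma measurable_F_M: "f \<in> measurable (F t) N ==> f \<in> measurable M N"
 using measurable_from_subalg[OF subalg] by blast

lemma measurable_F_mono: "s \<le> t ==> f \<in> measurable (F s) N ==> f \<in> measurable (F t) N"
 using sets_F_mono[of s t] space_F[of s] space_F[of t] unfolding measurable_def by auto

lemma null_F: "N \<in> null_sets M ==> 0 \<le> t ==> N \<in> sets (F t)"
 using null_F0 sets_F_mono[of 0 t] by blast

lemma B_adapted: "0 \<le> t ==> B t \<in> borel_measurable (F t)"
 using bm unfolding brownian_motion_def by auto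

lemma B_meas [measurable]: "0 \<le> t ==> B t \<in> borel_measurable M"
 using B_adapted measurable_F_M by blast

lemma B_increment_distributed: "0 \<le> s ==> s < t ==>
  distributed M lborel (\<lambda>w. B t w - B s w) (\<lambda>x. ennreal (normal_density 0 (sqrt (t - s)) x))"
 using bm unfolding brownian_motion_def by auto

lemma B_increment_distr:
 assumes "0 \<le> s" "s < t"
 shows "distr M borel (\<lambda>w. B t w - B s w) = density lborel (normal_density 0 (sqrt (t - s)))"
proof -
 have "distr M borel (\<lambda>w. B t w - B s w) = distr M lborel (\<lambda>w. B t w - B s w)"
  by (rule distr_cong) auto
 then show ?thesis
  using distributed_distr_eq_density[OF B_increment_distributed[OF assms]] by simp
qed

lemma B_increment_indep:
 assumes "0 \<le> s" "s < t" "E \<in> sets (F s)" "A \<in> sets borel"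
 shows "prob (E \<inter> ((\<lambda>w. B t w - B s w) -` A \<inter> space M)) =
  prob E * prob ((\<lambda>w. B t w - B s w) -` A \<inter> space M)"
proof (rule indep_setD)
 show "indep_set (sets (F s)) (sets (vimage_algebra (space M) (\<lambda>w. B t w - B s w) borel))"
  using bm assms unfolding brownian_motion_def by auto
qed (use assms in \<open>auto intro: in_vimage_algebra\<close>)

text \<open>Independence of the increment from \<open>F s\<close>, put as a statement about the
  joint law of the sample point, viewed in \<open>F s\<close>, and the increment. In this form
  Fubini's theorem applies.\<close>

lemma B_increment_product_law:
 assumes st: "0 \<le> s" "s < t"
 shows "distr M (F s) (\<lambda>x. x) \<Otimes>\<^sub>M distr M borel (\<lambda>w. B t w - B s w) =
  distr M (F s \<Otimes>\<^sub>M borel) (\<lambda>w. (w, B t w - B s w))" (is "?P \<Otimes>\<^sub>M ?Q = _")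
proof (rule pair_measure_eqI)
 have id [measurable]: "(\<lambda>w. w) \<in> measurable M (F s)"
  using measurable_F_M[OF measurable_ident] by (simp add: id_def)
 have [measurable]: "(\<lambda>w. B t w - B s w) \<in> borel_measurable M"
  using st by (intro borel_measurable_diff B_meas) auto
 interpret P: prob_space ?P by (rule prob_space_distr) fact
 interpret Q: prob_space ?Q by (rule prob_space_distr) fact
 show "sigma_finite_measure ?P" "sigma_finite_measure ?Q" by unfold_locales
 show "sets (?P \<Otimes>\<^sub>M ?Q) = sets (distr M (F s \<Otimes>\<^sub>M borel) (\<lambda>w. (w, B t w - B s w)))"
  by (simp cong: sets_pair_measure_cong)
 fix E A assume "E \<in> sets ?P" "A \<in> sets ?Q"
 then have E: "E \<in> sets (F s)" and A: "A \<in> sets borel" by auto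
 have "(\<lambda>w. (w, B t w - B s w)) -` (E \<times> A) \<inter> space M = E \<inter> ((\<lambda>w. B t w - B s w) -` A \<inter> space M)"
  by auto
 then have "emeasure (distr M (F s \<Otimes>\<^sub>M borel) (\<lambda>w. (w, B t w - B s w))) (E \<times> A)
   = ennreal (prob E * prob ((\<lambda>w. B t w - B s w) -` A \<inter> space M))"
  using E A B_increment_indep[OF st E A]
  by (subst emeasure_distr) (auto simp: emeasure_eq_measure)
 moreover have "(\<lambda>w. w) -` E \<inter> space M = E"
  using sets.sets_into_space[OF sets_F_M[OF E]] by auto
 ultimately show "emeasure ?P E * emeasure ?Q A =
   emeasure (distr M (F s \<Otimes>\<^sub>M borel) (\<lambda>w. (w, B t w - B s w))) (E \<times> A)"
  using E A by (simp add: emeasure_distr emeasure_eq_measure ennreal_mult)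
qed

text \<open>Fubini for the product law: what is known at time \<open>s\<close> is frozen while the
  increment is integrated out. It takes the place of a conditional expectation.\<close>

lemma integral_freeze:
 fixes \<phi> :: "'a \<times> real => 'b::{banach, second_countable_topology}"
 assumes st: "0 \<le> s" "s < t" and m [measurable]: "\<phi> \<in> borel_measurable (F s \<Otimes>\<^sub>M borel)"
  and bd: "\<And>x. norm (\<phi> x) \<le> K"
 shows "(LINT w|M. \<phi> (w, B t w - B s w)) =
  (LINT w|M. LINT y|density lborel (normal_density 0 (sqrt (t - s))). \<phi> (w, y))"
proof -
 let ?D = "\<lambda>w. B t w - B s w"
 let ?P = "distr M (F s) (\<lambda>x. x)"
 let ?Q = "distr M borel ?D"
 have iv: "random_variable (F s) (\<lambda>x. x)" "random_variable borel ?D"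
  "?P \<Otimes>\<^sub>M ?Q = distr M (F s \<Otimes>\<^sub>M borel) (\<lambda>x. (x, ?D x))"
  using B_increment_product_law[OF st] measurable_F_M[OF measurable_ident, of s] st
  by (auto simp: id_def)
 note [measurable] = iv(1,2)
 interpret P: prob_space ?P by (rule prob_space_distr) fact
 interpret Q: prob_space ?Q by (rule prob_space_distr) fact
 interpret PQ: pair_prob_space ?P ?Q ..
 have mQ: "\<phi> \<in> borel_measurable (?P \<Otimes>\<^sub>M ?Q)"
  using m by (simp cong: measurable_cong_sets sets_pair_measure_cong)
 have int: "integrable (?P \<Otimes>\<^sub>M ?Q) \<phi>"
  using mQ bd by (intro PQ.integrable_const_bound[of _ K]) auto
 have "(LINT w|M. \<phi> (w, ?D w)) = (LINT x|(distr M (F s \<Otimes>\<^sub>M borel) (\<lambda>x. (x, ?D x))). \<phi> x)"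
  by (subst integral_distr) auto
 also have "\<dots> = (LINT x|(?P \<Otimes>\<^sub>M ?Q). \<phi> x)"
  by (simp add: iv(3))
 also have "\<dots> = (LINT x|?P. LINT y|?Q. \<phi> (x, y))"
  using int by (simp add: PQ.integral_fst')
 also have "\<dots> = (LINT x|M. LINT y|?Q. \<phi> (x, y))"
 proof (subst integral_distr)
  have "(\<lambda>x. LINT y|?Q. \<phi> (x, y)) \<in> borel_measurable ?P"
   using mQ by (intro Q.borel_measurable_lebesgue_integral) (simp add: case_prod_beta')
  then show "(\<lambda>x. LINT y|?Q. \<phi> (x, y)) \<in> borel_measurable (F s)" by simp
 qed auto
 finally show ?thesis
  using B_increment_distr[OF st] by simp
qed

end

lemma char_normal_density:
 assumes "0 < \<sigma>"
 shows "char (density lborel (normal_density 0 \<sigma>)) u = exp (- (of_real ((u * \<sigma>)\<^sup>2) / 2))"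
proof -
 interpret S: prob_space std_normal_distribution
  by (simp add: prob_space_normal_density)
 have "distributed std_normal_distribution lborel (\<lambda>x. x) (\<lambda>x. ennreal (normal_density 0 1 x))"
  unfolding distributed_def
  using distr_id[of "density lborel (\<lambda>x. ennreal (std_normal_density x))"]
   distr_cong[of std_normal_distribution std_normal_distribution lborel std_normal_distribution "\<lambda>x. x" "\<lambda>x. x"]
  by (simp add: id_def)
 from S.normal_density_affine[OF this, of \<sigma> 0] assms
 have "distributed std_normal_distribution lborel (\<lambda>x. \<sigma> * x) (\<lambda>x. ennreal (normal_density 0 \<sigma> x))"
  by simp
 from distributed_distr_eq_density[OF this]
 have eq: "distr std_normal_distribution lborel (\<lambda>x. \<sigma> * x) = density lborel (normal_density 0 \<sigma>)" .
 have "char (density lborel (normal_density 0 \<sigma>)) u =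
   (CLINT x|distr std_normal_distribution lborel (\<lambda>x. \<sigma> * x). iexp (u * x))"
  unfolding eq char_def ..
 also have "\<dots> = (CLINT x|std_normal_distribution. iexp (u * (\<sigma> * x)))"
  by (subst integral_distr) (auto simp: measurable_lborel1)
 also have "\<dots> = char std_normal_distribution (u * \<sigma>)"
  unfolding char_def by (simp add: mult.assoc)
 also have "\<dots> = exp (- (of_real ((u * \<sigma>)\<^sup>2) / 2))"
  unfolding char_std_normal_distribution by (simp add: exp_of_real[symmetric])
 finally show ?thesis .
qed

context filtered_brownian_motion
begin

text \<open>With \<open>a w\<close> frozen, the increment contributes its characteristic function
  \<open>exp (- (a w)^2 * (t - s) / 2)\<close>, which the compensating factor cancels. The bounds on
  \<open>X\<close> and \<open>a\<close> keep everything integrable.\<close>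

lemma exp_step:
 fixes X :: "'a => complex" and a :: "'a => real"
 assumes st: "0 \<le> s" "s < t"
  and X [measurable]: "X \<in> borel_measurable (F s)" and a [measurable]: "a \<in> borel_measurable (F s)"
  and bX: "\<And>w. norm (X w) \<le> K" and ba: "\<And>w. \<bar>a w\<bar> \<le> C"
 shows "(LINT w|M. X w * exp (\<i> * of_real (a w * (B t w - B s w)) + of_real ((a w)\<^sup>2 * (t - s) / 2)))
  = (LINT w|M. X w)"
proof -
 let ?N = "density lborel (normal_density 0 (sqrt (t - s)))"
 define \<phi> where "\<phi> = (\<lambda>(w, y). X w * exp (\<i> * of_real (a w * y) + of_real ((a w)\<^sup>2 * (t - s) / 2)))"
 have m: "\<phi> \<in> borel_measurable (F s \<Otimes>\<^sub>M borel)"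
  unfolding \<phi>_def by measurable
 have bd: "norm (\<phi> x) \<le> K * exp (C\<^sup>2 * (t - s) / 2)" for x
 proof -
  obtain w y where x: "x = (w, y)" by (cases x)
  have "(a w)\<^sup>2 \<le> C\<^sup>2"
   using ba[of w] by (rule abs_le_imp_sq_le)
  then have "exp ((a w)\<^sup>2 * (t - s) / 2) \<le> exp (C\<^sup>2 * (t - s) / 2)"
   using st by (simp add: mult_right_mono divide_right_mono)
  moreover have "K \<ge> 0" using bX[of w] norm_ge_zero order_trans by blast
  ultimately show ?thesis
   unfolding x \<phi>_def using bX[of w]
   by (auto simp: norm_mult intro!: mult_mono)
 qed
 have "(LINT w|M. X w * exp (\<i> * of_real (a w * (B t w - B s w)) + of_real ((a w)\<^sup>2 * (t - s) / 2)))
  = (LINT w|M. \<phi> (w, B t w - B s w))"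
  by (simp add: \<phi>_def)
 also have "\<dots> = (LINT w|M. LINT y|?N. \<phi> (w, y))"
  by (rule integral_freeze[OF st m bd])
 also have "(\<lambda>w. LINT y|?N. \<phi> (w, y)) = X"
 proof
  fix w
  have "(LINT y|?N. \<phi> (w, y)) = (LINT y|?N. X w * exp (of_real ((a w)\<^sup>2 * (t - s) / 2)) * iexp (a w * y))"
   unfolding \<phi>_def by (simp add: exp_add mult_ac)
  also have "\<dots> = X w * exp (of_real ((a w)\<^sup>2 * (t - s) / 2)) * char ?N (a w)"
   unfolding char_def by simp
  also have "\<dots> = X w * (exp (of_real ((a w)\<^sup>2 * (t - s) / 2)) * exp (- of_real ((a w)\<^sup>2 * (t - s) / 2)))"
   using st by (subst char_normal_density) (auto simp: power_mult_distrib)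
  also have "\<dots> = X w"
   by (simp add: exp_minus)
  finally show "(LINT y|?N. \<phi> (w, y)) = X w" .
 qed
 finally show ?thesis .
qed

text \<open>Induction on the last increment: all earlier factors are known at time
  \<open>N * d\<close> and form the \<open>X\<close> of \<open>exp_step\<close>.\<close>

lemma exp_sum:
 fixes a :: "nat => 'a => real"
 assumes d: "0 < d"
  and a: "\<And>i. i < N ==> a i \<in> borel_measurable (F (real i * d))"
  and ba: "\<And>i w. \<bar>a i w\<bar> \<le> C"
 shows "(LINT w|M. exp (\<i> * of_real (\<Sum>i<N. a i w * (B (real (Suc i) * d) w - B (real i * d) w)) +
       of_real ((\<Sum>i<N. (a i w)\<^sup>2 * d) / 2))) = 1"
 using a
proof (induction N)
 case 0
 then show ?case by (simp add: prob_space)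
next
 case (Suc N)
 define X where "X = (\<lambda>w. exp (\<i> * of_real (\<Sum>i<N. a i w * (B (real (Suc i) * d) w - B (real i * d) w)) +
       of_real ((\<Sum>i<N. (a i w)\<^sup>2 * d) / 2)))"
 have t: "0 \<le> real N * d" "real N * d < real (Suc N) * d" "real (Suc N) * d - real N * d = d"
  using d by (auto simp: algebra_simps)
 have a' [measurable]: "i \<le> N ==> a i \<in> borel_measurable (F (real N * d))" for i
  using Suc.prems[of i] d by (intro measurable_F_mono[of "real i * d" "real N * d"]) auto
 have B' [measurable]: "i \<le> N ==> B (real i * d) \<in> borel_measurable (F (real N * d))" for i
  using d by (intro measurable_F_mono[OF _ B_adapted]) auto
 have [measurable]: "i < N ==> B (real (Suc i) * d) \<in> borel_measurable (F (real N * d))" for i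
  using B'[of "Suc i"] by simp
 then have [measurable]: "i < N ==> B ((1 + real i) * d) \<in> borel_measurable (F (real N * d))" for i
  by simp
 have X: "X \<in> borel_measurable (F (real N * d))"
  unfolding X_def by (auto intro!: measurable_compose[OF _ borel_measurable_exp] borel_measurable_add
   borel_measurable_times borel_measurable_sum borel_measurable_diff borel_measurable_power borel_measurable_divide measurable_compose[OF _ borel_measurable_of_real])
 have bX: "norm (X w) \<le> exp ((\<Sum>i<N. C\<^sup>2 * d) / 2)" for w
 proof -
  have "(a i w)\<^sup>2 \<le> C\<^sup>2" for i
   using ba[of i w] by (rule abs_le_imp_sq_le)
  then have "(\<Sum>i<N. (a i w)\<^sup>2 * d) \<le> (\<Sum>i<N. C\<^sup>2 * d)"
   using d by (intro sum_mono) (auto intro: mult_right_mono)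
  then show ?thesis unfolding X_def by simp
 qed
 have "(LINT w|M. X w * exp (\<i> * of_real (a N w * (B (real (Suc N) * d) w - B (real N * d) w)) + of_real ((a N w)\<^sup>2 * (real (Suc N) * d - real N * d) / 2)))
  = (LINT w|M. X w)"
  by (rule exp_step[OF t(1,2) X a' bX ba]) simp
 also have "\<dots> = 1"
  unfolding X_def using Suc by simp
 finally show ?case
  unfolding X_def t(3) exp_add[symmetric] by (simp add: algebra_simps add_divide_distrib)
qed


lemma B_increment_indep_var:
 assumes st: "0 \<le> s" "s < t" and X: "X \<in> borel_measurable (F s)" and f: "f \<in> borel_measurable borel"
 shows "indep_var borel X borel (\<lambda>w. f (B t w - B s w) :: real)"
 unfolding indep_var_eq
proof (intro conjI indep_setI)
 let ?D = "\<lambda>w. B t w - B s w"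
 let ?V = "vimage_algebra (space M) ?D borel"
 have D [measurable]: "random_variable borel ?D"
  using st by (intro borel_measurable_diff B_meas) auto
 show X': "random_variable borel X" using measurable_F_M[OF X] .
 show Y': "random_variable borel (\<lambda>w. f (?D w))" using D f by measurable
 show 1: "sigma_sets (space M) {X -` A \<inter> space M |A. A \<in> sets borel} \<subseteq> events"
  by (rule sets.sigma_sets_subset) (use X' in \<open>auto simp: measurable_sets\<close>)
 show 2: "sigma_sets (space M) {(\<lambda>w. f (?D w)) -` A \<inter> space M |A. A \<in> sets borel} \<subseteq> events"
  by (rule sets.sigma_sets_subset) (use Y' in \<open>auto simp: measurable_sets\<close>)
 fix a b assume a: "a \<in> sigma_sets (space M) {X -` A \<inter> space M |A. A \<in> sets borel}"
  and b: "b \<in> sigma_sets (space M) {(\<lambda>w. f (?D w)) -` A \<inter> space M |A. A \<in> sets borel}"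
 have "sigma_sets (space M) {X -` A \<inter> space M |A. A \<in> sets borel} \<subseteq> sets (F s)"
 proof -
  have "{X -` A \<inter> space M |A. A \<in> sets borel} \<subseteq> sets (F s)"
   using measurable_sets[OF X] by (auto simp: space_F)
  then show ?thesis using sets.sigma_sets_subset[of _ "F s"] by (simp add: space_F)
 qed
 with a have aF: "a \<in> sets (F s)" by auto
 have "sigma_sets (space M) {(\<lambda>w. f (?D w)) -` A \<inter> space M |A. A \<in> sets borel} \<subseteq> sets ?V"
 proof -
  have "{(\<lambda>w. f (?D w)) -` A \<inter> space M |A. A \<in> sets borel} \<subseteq> sets ?V"
  proof safe
   fix A :: "real set" assume "A \<in> sets borel"
   then have "f -` A \<in> sets borel" using f measurable_sets[of f borel borel A] by simp
   then have "?D -` (f -` A) \<inter> space M \<in> sets ?V" by (rule in_vimage_algebra)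
   then show "(\<lambda>w. f (?D w)) -` A \<inter> space M \<in> sets ?V" by (simp add: vimage_def)
  qed
  then show ?thesis using sets.sigma_sets_subset[of _ ?V] by simp
 qed
 with b have bV: "b \<in> sets ?V" by auto
 have "indep_set (sets (F s)) (sets ?V)"
  using bm st unfolding brownian_motion_def by auto
 from indep_setD[OF this aF bV] show "prob (a \<inter> b) = prob a * prob b" .
qed

lemma B_increment_moments:
 assumes st: "0 \<le> s" "s < t"
 shows "integrable M (\<lambda>w. (B t w - B s w)^2)" "expectation (\<lambda>w. (B t w - B s w)^2) = t - s"
  "integrable M (\<lambda>w. (B t w - B s w)^4)" "expectation (\<lambda>w. (B t w - B s w)^4) = 3 * (t - s)^2"
proof -
 note D = B_increment_distributed[OF st]
 have p: "0 < sqrt (t - s)" using st by simp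
 note n2 = normal_moment_even[OF p, of 0 1] and n4 = normal_moment_even[OF p, of 0 2]
 show "integrable M (\<lambda>w. (B t w - B s w)^2)"
  using n2 distributed_integrable[OF D, of "\<lambda>x. x^2"] by (auto simp: has_bochner_integral_iff normal_density_nonneg)
 show "integrable M (\<lambda>w. (B t w - B s w)^4)"
  using n4 distributed_integrable[OF D, of "\<lambda>x. x^4"] by (auto simp: has_bochner_integral_iff normal_density_nonneg)
 show "expectation (\<lambda>w. (B t w - B s w)^2) = t - s"
  using n2 distributed_integral[OF D, of "\<lambda>x. x^2"] st by (auto simp: has_bochner_integral_iff normal_density_nonneg)
 show "expectation (\<lambda>w. (B t w - B s w)^4) = 3 * (t - s)^2"
  using n4 distributed_integral[OF D, of "\<lambda>x. x^4"] st
  by (auto simp: has_bochner_integral_iff normal_density_nonneg fact_numeral field_simps)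
qed

text \<open>Orthogonality: each centred square has mean zero and is independent of the past, so the
  cross terms drop out and the second moments add up. A single centred square has second moment
  \<open>3 * d^2 - 2 * d^2 + d^2 = 2 * d^2\<close>.\<close>

lemma qv_sum_bound:
 fixes a :: "nat => 'a => real"
 assumes d: "0 < d"
  and a: "\<And>i. i < N ==> a i \<in> borel_measurable (F (real i * d))"
  and ba: "\<And>i w. \<bar>a i w\<bar> \<le> C"
 defines "X \<equiv> \<lambda>w. \<Sum>i<N. a i w * ((B (real (Suc i) * d) w - B (real i * d) w)\<^sup>2 - d)"
 shows "X \<in> borel_measurable (F (real N * d)) \<and> integrable M (\<lambda>w. (X w)\<^sup>2) \<and>
  expectation (\<lambda>w. (X w)\<^sup>2) \<le> real N * (C\<^sup>2 * (2 * d\<^sup>2))"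
 using a unfolding X_def
proof (induction N)
 case 0
 then show ?case by simp
next
 case (Suc N)
 define X where "X = (\<lambda>w. \<Sum>i<N. a i w * ((B (real (Suc i) * d) w - B (real i * d) w)\<^sup>2 - d))"
 define s where "s = real N * d"
 define t where "t = real (Suc N) * d"
 have st: "0 \<le> s" "s < t" "t - s = d"
  using d by (auto simp: s_def t_def algebra_simps)
 have IH: "X \<in> borel_measurable (F s)" "integrable M (\<lambda>w. (X w)\<^sup>2)"
  "expectation (\<lambda>w. (X w)\<^sup>2) \<le> real N * (C\<^sup>2 * (2 * d\<^sup>2))"
  using Suc unfolding X_def s_def by auto
 have aN: "a N \<in> borel_measurable (F s)"
  using Suc.prems[of N] by (simp add: s_def)
 define \<xi> where "\<xi> = (\<lambda>w. (B t w - B s w)\<^sup>2 - d)"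
 have [measurable]: "B s \<in> borel_measurable M" "B t \<in> borel_measurable M" "X \<in> borel_measurable M" "a N \<in> borel_measurable M"
  using st IH(1) aN by (auto intro: measurable_F_M)
 have [measurable]: "\<xi> \<in> borel_measurable M"
  unfolding \<xi>_def by measurable
 note mom = B_increment_moments[OF st(1,2), unfolded st(3)]
 have x1: "integrable M \<xi>" "expectation \<xi> = 0"
  unfolding \<xi>_def using mom by (auto simp: prob_space)
 have sq: "(\<xi> w)\<^sup>2 = (B t w - B s w)^4 - 2 * d * (B t w - B s w)\<^sup>2 + d\<^sup>2" for w
  unfolding \<xi>_def by (simp add: power2_eq_square power4_eq_xxxx algebra_simps)
 have x2: "integrable M (\<lambda>w. (\<xi> w)\<^sup>2)" "expectation (\<lambda>w. (\<xi> w)\<^sup>2) = 2 * d\<^sup>2"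
  unfolding sq using mom by (auto simp: prob_space power2_eq_square)
 have a2: "integrable M (\<lambda>w. (a N w)\<^sup>2)"
 proof (rule integrable_const_bound[of _ "C\<^sup>2"])
  show "AE w in M. norm ((a N w)\<^sup>2) \<le> C\<^sup>2"
   using ba by (intro AE_I2) (simp add: abs_le_imp_sq_le)
 qed measurable
 have XA: "integrable M (\<lambda>w. X w * a N w)"
 proof (rule Bochner_Integration.integrable_bound)
  show "integrable M (\<lambda>w. (X w)\<^sup>2 + (a N w)\<^sup>2)" using IH(2) a2 by simp
  have "\<bar>x * y\<bar> \<le> x\<^sup>2 + y\<^sup>2" for x y :: real
   using sum_squares_bound[of "\<bar>x\<bar>" "\<bar>y\<bar>"] mult_nonneg_nonneg[of "\<bar>x\<bar>" "\<bar>y\<bar>"]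
   unfolding abs_mult power2_abs mult.assoc by linarith
  then show "AE w in M. norm (X w * a N w) \<le> norm ((X w)\<^sup>2 + (a N w)\<^sup>2)"
   by (intro AE_I2) simp
 qed measurable
 have f: "(\<lambda>x::real. x\<^sup>2 - d) \<in> borel_measurable borel" by measurable
 have i1: "indep_var borel (\<lambda>w. X w * a N w) borel \<xi>"
  unfolding \<xi>_def using B_increment_indep_var[OF st(1,2) _ f, of "\<lambda>w. X w * a N w"] IH(1) aN by measurable
 have f': "(\<lambda>x::real. (x\<^sup>2 - d)\<^sup>2) \<in> borel_measurable borel" by measurable
 have i2: "indep_var borel (\<lambda>w. (a N w)\<^sup>2) borel (\<lambda>w. (\<xi> w)\<^sup>2)"
  unfolding \<xi>_def using B_increment_indep_var[OF st(1,2) _ f', of "\<lambda>w. (a N w)\<^sup>2"] aN by measurable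
 have c1: "integrable M (\<lambda>w. X w * a N w * \<xi> w)" "expectation (\<lambda>w. X w * a N w * \<xi> w) = 0"
  using indep_var_integrable[OF i1 XA x1(1)] indep_var_lebesgue_integral[OF i1 XA x1(1)] x1(2) by auto
 have c2: "integrable M (\<lambda>w. (a N w)\<^sup>2 * (\<xi> w)\<^sup>2)"
  "expectation (\<lambda>w. (a N w)\<^sup>2 * (\<xi> w)\<^sup>2) = expectation (\<lambda>w. (a N w)\<^sup>2) * (2 * d\<^sup>2)"
  using indep_var_integrable[OF i2 a2 x2(1)] indep_var_lebesgue_integral[OF i2 a2 x2(1)] x2(2) by auto
 have "expectation (\<lambda>w. (a N w)\<^sup>2) \<le> expectation (\<lambda>w. C\<^sup>2)"
  using a2 ba by (intro integral_mono) (auto simp: abs_le_imp_sq_le)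
 then have ea: "expectation (\<lambda>w. (a N w)\<^sup>2) * (2 * d\<^sup>2) \<le> C\<^sup>2 * (2 * d\<^sup>2)"
  by (intro mult_right_mono) (auto simp: prob_space)
 have eq: "(X w + a N w * \<xi> w)\<^sup>2 = (X w)\<^sup>2 + 2 * (X w * a N w * \<xi> w) + (a N w)\<^sup>2 * (\<xi> w)\<^sup>2" for w
  by (simp add: power2_eq_square algebra_simps)
 have int: "integrable M (\<lambda>w. (X w + a N w * \<xi> w)\<^sup>2)"
  unfolding eq using IH(2) c1(1) c2(1) by simp
 have "expectation (\<lambda>w. (X w + a N w * \<xi> w)\<^sup>2) \<le> real N * (C\<^sup>2 * (2 * d\<^sup>2)) + C\<^sup>2 * (2 * d\<^sup>2)"
  unfolding eq using IH(2,3) c1 c2 ea by simp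
 moreover have "(\<lambda>w. X w + a N w * \<xi> w) \<in> borel_measurable (F t)"
 proof -
  have [measurable]: "X \<in> borel_measurable (F t)" "a N \<in> borel_measurable (F t)"
   "B s \<in> borel_measurable (F t)" "B t \<in> borel_measurable (F t)"
   using measurable_F_mono[of s t] st IH(1) aN B_adapted by auto
  show ?thesis unfolding \<xi>_def by measurable
 qed
 moreover have eqX: "(\<Sum>i<Suc N. a i w * ((B (real (Suc i) * d) w - B (real i * d) w)\<^sup>2 - d)) = X w + a N w * \<xi> w" for w
  by (simp add: X_def \<xi>_def s_def t_def)
 moreover have "real (Suc N) * (C\<^sup>2 * (2 * d\<^sup>2)) = real N * (C\<^sup>2 * (2 * d\<^sup>2)) + C\<^sup>2 * (2 * d\<^sup>2)"
  by (simp add: algebra_simps)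
 ultimately show ?case
  using int unfolding eqX t_def[symmetric] by simp
qed

end

section \<open>Limits of dyadic sums along almost every path\<close>

text \<open>Summable expectations make the series of the squares finite almost surely, and the terms
  of a convergent series tend to zero.\<close>

lemma AE_tendsto_zero_of_square_integrals:
 fixes M :: "'a measure" and X :: "nat => 'a => real"
 assumes i: "\<And>j. integrable M (\<lambda>w. (X j w)\<^sup>2)"
  and b: "\<And>j. (LINT w|M. (X j w)\<^sup>2) \<le> K / 2 ^ j"
 shows "AE w in M. (\<lambda>j. X j w) \<longlonglongrightarrow> 0"
proof -
 have [measurable]: "(\<lambda>w. (X j w)\<^sup>2) \<in> borel_measurable M" for j using i by auto
 have s: "summable (\<lambda>j. K / 2 ^ j)"
  using summable_mult[OF summable_geometric[of "1/2::real"], of K] by (simp add: power_one_over field_simps)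
 have Kj: "0 \<le> K / 2 ^ j" for j
 proof -
  have "0 \<le> (LINT w|M. (X j w)\<^sup>2)" by (rule Bochner_Integration.integral_nonneg) simp
  then show ?thesis using b[of j] by linarith
 qed
 have "(\<integral>\<^sup>+w. (\<Sum>j. ennreal ((X j w)\<^sup>2)) \<partial>M) = (\<Sum>j. \<integral>\<^sup>+w. ennreal ((X j w)\<^sup>2) \<partial>M)"
  by (intro nn_integral_suminf) measurable
 also have "\<dots> = (\<Sum>j. ennreal (LINT w|M. (X j w)\<^sup>2))"
  by (intro arg_cong[where f = suminf] ext nn_integral_eq_integral i) simp
 also have "\<dots> \<le> (\<Sum>j. ennreal (K / 2 ^ j))"
  by (intro suminf_le) (auto intro: ennreal_leI b)
 also have "\<dots> = ennreal (\<Sum>j. K / 2 ^ j)"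
  by (intro suminf_ennreal2 s Kj)
 finally have "(\<integral>\<^sup>+w. (\<Sum>j. ennreal ((X j w)\<^sup>2)) \<partial>M) \<noteq> \<infinity>"
  unfolding infinity_ennreal_def by (rule neq_top_trans[OF ennreal_neq_top])
 then have "AE w in M. (\<Sum>j. ennreal ((X j w)\<^sup>2)) \<noteq> \<infinity>"
  by (intro nn_integral_PInf_AE) measurable
 then show ?thesis
 proof eventually_elim
  case (elim w)
  then have "summable (\<lambda>j. (X j w)\<^sup>2)"
   by (intro summable_suminf_not_top) auto
  then have "(\<lambda>j. (X j w)\<^sup>2) \<longlonglongrightarrow> 0" by (rule summable_LIMSEQ_zero)
  then have "(\<lambda>j. sqrt ((X j w)\<^sup>2)) \<longlonglongrightarrow> sqrt 0" by (rule tendsto_real_sqrt)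
  then show ?case by (simp add: tendsto_rabs_zero_iff)
 qed
qed

text \<open>At most one open mesh interval contains \<open>x\<close>, so a boundary effect at
  \<open>x\<close> is paid for only once.\<close>

lemma card_grid_interval: "(\<Sum>i<N. if real i * d < x \<and> x < real (Suc i) * d then e else 0) \<le> (e::real)" if "0 \<le> e" "0 < d"
proof -
 let ?S = "{i\<in>{..<N}. real i * d < x \<and> x < real (Suc i) * d}"
 have "i = j" if "i \<in> ?S" "j \<in> ?S" for i j
 proof -
  have "real i * d < real (Suc j) * d" "real j * d < real (Suc i) * d" using that by auto
  then have "real i < real (Suc j)" "real j < real (Suc i)"
   using mult_less_cancel_right_pos[OF \<open>0 < d\<close>] by blast+
  then have "i < Suc j" "j < Suc i" unfolding of_nat_less_iff .
  then show ?thesis by simp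
 qed
 then have "card ?S \<le> 1"
  unfolding One_nat_def by (subst card_le_Suc0_iff_eq) (simp, blast)
 moreover have "(\<Sum>i<N. if real i * d < x \<and> x < real (Suc i) * d then e else 0) = real (card ?S) * e"
  by (subst sum.inter_filter[symmetric]) simp_all
 moreover have "real (card ?S) * e \<le> 1 * e"
  using \<open>card ?S \<le> 1\<close> \<open>0 \<le> e\<close> by (intro mult_right_mono) auto
 ultimately show ?thesis by simp
qed

text \<open>The sum is compared with a telescoping sum of \<open>X\<close> over the grid points
  clamped to \<open>[S, S']\<close>. Mesh intervals inside \<open>[S, S']\<close> cost at most
  \<open>eps * (c + K)\<close> in total. Those with \<open>S\<close> or \<open>S'\<close> in their
  interior are handled by continuity of \<open>X\<close> and smallness of \<open>D\<close>. The last
  increment may reach beyond \<open>S'\<close>, which is why \<open>sm\<close> allows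
  \<open>v\<close> up to \<open>c\<close>.\<close>

lemma clipped_sum_tendsto:
 fixes X b :: "real => real" and D :: "real => real => real"
 assumes c: "0 < c" and S: "0 \<le> S" "S \<le> S'" "S' \<le> c"
  and X: "continuous_on {S..S'} X"
  and ex: "\<And>eps. 0 < eps ==> \<exists>dl>0. \<forall>u v. S \<le> u \<and> u \<le> v \<and> v \<le> S' \<and> v - u < dl -->
    \<bar>X v - X u - D u v\<bar> \<le> eps * ((v - u) + (b v - b u)\<^sup>2)"
  and sm: "\<And>eps. 0 < eps ==> \<exists>dl>0. \<forall>u v. S \<le> u \<and> u < S' \<and> u \<le> v \<and> v \<le> c \<and> v - u < dl --> \<bar>D u v\<bar> \<le> eps"
  and qv: "\<And>j. (\<Sum>i<2^j. (b (real (Suc i) * (c / 2^j)) - b (real i * (c / 2^j)))\<^sup>2) \<le> K"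
 shows "(\<lambda>j. \<Sum>i<2^j. if S \<le> real i * (c / 2^j) \<and> real i * (c / 2^j) < S'
        then D (real i * (c / 2^j)) (real (Suc i) * (c / 2^j)) else 0) \<longlonglongrightarrow> X S' - X S"
proof (rule LIMSEQ_I)
 fix e :: real assume "0 < e"
 have "0 \<le> (\<Sum>i<2^0. (b (real (Suc i) * (c / 2^0)) - b (real i * (c / 2^0)))\<^sup>2)"
  by (intro sum_nonneg) simp
 then have K: "0 \<le> K" using qv[of 0] by linarith
 \<comment> \<open>\<open>c + K\<close> collects the errors of the inner mesh intervals,
   \<open>1\<close> comes from the interval around \<open>S\<close> and \<open>2\<close> from the
   one around \<open>S'\<close>; the factor \<open>2\<close> makes the final inequality
   strict.\<close>
 define eps where "eps = e / (2 * (c + K + 3))"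
 have pos: "0 < c + K + 3" using c K by simp
 have "x / (2 * y) * y = x / 2" if "0 < y" for x y :: real
  using that by simp
 from this[OF pos, of e] have e2: "eps * (c + K + 3) = e / 2"
  unfolding eps_def .
 have e: "0 < eps" "eps * (c + K + 3) < e"
  unfolding e2 using \<open>0 < e\<close> pos unfolding eps_def by (simp_all del: distrib_left_numeral)
 obtain dl1 where d1: "dl1 > 0" "\<And>u v. S \<le> u ==> u \<le> v ==> v \<le> S' ==> v - u < dl1 ==>
    \<bar>X v - X u - D u v\<bar> \<le> eps * ((v - u) + (b v - b u)\<^sup>2)" using ex[OF e(1)] by blast
 obtain dl2 where d2: "dl2 > 0" "\<And>u v. S \<le> u ==> u < S' ==> u \<le> v ==> v \<le> c ==> v - u < dl2 ==> \<bar>D u v\<bar> \<le> eps"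
  using sm[OF e(1)] by blast
 have "uniformly_continuous_on {S..S'} X"
  using X by (intro compact_uniformly_continuous) auto
 then obtain dl3 where d3: "dl3 > 0" "\<And>u v. u \<in> {S..S'} ==> v \<in> {S..S'} ==> dist v u < dl3 ==> dist (X v) (X u) < eps"
  using e(1) unfolding uniformly_continuous_on_def by metis
 define dl where "dl = min dl1 (min dl2 dl3)"
 have d: "0 < dl" using d1 d2 d3 by (auto simp: dl_def)
 have "(\<lambda>j. c * (1/2)^j) \<longlonglongrightarrow> c * 0"
  by (intro tendsto_mult tendsto_const LIMSEQ_realpow_zero) auto
 then have "(\<lambda>j. c / 2^j) \<longlonglongrightarrow> 0" by (simp add: power_one_over field_simps)
 then have "\<forall>\<^sub>F j in sequentially. c / 2^j < dl" using d by (simp add: order_tendsto_iff)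
 then obtain j0 where j0: "\<And>j. j \<ge> j0 ==> c / 2^j < dl" by (auto simp: eventually_sequentially)
 show "\<exists>no. \<forall>j\<ge>no. norm ((\<Sum>i<2^j. if S \<le> real i * (c / 2^j) \<and> real i * (c / 2^j) < S'
        then D (real i * (c / 2^j)) (real (Suc i) * (c / 2^j)) else 0) - (X S' - X S)) < e"
 proof (intro exI allI impI)
  fix j assume "j0 \<le> j"
  define m where "m = c / 2^j"
  have m: "0 < m" "m < dl" using j0[OF \<open>j0 \<le> j\<close>] c by (auto simp: m_def)
  define t where "t = (\<lambda>i. real i * m)"
  have tS: "t (Suc i) - t i = m" "0 \<le> t i" for i using m by (auto simp: t_def algebra_simps)
  have tN: "t (2^j) = c" "t 0 = 0" by (auto simp: t_def m_def)
  have tle: "t i \<le> c" if "i \<le> 2^j" for i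
  proof -
   have "real i \<le> real (2^j)" using that by (simp only: of_nat_le_iff)
   then have "t i \<le> t (2^j)" unfolding t_def using m by (intro mult_right_mono) auto
   then show ?thesis using tN by simp
  qed
  define v where "v = (\<lambda>i. max S (min (t i) S'))"
  define I where "I = (\<lambda>i. if S \<le> t i \<and> t i < S' then D (t i) (t (Suc i)) else 0)"
  have tel: "(\<Sum>i<2^j. X (v (Suc i)) - X (v i)) = X S' - X S"
   using S tN sum_lessThan_telescope[of "\<lambda>i. X (v i)" "2^j"] by (simp add: v_def)
  have dX: "\<bar>X x - X y\<bar> \<le> eps" if "S \<le> x" "x \<le> S'" "S \<le> y" "y \<le> S'" "\<bar>x - y\<bar> \<le> m" for x y
  proof -
   have "dist x y < dl3" using that m d3 by (auto simp: dl_def dist_real_def)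
   then show ?thesis using d3(2)[of y x] that by (auto simp: dist_real_def)
  qed
  have step: "\<bar>I i - (X (v (Suc i)) - X (v i))\<bar> \<le> eps * (m + (b (t (Suc i)) - b (t i))\<^sup>2)
    + (if t i < S \<and> S < t (Suc i) then eps else 0) + (if t i < S' \<and> S' < t (Suc i) then 2 * eps else 0)"
   if i: "i < 2^j" for i
  proof -
   have p: "0 \<le> eps * (m + (b (t (Suc i)) - b (t i))\<^sup>2)" using e m by simp
   have tc: "t (Suc i) \<le> c" using tle[of "Suc i"] i by simp
   note t1 = tS(1)[of i]
   \<comment> \<open>The mesh interval lies left of \<open>S\<close>, across \<open>S\<close>, right
     of \<open>S'\<close>, inside, or across \<open>S'\<close>. If it starts before
     \<open>S\<close>, its term in the sum is zero.\<close>
   consider "t i < S" "t (Suc i) \<le> S" | "t i < S" "S < t (Suc i)" | "S \<le> t i" "S' \<le> t i" |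
    "S \<le> t i" "t i < S'" "t (Suc i) \<le> S'" | "S \<le> t i" "t i < S'" "S' < t (Suc i)" by linarith
   then show ?thesis
   proof cases
    case 1
    then have "v i = S" "v (Suc i) = S" using S by (auto simp: v_def)
    then show ?thesis using 1 p e by (simp add: I_def)
   next
    case 2
    then have v1: "v i = S" "v (Suc i) = min (t (Suc i)) S'" using S by (auto simp: v_def)
    have "\<bar>X (v (Suc i)) - X (v i)\<bar> \<le> eps"
     using 2 S t1 m unfolding v1 by (intro dX) auto
    then show ?thesis using 2 p e by (simp add: I_def abs_minus_commute)
   next
    case 3
    then have "v i = S'" "v (Suc i) = S'" using S t1 m by (auto simp: v_def)
    then show ?thesis using 3 p e by (simp add: I_def)
   next
    case 4
    then have v1: "v i = t i" "v (Suc i) = t (Suc i)" using S t1 m by (auto simp: v_def)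
    have "\<bar>X (t (Suc i)) - X (t i) - D (t i) (t (Suc i))\<bar> \<le> eps * ((t (Suc i) - t i) + (b (t (Suc i)) - b (t i))\<^sup>2)"
     using 4 t1 m by (intro d1(2)) (auto simp: dl_def)
    then show ?thesis unfolding v1 t1 using 4 p e by (simp add: I_def abs_minus_commute)
   next
    case 5
    then have v1: "v i = t i" "v (Suc i) = S'" using S t1 m by (auto simp: v_def)
    have "\<bar>X S' - X (t i)\<bar> \<le> eps" using 5 S t1 by (intro dX) auto
    moreover have "\<bar>D (t i) (t (Suc i))\<bar> \<le> eps"
     using 5 t1 m tc by (intro d2(2)) (auto simp: dl_def)
    ultimately have "\<bar>I i - (X (v (Suc i)) - X (v i))\<bar> \<le> 2 * eps"
     unfolding v1 I_def using 5 by simp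
    then show ?thesis using 5 p e by simp
   qed
  qed
  have "\<bar>(\<Sum>i<2^j. I i) - (X S' - X S)\<bar> = \<bar>\<Sum>i<2^j. I i - (X (v (Suc i)) - X (v i))\<bar>"
   by (simp add: sum_subtractf tel[symmetric])
  also have "\<dots> \<le> (\<Sum>i<2^j. \<bar>I i - (X (v (Suc i)) - X (v i))\<bar>)" by (rule sum_abs)
  also have "\<dots> \<le> (\<Sum>i<2^j. eps * (m + (b (t (Suc i)) - b (t i))\<^sup>2)
    + (if t i < S \<and> S < t (Suc i) then eps else 0) + (if t i < S' \<and> S' < t (Suc i) then 2 * eps else 0))"
   by (intro sum_mono step) auto
  also have "\<dots> = eps * (2^j * m + (\<Sum>i<2^j. (b (t (Suc i)) - b (t i))\<^sup>2))
    + (\<Sum>i<2^j. if t i < S \<and> S < t (Suc i) then eps else 0) + (\<Sum>i<2^j. if t i < S' \<and> S' < t (Suc i) then 2 * eps else 0)"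
   by (simp add: sum.distrib sum_distrib_left[symmetric] distrib_left)
  also have "\<dots> \<le> eps * (c + K) + eps + 2 * eps"
  proof (intro add_mono mult_left_mono)
   show "2^j * m \<le> c" by (simp add: m_def)
   show "(\<Sum>i<2^j. (b (t (Suc i)) - b (t i))\<^sup>2) \<le> K" using qv[of j] by (simp add: t_def m_def)
  qed (use e m card_grid_interval[of eps m S "2^j"] card_grid_interval[of "2*eps" m S' "2^j"] in \<open>auto simp: t_def\<close>)
  also have "\<dots> < e" using e by (simp add: algebra_simps)
  finally show "norm ((\<Sum>i<2^j. if S \<le> real i * (c / 2^j) \<and> real i * (c / 2^j) < S'
        then D (real i * (c / 2^j)) (real (Suc i) * (c / 2^j)) else 0) - (X S' - X S)) < e"
   unfolding I_def t_def m_def by simp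
 qed
qed

section \<open>The exponential identity between stopping times\<close>

context filtered_brownian_motion
begin

text \<open>All null sets lie in \<open>F 0\<close>, and by completeness so do their subsets. Hence
  path properties that hold almost surely may be used in proofs of adaptedness.\<close>

lemma sets_F_AE:
 assumes t: "0 \<le> t" and A: "A \<in> sets (F t)" and G: "G \<subseteq> space M" and AE: "AE w in M. w \<in> A \<longleftrightarrow> w \<in> G"
 shows "G \<in> sets (F t)"
proof -
 interpret complete_measure M by (rule complete_M)
 from AE_E[OF AE] obtain N where "{w\<in>space M. \<not> (w \<in> A \<longleftrightarrow> w \<in> G)} \<subseteq> N" "emeasure M N = 0" "N \<in> sets M"
  by blast
 then have N: "N \<in> null_sets M" "{w\<in>space M. \<not> (w \<in> A \<longleftrightarrow> w \<in> G)} \<subseteq> N"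
  by auto
 have sub: "C \<in> sets (F t)" if "C \<subseteq> N" for C
  using null_F[OF _ t] that N(1) complete2 by blast
 have AM: "A \<subseteq> space M" using sets.sets_into_space[OF A] by (simp add: space_F)
 have "G = (A - N) \<union> (G \<inter> N)" using N(2) AM G by auto
 moreover have "(A - N) \<union> (G \<inter> N) \<in> sets (F t)"
  by (intro sets.Un sets.Diff A sub) auto
 ultimately show ?thesis by simp
qed

lemma measurable_F_AE:
 assumes t: "0 \<le> t" and f: "f \<in> borel_measurable (F t)" and AE: "AE w in M. f w = g w"
 shows "g \<in> borel_measurable (F t)"
proof (rule measurableI)
 fix A :: "'b set" assume A: "A \<in> sets borel"
 have "f -` A \<inter> space (F t) \<in> sets (F t)" using measurable_sets[OF f A] .
 then show "g -` A \<inter> space (F t) \<in> sets (F t)"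
  by (rule sets_F_AE[OF t]) (use AE in \<open>auto simp: space_F elim: AE_mp\<close>)
qed auto

lemma borel_measurable_AE_M:
 assumes f: "f \<in> borel_measurable M" and AE: "AE w in M. f w = g w"
 shows "g \<in> borel_measurable M"
proof (rule measurableI)
 interpret complete_measure M by (rule complete_M)
 fix A :: "'b set" assume A: "A \<in> sets borel"
 from AE_E[OF AE] obtain N where "{w\<in>space M. \<not> f w = g w} \<subseteq> N" "emeasure M N = 0" "N \<in> sets M"
  by blast
 then have N: "N \<in> null_sets M" "{w\<in>space M. \<not> f w = g w} \<subseteq> N"
  by auto
 have "g -` A \<inter> space M = (f -` A \<inter> space M - N) \<union> (g -` A \<inter> space M \<inter> N)" using N(2) by auto
 moreover have "g -` A \<inter> space M \<inter> N \<in> sets M"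
  by (rule complete[OF _ N(1)]) auto
 moreover have "f -` A \<inter> space M - N \<in> sets M"
  using measurable_sets[OF f A] N(1) by (intro sets.Diff) auto
 ultimately show "g -` A \<inter> space M \<in> sets M"
  by (metis sets.Un)
qed auto

lemma borel_measurable_AE_lim:
 fixes f :: "nat => 'a => 'b::{banach, second_countable_topology}"
 assumes f: "\<And>j. f j \<in> borel_measurable M" and AE: "AE w in M. (\<lambda>j. f j w) \<longlonglongrightarrow> g w"
 shows "g \<in> borel_measurable M"
proof (rule borel_measurable_AE_M)
 show "(\<lambda>w. lim (\<lambda>j. f j w)) \<in> borel_measurable M"
  by (rule borel_measurable_lim_metric[OF f])
 show "AE w in M. lim (\<lambda>j. f j w) = g w"
  using AE by eventually_elim (rule limI)
qed

text \<open>Outside \<open>[S, S')\<close> the coefficients are switched off. By \<open>stop\<close>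
  the switched coefficients are adapted, and they are bounded by \<open>C\<close>, so
  \<open>exp_sum\<close> applies to every dyadic partition of \<open>[0, c]\<close>. The expansions
  identify the limits of the sums as \<open>V\<close> and \<open>Q\<close>, and the exponentials are
  dominated by the constant \<open>exp (th^2 * C^2 * c / 2)\<close>.\<close>

lemma exp_stopped:
 fixes U A h q :: "real => 'a => real" and S S' :: "'a => real"
 assumes c: "0 < c" and C: "0 \<le> C" and E: "E \<in> sets M"
  and had: "\<And>t. 0 \<le> t ==> h t \<in> borel_measurable (F t)"
  and qad: "\<And>t. 0 \<le> t ==> q t \<in> borel_measurable (F t)"
  and stop: "\<And>t. 0 \<le> t ==> {w\<in>E. S w \<le> t \<and> t < S' w} \<in> sets (F t)"
  and bnd: "\<And>w t. w \<in> E ==> 0 \<le> t ==> S w \<le> t ==> t < S' w ==> \<bar>h t w\<bar> \<le> C \<and> \<bar>q t w\<bar> \<le> C"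
  and path: "\<And>w. w \<in> E ==> 0 \<le> S w \<and> S w \<le> S' w \<and> S' w \<le> c \<and>
    continuous_on {S w..S' w} (\<lambda>t. U t w) \<and> continuous_on {S w..S' w} (\<lambda>t. A t w)"
  and expU: "\<And>w eps. w \<in> E ==> 0 < eps ==> \<exists>dl>0. \<forall>u v. S w \<le> u \<and> u \<le> v \<and> v \<le> S' w \<and> v - u < dl -->
    \<bar>U v w - U u w - (h u w * (B v w - B u w) + q u w * ((B v w - B u w)\<^sup>2 - (v - u)))\<bar>
     \<le> eps * ((v - u) + (B v w - B u w)\<^sup>2)"
  and expA: "\<And>w eps. w \<in> E ==> 0 < eps ==> \<exists>dl>0. \<forall>u v. S w \<le> u \<and> u \<le> v \<and> v \<le> S' w \<and> v - u < dl -->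
    \<bar>A v w - A u w - (h u w)\<^sup>2 * (v - u)\<bar> \<le> eps * ((v - u) + (B v w - B u w)\<^sup>2)"
 defines "V \<equiv> \<lambda>w. if w \<in> E then U (S' w) w - U (S w) w else 0"
  and "Q \<equiv> \<lambda>w. if w \<in> E then A (S' w) w - A (S w) w else 0"
 shows "V \<in> borel_measurable M" "Q \<in> borel_measurable M"
  "(LINT w|M. exp (\<i> * of_real (th * V w) + of_real (th\<^sup>2 * Q w / 2))) = 1"
proof -
 define d where "d = (\<lambda>j::nat. c / 2 ^ j)"
 define on where "on = (\<lambda>t w. w \<in> E \<and> S w \<le> t \<and> t < S' w)"
 define a where "a = (\<lambda>j (i::nat) w. if on (real i * d j) w then h (real i * d j) w else 0)"
 define r where "r = (\<lambda>j (i::nat) w. if on (real i * d j) w then q (real i * d j) w else 0)"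
 define \<Delta> where "\<Delta> = (\<lambda>j (i::nat) w. B (real (Suc i) * d j) w - B (real i * d j) w)"
 have d: "0 < d j" for j using c by (simp add: d_def)
 have pw: "2 ^ j * (C' * (2 * (d j)\<^sup>2)) = 2 * c\<^sup>2 * C' / 2 ^ j" for j C'
  by (simp add: d_def power2_eq_square field_simps)
 have on_set: "{w\<in>space (F t). on t w} \<in> sets (F t)" if "0 \<le> t" for t
 proof -
  have "{w\<in>space (F t). on t w} = {w\<in>E. S w \<le> t \<and> t < S' w}"
   using sets.sets_into_space[OF E] by (auto simp: on_def space_F)
  then show ?thesis using stop[OF that] by simp
 qed
 have am: "a j i \<in> borel_measurable (F (real i * d j))" for i j
  unfolding a_def using d[of j] by (intro measurable_If had on_set) auto
 have rm: "r j i \<in> borel_measurable (F (real i * d j))" for i j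
  unfolding r_def using d[of j] by (intro measurable_If qad on_set) auto
 have ab: "\<bar>a j i w\<bar> \<le> C" and rb: "\<bar>r j i w\<bar> \<le> C" for i j w
  using bnd[of w "real i * d j"] C d[of j] by (auto simp: a_def r_def on_def)
 have [measurable]: "a j i \<in> borel_measurable M" for i j using measurable_F_M[OF am] .
 have [measurable]: "B (real i * d j) \<in> borel_measurable M" for i j using d[of j] by (intro B_meas) auto
 have [measurable]: "\<Delta> j i \<in> borel_measurable M" for i j
  unfolding \<Delta>_def using d[of j] by (intro borel_measurable_diff B_meas) auto
 \<comment> \<open>The part of the expansion with \<open>q\<close> vanishes in the limit: its second
   moment is at most \<open>2 * c^2 * C^2 / 2^j\<close>.\<close>
 have q1: "AE w in M. (\<lambda>j. \<Sum>i<2^j. r j i w * ((\<Delta> j i w)\<^sup>2 - d j)) \<longlonglongrightarrow> 0"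
 proof (rule AE_tendsto_zero_of_square_integrals)
  fix j
  note b = qv_sum_bound[of "d j" "2^j" "r j" C, OF d rm rb]
  show "integrable M (\<lambda>w. (\<Sum>i<2^j. r j i w * ((\<Delta> j i w)\<^sup>2 - d j))\<^sup>2)" using b by (simp add: \<Delta>_def)
  show "(LINT w|M. (\<Sum>i<2^j. r j i w * ((\<Delta> j i w)\<^sup>2 - d j))\<^sup>2) \<le> 2 * c\<^sup>2 * C\<^sup>2 / 2 ^ j"
   using b unfolding \<Delta>_def by (simp add: pw)
 qed
 \<comment> \<open>The same with coefficient \<open>1\<close>: the quadratic variations along the
   dyadic partitions converge to \<open>c\<close>. In particular they are bounded, as
   \<open>clipped_sum_tendsto\<close> demands.\<close>
 have q2: "AE w in M. (\<lambda>j. \<Sum>i<2^j. 1 * ((\<Delta> j i w)\<^sup>2 - d j)) \<longlonglongrightarrow> 0"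
 proof (rule AE_tendsto_zero_of_square_integrals)
  fix j
  note b = qv_sum_bound[of "d j" "2^j" "\<lambda>_ _. 1" 1, OF d]
  show "integrable M (\<lambda>w. (\<Sum>i<2^j. 1 * ((\<Delta> j i w)\<^sup>2 - d j))\<^sup>2)" using b by (simp add: \<Delta>_def)
  show "(LINT w|M. (\<Sum>i<2^j. 1 * ((\<Delta> j i w)\<^sup>2 - d j))\<^sup>2) \<le> 2 * c\<^sup>2 * 1 / 2 ^ j"
   using b pw[of j 1] unfolding \<Delta>_def by simp
 qed
 have Bc: "AE w in M. continuous_on {0..} (\<lambda>t. B t w)"
  using bm unfolding brownian_motion_def by auto
 have lim: "AE w in M. (\<lambda>j. \<Sum>i<2^j. a j i w * \<Delta> j i w) \<longlonglongrightarrow> V w \<and> (\<lambda>j. \<Sum>i<2^j. (a j i w)\<^sup>2 * d j) \<longlonglongrightarrow> Q w"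
  using q1 q2 Bc
 proof eventually_elim
  case (elim w)
  show ?case
  proof (cases "w \<in> E")
   case False
   then have "a j i w = 0" for i j by (simp add: a_def on_def)
   then show ?thesis using False by (simp add: V_def Q_def)
  next
   case True
   have dd: "real (Suc i) * d j - real i * d j = d j" for i j by (simp add: algebra_simps)
   have sd: "(\<Sum>i<(2::nat)^j. d j) = c" for j by (simp add: d_def)
   obtain K where K: "\<And>j. norm (\<Sum>i<2^j. 1 * ((\<Delta> j i w)\<^sup>2 - d j)) \<le> K"
    using BseqE[OF convergent_imp_Bseq[OF convergentI[OF elim(2)]]] by metis
   have qv: "(\<Sum>i<2^j. (B (real (Suc i) * (c / 2^j)) w - B (real i * (c / 2^j)) w)\<^sup>2) \<le> c + K" for j
    using K[of j] sd[of j] by (simp add: sum_subtractf \<Delta>_def d_def)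
   have uB: "\<exists>dl>0. \<forall>u v. 0 \<le> u \<and> u \<le> v \<and> v \<le> c \<and> v - u < dl --> \<bar>B v w - B u w\<bar> < eps" if e: "0 < eps" for eps
   proof -
    have "uniformly_continuous_on {0..c} (\<lambda>t. B t w)"
     by (intro compact_uniformly_continuous continuous_on_subset[OF elim(3)]) auto
    then obtain dl where "dl > 0" "\<And>u v. u \<in> {0..c} ==> v \<in> {0..c} ==> dist v u < dl ==> dist (B v w) (B u w) < eps"
     using e unfolding uniformly_continuous_on_def by metis
    then show ?thesis by (intro exI[of _ dl]) (auto simp: dist_real_def)
   qed
   note P = path[OF True]
   have SS: "0 \<le> S w" "S w \<le> S' w" "S' w \<le> c" using P by auto
   have "(\<lambda>j. \<Sum>i<2^j. if S w \<le> real i * (c / 2^j) \<and> real i * (c / 2^j) < S' w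
      then h (real i * (c / 2^j)) w * (B (real (Suc i) * (c / 2^j)) w - B (real i * (c / 2^j)) w)
       + q (real i * (c / 2^j)) w * ((B (real (Suc i) * (c / 2^j)) w - B (real i * (c / 2^j)) w)\<^sup>2 - (real (Suc i) * (c / 2^j) - real i * (c / 2^j)))
      else 0) \<longlonglongrightarrow> U (S' w) w - U (S w) w"
   proof (rule clipped_sum_tendsto[where D = "\<lambda>u v. h u w * (B v w - B u w) + q u w * ((B v w - B u w)\<^sup>2 - (v - u))" and X = "\<lambda>t. U t w" and b = "\<lambda>t. B t w", OF c SS _ expU[OF True] _ qv])
    show "continuous_on {S w..S' w} (\<lambda>t. U t w)" using P by auto
    fix eps :: real assume e: "0 < eps"
    \<comment> \<open>Since \<open>e1 \<le> 1\<close>, an increment of \<open>B\<close> below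
      \<open>e1\<close> also has its square below \<open>e1\<close>, so the linear and the quadratic
      term each cost at most \<open>C * e1 \<le> eps / 3\<close>.\<close>
    define e1 where "e1 = min 1 (eps / (3 * (C + 1)))"
    have e1: "0 < e1" "e1 \<le> 1" "C * e1 \<le> eps / 3"
    proof -
     show "0 < e1" "e1 \<le> 1" using e C by (auto simp: e1_def)
     have "C * e1 \<le> (C + 1) * (eps / (3 * (C + 1)))" using C \<open>0 < e1\<close> by (intro mult_mono) (auto simp: e1_def)
     also have "\<dots> = eps / 3" using C by (simp add: divide_simps)
     finally show "C * e1 \<le> eps / 3" .
    qed
    obtain dl where dl: "dl > 0" "\<And>u v. 0 \<le> u ==> u \<le> v ==> v \<le> c ==> v - u < dl ==> \<bar>B v w - B u w\<bar> < e1"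
     using uB[OF e1(1)] by blast
    show "\<exists>dl>0. \<forall>u v. S w \<le> u \<and> u < S' w \<and> u \<le> v \<and> v \<le> c \<and> v - u < dl -->
      \<bar>h u w * (B v w - B u w) + q u w * ((B v w - B u w)\<^sup>2 - (v - u))\<bar> \<le> eps"
    proof (intro exI[of _ "min dl e1"] conjI allI impI)
     show "0 < min dl e1" using dl e1 by auto
     fix u v assume uv: "S w \<le> u \<and> u < S' w \<and> u \<le> v \<and> v \<le> c \<and> v - u < min dl e1"
     have b: "\<bar>B v w - B u w\<bar> \<le> e1" using dl(2)[of u v] uv SS by auto
     have hq: "\<bar>h u w\<bar> \<le> C" "\<bar>q u w\<bar> \<le> C" using bnd[OF True, of u] uv SS by auto
     have "\<bar>B v w - B u w\<bar> * \<bar>B v w - B u w\<bar> \<le> e1 * 1"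
      using b e1 by (intro mult_mono) auto
     then have b2: "(B v w - B u w)\<^sup>2 \<le> e1" by (simp add: power2_eq_square abs_mult[symmetric])
     have "\<bar>h u w * (B v w - B u w)\<bar> \<le> C * e1"
      unfolding abs_mult using hq b C by (intro mult_mono) auto
     moreover have "\<bar>q u w * ((B v w - B u w)\<^sup>2 - (v - u))\<bar> \<le> C * e1"
     proof -
      have "\<bar>(B v w - B u w)\<^sup>2 - (v - u)\<bar> \<le> e1"
       using b2 uv zero_le_power2[of "B v w - B u w"] by linarith
      then show ?thesis unfolding abs_mult using hq C by (intro mult_mono) auto
     qed
     ultimately show "\<bar>h u w * (B v w - B u w) + q u w * ((B v w - B u w)\<^sup>2 - (v - u))\<bar> \<le> eps"
      using e1(3) e by linarith
    qed
   qed
   also have "(\<lambda>j. \<Sum>i<2^j. if S w \<le> real i * (c / 2^j) \<and> real i * (c / 2^j) < S' w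
      then h (real i * (c / 2^j)) w * (B (real (Suc i) * (c / 2^j)) w - B (real i * (c / 2^j)) w)
       + q (real i * (c / 2^j)) w * ((B (real (Suc i) * (c / 2^j)) w - B (real i * (c / 2^j)) w)\<^sup>2 - (real (Suc i) * (c / 2^j) - real i * (c / 2^j)))
      else 0) = (\<lambda>j. (\<Sum>i<2^j. a j i w * \<Delta> j i w) + (\<Sum>i<2^j. r j i w * ((\<Delta> j i w)\<^sup>2 - d j)))"
    unfolding sum.distrib[symmetric] d_def[symmetric] fun_cong[OF d_def, symmetric] dd
    by (intro ext sum.cong refl) (auto simp: a_def r_def on_def \<Delta>_def True)
   finally have "(\<lambda>j. (\<Sum>i<2^j. a j i w * \<Delta> j i w) + (\<Sum>i<2^j. r j i w * ((\<Delta> j i w)\<^sup>2 - d j))) \<longlonglongrightarrow> V w"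
    by (simp add: V_def True)
   from tendsto_diff[OF this elim(1)] have 1: "(\<lambda>j. \<Sum>i<2^j. a j i w * \<Delta> j i w) \<longlonglongrightarrow> V w" by simp
   have "(\<lambda>j. \<Sum>i<2^j. if S w \<le> real i * (c / 2^j) \<and> real i * (c / 2^j) < S' w
      then (h (real i * (c / 2^j)) w)\<^sup>2 * (real (Suc i) * (c / 2^j) - real i * (c / 2^j))
      else 0) \<longlonglongrightarrow> A (S' w) w - A (S w) w"
   proof (rule clipped_sum_tendsto[where D = "\<lambda>u v. (h u w)\<^sup>2 * (v - u)" and X = "\<lambda>t. A t w" and b = "\<lambda>t. B t w", OF c SS _ expA[OF True] _ qv])
    show "continuous_on {S w..S' w} (\<lambda>t. A t w)" using P by auto
    fix eps :: real assume e: "0 < eps"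
    show "\<exists>dl>0. \<forall>u v. S w \<le> u \<and> u < S' w \<and> u \<le> v \<and> v \<le> c \<and> v - u < dl --> \<bar>(h u w)\<^sup>2 * (v - u)\<bar> \<le> eps"
    proof (intro exI[of _ "eps / (C\<^sup>2 + 1)"] conjI allI impI)
     have C2: "0 < C\<^sup>2 + 1" by (simp add: add_nonneg_pos)
     then show "0 < eps / (C\<^sup>2 + 1)" using e by simp
     fix u v assume uv: "S w \<le> u \<and> u < S' w \<and> u \<le> v \<and> v \<le> c \<and> v - u < eps / (C\<^sup>2 + 1)"
     have "(h u w)\<^sup>2 \<le> C\<^sup>2" using bnd[OF True, of u] uv SS by (intro abs_le_imp_sq_le) auto
     then have "(h u w)\<^sup>2 * (v - u) \<le> (C\<^sup>2 + 1) * (eps / (C\<^sup>2 + 1))"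
      using uv by (intro mult_mono) auto
     also have "\<dots> = eps" using C2 by simp
     finally show "\<bar>(h u w)\<^sup>2 * (v - u)\<bar> \<le> eps" using uv by simp
    qed
   qed
   also have "(\<lambda>j. \<Sum>i<2^j. if S w \<le> real i * (c / 2^j) \<and> real i * (c / 2^j) < S' w
      then (h (real i * (c / 2^j)) w)\<^sup>2 * (real (Suc i) * (c / 2^j) - real i * (c / 2^j))
      else 0) = (\<lambda>j. \<Sum>i<2^j. (a j i w)\<^sup>2 * d j)"
    unfolding fun_cong[OF d_def, symmetric] dd
    by (intro ext sum.cong refl) (auto simp: a_def on_def True)
   finally have 2: "(\<lambda>j. \<Sum>i<2^j. (a j i w)\<^sup>2 * d j) \<longlonglongrightarrow> Q w" by (simp add: Q_def True)
   show ?thesis using 1 2 by simp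
  qed
 qed
 show V [measurable]: "V \<in> borel_measurable M"
 proof (rule borel_measurable_AE_lim)
  show "(\<lambda>w. \<Sum>i<2^j. a j i w * \<Delta> j i w) \<in> borel_measurable M" for j by measurable
  show "AE w in M. (\<lambda>j. \<Sum>i<2^j. a j i w * \<Delta> j i w) \<longlonglongrightarrow> V w" using lim by auto
 qed
 show Q [measurable]: "Q \<in> borel_measurable M"
 proof (rule borel_measurable_AE_lim)
  show "(\<lambda>w. \<Sum>i<2^j. (a j i w)\<^sup>2 * d j) \<in> borel_measurable M" for j by measurable
  show "AE w in M. (\<lambda>j. \<Sum>i<2^j. (a j i w)\<^sup>2 * d j) \<longlonglongrightarrow> Q w" using lim by auto
 qed
 define X where "X = (\<lambda>j w. exp (\<i> * of_real (th * (\<Sum>i<2^j. a j i w * \<Delta> j i w)) + of_real (th\<^sup>2 * (\<Sum>i<2^j. (a j i w)\<^sup>2 * d j) / 2)))"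
 have "(\<lambda>j. LINT w|M. X j w) \<longlonglongrightarrow> (LINT w|M. exp (\<i> * of_real (th * V w) + of_real (th\<^sup>2 * Q w / 2)))"
 proof (rule integral_dominated_convergence)
  show "(\<lambda>w. exp (\<i> * of_real (th * V w) + of_real (th\<^sup>2 * Q w / 2))) \<in> borel_measurable M"
   by measurable
  show "X j \<in> borel_measurable M" for j unfolding X_def by measurable
  show "integrable M (\<lambda>_. exp (th\<^sup>2 * (C\<^sup>2 * c) / 2))" by simp
  show "AE w in M. (\<lambda>j. X j w) \<longlonglongrightarrow> exp (\<i> * of_real (th * V w) + of_real (th\<^sup>2 * Q w / 2))"
   using lim unfolding X_def
   by eventually_elim (intro tendsto_exp tendsto_add tendsto_mult tendsto_of_real tendsto_divide tendsto_const; simp)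
  show "AE w in M. norm (X j w) \<le> exp (th\<^sup>2 * (C\<^sup>2 * c) / 2)" for j
  proof (rule AE_I2)
   fix w
   have "(\<Sum>i<2^j. (a j i w)\<^sup>2 * d j) \<le> (\<Sum>i<(2^j::nat). C\<^sup>2 * d j)"
    using ab[of j _ w] d[of j] by (intro sum_mono mult_right_mono abs_le_imp_sq_le) auto
   also have "\<dots> = C\<^sup>2 * c" by (simp add: d_def)
   finally have "th\<^sup>2 * (\<Sum>i<2^j. (a j i w)\<^sup>2 * d j) \<le> th\<^sup>2 * (C\<^sup>2 * c)" by (intro mult_left_mono) auto
   then show "norm (X j w) \<le> exp (th\<^sup>2 * (C\<^sup>2 * c) / 2)" unfolding X_def by simp
  qed
 qed
 moreover have "(LINT w|M. X j w) = 1" for j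
 proof -
  have "(LINT w|M. exp (\<i> * of_real (\<Sum>i<2^j. (th * a j i w) * (B (real (Suc i) * d j) w - B (real i * d j) w)) +
       of_real ((\<Sum>i<2^j. (th * a j i w)\<^sup>2 * d j) / 2))) = 1"
  proof (rule exp_sum[OF d])
   show "(\<lambda>w. th * a j i w) \<in> borel_measurable (F (real i * d j))" for i
    using am[of j i] by measurable
   show "\<bar>th * a j i w\<bar> \<le> \<bar>th\<bar> * C" for i w
    unfolding abs_mult using ab by (intro mult_left_mono) auto
  qed
  then show ?thesis
   unfolding X_def \<Delta>_def by (simp add: power_mult_distrib sum_distrib_left mult.assoc)
 qed
 ultimately show "(LINT w|M. exp (\<i> * of_real (th * V w) + of_real (th\<^sup>2 * Q w / 2))) = 1"
  using LIMSEQ_unique[OF _ tendsto_const[of 1]] by simp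
qed

end

text \<open>The identity is expanded at \<open>th = 1 / (n + 1)\<close>: the imaginary part times
  \<open>n + 1\<close> tends to \<open>X\<close>, and the real part minus \<open>1\<close>, times
  \<open>(n + 1)^2\<close>, tends to \<open>(Q - X^2) / 2\<close>. The bounds on \<open>X\<close>
  and \<open>Q\<close> allow dominated convergence.\<close>

lemma moments_from_exponential:
 fixes X Q :: "'a => real"
 assumes p: "prob_space M" and X [measurable]: "X \<in> borel_measurable M" and Q [measurable]: "Q \<in> borel_measurable M"
  and bX: "\<And>w. \<bar>X w\<bar> \<le> K" and bQ: "\<And>w. 0 \<le> Q w \<and> Q w \<le> K"
  and e: "\<And>th. (LINT w|M. exp (\<i> * of_real (th * X w) + of_real (th\<^sup>2 * Q w / 2))) = 1"
 shows "(LINT w|M. X w) = 0" "(LINT w|M. (X w)\<^sup>2) = (LINT w|M. Q w)"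
proof -
 interpret prob_space M by (rule p)
 define N where "N = (\<lambda>n::nat. real n + 1)"
 define Y where "Y = (\<lambda>n w. exp (\<i> * of_real (1 / N n * X w) + of_real ((1 / N n)\<^sup>2 * Q w / 2)))"
 have N: "N n \<ge> 1" for n by (simp add: N_def)
 have K: "0 \<le> K" using bQ[of undefined] by linarith
 have ReY: "Re (Y n w) = exp (Q w / (2 * (N n)\<^sup>2)) * cos (X w / N n)"
  and ImY: "Im (Y n w) = exp (Q w / (2 * (N n)\<^sup>2)) * sin (X w / N n)" for n w
  unfolding Y_def by (auto simp: Re_exp Im_exp power_one_over field_simps)
 have ea: "Q w / (2 * (N n)\<^sup>2) \<le> K / 2" "0 \<le> Q w / (2 * (N n)\<^sup>2)" for n w
 proof -
  have "1 \<le> (N n)\<^sup>2" using N[of n] by (simp add: one_le_power)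
  then have "Q w / (2 * (N n)\<^sup>2) \<le> Q w / (2 * 1)" using bQ[of w] by (intro divide_left_mono) auto
  then show "Q w / (2 * (N n)\<^sup>2) \<le> K / 2" using bQ[of w] by auto
  show "0 \<le> Q w / (2 * (N n)\<^sup>2)" using bQ[of w] by simp
 qed
 have Ym [measurable]: "Y n \<in> borel_measurable M" for n unfolding Y_def by measurable
 have int: "integrable M (Y n)" for n
 proof (rule integrable_const_bound[of _ "exp (K / 2)"])
  show "AE w in M. norm (Y n w) \<le> exp (K / 2)"
  proof (rule AE_I2)
   fix w have "norm (Y n w) = exp (Q w / (2 * (N n)\<^sup>2))"
    unfolding Y_def by (simp add: power_one_over field_simps)
   then show "norm (Y n w) \<le> exp (K / 2)" using ea[of w n] by simp
  qed
 qed measurable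
 have EY: "(LINT w|M. Y n w) = 1" for n unfolding Y_def by (rule e)
 have ERe: "(LINT w|M. Re (Y n w)) = 1" and EIm: "(LINT w|M. Im (Y n w)) = 0" for n
  using integral_Re[OF int, of n] integral_Im[OF int, of n] by (auto simp: EY)
 have "(\<lambda>n. LINT w|M. N n * Im (Y n w)) \<longlonglongrightarrow> (LINT w|M. X w)"
 proof (rule integral_dominated_convergence)
  show "integrable M (\<lambda>_. exp (K / 2) * K)" by simp
  show "AE w in M. norm (N n * Im (Y n w)) \<le> exp (K / 2) * K" for n
  proof (rule AE_I2)
   fix w
   have "\<bar>sin (X w / N n)\<bar> \<le> \<bar>X w / N n\<bar>" by (rule abs_sin_x_le_abs_x)
   then have "N n * \<bar>sin (X w / N n)\<bar> \<le> \<bar>X w\<bar>" using N[of n] by (simp add: abs_divide field_simps)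
   then have "exp (Q w / (2 * (N n)\<^sup>2)) * (N n * \<bar>sin (X w / N n)\<bar>) \<le> exp (K / 2) * K"
    using ea[of w n] bX[of w] N[of n] by (intro mult_mono) auto
   then show "norm (N n * Im (Y n w)) \<le> exp (K / 2) * K"
    unfolding ImY using N[of n] by (simp add: abs_mult mult_ac)
  qed
  show "AE w in M. (\<lambda>n. N n * Im (Y n w)) \<longlonglongrightarrow> X w"
  proof (rule AE_I2)
   fix w
   show "(\<lambda>n. N n * Im (Y n w)) \<longlonglongrightarrow> X w" unfolding ImY N_def by real_asymp
  qed
 qed (auto simp: Ym)
 moreover have "(LINT w|M. N n * Im (Y n w)) = 0" for n using EIm[of n] by simp
 ultimately have "(\<lambda>n::nat. 0) \<longlonglongrightarrow> (LINT w|M. X w)" by (simp only:)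
 then show "(LINT w|M. X w) = 0"
  by (simp add: LIMSEQ_const_iff)
 have "(\<lambda>n. LINT w|M. (N n)\<^sup>2 * (Re (Y n w) - 1)) \<longlonglongrightarrow> (LINT w|M. Q w / 2 - (X w)\<^sup>2 / 2)"
 proof (rule integral_dominated_convergence)
  show "integrable M (\<lambda>_. exp (K / 2) * (K / 2) + K\<^sup>2 / 2)" by simp
  show "AE w in M. norm ((N n)\<^sup>2 * (Re (Y n w) - 1)) \<le> exp (K / 2) * (K / 2) + K\<^sup>2 / 2" for n
  proof (rule AE_I2)
   fix w
   define s where "s = Q w / (2 * (N n)\<^sup>2)"
   define b where "b = X w / N n"
   have s: "0 \<le> s" "s \<le> K / 2" using ea[of w n] by (auto simp: s_def)
   have "1 - s \<le> exp (- s)" using exp_ge_add_one_self[of "-s"] by simp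
   then have "exp s * (1 - s) \<le> exp s * exp (- s)" by (intro mult_left_mono) auto
   then have es: "exp s - 1 \<le> exp s * s" by (simp add: exp_minus algebra_simps)
   have cb: "1 - cos b \<le> b\<^sup>2 / 2"
   proof -
    have "cos b = 1 - 2 * (sin (b / 2))\<^sup>2" using cos_double_sin[of "b / 2"] by simp
    moreover have "(sin (b / 2))\<^sup>2 \<le> (b / 2)\<^sup>2"
     using abs_sin_x_le_abs_x[of "b / 2"] by (rule abs_le_square_iff[THEN iffD1])
    ultimately show ?thesis by (simp add: power2_eq_square)
   qed
   have "\<bar>exp s * cos b - 1\<bar> = \<bar>(exp s - 1) * cos b - (1 - cos b)\<bar>" by (simp add: algebra_simps)
   also have "\<dots> \<le> \<bar>(exp s - 1) * cos b\<bar> + \<bar>1 - cos b\<bar>" by (rule abs_triangle_ineq4)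
   also have "\<bar>(exp s - 1) * cos b\<bar> \<le> (exp s - 1) * 1"
    unfolding abs_mult using s by (intro mult_mono) auto
   finally have "\<bar>exp s * cos b - 1\<bar> \<le> exp s * s + b\<^sup>2 / 2" using es cb by auto
   then have "(N n)\<^sup>2 * \<bar>exp s * cos b - 1\<bar> \<le> (N n)\<^sup>2 * (exp s * s + b\<^sup>2 / 2)" by (intro mult_left_mono) auto
   also have "\<dots> = exp s * (Q w / 2) + (X w)\<^sup>2 / 2"
    using N[of n] by (simp add: s_def b_def power_divide field_simps power2_eq_square)
   also have "\<dots> \<le> exp (K / 2) * (K / 2) + K\<^sup>2 / 2"
    using s bQ[of w] abs_le_imp_sq_le[OF bX[of w]] by (intro add_mono mult_mono) auto
   finally show "norm ((N n)\<^sup>2 * (Re (Y n w) - 1)) \<le> exp (K / 2) * (K / 2) + K\<^sup>2 / 2"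
    unfolding ReY s_def b_def by (simp add: abs_mult)
  qed
  show "AE w in M. (\<lambda>n. (N n)\<^sup>2 * (Re (Y n w) - 1)) \<longlonglongrightarrow> Q w / 2 - (X w)\<^sup>2 / 2"
  proof (rule AE_I2)
   fix w
   show "(\<lambda>n. (N n)\<^sup>2 * (Re (Y n w) - 1)) \<longlonglongrightarrow> Q w / 2 - (X w)\<^sup>2 / 2" unfolding ReY N_def power2_eq_square by real_asymp
  qed
 qed (auto simp: Ym)
 moreover have "(LINT w|M. (N n)\<^sup>2 * (Re (Y n w) - 1)) = 0" for n
  using ERe[of n] int[of n] by (simp add: prob_space)
 ultimately have "(\<lambda>n::nat. 0) \<longlonglongrightarrow> (LINT w|M. Q w / 2 - (X w)\<^sup>2 / 2)" by (simp only:)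
 then have "(LINT w|M. Q w / 2 - (X w)\<^sup>2 / 2) = 0"
  by (simp add: LIMSEQ_const_iff)
 moreover have "integrable M Q" by (rule integrable_const_bound[of _ K]) (use bQ in auto)
 moreover have "integrable M (\<lambda>w. (X w)\<^sup>2)"
  by (rule integrable_const_bound[of _ "K\<^sup>2"]) (use abs_le_imp_sq_le[OF bX] in auto)
 ultimately show "(LINT w|M. (X w)\<^sup>2) = (LINT w|M. Q w)" by simp
qed

section \<open>Entrance times and stopped processes\<close>

text \<open>Paths live on a half-open time interval, so \<open>G\<close> can only be expected to be
  closed below each of its points. The cap \<open>c\<close> keeps the time finite when
  \<open>G\<close> is empty.\<close>

lemma Inf_entrance:
 fixes G :: "real set"
 assumes G: "G \<subseteq> {0..}" and cl: "\<And>b. b \<in> G ==> closed (G \<inter> {0..b})" and c: "0 \<le> c"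
 defines "T \<equiv> Inf (insert c G)"
 shows "0 \<le> T" "T \<le> c" "T = c \<or> T \<in> G" "\<And>t. t < T ==> t \<notin> G" "\<And>t. T \<le> t \<longleftrightarrow> c \<le> t \<or> (\<exists>s\<in>G. s \<le> t)"
proof -
 have bb: "bdd_below (insert c G)" using G c by (intro bdd_belowI[of _ 0]) auto
 show "0 \<le> T" unfolding T_def using G c by (intro cInf_greatest) auto
 show Tc: "T \<le> c" unfolding T_def using bb by (intro cInf_lower) auto
 have TG: "T \<le> s" if "s \<in> G" for s unfolding T_def using bb that by (intro cInf_lower) auto
 then show "\<And>t. t < T ==> t \<notin> G" by force
 show 3: "T = c \<or> T \<in> G"
 proof (rule ccontr)
  assume n: "\<not> (T = c \<or> T \<in> G)"
  then have "T < c" using Tc by auto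
  then obtain b where b: "b \<in> insert c G" "b < c" unfolding T_def using cInf_lessD[of "insert c G" c] by auto
  then have bG: "b \<in> G" by auto
  \<comment> \<open>The infimum does not change when \<open>G\<close> is cut off at a point
    \<open>b < c\<close> of its own, and the closed set that remains attains it.\<close>
  let ?H = "G \<inter> {0..b}"
  have "b \<in> ?H" using bG G by auto
  then have H: "?H \<noteq> {}" "bdd_below ?H" "closed ?H" using bG G cl bdd_below_mono[OF bb, of ?H] by auto
  then have i: "Inf ?H \<in> ?H" by (intro closed_contains_Inf)
  have "Inf ?H \<le> T"
   unfolding T_def
  proof (rule cInf_greatest)
   fix x assume "x \<in> insert c G"
   then consider "x \<in> ?H" | "b \<le> x" using b G by force
   then show "Inf ?H \<le> x"
   proof cases
    case 1 then show ?thesis using H(2) by (intro cInf_lower)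
   next
    case 2
    have "Inf ?H \<le> b" using bG G H(2) by (intro cInf_lower) auto
    then show ?thesis using 2 by simp
   qed
  qed auto
  then have "T = Inf ?H" using TG[of "Inf ?H"] i by auto
  then show False using i n by auto
 qed
 show "\<And>t. T \<le> t \<longleftrightarrow> c \<le> t \<or> (\<exists>s\<in>G. s \<le> t)"
  using 3 TG Tc by (metis order_trans)
qed

text \<open>That a running maximum over \<open>[0, t]\<close> reaches \<open>l\<close> becomes
  countably many conditions. Rationals approximate from the right, so \<open>t\<close> itself is
  added for a maximum at the right end; compactness removes the slack
  \<open>1 / (j + 1)\<close>.\<close>

lemma exceeds_iff_rational:
 fixes X :: "real => real"
 assumes t: "0 \<le> t" and X: "continuous_on {0..t} X"
 shows "(\<exists>s\<in>{0..t}. l \<le> X s) \<longleftrightarrow> (\<forall>j::nat. \<exists>r\<in>insert t (\<rat> \<inter> {0..t}). l - 1 / (real j + 1) < X r)"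
proof
 assume "\<exists>s\<in>{0..t}. l \<le> X s"
 then obtain s where s: "s \<in> {0..t}" "l \<le> X s" by auto
 show "\<forall>j::nat. \<exists>r\<in>insert t (\<rat> \<inter> {0..t}). l - 1 / (real j + 1) < X r"
 proof
  fix j :: nat
  let ?e = "1 / (real j + 1)"
  have "0 < ?e" by simp
  then obtain d where d: "d > 0" "\<And>r. r \<in> {0..t} ==> dist r s < d ==> dist (X r) (X s) < ?e"
   using X s(1) unfolding continuous_on_iff by metis
  show "\<exists>r\<in>insert t (\<rat> \<inter> {0..t}). l - ?e < X r"
  proof (cases "s = t")
   case True then show ?thesis using s by (intro bexI[of _ t]) (auto intro: less_le_trans[of _ l])
  next
   case False
   then have "s < min t (s + d)" using s d by auto
   then obtain r where r: "r \<in> \<rat>" "s < r" "r < min t (s + d)" using Rats_dense_in_real by blast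
   then have "dist (X r) (X s) < ?e" using s by (intro d(2)) (auto simp: dist_real_def)
   then have "l - ?e < X r" using s by (simp add: dist_real_def)
   then show ?thesis using r s by (intro bexI[of _ r]) auto
  qed
 qed
next
 assume R: "\<forall>j::nat. \<exists>r\<in>insert t (\<rat> \<inter> {0..t}). l - 1 / (real j + 1) < X r"
 obtain s where s: "s \<in> {0..t}" "\<And>y. y \<in> {0..t} ==> X y \<le> X s"
  using continuous_attains_sup[OF _ _ X] t by auto
 have "l \<le> X s"
 proof (rule field_le_epsilon)
  fix e :: real assume "0 < e"
  then obtain j where j: "1 / (real j + 1) < e" using reals_Archimedean[of e] by (auto simp: inverse_eq_divide add.commute)
  obtain r where "r \<in> insert t (\<rat> \<inter> {0..t})" "l - 1 / (real j + 1) < X r" using R by blast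
  then show "l \<le> X s + e" using s(2)[of r] j t by auto
 qed
 then show "\<exists>s\<in>{0..t}. l \<le> X s" using s by auto
qed

context filtered_brownian_motion
begin

lemma sets_exceeds_rational:
 assumes X: "\<And>s. 0 \<le> s ==> X s \<in> borel_measurable (F s)" and t: "0 \<le> t"
 shows "{w\<in>space M. \<forall>j::nat. \<exists>r\<in>insert t (\<rat> \<inter> {0..t}). l - 1 / (real j + 1) < (X r w :: real)} \<in> sets (F t)"
proof -
 have [measurable]: "X r \<in> borel_measurable (F t)" if "r \<in> insert t (\<rat> \<inter> {0..t})" for r
  using measurable_F_mono[OF _ X, of r t] that t by auto
 have c: "countable (insert t (\<rat> \<inter> {0..t}))" using countable_rat by auto
 have "{w\<in>space (F t). \<forall>j::nat. \<exists>r\<in>insert t (\<rat> \<inter> {0..t}). l - 1 / (real j + 1) < X r w} \<in> sets (F t)"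
 proof (rule sets.sets_Collect_countable_All)
  fix j
  show "{w\<in>space (F t). \<exists>r\<in>insert t (\<rat> \<inter> {0..t}). l - 1 / (real j + 1) < X r w} \<in> sets (F t)"
   by (rule sets.sets_Collect_countable_Ex'[OF _ c]) measurable
 qed
 then show ?thesis by (simp only: space_F)
qed

text \<open>\<open>stopping_time\<close> speaks of all real times; at the negative ones the event is
  empty.\<close>

lemma stopping_timeI_nonneg:
 assumes "\<And>w. w \<in> space M ==> 0 \<le> T w" "\<And>t. 0 \<le> t ==> {w\<in>space M. T w \<le> t} \<in> sets (F t)"
 shows "stopping_time F T"
 unfolding stopping_time_def
proof
 fix t show "Measurable.pred (F t) (\<lambda>x. T x \<le> t)"
 proof (cases "0 \<le> t")
  case True then show ?thesis using assms(2)[OF True] by (simp add: pred_def space_F)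
 next
  case False
  then have "{w\<in>space M. T w \<le> t} = {}" using assms(1) by fastforce
  then show ?thesis unfolding pred_def space_F by (metis sets.empty_sets)
 qed
qed

lemma stopping_time_sets:
 assumes "stopping_time F T" shows "{w\<in>space M. T w \<le> t} \<in> sets (F t)" "{w\<in>space M. t < T w} \<in> sets (F t)"
  "{w\<in>space M. T w < t} \<in> sets (F t)" "{w\<in>space M. t \<le> T w} \<in> sets (F t)"
proof -
 note a = stopping_timeD[OF assms, of t] stopping_time_less_const[OF assms, of t]
 note [measurable] = a
 show "{w\<in>space M. T w \<le> t} \<in> sets (F t)" "{w\<in>space M. T w < t} \<in> sets (F t)"
  using a by (auto simp: pred_def space_F)
 have "{w\<in>space M. t < T w} = space (F t) - {w\<in>space M. T w \<le> t}" "{w\<in>space M. t \<le> T w} = space (F t) - {w\<in>space M. T w < t}"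
  by (auto simp: space_F)
 then show "{w\<in>space M. t < T w} \<in> sets (F t)" "{w\<in>space M. t \<le> T w} \<in> sets (F t)"
  using a sets.compl_sets[of "{w\<in>space M. T w \<le> t}" "F t"] sets.compl_sets[of "{w\<in>space M. T w < t}" "F t"]
  by (simp_all add: pred_def space_F)
qed

text \<open>Dyadic rounding of \<open>min t (S w)\<close> downwards takes countably many values, all
  at most \<open>t\<close>, so the rounded process is measurable for \<open>F t\<close>. It
  converges because the rounded times stay in \<open>[0, S w]\<close>, where the path is
  continuous.\<close>

lemma stopped_adapted:
 fixes X :: "real => 'a => real"
 assumes X: "\<And>s. 0 \<le> s ==> X s \<in> borel_measurable (F s)" and S: "stopping_time F S" and t: "0 \<le> t"
  and c: "AE w in M. 0 \<le> S w \<and> continuous_on {0..S w} (\<lambda>s. X s w)"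
 shows "(\<lambda>w. X (min t (S w)) w) \<in> borel_measurable (F t)"
proof (cases "t = 0")
 case True
 show ?thesis
  by (rule measurable_F_AE[OF t X[OF t]]) (use c True in \<open>auto elim!: AE_mp\<close>)
next
 case False
 then have t0: "0 < t" using t by simp
 define g where "g = (\<lambda>(N::nat) w. nat \<lfloor>min t (S w) / t * 2 ^ N\<rfloor>)"
 define Y where "Y = (\<lambda>N w. X (min t (real (g N w) * (t / 2 ^ N))) w)"
 have m: "(\<lambda>w. min t (S w)) \<in> borel_measurable (F t)"
 proof (rule borel_measurable_iff_le[THEN iffD2], intro allI)
  fix a
  show "{w \<in> space (F t). min t (S w) \<le> a} \<in> sets (F t)"
  proof (cases "t \<le> a")
   case True then show ?thesis by (simp add: min_le_iff_disj)
  next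
   case False
   then have "{w \<in> space (F t). min t (S w) \<le> a} = {w\<in>space M. S w \<le> a}"
    by (auto simp: space_F min_le_iff_disj)
   then show ?thesis using stopping_time_sets(1)[OF S, of a] sets_F_mono[of a t] False by auto
  qed
 qed
 have gm: "g N \<in> measurable (F t) (count_space UNIV)" for N
  unfolding g_def using m by measurable
 have Ym: "Y N \<in> borel_measurable (F t)" for N
  unfolding Y_def
 proof (rule measurable_compose_countable[OF _ gm])
  fix i show "(\<lambda>w. X (min t (real i * (t / 2 ^ N))) w) \<in> borel_measurable (F t)"
   using t0 by (intro measurable_F_mono[OF _ X]) auto
 qed
 have lim: "AE w in M. (\<lambda>N. Y N w) \<longlonglongrightarrow> X (min t (S w)) w"
  using c
 proof eventually_elim
  case (elim w)
  define m where "m = min t (S w)"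
  have m0: "0 \<le> m" "m \<le> t" "m \<le> S w" using elim t by (auto simp: m_def)
  define r where "r = (\<lambda>N. real (g N w) * (t / 2 ^ N))"
  have gr: "real (g N w) \<le> m / t * 2 ^ N" "m / t * 2 ^ N < real (g N w) + 1" for N
  proof -
   have "0 \<le> m / t * 2 ^ N" using m0 t0 by simp
   then show "real (g N w) \<le> m / t * 2 ^ N" "m / t * 2 ^ N < real (g N w) + 1"
    unfolding g_def m_def[symmetric] by linarith+
  qed
  have r: "0 \<le> r N" "r N \<le> m" "m - t / 2 ^ N \<le> r N" for N
  proof -
   show "0 \<le> r N" using t0 by (simp add: r_def)
   have "r N \<le> m / t * 2 ^ N * (t / 2 ^ N)" unfolding r_def using gr(1)[of N] t0 by (intro mult_right_mono) auto
   also have e: "m / t * 2 ^ N * (t / 2 ^ N) = m" using t0 by simp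
   finally show "r N \<le> m" .
   have "m / t * 2 ^ N * (t / 2 ^ N) \<le> (real (g N w) + 1) * (t / 2 ^ N)" using gr(2)[of N] t0 by (intro mult_right_mono) auto
   then show "m - t / 2 ^ N \<le> r N" unfolding e r_def by (simp add: distrib_right add_divide_distrib)
  qed
  have "(\<lambda>N. m - t * (1/2) ^ N) \<longlonglongrightarrow> m - t * 0"
   by (intro tendsto_intros LIMSEQ_realpow_zero) auto
  then have "(\<lambda>N. m - t / 2 ^ N) \<longlonglongrightarrow> m" by (simp add: power_one_over)
  then have "r \<longlonglongrightarrow> m"
   by (rule tendsto_sandwich[rotated 2, OF _ tendsto_const]) (use r in auto)
  moreover have "continuous_on {0..m} (\<lambda>s. X s w)" using elim m0 by (auto intro: continuous_on_subset)
  ultimately have "(\<lambda>N. X (r N) w) \<longlonglongrightarrow> X m w"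
   using m0 r by (intro continuous_on_tendsto_compose[of "{0..m}" "\<lambda>s. X s w" r m]) auto
  moreover have "min t (r N) = r N" for N using r(2)[of N] m0 by auto
  ultimately show ?case by (simp add: Y_def r_def m_def)
 qed
 show ?thesis
 proof (rule measurable_F_AE[OF t])
  show "(\<lambda>w. lim (\<lambda>N. Y N w)) \<in> borel_measurable (F t)" by (rule borel_measurable_lim_metric[OF Ym])
  show "AE w in M. lim (\<lambda>N. Y N w) = X (min t (S w)) w"
   using lim by eventually_elim (rule limI)
 qed
qed

text \<open>The cap at \<open>T w\<close> is there because the level may never be reached and
  \<open>X\<close> will be continuous only up to \<open>T w\<close>.\<close>

definition hit :: "(real => 'a => real) => real => ('a => real) => 'a => real" where
 "hit X l T w = Inf (insert (T w) {t. 0 \<le> t \<and> t \<le> T w \<and> l \<le> X t w})"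

lemma hit_props:
 assumes T: "0 \<le> T w" and X: "continuous_on {0..T w} (\<lambda>t. X t w)"
 shows "0 \<le> hit X l T w" "hit X l T w \<le> T w" "hit X l T w = T w \<or> l \<le> X (hit X l T w) w"
  "\<And>t. 0 \<le> t ==> t < hit X l T w ==> X t w < l"
  "\<And>t. hit X l T w \<le> t \<longleftrightarrow> T w \<le> t \<or> (\<exists>s. 0 \<le> s \<and> s \<le> T w \<and> s \<le> t \<and> l \<le> X s w)"
proof -
 let ?G = "{t. 0 \<le> t \<and> t \<le> T w \<and> l \<le> X t w}"
 have cl: "closed (?G \<inter> {0..b})" if "b \<in> ?G" for b
 proof -
  have "continuous_on {0..b} (\<lambda>t. X t w)" using X that by (auto intro: continuous_on_subset)
  then have "closed ({0..b} \<inter> (\<lambda>t. X t w) -` {l..})"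
   by (intro continuous_closed_preimage) auto
  moreover have "?G \<inter> {0..b} = {0..b} \<inter> (\<lambda>t. X t w) -` {l..}" using that by auto
  ultimately show ?thesis by simp
 qed
 note I = Inf_entrance[of ?G "T w", OF _ cl T, folded hit_def]
 show "0 \<le> hit X l T w" "hit X l T w \<le> T w" using I(1,2) by auto
 show "hit X l T w = T w \<or> l \<le> X (hit X l T w) w" using I(3) by auto
 show "X t w < l" if "0 \<le> t" "t < hit X l T w" for t
  using I(4)[OF _ _ that(2)] I(2) that by force
 show "hit X l T w \<le> t \<longleftrightarrow> T w \<le> t \<or> (\<exists>s. 0 \<le> s \<and> s \<le> T w \<and> s \<le> t \<and> l \<le> X s w)" for t
  using I(5)[of t] by auto
qed

text \<open>On \<open>T w \<le> t\<close> the capped time is at most \<open>t\<close> anyway.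
  Elsewhere the path is continuous on \<open>[0, t]\<close>, and the rational criterion
  decides.\<close>

lemma stopping_time_hit:
 assumes X: "\<And>s. 0 \<le> s ==> X s \<in> borel_measurable (F s)" and T: "stopping_time F T"
  and T0: "\<And>w. w \<in> space M ==> 0 \<le> T w"
  and c: "AE w in M. continuous_on {0..T w} (\<lambda>s. X s w)"
 shows "stopping_time F (hit X l T)"
proof (rule stopping_timeI_nonneg)
 show "0 \<le> hit X l T w" if "w \<in> space M" for w
  unfolding hit_def using T0[OF that] by (intro cInf_greatest) auto
 fix t :: real assume t: "0 \<le> t"
 let ?G = "{w\<in>space M. \<forall>j::nat. \<exists>r\<in>insert t (\<rat> \<inter> {0..t}). l - 1 / (real j + 1) < X r w}"
 show "{w\<in>space M. hit X l T w \<le> t} \<in> sets (F t)"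
 proof (rule sets_F_AE[OF t])
  show "{w\<in>space M. T w \<le> t} \<union> ({w\<in>space M. t < T w} \<inter> ?G) \<in> sets (F t)"
   using stopping_time_sets[OF T] sets_exceeds_rational[OF X t] by auto
  show "AE w in M. w \<in> {w\<in>space M. T w \<le> t} \<union> ({w\<in>space M. t < T w} \<inter> ?G) \<longleftrightarrow> w \<in> {w\<in>space M. hit X l T w \<le> t}"
   using c AE_space
  proof eventually_elim
   case (elim w)
   note h = hit_props(5)[of T w X l t, OF T0[OF elim(2)] elim(1)]
   show ?case
   proof (cases "T w \<le> t")
    case True then show ?thesis using h elim by auto
   next
    case False
    have "continuous_on {0..t} (\<lambda>s. X s w)" using False elim(1) by (auto intro: continuous_on_subset)
    note ex = exceeds_iff_rational[OF t this, of l]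
    have eq: "(\<exists>s. 0 \<le> s \<and> s \<le> T w \<and> s \<le> t \<and> l \<le> X s w) \<longleftrightarrow> (\<exists>s\<in>{0..t}. l \<le> X s w)"
     using False by (auto intro: order_trans)
    have "(\<exists>s. 0 \<le> s \<and> s \<le> T w \<and> s \<le> t \<and> l \<le> X s w) \<longleftrightarrow> w \<in> ?G"
     unfolding eq ex mem_Collect_eq using elim(2) by (simp only: simp_thms)
    then show ?thesis using h False elim(2) by auto
   qed
  qed
 qed auto
qed

end

section \<open>Processes with a second-order Brownian expansion\<close>

lemma interval_before_D: "t \<in> interval_before \<sigma> ==> {0..t} \<subseteq> interval_before \<sigma>"
 by (auto simp: interval_before_def intro: order_le_less_trans[of "ereal _" "ereal t"])

lemma interval_before_extend:
 assumes "s \<in> interval_before \<sigma>" obtains s' where "s < s'" "s' \<in> interval_before \<sigma>"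
proof -
 have "ereal s < \<sigma>" "0 \<le> s" using assms by (auto simp: interval_before_def)
 then obtain r where "ereal s < r" "r < \<sigma>" using dense by blast
 moreover then obtain s' where "r = ereal s'" by (cases r) auto
 ultimately show ?thesis using that[of s'] \<open>0 \<le> s\<close> by (auto simp: interval_before_def)
qed

text \<open>\<open>R\<close> dominates all coefficients and blows up at a finite \<open>\<sigma>\<close>, so that its level crossing times exhaust
\<open>[0, \<sigma>)\<close>.\<close>

locale stopped_ito = filtered_brownian_motion M F B
 for M :: "'a measure" and F :: "real => 'a measure" and B :: "real => 'a => real" +
 fixes \<sigma> :: "'a => ereal" and U h q A R :: "real => 'a => real" and R0 :: real and G0 :: "'a set"
 assumes G0: "G0 \<subseteq> space M" "AE w in M. w \<in> G0"
  and adapted: "\<And>t. 0 \<le> t ==> U t \<in> borel_measurable (F t)" "\<And>t. 0 \<le> t ==> h t \<in> borel_measurable (F t)"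
   "\<And>t. 0 \<le> t ==> q t \<in> borel_measurable (F t)" "\<And>t. 0 \<le> t ==> A t \<in> borel_measurable (F t)"
   "\<And>t. 0 \<le> t ==> R t \<in> borel_measurable (F t)"
  and \<sigma>_pos: "\<And>w. w \<in> G0 ==> 0 < \<sigma> w"
  and cont: "\<And>w. w \<in> G0 ==> continuous_on (interval_before (\<sigma> w)) (\<lambda>t. U t w)"
   "\<And>w. w \<in> G0 ==> continuous_on (interval_before (\<sigma> w)) (\<lambda>t. A t w)"
   "\<And>w. w \<in> G0 ==> continuous_on (interval_before (\<sigma> w)) (\<lambda>t. R t w)"
  and dom: "\<And>w t. w \<in> G0 ==> t \<in> interval_before (\<sigma> w) ==>
    \<bar>U t w\<bar> \<le> R t w \<and> \<bar>h t w\<bar> \<le> R t w \<and> \<bar>q t w\<bar> \<le> R t w \<and> A t w \<le> R t w"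
  and R0: "\<And>w. w \<in> G0 ==> R 0 w \<le> R0" "0 \<le> R0"
  and explode: "\<And>w s K. w \<in> G0 ==> \<sigma> w = ereal s ==> \<exists>t\<in>interval_before (\<sigma> w). K \<le> R t w"
  and A0: "\<And>w. w \<in> G0 ==> A 0 w = 0"
  and A_mono: "\<And>w s t. w \<in> G0 ==> t \<in> interval_before (\<sigma> w) ==> 0 \<le> s ==> s < t ==> A s w < A t w"
  and expU: "\<And>w eps T. w \<in> G0 ==> T \<in> interval_before (\<sigma> w) ==> 0 < eps ==>
    \<exists>dl>0. \<forall>u v. 0 \<le> u \<and> u \<le> v \<and> v \<le> T \<and> v - u < dl -->
    \<bar>U v w - U u w - (h u w * (B v w - B u w) + q u w * ((B v w - B u w)\<^sup>2 - (v - u)))\<bar>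
     \<le> eps * ((v - u) + (B v w - B u w)\<^sup>2)"
  and expA: "\<And>w eps T. w \<in> G0 ==> T \<in> interval_before (\<sigma> w) ==> 0 < eps ==>
    \<exists>dl>0. \<forall>u v. 0 \<le> u \<and> u \<le> v \<and> v \<le> T \<and> v - u < dl -->
    \<bar>A v w - A u w - (h u w)\<^sup>2 * (v - u)\<bar> \<le> eps * ((v - u) + (B v w - B u w)\<^sup>2)"
begin

abbreviation J where "J w \<equiv> interval_before (\<sigma> w)"

lemma G0_sets: "0 \<le> t ==> G0 \<in> sets (F t)" "G0 \<in> sets M"
proof -
 show a: "G0 \<in> sets (F t)" if "0 \<le> t" for t
 proof (rule sets_F_AE[OF that sets.top G0(1)])
  show "AE w in M. (w \<in> space (F t)) = (w \<in> G0)"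
   using G0(2) by eventually_elim (use G0(1) space_F in auto)
 qed
 then show "G0 \<in> sets M" using sets_F_M[of G0 0] by auto
qed

text \<open>The \<open>1\<close> puts every level strictly above the initial value of
  \<open>R\<close>, which makes the crossing times positive.\<close>

definition level :: "nat => real" where "level m = R0 + 1 + real m"

text \<open>The level serves twice, as a bound on \<open>R\<close> and as a bound on time; the
  latter keeps the crossing time finite when \<open>\<sigma>\<close> is infinite.\<close>

definition exhaust :: "nat => 'a => real" where
 "exhaust m w = (if w \<in> G0 then Inf (insert (level m) {t\<in>J w. level m \<le> R t w}) else 0)"

lemma level_pos: "0 < level m" "1 \<le> level m" using R0(2) by (auto simp: level_def)

text \<open>That the time lies strictly before a finite \<open>\<sigma>\<close> comes from
  \<open>explode\<close>: a crossing of the level must take place before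
  \<open>\<sigma>\<close>.\<close>

lemma exhaust_props:
 assumes w: "x \<in> G0"
 shows "0 < exhaust m x" "exhaust m x \<le> level m" "exhaust m x \<in> J x"
  "\<And>t. 0 \<le> t ==> t \<le> exhaust m x ==> R t x \<le> level m"
  "\<And>t. 0 \<le> t ==> t < exhaust m x ==> R t x < level m"
  "exhaust m x = level m \<or> level m \<le> R (exhaust m x) x"
  "\<And>t. exhaust m x \<le> t \<longleftrightarrow> level m \<le> t \<or> (\<exists>s\<in>J x. s \<le> t \<and> level m \<le> R s x)"
proof -
 let ?G = "{t\<in>J x. level m \<le> R t x}"
 define T where "T = exhaust m x"
 have Te: "T = Inf (insert (level m) ?G)" using w by (simp add: T_def exhaust_def)
 have cl: "closed (?G \<inter> {0..b})" if "b \<in> ?G" for b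
 proof -
  have sub: "{0..b} \<subseteq> J x" using that interval_before_D by auto
  then have "continuous_on {0..b} (\<lambda>t. R t x)" using continuous_on_subset[OF cont(3)[OF w]] by auto
  then have "closed ({0..b} \<inter> (\<lambda>t. R t x) -` {level m..})" by (intro continuous_closed_preimage) auto
  moreover have "?G \<inter> {0..b} = {0..b} \<inter> (\<lambda>t. R t x) -` {level m..}" using sub by auto
  ultimately show ?thesis by simp
 qed
 have G0: "?G \<subseteq> {0..}" by (auto simp: interval_before_def)
 note I = Inf_entrance[OF G0 cl less_imp_le[OF level_pos(1)[of m]], folded Te]
 have 0: "0 \<in> J x" using \<sigma>_pos[OF w] by (simp add: interval_before_def zero_ereal_def[symmetric])
 have "T \<noteq> 0"
 proof
  assume "T = 0"
  then have "0 \<in> ?G" using I(3) level_pos(1)[of m] by auto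
  then show False using R0(1)[OF w] by (auto simp: level_def)
 qed
 then show T0: "0 < exhaust m x" using I(1) by (simp add: T_def)
 show "exhaust m x \<le> level m" using I(2) by (simp add: T_def)
 show Ts: "exhaust m x \<in> J x"
 proof (cases "T \<in> ?G")
  case True then show ?thesis by (simp add: T_def)
 next
  case False
  show ?thesis
  proof (cases "\<sigma> x")
   case (real s)
   then obtain t where "t \<in> J x" "level m \<le> R t x" using explode[OF w real] by blast
   then have "T \<le> t" using I(5)[of t] by auto
   then show ?thesis using interval_before_D[OF \<open>t \<in> J x\<close>] I(1) by (auto simp: T_def)
  next
   case PInf then show ?thesis using I(1) by (simp add: T_def interval_before_def)
  next
   case MInf then show ?thesis using \<sigma>_pos[OF w] by simp
  qed
 qed
 show lt: "R t x < level m" if "0 \<le> t" "t < exhaust m x" for t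
  using I(4)[of t] that interval_before_D[OF Ts] by (force simp: T_def)
 show "R t x \<le> level m" if "0 \<le> t" "t \<le> exhaust m x" for t
 proof (cases "t < exhaust m x")
  case True then show ?thesis using lt that by force
 next
  case False
  then have t: "t = exhaust m x" using that by simp
  have c: "continuous_on {0..t} (\<lambda>t. R t x)" using continuous_on_subset[OF cont(3)[OF w]] interval_before_D[OF Ts] t by auto
  have "((\<lambda>t. R t x) \<longlongrightarrow> R t x) (at_left t)"
   using c T0 t by (auto simp: continuous_on_def at_within_Icc_at_left dest!: bspec[of _ _ t])
  moreover have "\<forall>\<^sub>F s in at_left t. R s x \<le> level m"
   using T0 t lt by (intro eventually_at_leftI[of 0]) (auto intro: less_imp_le)
  ultimately show ?thesis by (rule tendsto_upperbound) simp
 qed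
 show "exhaust m x = level m \<or> level m \<le> R (exhaust m x) x" using I(3) by (auto simp: T_def)
 show "exhaust m x \<le> t \<longleftrightarrow> level m \<le> t \<or> (\<exists>s\<in>J x. s \<le> t \<and> level m \<le> R s x)" for t
  using I(5)[of t] by (auto simp: T_def)
qed

lemma exhaust_nonneg: "0 \<le> exhaust m w"
 using exhaust_props(1)[of w m] by (cases "w \<in> G0") (auto simp: exhaust_def)

lemma exhaust_le_level: "exhaust m w \<le> level m"
 using exhaust_props(2)[of w m] level_pos[of m] by (cases "w \<in> G0") (auto simp: exhaust_def)

lemma exhaust_mono: "m \<le> m' ==> exhaust m w \<le> exhaust m' w"
proof (cases "w \<in> G0")
 case True
 assume m: "m \<le> m'"
 then have l: "level m \<le> level m'" by (simp add: level_def)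
 show ?thesis
  using exhaust_props(6)[OF True, of m'] l exhaust_props(3)[OF True, of m']
  unfolding exhaust_props(7)[OF True] by (metis order_trans order_refl)
qed (simp add: exhaust_def)

text \<open>By continuity \<open>R\<close> is bounded on \<open>[0, t]\<close>; every level above
  this bound and above \<open>t\<close> will do.\<close>

lemma exhaust_eventually_ge:
 assumes w: "x \<in> G0" and t: "t \<in> J x"
 shows "\<exists>m0. \<forall>m\<ge>m0. t < exhaust m x"
proof -
 have t0: "0 \<le> t" using t by (auto simp: interval_before_def)
 have c: "continuous_on {0..t} (\<lambda>t. R t x)" using continuous_on_subset[OF cont(3)[OF w]] interval_before_D[OF t] by auto
 have "\<exists>s\<in>{0..t}. \<forall>y\<in>{0..t}. R y x \<le> R s x"
  using t0 by (intro continuous_attains_sup c) auto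
 then obtain s where s: "\<And>y. y \<in> {0..t} ==> R y x \<le> R s x" by blast
 obtain m0 :: nat where m0: "max t (R s x) < real m0" using reals_Archimedean2 by blast
 have "t < exhaust m0 x"
 proof (rule ccontr)
  assume "\<not> t < exhaust m0 x"
  then have "exhaust m0 x \<le> t" by simp
  then obtain r where r: "level m0 \<le> t \<or> r \<in> J x \<and> r \<le> t \<and> level m0 \<le> R r x"
   unfolding exhaust_props(7)[OF w] by blast
  have "level m0 > max t (R s x)" using m0 R0(2) by (simp add: level_def)
  then show False using r s[of r] by (auto simp: interval_before_def)
 qed
 then show ?thesis using exhaust_mono[of m0 _ x] by (meson less_le_trans)
qed

text \<open>For \<open>t\<close> before \<open>\<sigma>\<close> the rational criterion applies to
  the path up to \<open>t\<close>. From \<open>\<sigma>\<close> on the path is arbitrary, and the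
  criterion has to hold for another reason.\<close>

lemma stopping_time_exhaust: "stopping_time F (exhaust m)"
proof (rule stopping_timeI_nonneg)
 fix t :: real assume t: "0 \<le> t"
 let ?G = "{y\<in>space M. \<forall>j::nat. \<exists>r\<in>insert t (\<rat> \<inter> {0..t}). level m - 1 / (real j + 1) < R r y}"
 show "{y\<in>space M. exhaust m y \<le> t} \<in> sets (F t)"
 proof (cases "level m \<le> t")
  case True
  then have "{y\<in>space M. exhaust m y \<le> t} = space (F t)"
   using exhaust_le_level[of m] by (auto simp: space_F intro: order_trans)
  then show ?thesis by simp
 next
  case False
  show ?thesis
  proof (rule sets_F_AE[OF t sets_exceeds_rational[OF adapted(5) t]])
   show "AE y in M. y \<in> ?G \<longleftrightarrow> y \<in> {y\<in>space M. exhaust m y \<le> t}"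
    using G0(2)
   proof eventually_elim
    case w: (elim y)
    then have sp: "y \<in> space M" using G0 by auto
    have e: "exhaust m y \<le> t \<longleftrightarrow> (\<exists>s\<in>J y. s \<le> t \<and> level m \<le> R s y)"
     using exhaust_props(7)[OF w, of m t] False by simp
    show ?case
    proof (cases "t \<in> J y")
     case True
     have c: "continuous_on {0..t} (\<lambda>t. R t y)" using continuous_on_subset[OF cont(3)[OF w]] interval_before_D[OF True] by auto
     have "(\<exists>s\<in>J y. s \<le> t \<and> level m \<le> R s y) \<longleftrightarrow> (\<exists>s\<in>{0..t}. level m \<le> R s y)"
      using interval_before_D[OF True] by (auto simp: interval_before_def)
     then show ?thesis using e exceeds_iff_rational[OF t c, of "level m"] sp by simp
    next
     case out: False
     then obtain s where s: "\<sigma> y = ereal s" "s \<le> t"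
      using t \<sigma>_pos[OF w] by (cases "\<sigma> y") (auto simp: interval_before_def)
     \<comment> \<open>Explosion yields a crossing at some \<open>r\<close> before
       \<open>\<sigma>\<close>. A rational \<open>r'\<close> in between provides an interval
       \<open>[0, r']\<close> on which the path is continuous and the criterion holds; the points up
       to \<open>t\<close> only add candidates to an existential statement.\<close>
     obtain r where r: "r \<in> J y" "level m \<le> R r y" using explode[OF w s(1)] by blast
     have rs: "r < s" "0 \<le> r" using r(1) s by (auto simp: interval_before_def)
     have 1: "exhaust m y \<le> t" unfolding e using r rs s by (intro bexI[of _ r]) auto
     obtain r' where r': "r' \<in> \<rat>" "r < r'" "r' < s" using Rats_dense_in_real[OF rs(1)] by blast
     then have i: "r' \<in> J y" using rs s by (auto simp: interval_before_def)
     have c: "continuous_on {0..r'} (\<lambda>t. R t y)" using continuous_on_subset[OF cont(3)[OF w]] interval_before_D[OF i] by auto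
     have "\<exists>x\<in>{0..r'}. level m \<le> R x y" using r r' rs by (intro bexI[of _ r]) auto
     then have "\<forall>j::nat. \<exists>x\<in>insert r' (\<rat> \<inter> {0..r'}). level m - 1 / (real j + 1) < R x y"
      using exceeds_iff_rational[OF _ c, of "level m"] r' rs by auto
     moreover have "insert r' (\<rat> \<inter> {0..r'}) \<subseteq> insert t (\<rat> \<inter> {0..t})" using r' s rs by auto
     ultimately have "y \<in> ?G" using sp by blast
     then show ?thesis using 1 sp by simp
    qed
   qed
  qed auto
 qed
qed (rule exhaust_nonneg)

lemma exhaust_tendsto:
 assumes w: "x \<in> G0" shows "(\<lambda>m. ereal (exhaust m x)) \<longlonglongrightarrow> \<sigma> x"
proof (rule order_tendstoI)
 fix a assume a: "a < \<sigma> x"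
 obtain r where r: "max a 0 < r" "r < \<sigma> x" using dense[of "max a 0" "\<sigma> x"] a \<sigma>_pos[OF w] by auto
 then obtain t where t: "r = ereal t" by (cases r) auto
 then have "t \<in> J x" using r by (auto simp: interval_before_def)
 from exhaust_eventually_ge[OF w this] show "\<forall>\<^sub>F m in sequentially. a < ereal (exhaust m x)"
  unfolding eventually_sequentially using r t by (metis ereal_less_le less_imp_le max_less_iff_conj order.strict_trans1 less_ereal.simps(1) order.strict_trans)
next
 fix a assume "\<sigma> x < a"
 then show "\<forall>\<^sub>F m in sequentially. ereal (exhaust m x) < a"
  using exhaust_props(3)[OF w] by (intro always_eventually allI) (auto simp: interval_before_def intro: less_trans)
qed

lemma A_nonneg: "w \<in> G0 ==> t \<in> J w ==> 0 \<le> A t w"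
 using A_mono[of w t 0] A0[of w] by (cases "t = 0") (auto simp: interval_before_def)

lemma A_mono_le: "w \<in> G0 ==> t \<in> J w ==> 0 \<le> s ==> s \<le> t ==> A s w \<le> A t w"
 using A_mono[of w t s] by (cases "t = s") auto

lemma before_exhaust: "w \<in> G0 ==> 0 \<le> t ==> t \<le> exhaust m w ==> t \<in> J w"
 using interval_before_D[OF exhaust_props(3)[of w m]] by auto

lemma bounds_exhaust:
 assumes w: "x \<in> G0" and t: "0 \<le> t" "t \<le> exhaust m x"
 shows "\<bar>U t x\<bar> \<le> level m" "\<bar>h t x\<bar> \<le> level m" "\<bar>q t x\<bar> \<le> level m" "A t x \<le> level m" "0 \<le> A t x"
 using dom[OF w before_exhaust[OF w t]] exhaust_props(4)[OF w t] A_nonneg[OF w before_exhaust[OF w t]] by auto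

text \<open>Before \<open>exhaust m\<close> the coefficients are bounded by \<open>level m\<close>,
  and so is time itself. Hence \<open>level m\<close> plays both roles, \<open>c\<close> and
  \<open>C\<close>, in \<open>exp_stopped\<close>.\<close>

lemma increment_exponential:
 assumes E: "E \<in> sets M" "E \<subseteq> G0"
  and stop: "\<And>t. 0 \<le> t ==> {x\<in>E. S x \<le> t \<and> t < S' x} \<in> sets (F t)"
  and SS: "\<And>x. x \<in> E ==> 0 \<le> S x \<and> S x \<le> S' x \<and> S' x \<le> exhaust m x"
 defines "V \<equiv> \<lambda>x. if x \<in> E then U (S' x) x - U (S x) x else 0"
  and "Q \<equiv> \<lambda>x. if x \<in> E then A (S' x) x - A (S x) x else 0"
 shows "V \<in> borel_measurable M" "Q \<in> borel_measurable M"
  "\<And>th. (LINT x|M. exp (\<i> * of_real (th * V x) + of_real (th\<^sup>2 * Q x / 2))) = 1"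
  "\<And>x. \<bar>V x\<bar> \<le> 2 * level m" "\<And>x. 0 \<le> Q x \<and> Q x \<le> 2 * level m"
  "(LINT x|M. V x) = 0" "(LINT x|M. (V x)\<^sup>2) = (LINT x|M. Q x)"
proof -
 have main: "V \<in> borel_measurable M \<and> Q \<in> borel_measurable M \<and>
  (LINT x|M. exp (\<i> * of_real (th * V x) + of_real (th\<^sup>2 * Q x / 2))) = 1" for th
 proof -
  have sub: "{S x..S' x} \<subseteq> J x" "S' x \<in> J x" if "x \<in> E" for x
   using before_exhaust[of x _ m] SS[OF that] E that by auto
  have b1: "\<And>x t. x \<in> E ==> 0 \<le> t ==> S x \<le> t ==> t < S' x ==> \<bar>h t x\<bar> \<le> level m \<and> \<bar>q t x\<bar> \<le> level m"
   using SS bounds_exhaust[of _ _ m] E(2) by (meson less_imp_le order_trans subsetD)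
  have b2: "\<And>x. x \<in> E ==> 0 \<le> S x \<and> S x \<le> S' x \<and> S' x \<le> level m \<and>
    continuous_on {S x..S' x} (\<lambda>t. U t x) \<and> continuous_on {S x..S' x} (\<lambda>t. A t x)"
   using SS sub cont(1,2) E(2) exhaust_le_level[of m] by (meson continuous_on_subset order_trans subsetD)
  have b3: "\<exists>dl>0. \<forall>u v. S x \<le> u \<and> u \<le> v \<and> v \<le> S' x \<and> v - u < dl -->
    \<bar>U v x - U u x - (h u x * (B v x - B u x) + q u x * ((B v x - B u x)\<^sup>2 - (v - u)))\<bar>
     \<le> eps * ((v - u) + (B v x - B u x)\<^sup>2)" if we: "x \<in> E" "0 < eps" for x eps
  proof -
   have w: "x \<in> G0" "0 \<le> S x" using we E SS by auto
   obtain dl where "dl > 0" "\<forall>u v. 0 \<le> u \<and> u \<le> v \<and> v \<le> S' x \<and> v - u < dl -->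
    \<bar>U v x - U u x - (h u x * (B v x - B u x) + q u x * ((B v x - B u x)\<^sup>2 - (v - u)))\<bar>
     \<le> eps * ((v - u) + (B v x - B u x)\<^sup>2)" using expU[OF w(1) sub(2)[OF we(1)] we(2)] by blast
   then show ?thesis using w(2) by (intro exI[of _ dl]) auto
  qed
  have b4: "\<exists>dl>0. \<forall>u v. S x \<le> u \<and> u \<le> v \<and> v \<le> S' x \<and> v - u < dl -->
    \<bar>A v x - A u x - (h u x)\<^sup>2 * (v - u)\<bar> \<le> eps * ((v - u) + (B v x - B u x)\<^sup>2)" if we: "x \<in> E" "0 < eps" for x eps
  proof -
   have w: "x \<in> G0" "0 \<le> S x" using we E SS by auto
   obtain dl where "dl > 0" "\<forall>u v. 0 \<le> u \<and> u \<le> v \<and> v \<le> S' x \<and> v - u < dl -->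
    \<bar>A v x - A u x - (h u x)\<^sup>2 * (v - u)\<bar> \<le> eps * ((v - u) + (B v x - B u x)\<^sup>2)" using expA[OF w(1) sub(2)[OF we(1)] we(2)] by blast
   then show ?thesis using w(2) by (intro exI[of _ dl]) auto
  qed
  have lp: "0 < level m" "0 \<le> level m" using level_pos[of m] by auto
  show ?thesis
   unfolding V_def Q_def
  proof (intro conjI)
   note X = exp_stopped[OF lp(1) lp(2) E(1) adapted(2) adapted(3) stop b1 b2 b3 b4]
   show "(\<lambda>x. if x \<in> E then U (S' x) x - U (S x) x else 0) \<in> borel_measurable M"
    by (rule X(1))
   show "(\<lambda>x. if x \<in> E then A (S' x) x - A (S x) x else 0) \<in> borel_measurable M"
    by (rule X(2))
   show "(LINT x|M. exp (\<i> * of_real (th * (if x \<in> E then U (S' x) x - U (S x) x else 0))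
     + of_real (th\<^sup>2 * (if x \<in> E then A (S' x) x - A (S x) x else 0) / 2))) = 1"
    by (rule X(3))
  qed
 qed
 show V: "V \<in> borel_measurable M" and Q: "Q \<in> borel_measurable M" using main[of 0] by auto
 show e: "\<And>th. (LINT x|M. exp (\<i> * of_real (th * V x) + of_real (th\<^sup>2 * Q x / 2))) = 1"
  using main by auto
 have both: "\<bar>V x\<bar> \<le> 2 * level m \<and> 0 \<le> Q x \<and> Q x \<le> 2 * level m" for x
 proof (cases "x \<in> E")
  case True
  then have w: "x \<in> G0" "0 \<le> S x" "S x \<le> S' x" "S' x \<le> exhaust m x" using E SS by auto
  have A: "A (S x) x \<le> A (S' x) x" using w before_exhaust[of x "S' x" m] by (intro A_mono_le) auto
  show ?thesis
   using True bounds_exhaust[of x "S x" m] bounds_exhaust[of x "S' x" m] w A level_pos[of m] by (auto simp: V_def Q_def)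
 qed (use level_pos[of m] in \<open>auto simp: V_def Q_def\<close>)
 then show b: "\<And>x. \<bar>V x\<bar> \<le> 2 * level m" "\<And>x. 0 \<le> Q x \<and> Q x \<le> 2 * level m" by auto
 show "(LINT x|M. V x) = 0" "(LINT x|M. (V x)\<^sup>2) = (LINT x|M. Q x)"
  using moments_from_exponential[OF prob_space_axioms V Q b e] by auto
qed

text \<open>Only the part of \<open>E\<close> on which \<open>exhaust m\<close> is still to come at
  time \<open>s\<close> matters, since elsewhere the stopped process no longer moves. On that part
  the increment has mean zero by \<open>increment_exponential\<close>.\<close>

theorem martingale_before_stopped:
 assumes X: "AE w in M. \<forall>t\<in>J w. X t w = c * of_real (U t w)"
  and s: "AE w in M. \<sigma>' w = \<sigma> w"
 shows "martingale_before M F \<sigma>' X"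
 unfolding martingale_before_def
proof (intro exI[of _ exhaust] conjI allI)
 show "stopping_time F (exhaust m)" "\<forall>w\<in>space M. 0 \<le> exhaust m w" for m
  by (auto simp: stopping_time_exhaust exhaust_nonneg)
 show "AE w in M. incseq (\<lambda>m. exhaust m w) \<and> (\<forall>m. ereal (exhaust m w) < \<sigma>' w) \<and> (\<lambda>m. ereal (exhaust m w)) \<longlonglongrightarrow> \<sigma>' w"
  using G0(2) s
 proof eventually_elim
  case (elim w)
  then show ?case using exhaust_tendsto[OF elim(1)] exhaust_mono exhaust_props(3)[OF elim(1)]
   by (auto simp: incseq_def interval_before_def)
 qed
 fix m
 define Y where "Y = (\<lambda>t w. U (min t (exhaust m w)) w)"
 have AEeq: "AE w in M. c * of_real (Y t w) = X (min t (exhaust m w)) w" if "0 \<le> t" for t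
  using G0(2) X
 proof eventually_elim
  case (elim w)
  then show ?case using before_exhaust[OF elim(1), of "min t (exhaust m w)" m] that exhaust_nonneg[of m w] by (simp add: Y_def)
 qed
 have c: "AE w in M. 0 \<le> exhaust m w \<and> continuous_on {0..exhaust m w} (\<lambda>s. U s w)"
  using G0(2)
 proof eventually_elim
  case (elim w)
  show ?case using exhaust_nonneg[of m w] continuous_on_subset[OF cont(1)[OF elim] interval_before_D[OF exhaust_props(3)[OF elim]]] by auto
 qed
 have Ym: "Y t \<in> borel_measurable (F t)" if "0 \<le> t" for t
  unfolding Y_def by (rule stopped_adapted[OF adapted(1) stopping_time_exhaust that c])
 have [measurable]: "Y t \<in> borel_measurable M" if "0 \<le> t" for t using measurable_F_M[OF Ym[OF that]] .
 have Yb: "AE w in M. norm (Y t w) \<le> level m" if "0 \<le> t" for t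
  using G0(2)
 proof eventually_elim
  case (elim w)
  then show ?case using bounds_exhaust(1)[OF elim, of "min t (exhaust m w)" m] that exhaust_nonneg[of m w] by (simp add: Y_def)
 qed
 have Yi: "integrable M (Y t)" if "0 \<le> t" for t
  using Yb[OF that] that by (intro integrable_const_bound[of _ "level m"]) auto
 have Xm: "(\<lambda>w. X (min t (exhaust m w)) w) \<in> borel_measurable (F t)" if "0 \<le> t" for t
 proof (rule measurable_F_AE[OF that _ AEeq[OF that]])
  show "(\<lambda>w. c * of_real (Y t w)) \<in> borel_measurable (F t)" using Ym[OF that] by measurable
 qed
 have Xi: "integrable M (\<lambda>w. X (min t (exhaust m w)) w)" if "0 \<le> t" for t
  using integrable_cong_AE[OF _ _ AEeq[OF that]] Yi[OF that] measurable_F_M[OF Xm[OF that]] that by auto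
 show "martingale M F (\<lambda>t w. X (min t (exhaust m w)) w)"
  unfolding martingale_def
 proof (intro conjI allI impI ballI)
  fix s t E assume st: "0 \<le> s \<and> s \<le> t" and E: "E \<in> sets (F s)"
  have EM [measurable]: "E \<in> sets M" using sets_F_M[OF E] .
  have [measurable]: "Y t \<in> borel_measurable M" "Y s \<in> borel_measurable M"
   using st by (auto intro: measurable_F_M Ym)
  define E' where "E' = {w\<in>E \<inter> G0. s < exhaust m w}"
  have E'F: "E' \<in> sets (F s)"
  proof -
   have "E' = E \<inter> G0 \<inter> {w\<in>space M. s < exhaust m w}" using G0(1) by (auto simp: E'_def)
   then show ?thesis using E G0_sets(1)[of s] st stopping_time_sets(2)[OF stopping_time_exhaust] by auto
  qed
  define V where "V = (\<lambda>w. if w \<in> E' then U (min t (exhaust m w)) w - U s w else 0)"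
  have V0: "(LINT w|M. V w) = 0"
   unfolding V_def
  proof (rule increment_exponential(6)[where S = "\<lambda>_. s" and S' = "\<lambda>w. min t (exhaust m w)" and m = m])
   show "E' \<in> sets M" using sets_F_M[OF E'F] .
   show "E' \<subseteq> G0" by (auto simp: E'_def)
   show "0 \<le> s \<and> s \<le> min t (exhaust m w) \<and> min t (exhaust m w) \<le> exhaust m w" if "w \<in> E'" for w
    using that st by (auto simp: E'_def)
   fix r :: real assume r: "0 \<le> r"
   show "{w \<in> E'. s \<le> r \<and> r < min t (exhaust m w)} \<in> sets (F r)"
   proof (cases "s \<le> r \<and> r < t")
    case True
    then have eq: "{w \<in> E'. s \<le> r \<and> r < min t (exhaust m w)} = E' \<inter> {w\<in>space M. r < exhaust m w}"
     using G0(1) by (auto simp: E'_def)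
    have "E' \<in> sets (F r)" using E'F sets_F_mono[of s r] True by blast
    then show ?thesis unfolding eq using stopping_time_sets(2)[OF stopping_time_exhaust] by (rule sets.Int)
   next
    case False
    then have eq: "{w \<in> E'. s \<le> r \<and> r < min t (exhaust m w)} = {}" by auto
    show ?thesis unfolding eq by (rule sets.empty_sets)
   qed
  qed
  have "AE w in M. V w = Y t w * indicator E w - Y s w * indicator E w"
   using G0(2)
  proof eventually_elim
   case (elim w)
   then show ?case using st by (auto simp: V_def E'_def Y_def indicator_def min_def)
  qed
  then have "(LINT w|M. V w) = (LINT w|M. Y t w * indicator E w - Y s w * indicator E w)"
  proof (rule integral_cong_AE[rotated 2])
   show "V \<in> borel_measurable M"
   proof (rule borel_measurable_AE_M)
    show "(\<lambda>w. Y t w * indicator E w - Y s w * indicator E w) \<in> borel_measurable M" by measurable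
    show "AE w in M. Y t w * indicator E w - Y s w * indicator E w = V w"
     using G0(2)
    proof eventually_elim
     case (elim w)
     then show ?case using st by (auto simp: V_def E'_def Y_def indicator_def min_def)
    qed
   qed
  qed measurable
  also have "\<dots> = (LINT w|M. Y t w * indicator E w) - (LINT w|M. Y s w * indicator E w)"
   using Yi[of t] Yi[of s] st EM by (intro Bochner_Integration.integral_diff integrable_real_mult_indicator) auto
  finally have eq: "(LINT w|M. Y t w * indicator E w) = (LINT w|M. Y s w * indicator E w)" using V0 by simp
  have "(LINT w:E|M. X (min r (exhaust m w)) w) = c * of_real (LINT w|M. Y r w * indicator E w)" if r: "0 \<le> r" for r
  proof -
   have "(LINT w:E|M. X (min r (exhaust m w)) w) = (LINT w|M. c * of_real (Y r w * indicator E w))"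
    unfolding set_lebesgue_integral_def
   proof (rule integral_cong_AE)
    show "(\<lambda>w. indicat_real E w *\<^sub>R X (min r (exhaust m w)) w) \<in> borel_measurable M"
     using EM measurable_F_M[OF Xm[OF r]] by measurable
    show "(\<lambda>w. c * of_real (Y r w * indicator E w)) \<in> borel_measurable M" using EM r by measurable
    show "AE w in M. indicat_real E w *\<^sub>R X (min r (exhaust m w)) w = c * of_real (Y r w * indicator E w)"
     using AEeq[OF r] by eventually_elim (auto simp: indicator_def)
   qed
   then show ?thesis by (simp only: integral_mult_right_zero integral_complex_of_real)
  qed
  then show "(LINT w:E|M. X (min t (exhaust m w)) w) = (LINT w:E|M. X (min s (exhaust m w)) w)"
   using eq st by simp
 qed (use Xm Xi in auto)
qed

section \<open>The time change by \<open>A\<close>\<close>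

definition total :: "'a => ereal" where
 "total w = Sup ((\<lambda>t. ereal (A t w)) ` J w)"

text \<open>As long as \<open>A\<close> has not reached \<open>s\<close>, the value is
  \<open>exhaust m\<close>. So the time change at \<open>s\<close> is approximated by stopping times
  before \<open>\<sigma>\<close>, whether or not \<open>s\<close> is ever reached.\<close>

definition clock :: "real => nat => 'a => real" where
 "clock s m = hit A s (exhaust m)"

lemma cont_exhaust:
 assumes w: "x \<in> G0"
 shows "continuous_on {0..exhaust m x} (\<lambda>t. A t x)" "continuous_on {0..exhaust m x} (\<lambda>t. U t x)"
 using continuous_on_subset[OF cont(2)[OF w] interval_before_D[OF exhaust_props(3)[OF w]]]
  continuous_on_subset[OF cont(1)[OF w] interval_before_D[OF exhaust_props(3)[OF w]]] by auto

text \<open>The supremum is not attained: \<open>A\<close> increases strictly and \<open>J x\<close>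
  has no last point.\<close>

lemma A_less_total:
 assumes w: "x \<in> G0" and t: "t \<in> J x"
 shows "ereal (A t x) < total x"
proof -
 obtain t' where t': "t < t'" "t' \<in> J x" using interval_before_extend[OF t] .
 have "A t x < A t' x" using A_mono[OF w t'(2) _ t'(1)] t by (auto simp: interval_before_def)
 then have "ereal (A t x) < ereal (A t' x)" by simp
 also have "\<dots> \<le> total x" unfolding total_def using t'(2) by (intro Sup_upper) auto
 finally show ?thesis .
qed

lemma total_iff:
 assumes w: "x \<in> G0"
 shows "ereal s < total x \<longleftrightarrow> (\<exists>m0. \<forall>m\<ge>m0. s \<le> A (exhaust m x) x)" "ereal s < total x \<longleftrightarrow> (\<exists>m. s \<le> A (exhaust m x) x)"
proof -
 have 1: "\<exists>m0. \<forall>m\<ge>m0. s \<le> A (exhaust m x) x" if lt: "ereal s < total x"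
 proof -
  obtain t where t: "t \<in> J x" "s < A t x"
   using lt unfolding total_def less_Sup_iff by auto
  obtain m0 where m0: "\<forall>m\<ge>m0. t < exhaust m x" using exhaust_eventually_ge[OF w t(1)] by blast
  have "s \<le> A (exhaust m x) x" if "m \<ge> m0" for m
   using A_mono_le[OF w exhaust_props(3)[OF w], of t m] m0 that t by (auto simp: interval_before_def less_imp_le)
  then show ?thesis by blast
 qed
 have 2: "ereal s < total x" if "s \<le> A (exhaust m x) x" for m
  using A_less_total[OF w exhaust_props(3)[OF w, of m]] that by (meson ereal_less_eq(3) le_less_trans)
 show "ereal s < total x \<longleftrightarrow> (\<exists>m0. \<forall>m\<ge>m0. s \<le> A (exhaust m x) x)" using 1 2 by blast
 show "ereal s < total x \<longleftrightarrow> (\<exists>m. s \<le> A (exhaust m x) x)" using 1 2 by blast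
qed

lemma clock_reached:
 assumes w: "y \<in> G0" and s: "0 \<le> s" and r: "0 \<le> r" "r \<le> exhaust m y" "A r y = s"
 shows "clock s m y = r"
proof -
 note h = hit_props[where T = "exhaust m" and X = A and l = s and w = y, OF exhaust_nonneg cont_exhaust(1)[OF w], folded clock_def]
 have "clock s m y \<le> r" unfolding h(5) using r by auto
 moreover have "\<not> clock s m y < r"
 proof
  assume lt: "clock s m y < r"
  then have "\<exists>x. 0 \<le> x \<and> x \<le> clock s m y \<and> s \<le> A x y" using h(3) h(1) r by auto
  then obtain x where x: "0 \<le> x" "x < r" "s \<le> A x y" using lt by auto
  have "A x y < A r y" using x before_exhaust[OF w r(1,2)] by (intro A_mono w)
  then show False using x r by simp
 qed
 ultimately show ?thesis by simp
qed

text \<open>The last equivalence expresses through a stopped value of \<open>A\<close> that the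
  clock shows \<open>s\<close> by time \<open>r\<close>. The sigma-algebras of the time-changed
  process rest on it.\<close>

lemma clock_cases:
 assumes w: "y \<in> G0" and s: "0 \<le> s"
 shows "0 \<le> clock s m y" "clock s m y \<le> exhaust m y" "A (clock s m y) y = min s (A (exhaust m y) y)"
  "A (exhaust m y) y < s ==> clock s m y = exhaust m y"
  "0 \<le> r ==> s \<le> A (min r (exhaust m y)) y \<longleftrightarrow> clock s m y \<le> r \<and> s \<le> A (exhaust m y) y"
proof -
 note h = hit_props[where T = "exhaust m" and X = A and l = s and w = y, OF exhaust_nonneg cont_exhaust(1)[OF w], folded clock_def]
 show c: "0 \<le> clock s m y" "clock s m y \<le> exhaust m y" using h(1,2) by auto
 show less: "clock s m y = exhaust m y" if "A (exhaust m y) y < s"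
  using h(3) A_mono_le[OF w exhaust_props(3)[OF w] c] that by auto
 have reach: "\<exists>r. 0 \<le> r \<and> r \<le> exhaust m y \<and> A r y = s" if "s \<le> A (exhaust m y) y"
  using IVT'[of "\<lambda>t. A t y" 0 s "exhaust m y"] A0[OF w] s that exhaust_nonneg[of m y] cont_exhaust(1)[OF w] by auto
 show Ac: "A (clock s m y) y = min s (A (exhaust m y) y)"
 proof (cases "s \<le> A (exhaust m y) y")
  case True
  then obtain r where "0 \<le> r" "r \<le> exhaust m y" "A r y = s" using reach by blast
  then show ?thesis using clock_reached[OF w s] True by auto
 qed (use less in auto)
 show "s \<le> A (min r (exhaust m y)) y \<longleftrightarrow> clock s m y \<le> r \<and> s \<le> A (exhaust m y) y" if r: "0 \<le> r"
 proof
  let ?x = "min r (exhaust m y)"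
  assume a: "s \<le> A ?x y"
  have x: "0 \<le> ?x" "?x \<le> exhaust m y" using r exhaust_nonneg by auto
  have "clock s m y \<le> ?x" unfolding h(5) using a x by auto
  moreover have "A ?x y \<le> A (exhaust m y) y" using x by (intro A_mono_le w exhaust_props(3))
  ultimately show "clock s m y \<le> r \<and> s \<le> A (exhaust m y) y" using a by auto
 next
  let ?x = "min r (exhaust m y)"
  assume a: "clock s m y \<le> r \<and> s \<le> A (exhaust m y) y"
  have x: "0 \<le> ?x" "?x \<le> exhaust m y" using r exhaust_nonneg by auto
  have "A (clock s m y) y \<le> A ?x y"
   using a c by (intro A_mono_le w before_exhaust[OF w x]) auto
  then show "s \<le> A ?x y" using a Ac by auto
 qed
qed

lemma clock_nonneg: "0 \<le> clock s m w" "clock s m w \<le> exhaust m w"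
proof -
 have bb: "bdd_below (insert (exhaust m w) {t. 0 \<le> t \<and> t \<le> exhaust m w \<and> s \<le> A t w})"
  using exhaust_nonneg[of m w] by (intro bdd_belowI[of _ 0]) auto
 show "0 \<le> clock s m w" unfolding clock_def hit_def using exhaust_nonneg[of m w] by (intro cInf_greatest) auto
 show "clock s m w \<le> exhaust m w" unfolding clock_def hit_def using bb by (intro cInf_lower) auto
qed

lemma stopping_time_clock: "stopping_time F (clock s m)"
 unfolding clock_def
proof (rule stopping_time_hit[OF adapted(4) stopping_time_exhaust exhaust_nonneg])
 show "AE w in M. continuous_on {0..exhaust m w} (\<lambda>s. A s w)"
  using G0(2) by eventually_elim (rule cont_exhaust)
qed

lemma clock_mono:
 assumes w: "x \<in> G0" and s: "0 \<le> s" and m: "k \<le> m" shows "clock s k x \<le> clock s m x"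
proof (cases "s \<le> A (exhaust k x) x")
 case True
 have "A (clock s k x) x = s" using clock_cases(3)[OF w s, of k] True by simp
 then have "clock s m x = clock s k x"
  using clock_nonneg[of s k x] exhaust_mono[OF m, of x] by (intro clock_reached[OF w s]) auto
 then show ?thesis by simp
next
 case False
 then have k: "clock s k x = exhaust k x" using clock_cases(4)[OF w s] by auto
 show ?thesis
 proof (rule ccontr)
  assume "\<not> clock s k x \<le> clock s m x"
  then have lt: "clock s m x < exhaust k x" using k by simp
  then have "A (clock s m x) x < A (exhaust k x) x" using clock_nonneg by (intro A_mono w exhaust_props(3)) auto
  moreover have "clock s m x < exhaust m x" using lt exhaust_mono[OF m, of x] by simp
  then have "s \<le> A (exhaust m x) x" using clock_cases(4)[OF w s, of m] by force
  ultimately show False using clock_cases(3)[OF w s, of m] False by auto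
 qed
qed

lemma bounds_clock:
 assumes w: "x \<in> G0" shows "0 \<le> A (clock s m x) x" "\<bar>U (clock s m x) x\<bar> \<le> level m"
 using bounds_exhaust[OF w clock_nonneg] by auto

lemma stopped_measurable_M:
 assumes S: "stopping_time F S" "\<And>w. 0 \<le> S w" "\<And>w. S w \<le> exhaust m w"
  and X: "X = U \<or> X = A" and t: "0 \<le> t"
 shows "(\<lambda>w. X (min t (S w)) w) \<in> borel_measurable (F t)" "(\<lambda>w. X (S w) w) \<in> borel_measurable M"
proof -
 have c: "AE w in M. 0 \<le> S w \<and> continuous_on {0..S w} (\<lambda>s. X s w)"
  using G0(2)
 proof eventually_elim
  case (elim w)
  have sub: "{0..S w} \<subseteq> {0..exhaust m w}" using S(3)[of w] by auto
  show ?case using X S(2) continuous_on_subset[OF cont_exhaust(1)[OF elim] sub]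
   continuous_on_subset[OF cont_exhaust(2)[OF elim] sub] by auto
 qed
 have ad: "X s \<in> borel_measurable (F s)" if "0 \<le> s" for s using X adapted that by auto
 have m: "(\<lambda>w. X (min t (S w)) w) \<in> borel_measurable (F t)" if "0 \<le> t" for t
  by (rule stopped_adapted[OF ad S(1) that c])
 have "min (level m) (S w) = S w" for w using S(3)[of w] exhaust_le_level[of m w] by auto
 then show "(\<lambda>w. X (S w) w) \<in> borel_measurable M"
  using measurable_F_M[OF m[of "level m"]] level_pos[of m] by simp
 show "(\<lambda>w. X (min t (S w)) w) \<in> borel_measurable (F t)" by (rule m[OF t])
qed

text \<open>A maximal inequality by stopping. At the first time after \<open>clock s k\<close> at
  which \<open>U\<close> has moved by \<open>\<eta>\<close>, the increment is at least
  \<open>\<eta>\<close> in modulus on \<open>Bk\<close>, and its second moment is the mean increase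
  of \<open>A\<close> up to that time.\<close>

lemma oscillation_bound:
 assumes s: "0 \<le> s" and \<eta>: "0 < \<eta>" and km: "k \<le> m"
 defines "Bk \<equiv> {x\<in>G0. \<exists>r. clock s k x \<le> r \<and> r \<le> clock s m x \<and> \<eta> \<le> \<bar>U r x - U (clock s k x) x\<bar>}"
 shows "Bk \<in> sets M" "\<eta>\<^sup>2 * prob Bk \<le> (LINT x|M. A (clock s m x) x - A (clock s k x) x)"
proof -
 \<comment> \<open>\<open>X\<close> vanishes up to \<open>clock s k\<close>, so that its first time
   at level \<open>\<eta>\<close> looks only at what happens afterwards.\<close>
 define X where "X = (\<lambda>r x. \<bar>U r x - U (min r (clock s k x)) x\<bar>)"
 have Xad: "X r \<in> borel_measurable (F r)" if "0 \<le> r" for r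
  unfolding X_def using adapted(1)[OF that] stopped_measurable_M(1)[OF stopping_time_clock clock_nonneg disjI1[OF refl] that, of s k] by measurable
 define S' where "S' = hit X \<eta> (clock s m)"
 have Xc: "continuous_on {0..clock s m x} (\<lambda>r. X r x)" if w: "x \<in> G0" for x
 proof -
  have c: "continuous_on {0..clock s m x} (\<lambda>r. U r x)"
   using cont_exhaust(2)[OF w, of m] clock_nonneg(2)[of s m x] by (auto intro: continuous_on_subset)
  have "continuous_on {0..clock s m x} (\<lambda>r. U (min r (clock s k x)) x)"
   using clock_nonneg(1)[of s k x] clock_mono[OF w s km]
   by (intro continuous_on_compose2[OF c] continuous_intros) auto
  then show ?thesis unfolding X_def using c by (intro continuous_intros)
 qed
 note h = hit_props[where T = "clock s m" and X = X and l = \<eta>, folded S'_def, OF clock_nonneg(1) Xc]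
 have S'st: "stopping_time F S'"
  unfolding S'_def
 proof (rule stopping_time_hit[OF Xad stopping_time_clock clock_nonneg(1)])
  show "AE x in M. continuous_on {0..clock s m x} (\<lambda>r. X r x)" using G0(2) by eventually_elim (rule Xc)
 qed
 have ge: "clock s k x \<le> S' x" if w: "x \<in> G0" for x
 proof (rule ccontr)
  assume n: "\<not> clock s k x \<le> S' x"
  then have "S' x \<noteq> clock s m x" using clock_mono[OF w s km] by auto
  then have "\<eta> \<le> X (S' x) x" using h(3)[OF w] by auto
  then show False using n \<eta> by (simp add: X_def)
 qed
 have st: "{x\<in>G0. clock s k x \<le> t \<and> t < S' x} \<in> sets (F t)" if "0 \<le> t" for t
 proof -
  have "{x\<in>G0. clock s k x \<le> t \<and> t < S' x} = G0 \<inter> ({x\<in>space M. clock s k x \<le> t} \<inter> {x\<in>space M. t < S' x})"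
   using G0(1) by auto
  then show ?thesis
   using G0_sets(1)[OF that] stopping_time_sets(1)[OF stopping_time_clock] stopping_time_sets(2)[OF S'st] by auto
 qed
 have ord: "0 \<le> clock s k x \<and> clock s k x \<le> S' x \<and> S' x \<le> exhaust m x" if "x \<in> G0" for x
  using clock_nonneg[of s k x] ge[OF that] h(2)[OF that] clock_nonneg(2)[of s m x] by auto
 define V where "V = (\<lambda>x. if x \<in> G0 then U (S' x) x - U (clock s k x) x else 0)"
 define Q where "Q = (\<lambda>x. if x \<in> G0 then A (S' x) x - A (clock s k x) x else 0)"
 note I = increment_exponential[where E = G0 and S = "clock s k" and S' = S' and m = m, OF G0_sets(2) order_refl st ord]
 have IV: "\<bar>V x\<bar> \<le> 2 * level m" for x unfolding V_def by (rule I(4))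
 have IQ: "0 \<le> Q x" "Q x \<le> 2 * level m" for x unfolding Q_def using I(5)[of x] by auto
 have Bk: "Bk = {x\<in>space M. x \<in> G0 \<and> \<eta> \<le> \<bar>V x\<bar>}"
 proof (rule set_eqI)
  fix x
  show "x \<in> Bk \<longleftrightarrow> x \<in> {x\<in>space M. x \<in> G0 \<and> \<eta> \<le> \<bar>V x\<bar>}"
  proof (cases "x \<in> G0")
   case w: True
   have Xe: "X r x = \<bar>U r x - U (clock s k x) x\<bar>" if "clock s k x \<le> r" for r using that by (simp add: X_def min_def)
   have "\<eta> \<le> \<bar>V x\<bar>" if wB: "x \<in> Bk"
   proof -
    obtain r where r: "clock s k x \<le> r" "r \<le> clock s m x" "\<eta> \<le> X r x" using wB Xe by (auto simp: Bk_def)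
    then have "S' x \<le> r" using h(5)[OF w] clock_nonneg(1)[of s k x] by auto
    then have "\<eta> \<le> X (S' x) x" using h(3)[OF w] r by auto
    then show ?thesis using Xe[OF ge[OF w]] w by (simp add: V_def)
   qed
   moreover have "x \<in> Bk" if "\<eta> \<le> \<bar>V x\<bar>"
    using that w ge[OF w] h(2)[OF w] by (auto simp: V_def Bk_def intro!: exI[of _ "S' x"])
   ultimately show ?thesis using w G0(1) by auto
  qed (auto simp: Bk_def)
 qed
 have [measurable]: "V \<in> borel_measurable M" unfolding V_def by (rule I(1))
 have [measurable]: "G0 \<in> sets M" by (rule G0_sets(2))
 show BkM [measurable]: "Bk \<in> sets M" unfolding Bk by measurable
 have iV: "integrable M (\<lambda>x. (V x)\<^sup>2)"
  by (rule integrable_const_bound[of _ "(2 * level m)\<^sup>2"]) (use abs_le_imp_sq_le[OF IV] in auto)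
 have iQ: "integrable M Q"
 proof (rule integrable_const_bound[of _ "2 * level m"])
  show "Q \<in> borel_measurable M" unfolding Q_def by (rule I(2))
 qed (use IQ in auto)
 have cm: "(\<lambda>x. A (clock s j x) x) \<in> borel_measurable M" for j
  by (rule stopped_measurable_M(2)[OF stopping_time_clock clock_nonneg disjI2[OF refl] order_refl])
 have iA: "integrable M (\<lambda>x. A (clock s j x) x)" for j
 proof (rule integrable_const_bound[of _ "level j"])
  show "AE x in M. norm (A (clock s j x) x) \<le> level j"
   using G0(2) by eventually_elim (use bounds_exhaust[OF _ clock_nonneg] in auto)
 qed (rule cm)
 have "\<eta>\<^sup>2 * prob Bk = (LINT x|M. \<eta>\<^sup>2 * indicator Bk x)" by simp
 also have "\<dots> \<le> (LINT x|M. (V x)\<^sup>2)"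
 proof (rule integral_mono[OF _ iV])
  show "integrable M (\<lambda>x. \<eta>\<^sup>2 * indicator Bk x)"
   by (intro integrable_mult_right integrable_real_indicator) (use BkM in \<open>auto simp: emeasure_eq_measure\<close>)
  fix x show "\<eta>\<^sup>2 * indicator Bk x \<le> (V x)\<^sup>2"
   using \<eta> power_mono[of \<eta> "\<bar>V x\<bar>" 2] by (auto simp: Bk indicator_def)
 qed
 also have "\<dots> = (LINT x|M. Q x)" unfolding V_def Q_def by (rule I(7))
 also have "\<dots> \<le> (LINT x|M. A (clock s m x) x - A (clock s k x) x)"
 proof (rule integral_mono_AE[OF iQ])
  show "integrable M (\<lambda>x. A (clock s m x) x - A (clock s k x) x)" using iA by simp
  show "AE x in M. Q x \<le> A (clock s m x) x - A (clock s k x) x"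
   using G0(2)
  proof eventually_elim
   case (elim x)
   have "A (S' x) x \<le> A (clock s m x) x"
    using h(1,2)[OF elim] by (intro A_mono_le elim before_exhaust[OF elim clock_nonneg])
   then show ?case using elim by (simp add: Q_def)
  qed
 qed
 finally show "\<eta>\<^sup>2 * prob Bk \<le> (LINT x|M. A (clock s m x) x - A (clock s k x) x)" .
qed

section \<open>The limit of \<open>U\<close> when the clock stops\<close>

text \<open>The means \<open>a j\<close> of \<open>A\<close> at the clocks increase and are bounded
  by \<open>s\<close>, hence converge to some \<open>l\<close>. An oscillation after
  \<open>clock s k\<close> has probability at most \<open>(l - a k) / \<eta>^2\<close>, which tends
  to zero.\<close>

lemma no_late_oscillation:
 assumes s: "0 \<le> s" and \<eta>: "0 < \<eta>"
 shows "AE w in M. \<exists>k. \<forall>m\<ge>k. \<forall>r. clock s k w \<le> r \<and> r \<le> clock s m w --> \<bar>U r w - U (clock s k w) w\<bar> < \<eta>"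
proof -
 define Bk where "Bk = (\<lambda>k m. {w\<in>G0. \<exists>r. clock s k w \<le> r \<and> r \<le> clock s m w \<and> \<eta> \<le> \<bar>U r w - U (clock s k w) w\<bar>})"
 have cm: "(\<lambda>w. A (clock s j w) w) \<in> borel_measurable M" for j
  by (rule stopped_measurable_M(2)[OF stopping_time_clock clock_nonneg disjI2[OF refl] order_refl])
 have bs: "0 \<le> A (clock s j w) w \<and> A (clock s j w) w \<le> s" if "w \<in> G0" for j w
  using bounds_clock(1)[OF that, of s j] clock_cases(3)[OF that s, of j] by (metis min.cobounded1)
 have iA: "integrable M (\<lambda>w. A (clock s j w) w)" for j
 proof (rule integrable_const_bound[of _ s])
  show "AE w in M. norm (A (clock s j w) w) \<le> s"
   using G0(2) by eventually_elim (use bs in auto)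
 qed (rule cm)
 define a where "a = (\<lambda>j. LINT w|M. A (clock s j w) w)"
 have ainc: "incseq a"
  unfolding incseq_def a_def
 proof (intro allI impI integral_mono_AE iA)
  fix k m :: nat assume "k \<le> m"
  show "AE w in M. A (clock s k w) w \<le> A (clock s m w) w"
   using G0(2)
  proof eventually_elim
   case (elim w)
   show ?case using clock_mono[OF elim s \<open>k \<le> m\<close>] clock_nonneg(1)
    by (intro A_mono_le elim before_exhaust[OF elim clock_nonneg])
  qed
 qed
 have "a j \<le> s" for j
 proof -
  have "a j \<le> (LINT w|M. s)" unfolding a_def
   using G0(2) bs by (intro integral_mono_AE iA) (auto elim!: eventually_mono)
  then show ?thesis by (simp add: prob_space)
 qed
 then obtain l where l: "a \<longlonglongrightarrow> l" "\<And>j. a j \<le> l" using incseq_convergent[OF ainc] by blast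
 have P: "prob (\<Union>m\<in>{k..}. Bk k m) \<le> (l - a k) / \<eta>\<^sup>2" for k
 proof -
  have m: "Bk k (k + j) \<in> sets M" "\<eta>\<^sup>2 * prob (Bk k (k + j)) \<le> a (k + j) - a k" for j
   using oscillation_bound[OF s \<eta>, of k "k + j"] iA by (auto simp: Bk_def a_def)
  have inc: "incseq (\<lambda>j. Bk k (k + j))"
   unfolding incseq_def
  proof (intro allI impI subsetI)
   fix i j w assume ij: "i \<le> j" and "w \<in> Bk k (k + i)"
   then obtain r where r: "w \<in> G0" "clock s k w \<le> r" "r \<le> clock s (k+i) w" "\<eta> \<le> \<bar>U r w - U (clock s k w) w\<bar>"
    by (auto simp: Bk_def)
   then have "r \<le> clock s (k + j) w" using clock_mono[OF r(1) s, of "k+i" "k+j"] ij by auto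
   then show "w \<in> Bk k (k + j)" using r by (auto simp: Bk_def)
  qed
  have "(\<lambda>j. prob (Bk k (k + j))) \<longlonglongrightarrow> prob (\<Union>j. Bk k (k + j))"
   by (rule finite_Lim_measure_incseq[OF _ inc]) (use m in auto)
  moreover have "prob (Bk k (k + j)) \<le> (l - a k) / \<eta>\<^sup>2" for j
  proof -
   have "\<eta>\<^sup>2 * prob (Bk k (k + j)) \<le> l - a k" using m(2)[of j] l(2)[of "k+j"] by linarith
   then show ?thesis using \<eta> by (simp add: field_simps)
  qed
  ultimately have "prob (\<Union>j. Bk k (k + j)) \<le> (l - a k) / \<eta>\<^sup>2"
   by (intro LIMSEQ_le_const2) auto
  moreover have "(\<Union>m\<in>{k..}. Bk k m) = (\<Union>j. Bk k (k + j))"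
  proof -
   have "{k..} = range ((+) k)" by (auto simp: le_iff_add image_iff)
   then show ?thesis by auto
  qed
  ultimately show ?thesis by simp
 qed
 define N where "N = (\<Inter>k. \<Union>m\<in>{k..}. Bk k m)"
 have Bs: "(\<Union>m\<in>{k..}. Bk k m) \<in> sets M" for k
  using oscillation_bound(1)[OF s \<eta>, of k] by (intro sets.countable_UN') (auto simp: Bk_def)
 have NM: "N \<in> sets M" unfolding N_def using Bs by auto
 have "(\<lambda>k. (l - a k) / \<eta>\<^sup>2) \<longlonglongrightarrow> (l - l) / \<eta>\<^sup>2" using \<eta> by (intro tendsto_intros l) auto
 moreover have "prob N \<le> (l - a k) / \<eta>\<^sup>2" for k
  using finite_measure_mono[OF _ Bs[of k], of N] P[of k] by (force simp: N_def)
 ultimately have "prob N \<le> 0" by (intro LIMSEQ_le_const) auto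
 then have "prob N = 0" using measure_nonneg[of M N] by linarith
 then have "N \<in> null_sets M" using NM by (auto simp: null_sets_def emeasure_eq_measure)
 then have "AE w in M. w \<notin> N" by (rule AE_not_in)
 then show ?thesis
  using G0(2)
 proof eventually_elim
  case (elim w)
  then obtain k where "w \<notin> (\<Union>m\<in>{k..}. Bk k m)" by (auto simp: N_def)
  have "\<bar>U r w - U (clock s k w) w\<bar> < \<eta>" if "k \<le> m" "clock s k w \<le> r \<and> r \<le> clock s m w" for m r
  proof (rule ccontr)
   assume "\<not> \<bar>U r w - U (clock s k w) w\<bar> < \<eta>"
   then have "w \<in> Bk k m"
    unfolding Bk_def mem_Collect_eq using that elim(2) by (intro conjI exI[of _ r]) auto
   then show False using \<open>w \<notin> (\<Union>m\<in>{k..}. Bk k m)\<close> that(1) by (simp add: UN_iff)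
  qed
  then show ?case by blast
 qed
qed

definition limit_exists :: "'a => bool" where
 "limit_exists w \<longleftrightarrow> w \<in> G0 \<and> (\<forall>s. 0 \<le> s \<and> total w \<le> ereal s --> (\<exists>l. \<forall>eps>0. \<exists>k. \<forall>r\<in>J w. exhaust k w \<le> r --> \<bar>U r w - l\<bar> \<le> eps))"

text \<open>If the total is at most \<open>s\<close>, the clocks for an integer
  \<open>a \<ge> s\<close> coincide with \<open>exhaust m\<close>. So countably many instances of
  \<open>no_late_oscillation\<close>, with \<open>\<eta> = 1 / (j + 1)\<close>, give the Cauchy
  property up to \<open>\<sigma>\<close>.\<close>

lemma AE_limit_exists: "AE w in M. limit_exists w"
proof -
 have "AE w in M. \<forall>a::nat. \<forall>j::nat. \<exists>k. \<forall>m\<ge>k. \<forall>r. clock (real a) k w \<le> r \<and> r \<le> clock (real a) m w --> \<bar>U r w - U (clock (real a) k w) w\<bar> < 1 / (real j + 1)"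
  unfolding AE_all_countable by (intro allI no_late_oscillation) auto
 then show ?thesis using G0(2)
 proof eventually_elim
  case (elim w)
  have "\<exists>l. \<forall>eps>0. \<exists>k. \<forall>r\<in>J w. exhaust k w \<le> r --> \<bar>U r w - l\<bar> \<le> eps"
   if s: "0 \<le> s" "total w \<le> ereal s" for s
  proof -
   obtain a :: nat where a: "s \<le> real a" using real_arch_simple by blast
   have "\<not> ereal (real a) < total w" using s a by (meson ereal_less_eq(3) le_less_trans not_less order_trans)
   then have "A (exhaust m w) w < real a" for m unfolding total_iff(2)[OF elim(2)] by (auto simp: not_le)
   then have ce: "clock (real a) m w = exhaust m w" for m using clock_cases(4)[OF elim(2)] by auto
   have osc: "\<exists>k. \<forall>r\<in>J w. exhaust k w \<le> r --> \<bar>U r w - U (exhaust k w) w\<bar> < eps" if e: "0 < eps" for eps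
   proof -
    obtain j :: nat where j: "1 / (real j + 1) < eps" using reals_Archimedean[OF e] by (auto simp: inverse_eq_divide add.commute)
    obtain k where k: "\<forall>m\<ge>k. \<forall>r. exhaust k w \<le> r \<and> r \<le> exhaust m w --> \<bar>U r w - U (exhaust k w) w\<bar> < 1 / (real j + 1)"
     using elim(1) unfolding ce[symmetric] by blast
    have "\<bar>U r w - U (exhaust k w) w\<bar> < eps" if r: "r \<in> J w" "exhaust k w \<le> r" for r
    proof -
     obtain m0 where "\<forall>m\<ge>m0. r < exhaust m w" using exhaust_eventually_ge[OF elim(2) r(1)] by blast
     then have "r \<le> exhaust (max m0 k) w" by (auto intro: less_imp_le)
     then show ?thesis using k r(2) j by (meson less_trans max.cobounded2)
    qed
    then show ?thesis by blast
   qed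
   have "Cauchy (\<lambda>k. U (exhaust k w) w)"
   proof (rule metric_CauchyI)
    fix e :: real assume "0 < e"
    then obtain k where k: "\<forall>r\<in>J w. exhaust k w \<le> r --> \<bar>U r w - U (exhaust k w) w\<bar> < e / 2" using osc[of "e/2"] by auto
    have "dist (U (exhaust m w) w) (U (exhaust n w) w) < e" if "m \<ge> k" "n \<ge> k" for m n
     using k[rule_format, OF exhaust_props(3)[OF elim(2)] exhaust_mono[OF that(1)]]
      k[rule_format, OF exhaust_props(3)[OF elim(2)] exhaust_mono[OF that(2)]] unfolding dist_real_def by linarith
    then show "\<exists>M. \<forall>m\<ge>M. \<forall>n\<ge>M. dist (U (exhaust m w) w) (U (exhaust n w) w) < e" by blast
   qed
   then obtain l where l: "(\<lambda>k. U (exhaust k w) w) \<longlonglongrightarrow> l" using Cauchy_convergent convergent_def by blast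
   show ?thesis
   proof (intro exI[of _ l] allI impI)
    fix eps :: real assume e: "0 < eps"
    obtain k where k: "\<forall>r\<in>J w. exhaust k w \<le> r --> \<bar>U r w - U (exhaust k w) w\<bar> < eps / 2" using osc[of "eps/2"] e by auto
    have "\<bar>l - U (exhaust k w) w\<bar> \<le> eps / 2"
    proof (rule tendsto_upperbound[OF tendsto_rabs[OF tendsto_diff[OF l tendsto_const]]])
     show "\<forall>\<^sub>F m in sequentially. \<bar>U (exhaust m w) w - U (exhaust k w) w\<bar> \<le> eps / 2"
      unfolding eventually_sequentially
      using k[rule_format, OF exhaust_props(3)[OF elim(2)] exhaust_mono] by (auto intro!: exI[of _ k] less_imp_le)
    qed simp
    then have "\<bar>U r w - l\<bar> \<le> eps" if "r \<in> J w" "exhaust k w \<le> r" for r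
     using k[rule_format, OF that] \<open>\<bar>l - U (exhaust k w) w\<bar> \<le> eps / 2\<close> by linarith
    then show "\<exists>k. \<forall>r\<in>J w. exhaust k w \<le> r --> \<bar>U r w - l\<bar> \<le> eps" by blast
   qed
  qed
  then show ?case using elim(2) by (auto simp: limit_exists_def)
 qed
qed

text \<open>The time-changed process. If the clock reaches \<open>s\<close>, the sequence is
  eventually constant. Otherwise it converges almost surely to the limit of \<open>U\<close> at
  \<open>\<sigma>\<close>, so that \<open>V\<close> is frozen once the clock has stopped.\<close>

definition V :: "real => 'a => real" where
 "V s w = lim (\<lambda>m. U (clock s m w) w)"

text \<open>The minimum of \<open>s\<close> and the total as a real number; on \<open>G0\<close> the
  second branch is taken only for a finite total.\<close>

definition upto :: "real => 'a => real" where
 "upto s w = (if ereal s \<le> total w then s else real_of_ereal (total w))"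

lemma V_before:
 assumes w: "x \<in> G0" and r: "r \<in> J x"
 shows "(\<lambda>m. U (clock (A r x) m x) x) \<longlonglongrightarrow> U r x" "V (A r x) x = U r x"
proof -
 have r0: "0 \<le> r" using r by (auto simp: interval_before_def)
 obtain m0 where m0: "\<forall>m\<ge>m0. r < exhaust m x" using exhaust_eventually_ge[OF w r] by blast
 have "clock (A r x) m x = r" if "m \<ge> m0" for m
  using m0 that r0 by (intro clock_reached[OF w A_nonneg[OF w r]]) (auto intro: less_imp_le)
 then have "\<forall>\<^sub>F m in sequentially. U (clock (A r x) m x) x = U r x"
  unfolding eventually_sequentially by (intro exI[of _ m0]) auto
 then show l: "(\<lambda>m. U (clock (A r x) m x) x) \<longlonglongrightarrow> U r x" by (rule tendsto_eventually)
 then show "V (A r x) x = U r x" unfolding V_def by (rule limI)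
qed

lemma before_total:
 assumes w: "x \<in> G0" and s: "0 \<le> s" "ereal s < total x"
 obtains r where "r \<in> J x" "A r x = s"
proof -
 obtain m where m: "s \<le> A (exhaust m x) x" using s(2) total_iff(2)[OF w] by blast
 then have "A (clock s m x) x = s" using clock_cases(3)[OF w s(1)] by auto
 then show ?thesis using that before_exhaust[OF w clock_nonneg] by blast
qed

lemma V_lim:
 assumes w: "limit_exists x" and s: "0 \<le> s"
 shows "(\<lambda>m. U (clock s m x) x) \<longlonglongrightarrow> V s x"
  "total x \<le> ereal s ==> 0 < eps ==> \<exists>k. \<forall>r\<in>J x. exhaust k x \<le> r --> \<bar>U r x - V s x\<bar> \<le> eps"
proof -
 have w0: "x \<in> G0" using w by (simp add: limit_exists_def)
 have main: "(\<lambda>m. U (clock s m x) x) \<longlonglongrightarrow> V s x \<and> (\<forall>eps>0. \<exists>k. \<forall>r\<in>J x. exhaust k x \<le> r --> \<bar>U r x - V s x\<bar> \<le> eps)"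
  if t: "total x \<le> ereal s"
 proof -
  have "A (exhaust m x) x < s" for m using t total_iff(2)[OF w0, of s] by (meson not_le)
  then have ce: "clock s m x = exhaust m x" for m using clock_cases(4)[OF w0 s] by auto
  obtain l where l: "\<forall>eps>0. \<exists>k. \<forall>r\<in>J x. exhaust k x \<le> r --> \<bar>U r x - l\<bar> \<le> eps"
   using w s t by (auto simp: limit_exists_def)
  have "(\<lambda>m. U (clock s m x) x) \<longlonglongrightarrow> l"
   unfolding ce
  proof (rule LIMSEQ_I)
   fix e :: real assume "0 < e"
   then obtain k where k: "\<forall>r\<in>J x. exhaust k x \<le> r --> \<bar>U r x - l\<bar> \<le> e / 2" using l half_gt_zero by blast
   show "\<exists>no. \<forall>n\<ge>no. norm (U (exhaust n x) x - l) < e"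
    using k[rule_format, OF exhaust_props(3)[OF w0] exhaust_mono] \<open>0 < e\<close> by (force intro!: exI[of _ k])
  qed
  moreover from this have "V s x = l" unfolding V_def by (rule limI)
  ultimately show ?thesis using l by simp
 qed
 show "(\<lambda>m. U (clock s m x) x) \<longlonglongrightarrow> V s x"
 proof (cases "total x \<le> ereal s")
  case False
  then obtain r where r: "r \<in> J x" "A r x = s" using before_total[OF w0 s] by (auto simp: not_le)
  show ?thesis using V_before[OF w0 r(1)] r(2) by simp
 qed (use main in auto)
 show "total x \<le> ereal s ==> 0 < eps ==> \<exists>k. \<forall>r\<in>J x. exhaust k x \<le> r --> \<bar>U r x - V s x\<bar> \<le> eps"
  using main by auto
qed

lemma total_real:
 assumes w: "x \<in> G0" and s: "total x \<le> ereal s"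
 obtains L where "total x = ereal L" "0 < L" "L \<le> s"
proof -
 have "0 < total x" using A_less_total[OF w before_exhaust[OF w order_refl exhaust_nonneg]] A0[OF w] by (simp add: zero_ereal_def)
 then show ?thesis using that s by (cases "total x") (auto simp: zero_ereal_def)
qed

lemma upto_props:
 assumes w: "x \<in> G0" and s: "0 \<le> s"
 shows "0 \<le> upto s x" "upto s x \<le> s" "(\<lambda>m. A (clock s m x) x) \<longlonglongrightarrow> upto s x"
  "ereal s \<le> total x ==> upto s x = s" "total x = ereal L ==> upto s x = min s L"
proof -
 show 1: "ereal s \<le> total x ==> upto s x = s" by (simp add: upto_def)
 show 2: "total x = ereal L ==> upto s x = min s L" for L by (auto simp: upto_def min_def)
 have "0 \<le> upto s x \<and> upto s x \<le> s"
 proof (cases "ereal s \<le> total x")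
  case False
  then obtain L where "total x = ereal L" "0 < L" using total_real[OF w, of s] False by (metis linear)
  then show ?thesis using 2 s by auto
 qed (use 1 s in auto)
 then show "0 \<le> upto s x" "upto s x \<le> s" by auto
 show "(\<lambda>m. A (clock s m x) x) \<longlonglongrightarrow> upto s x"
 proof (rule LIMSEQ_I)
  fix e :: real assume e: "0 < e"
  have "ereal (upto s x - e / 2) < total x"
  proof (cases "ereal s \<le> total x")
   case True
   have "ereal (s - e / 2) < ereal s" using e by simp
   from less_le_trans[OF this True] show ?thesis using 1[OF True] by simp
  next
   case False
   then obtain L where "total x = ereal L" using total_real[OF w, of s] False by (metis linear)
   then show ?thesis using 2 e by auto
  qed
  then obtain m0 where m0: "\<forall>m\<ge>m0. upto s x - e / 2 \<le> A (exhaust m x) x" using total_iff(1)[OF w] by blast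
  have le: "min s (A (exhaust m x) x) \<le> upto s x" for m
  proof (cases "ereal s \<le> total x")
   case False
   then obtain L where "total x = ereal L" using total_real[OF w, of s] False by (metis linear)
   then show ?thesis using 2 A_less_total[OF w exhaust_props(3)[OF w], of m] by auto
  qed (use 1 in auto)
  have "norm (A (clock s m x) x - upto s x) \<le> e / 2" if "m \<ge> m0" for m
   unfolding clock_cases(3)[OF w s] using m0[rule_format, OF that] le[of m] \<open>upto s x \<le> s\<close> e by (auto simp: min_def)
  then show "\<exists>no. \<forall>n\<ge>no. norm (A (clock s n x) x - upto s x) < e" using e by (force intro!: exI[of _ m0])
 qed
qed

section \<open>The filtration of the time-changed process\<close>

definition reached :: "real => nat => real => 'a set" where
 "reached s m r = {w\<in>G0. s \<le> A (min r (exhaust m w)) w}"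

text \<open>What is known when the clock shows \<open>s\<close>: the usual sigma-algebra of a
  stopping time, tested on the events that \<open>s\<close> has been reached by time
  \<open>r\<close>. Where the clock never shows \<open>s\<close>, every event of \<open>M\<close>
  counts as known.\<close>

definition past_sets :: "real => 'a set set" where
 "past_sets s = {E\<in>sets M. \<forall>m. \<forall>r\<ge>0. E \<inter> reached s m r \<in> sets (F r)}"

definition past :: "real => 'a measure" where
 "past s = sigma (space M) (past_sets s)"

lemma reached_sets: assumes r: "0 \<le> r" shows "reached s m r \<in> sets (F r)"
proof -
 have m: "(\<lambda>w. A (min r (exhaust m w)) w) \<in> borel_measurable (F r)"
  by (rule stopped_measurable_M(1)[OF stopping_time_exhaust exhaust_nonneg order_refl disjI2[OF refl] r])
 have "reached s m r = G0 \<inter> ((\<lambda>w. A (min r (exhaust m w)) w) -` {s..} \<inter> space (F r))"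
  using G0(1) by (auto simp: reached_def space_F)
 then show ?thesis using measurable_sets[OF m, of "{s..}"] G0_sets(1)[OF r] by auto
qed

lemma sigma_algebra_past: "sigma_algebra (space M) (past_sets s)"
proof (rule sigma_algebra_iff2[THEN iffD2], intro conjI ballI allI impI)
 show "past_sets s \<subseteq> Pow (space M)" using sets.sets_into_space by (auto simp: past_sets_def)
 show "{} \<in> past_sets s" by (auto simp: past_sets_def)
 fix E assume E: "E \<in> past_sets s"
 have "(space M - E) \<inter> reached s m r \<in> sets (F r)" if "0 \<le> r" for m r
 proof -
  have "(space M - E) \<inter> reached s m r = reached s m r - (E \<inter> reached s m r)"
   using G0(1) by (auto simp: reached_def)
  then show ?thesis using E that reached_sets[OF that, of s m] by (auto simp: past_sets_def)
 qed
 then show "space M - E \<in> past_sets s" using E by (auto simp: past_sets_def)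
next
 fix E :: "nat => 'a set" assume E: "range E \<subseteq> past_sets s"
 have "(\<Union>i. E i) \<inter> reached s m r \<in> sets (F r)" if "0 \<le> r" for m r
 proof -
  have "(\<Union>i. E i) \<inter> reached s m r = (\<Union>i. E i \<inter> reached s m r)" by auto
  also have "\<dots> \<in> sets (F r)" using E that by (intro sets.countable_UN) (auto simp: past_sets_def)
  finally show ?thesis .
 qed
 moreover have "(\<Union>i. E i) \<in> sets M" using E by (intro sets.countable_UN) (auto simp: past_sets_def)
 ultimately show "(\<Union>i. E i) \<in> past_sets s" by (simp add: past_sets_def)
qed

lemma sets_past: "sets (past s) = past_sets s" and space_past: "space (past s) = space M"
proof -
 interpret sigma_algebra "space M" "past_sets s" by (rule sigma_algebra_past)
 show "sets (past s) = past_sets s" unfolding past_def using space_closed by (simp add: sigma_sets_eq)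
 show "space (past s) = space M" unfolding past_def using space_closed by simp
qed

lemma past_mono: assumes st: "s \<le> t" shows "past_sets s \<subseteq> past_sets t"
proof
 fix E assume E: "E \<in> past_sets s"
 have "E \<inter> reached t m r \<in> sets (F r)" if "0 \<le> r" for m r
 proof -
  have "E \<inter> reached t m r = (E \<inter> reached s m r) \<inter> reached t m r" using st by (auto simp: reached_def)
  also have "\<dots> \<in> sets (F r)" using E that reached_sets[OF that, of t m] by (auto simp: past_sets_def)
  finally show ?thesis .
 qed
 then show "E \<in> past_sets t" using E by (auto simp: past_sets_def)
qed

text \<open>If the total is at most \<open>s\<close>, the clock never shows \<open>s\<close>, so
  such an event meets \<open>reached s m r\<close> only in a null set.\<close>

lemma past_setsI_total:
 assumes "G \<subseteq> space M" "AE w in M. w \<in> G \<longleftrightarrow> total w \<le> ereal s"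
 shows "G \<in> past_sets s"
proof -
 define H where "H = {w\<in>space M. \<forall>m. A (clock s m w) w < s}"
 have AEm: "AE w in M. w \<in> G0 \<inter> {w\<in>space M. \<forall>m. A (exhaust m w) w < s} \<longleftrightarrow> w \<in> G"
  using G0(2) assms(2)
 proof eventually_elim
  case (elim w)
  have "total w \<le> ereal s \<longleftrightarrow> (\<forall>m. A (exhaust m w) w < s)"
  proof -
   have "total w \<le> ereal s \<longleftrightarrow> \<not> ereal s < total w" by (simp add: not_less)
   then show ?thesis unfolding total_iff(2)[OF elim(1)] by (simp add: not_le)
  qed
  then show ?case using elim G0(1) by auto
 qed
 have em: "(\<lambda>w. A (exhaust m w) w) \<in> borel_measurable M" for m
  by (rule stopped_measurable_M(2)[OF stopping_time_exhaust exhaust_nonneg order_refl disjI2[OF refl] order_refl])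
 have "G0 \<inter> {w\<in>space M. \<forall>m. A (exhaust m w) w < s} \<in> sets M"
  using em G0_sets(2) by measurable
 then have "(\<lambda>w. indicator (G0 \<inter> {w\<in>space M. \<forall>m. A (exhaust m w) w < s}) w :: real) \<in> borel_measurable M" by measurable
 then have "(\<lambda>w. indicator G w :: real) \<in> borel_measurable M"
  by (rule borel_measurable_AE_M) (use AEm in \<open>auto elim!: eventually_mono simp: indicator_def\<close>)
 then have GM: "G \<in> sets M" using assms(1) by (simp add: borel_measurable_indicator_iff Int_absorb2)
 have "G \<inter> reached s m r \<in> sets (F r)" if r: "0 \<le> r" for m r
 proof (rule sets_F_AE[OF r sets.empty_sets])
  show "AE w in M. w \<in> {} \<longleftrightarrow> w \<in> G \<inter> reached s m r"
   using G0(2) assms(2)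
  proof eventually_elim
   case (elim w)
   have x: "min r (exhaust m w) \<in> J w" using r exhaust_nonneg by (intro before_exhaust[OF elim(1), of _ m]) auto
   have "\<not> (w \<in> G \<and> w \<in> reached s m r)"
   proof
    assume a: "w \<in> G \<and> w \<in> reached s m r"
    then have "ereal s \<le> ereal (A (min r (exhaust m w)) w)" by (simp add: reached_def)
    also have "\<dots> < total w" by (rule A_less_total[OF elim(1) x])
    also have "\<dots> \<le> ereal s" using a elim by auto
    finally show False by simp
   qed
   then show ?case by auto
  qed
 qed (use assms(1) in auto)
 then show ?thesis using GM by (auto simp: past_sets_def)
qed

lemma V_measurable_M: assumes s: "0 \<le> s" shows "V s \<in> borel_measurable M"
proof (rule borel_measurable_AE_lim)
 show "(\<lambda>w. U (clock s j w) w) \<in> borel_measurable M" for j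
  by (rule stopped_measurable_M(2)[OF stopping_time_clock clock_nonneg disjI1[OF refl] order_refl])
 show "AE w in M. (\<lambda>j. U (clock s j w) w) \<longlonglongrightarrow> V s w"
  using AE_limit_exists by eventually_elim (rule V_lim(1)[OF _ s])
qed

text \<open>On \<open>reached s m r\<close> the value \<open>V s\<close> is the value of
  \<open>U\<close> at a stopping time that does not exceed \<open>r\<close>.\<close>

lemma V_past: assumes s: "0 \<le> s" shows "V s \<in> borel_measurable (past s)"
proof (rule measurableI)
 fix D :: "real set" assume D: "D \<in> sets borel"
 have "(V s -` D \<inter> space M) \<inter> reached s m r \<in> sets (F r)" if r: "0 \<le> r" for m r
 proof -
  have m: "(\<lambda>x. U (min r (clock s m x)) x) \<in> borel_measurable (F r)"
   by (rule stopped_measurable_M(1)[OF stopping_time_clock clock_nonneg disjI1[OF refl] r])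
  have eq: "V s x = U (min r (clock s m x)) x" if w: "x \<in> reached s m r" for x
  proof -
   have w0: "x \<in> G0" using w by (simp add: reached_def)
   have c: "clock s m x \<le> r" "s \<le> A (exhaust m x) x"
    using w clock_cases(5)[OF w0 s r, of m] by (auto simp: reached_def)
   then have "A (clock s m x) x = s" using clock_cases(3)[OF w0 s, of m] by simp
   then have "V s x = U (clock s m x) x" using V_before(2)[OF w0 before_exhaust[OF w0 clock_nonneg], of s m] by simp
   then show ?thesis using c by (simp add: min_def)
  qed
  have "(V s -` D \<inter> space M) \<inter> reached s m r = ((\<lambda>x. U (min r (clock s m x)) x) -` D \<inter> space (F r)) \<inter> reached s m r"
   using eq by (auto simp: space_F)
  then show ?thesis using measurable_sets[OF m D] reached_sets[OF r, of s m] by auto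
 qed
 then show "V s -` D \<inter> space (past s) \<in> sets (past s)"
  using measurable_sets[OF V_measurable_M[OF s] D] by (auto simp: sets_past space_past past_sets_def)
qed auto

text \<open>For each \<open>m\<close> the event \<open>E\<close> is split according to whether the
  clock shows \<open>s\<close> by \<open>exhaust m\<close>. If so,
  \<open>increment_exponential\<close> applies between \<open>clock s m\<close> and
  \<open>clock t m\<close>. If not, both clocks equal \<open>exhaust m\<close> and the exponential
  is \<open>1\<close>. The increments of \<open>A\<close> are at most \<open>t\<close>, so
  \<open>m\<close> may tend to infinity under the integral.\<close>

lemma exponential_identity:
 assumes s: "0 \<le> s" "s \<le> t" and E: "E \<in> past_sets s"
 shows "(LINT y|M. indicator E y * exp (\<i> * of_real (th * (V t y - V s y)) + of_real (th\<^sup>2 * (upto t y - upto s y) / 2))) = of_real (prob E)"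
proof -
 have t: "0 \<le> t" using s by simp
 have EM [measurable]: "E \<in> sets M" using E by (simp add: past_sets_def)
 note [measurable] = G0_sets(2)
 define X where "X = (\<lambda>m y. U (clock t m y) y - U (clock s m y) y)"
 define Q where "Q = (\<lambda>m y. A (clock t m y) y - A (clock s m y) y)"
 have cm [measurable]: "(\<lambda>y. A (clock u m y) y) \<in> borel_measurable M" "(\<lambda>y. U (clock u m y) y) \<in> borel_measurable M" for u m
  by (auto intro: stopped_measurable_M(2)[OF stopping_time_clock clock_nonneg _ order_refl])
 have [measurable]: "X m \<in> borel_measurable M" "Q m \<in> borel_measurable M" for m unfolding X_def Q_def by measurable
 have Qb: "0 \<le> Q m y \<and> Q m y \<le> t" if w: "y \<in> G0" for m y
  using clock_cases(3)[OF w s(1), of m] clock_cases(3)[OF w t, of m] s bounds_clock(1)[OF w, of s m]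
  by (auto simp: Q_def min_def split: if_splits)
 define Y where "Y = (\<lambda>m y. exp (\<i> * of_real (th * X m y) + of_real (th\<^sup>2 * Q m y / 2)))"
 have [measurable]: "Y m \<in> borel_measurable M" for m unfolding Y_def by measurable
 have Yb: "norm (Y m y) \<le> exp (th\<^sup>2 * t / 2)" if w: "y \<in> G0" for m y
  using Qb[OF w, of m] by (auto simp: Y_def intro!: mult_left_mono)
 have iY: "integrable M (\<lambda>y. indicator D y * Y m y)" if [measurable]: "D \<in> sets M" for D m
 proof (rule integrable_const_bound[of _ "exp (th\<^sup>2 * t / 2)"])
  show "AE y in M. norm (indicator D y * Y m y) \<le> exp (th\<^sup>2 * t / 2)"
   using G0(2) by eventually_elim (use Yb in \<open>auto simp: indicator_def\<close>)
 qed measurable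
 have step: "(LINT y|M. indicator E y * Y m y) = of_real (prob E)" for m
 proof -
  \<comment> \<open>Since \<open>exhaust m \<le> level m\<close>, time \<open>level m\<close> is
    late enough to see all that happens up to \<open>exhaust m\<close>.\<close>
  define E' where "E' = E \<inter> reached s m (level m)"
  have mine: "min (level m) (exhaust m y) = exhaust m y" for y using exhaust_le_level[of m y] by auto
  have E'M [measurable]: "E' \<in> sets M"
   using E level_pos[of m] sets_F_M[of E' "level m"] by (auto simp: E'_def past_sets_def)
  have E'w: "y \<in> G0" "s \<le> A (exhaust m y) y" if "y \<in> E'" for y
   using that by (auto simp: E'_def reached_def mine)
  have stop: "{y\<in>E'. clock s m y \<le> r \<and> r < clock t m y} \<in> sets (F r)" if r: "0 \<le> r" for r
  proof -
   have "{y\<in>E'. clock s m y \<le> r \<and> r < clock t m y} = (E \<inter> reached s m r) \<inter> {y\<in>space M. r < clock t m y}"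
   proof (rule set_eqI)
    fix y
    show "y \<in> {y\<in>E'. clock s m y \<le> r \<and> r < clock t m y} \<longleftrightarrow> y \<in> (E \<inter> reached s m r) \<inter> {y\<in>space M. r < clock t m y}"
    proof (cases "y \<in> G0")
     case True
     then show ?thesis using clock_cases(5)[OF True s(1) r, of m] G0(1)
      by (auto simp: E'_def reached_def mine)
    qed (auto simp: E'_def reached_def)
   qed
   then show ?thesis using E r stopping_time_sets(2)[OF stopping_time_clock, of r t m] by (auto simp: past_sets_def)
  qed
  have ord: "0 \<le> clock s m y \<and> clock s m y \<le> clock t m y \<and> clock t m y \<le> exhaust m y" if w: "y \<in> E'" for y
  proof -
   note c = hit_props[where T = "exhaust m" and X = A and l = s and w = y, OF exhaust_nonneg cont_exhaust(1)[OF E'w(1)[OF w]], folded clock_def]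
   have "clock s m y \<le> clock t m y"
    unfolding c(5)
   proof (cases "A (exhaust m y) y < t")
    case True
    then show "exhaust m y \<le> clock t m y \<or> (\<exists>x\<ge>0. x \<le> exhaust m y \<and> x \<le> clock t m y \<and> s \<le> A x y)"
     using clock_cases(4)[OF E'w(1)[OF w] t, of m] by auto
   next
    case False
    then have "A (clock t m y) y = t" using clock_cases(3)[OF E'w(1)[OF w] t, of m] by auto
    then show "exhaust m y \<le> clock t m y \<or> (\<exists>x\<ge>0. x \<le> exhaust m y \<and> x \<le> clock t m y \<and> s \<le> A x y)"
     using clock_nonneg[of t m y] s by auto
   qed
   then show ?thesis using clock_nonneg by auto
  qed
  have E'sub: "E' \<subseteq> G0" using E'w by auto
  define G where "G = space M - E'"
  have [measurable]: "G \<in> sets M" unfolding G_def by measurable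
  \<comment> \<open>Outside \<open>E'\<close> the exponential equals \<open>1\<close>; subtracting
    the probability of the complement leaves the integral over \<open>E'\<close>.\<close>
  have "1 = (LINT y|M. exp (\<i> * of_real (th * (if y \<in> E' then X m y else 0)) + of_real (th\<^sup>2 * (if y \<in> E' then Q m y else 0) / 2)))"
   unfolding X_def Q_def
   by (rule increment_exponential(3)[symmetric, OF E'M E'sub stop ord])
  also have "\<dots> = (LINT y|M. indicator E' y * Y m y + indicator G y)"
   by (rule Bochner_Integration.integral_cong[OF refl]) (auto simp: Y_def G_def)
  also have "\<dots> = (LINT y|M. indicator E' y * Y m y) + (LINT y|M. indicator G y)"
   by (intro Bochner_Integration.integral_add iY integrable_const_bound[of _ 1]) (auto simp: indicator_def)
  also have "(LINT y|M. (indicator G y :: complex)) = of_real (prob G)"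
   using integral_complex_of_real[of M "indicator G"] by (simp add: of_real_indicator)
  finally have e1: "(LINT y|M. indicator E' y * Y m y) = of_real (prob E')"
   using prob_compl[OF E'M] by (simp add: G_def)
  define K where "K = E - E'"
  have [measurable]: "K \<in> sets M" unfolding K_def by measurable
  have "(LINT y|M. indicator K y * Y m y) = (LINT y|M. of_real (indicator K y))"
  proof (rule integral_cong_AE)
   show "AE y in M. indicator K y * Y m y = of_real (indicator K y)"
    using G0(2)
   proof eventually_elim
    case (elim y)
    have "Y m y = 1" if "y \<in> K"
    proof -
     have "A (exhaust m y) y < s" using that elim by (auto simp: K_def E'_def reached_def mine)
     then have "clock s m y = exhaust m y" "clock t m y = exhaust m y"
      using clock_cases(4)[OF elim s(1), of m] clock_cases(4)[OF elim t, of m] s by auto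
     then show ?thesis by (simp add: Y_def X_def Q_def)
    qed
    then show ?case by (auto simp: indicator_def)
   qed
  qed measurable
  also have "\<dots> = of_real (prob K)" by simp
  finally have e2: "(LINT y|M. indicator K y * Y m y) = of_real (prob K)" .
  have sub: "E' \<subseteq> E" by (auto simp: E'_def)
  have "(LINT y|M. indicator E y * Y m y) = (LINT y|M. indicator E' y * Y m y + indicator K y * Y m y)"
   using sub by (intro Bochner_Integration.integral_cong refl) (auto simp: K_def indicator_def)
  also have "\<dots> = of_real (prob E' + prob K)"
   using iY by (simp add: e1 e2)
  also have "prob E' + prob K = prob E"
   using finite_measure_Diff[OF EM E'M sub] by (simp add: K_def)
  finally show ?thesis .
 qed
 have "(\<lambda>m. LINT y|M. indicator E y * Y m y) \<longlonglongrightarrow>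
   (LINT y|M. indicator E y * exp (\<i> * of_real (th * (V t y - V s y)) + of_real (th\<^sup>2 * (upto t y - upto s y) / 2)))"
 proof (rule integral_dominated_convergence)
  have lim: "AE y in M. (\<lambda>m. indicator E y * Y m y) \<longlonglongrightarrow> indicator E y * exp (\<i> * of_real (th * (V t y - V s y)) + of_real (th\<^sup>2 * (upto t y - upto s y) / 2))"
   using AE_limit_exists
  proof eventually_elim
   case (elim y)
   have w: "y \<in> G0" using elim by (simp add: limit_exists_def)
   have x: "(\<lambda>m. X m y) \<longlonglongrightarrow> V t y - V s y" unfolding X_def by (intro tendsto_diff V_lim(1)[OF elim] s t)
   have q: "(\<lambda>m. Q m y) \<longlonglongrightarrow> upto t y - upto s y" unfolding Q_def by (intro tendsto_diff upto_props(3)[OF w] s t)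
   show ?case unfolding Y_def
    by (intro tendsto_mult tendsto_const tendsto_exp tendsto_add tendsto_of_real tendsto_divide x q) simp
  qed
  then show "AE y in M. (\<lambda>m. indicator E y * Y m y) \<longlonglongrightarrow> indicator E y * exp (\<i> * of_real (th * (V t y - V s y)) + of_real (th\<^sup>2 * (upto t y - upto s y) / 2))" .
  show "(\<lambda>y. indicator E y * exp (\<i> * of_real (th * (V t y - V s y)) + of_real (th\<^sup>2 * (upto t y - upto s y) / 2))) \<in> borel_measurable M"
   by (rule borel_measurable_AE_lim[OF _ lim]) measurable
  show "AE y in M. norm (indicator E y * Y m y) \<le> exp (th\<^sup>2 * t / 2)" for m
   using G0(2) by eventually_elim (use Yb in \<open>auto simp: indicator_def\<close>)
 qed auto
 then show ?thesis unfolding step by (simp add: LIMSEQ_const_iff)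
qed

text \<open>For \<open>a < s\<close>, the event \<open>upto s w \<le> a\<close> says that the total
  is at most \<open>a\<close>; for \<open>a \<ge> s\<close> it holds almost surely.\<close>

lemma upto_past: assumes s: "0 \<le> s" shows "upto s \<in> borel_measurable (past s)"
proof (rule borel_measurable_iff_le[THEN iffD2], intro allI)
 fix a
 show "{w \<in> space (past s). upto s w \<le> a} \<in> sets (past s)"
  unfolding sets_past space_past
 proof (cases "a < s")
  case True
  have "{w \<in> space M. upto s w \<le> a} \<in> past_sets a"
  proof (rule past_setsI_total)
   show "AE w in M. w \<in> {w \<in> space M. upto s w \<le> a} \<longleftrightarrow> total w \<le> ereal a"
    using G0(2)
   proof eventually_elim
    case (elim w)
    show ?case
    proof (cases "ereal s \<le> total w")
     case t: True
     then have "\<not> total w \<le> ereal a" using True by (meson ereal_less_eq(3) not_le order_trans)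
     then show ?thesis using t True by (simp add: upto_def)
    next
     case False
     then obtain L where "total w = ereal L" using total_real[OF elim, of s] by (metis linear)
     then show ?thesis using False elim G0(1) by (auto simp: upto_def)
    qed
   qed
  qed auto
  then show "{w \<in> space M. upto s w \<le> a} \<in> past_sets s" using past_mono[of a s] True by auto
 next
  case False
  have sp: "space M \<in> past_sets s" using sets_past[of s] space_past[of s] by (metis sets.top)
  show "{w \<in> space M. upto s w \<le> a} \<in> past_sets s"
  proof -
   have GM: "{w \<in> space M. upto s w \<le> a} \<in> sets M" "{w \<in> space M. upto s w \<le> a} \<inter> reached s m r \<in> sets (F r)" if r: "0 \<le> r" for m r
   proof -
    have AEs: "AE w in M. upto s w \<le> a"
     using G0(2) by eventually_elim (use upto_props(2)[OF _ s] False in force)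
    have "AE w in M. 1 = (indicator {w \<in> space M. upto s w \<le> a} w :: real)"
     using AEs AE_space by eventually_elim simp
    from borel_measurable_AE_M[OF borel_measurable_const this]
    have "indicat_real {w \<in> space M. upto s w \<le> a} \<in> borel_measurable M" .
    then show "{w \<in> space M. upto s w \<le> a} \<in> sets M"
     by (simp add: borel_measurable_indicator_iff Int_absorb2)
    show "{w \<in> space M. upto s w \<le> a} \<inter> reached s m r \<in> sets (F r)"
    proof (rule sets_F_AE[OF r reached_sets[OF r, of s m]])
     show "AE w in M. w \<in> reached s m r \<longleftrightarrow> w \<in> {w \<in> space M. upto s w \<le> a} \<inter> reached s m r"
      using AEs AE_space by eventually_elim simp
    qed auto
   qed
   then show ?thesis by (auto simp: past_sets_def)
  qed
 qed
qed

end

section \<open>Continuation by an independent Brownian motion\<close>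

lemma sets_pair_measure_subset:
 assumes "space A = space A'" "space C = space C'" "sets A \<subseteq> sets A'" "sets C \<subseteq> sets C'"
 shows "sets (A \<Otimes>\<^sub>M C) \<subseteq> sets (A' \<Otimes>\<^sub>M C')"
 unfolding sets_pair_measure assms(1,2) by (rule sigma_sets_mono') (use assms(3,4) in blast)

text \<open>Levy's uniqueness theorem under the probability conditioned on \<open>E\<close>. The
  product form of the result is what independence asks for.\<close>

lemma gaussian_given_event:
 fixes X :: "'b => real"
 assumes p: "prob_space N" and X [measurable]: "X \<in> borel_measurable N" and E [measurable]: "E \<in> sets N" and v: "0 < v"
  and ch: "\<And>th. (LINT x|N. indicator E x * exp (\<i> * of_real (th * X x))) = of_real (measure N E * exp (- th\<^sup>2 * v / 2))"
  and D: "D \<in> sets borel"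
 shows "measure N (E \<inter> (X -` D \<inter> space N)) = measure N E * measure (density lborel (normal_density 0 (sqrt v))) D"
proof (cases "measure N E = 0")
 case True
 interpret prob_space N by (rule p)
 have "measure N (E \<inter> (X -` D \<inter> space N)) \<le> measure N E"
  using E by (intro finite_measure_mono) auto
 then show ?thesis using True measure_nonneg[of N "E \<inter> (X -` D \<inter> space N)"] by simp
next
 case False
 interpret prob_space N by (rule p)
 let ?p = "measure N E"
 have p0: "0 < ?p" using False by (simp add: zero_less_measure_iff)
 define f where "f = (\<lambda>x. indicator E x / ?p)"
 have f [measurable]: "f \<in> borel_measurable N" and f0: "\<And>x. 0 \<le> f x" unfolding f_def using p0 by (auto simp: indicator_def)
 define N' where "N' = density N (\<lambda>x. ennreal (f x))"
 have em: "emeasure N' S = ennreal (measure N (E \<inter> S) / ?p)" if S: "S \<in> sets N" for S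
 proof -
  have "emeasure N' S = (\<integral>\<^sup>+x. ennreal (f x) * indicator S x \<partial>N)"
   unfolding N'_def using S by (simp add: emeasure_density)
  also have "\<dots> = (\<integral>\<^sup>+x. ennreal (1 / ?p) * indicator (E \<inter> S) x \<partial>N)"
   by (intro nn_integral_cong) (auto simp: f_def indicator_def)
  also have "\<dots> = ennreal (1 / ?p) * emeasure N (E \<inter> S)"
   using S E by (subst nn_integral_cmult_indicator) auto
  also have "\<dots> = ennreal (measure N (E \<inter> S) / ?p)"
   using p0 by (simp add: emeasure_eq_measure ennreal_mult[symmetric])
  finally show ?thesis .
 qed
 have sN': "sets N' = sets N" "space N' = space N" by (auto simp: N'_def)
 interpret N': prob_space N'
 proof
  have "E \<inter> space N = E" using sets.sets_into_space[OF E] by auto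
  then show "emeasure N' (space N') = 1" using em[of "space N"] p0 by (simp add: sN')
 qed
 have X': "X \<in> borel_measurable N'" using X by (simp add: N'_def)
 let ?Q = "distr N' borel X"
 let ?G = "density lborel (normal_density 0 (sqrt v))"
 have "?Q = ?G"
 proof (rule Levy_uniqueness)
  show "real_distribution ?Q" by (rule N'.real_distribution_distr) (rule X')
  show "real_distribution ?G"
   using v by (auto simp: real_distribution_def real_distribution_axioms_def intro!: prob_space_normal_density)
  show "char ?Q = char ?G"
  proof
   fix th
   have "char ?Q th = (LINT x|N'. exp (\<i> * of_real (th * X x)))"
    unfolding char_def by (subst integral_distr) (use X' in auto)
   also have "\<dots> = (LINT x|N. f x *\<^sub>R exp (\<i> * of_real (th * X x)))"
    unfolding N'_def using f0 by (intro integral_density) auto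
   also have "\<dots> = (LINT x|N. of_real (1 / ?p) * (indicator E x * exp (\<i> * of_real (th * X x))))"
    by (intro Bochner_Integration.integral_cong refl) (auto simp: f_def indicator_def scaleR_conv_of_real)
   also have "\<dots> = of_real (1 / ?p) * of_real (?p * exp (- th\<^sup>2 * v / 2))"
    unfolding integral_mult_right_zero ch ..
   also have "\<dots> = of_real (exp (- th\<^sup>2 * v / 2))" using p0 by simp
   also have "\<dots> = char ?G th"
    using v by (subst char_normal_density) (auto simp: power_mult_distrib exp_of_real[symmetric])
   finally show "char ?Q th = char ?G th" .
  qed
 qed
 then have "measure ?Q D = measure ?G D" by simp
 moreover have "measure ?Q D = measure N (E \<inter> (X -` D \<inter> space N)) / ?p"
 proof -
  have "measure ?Q D = measure N' (X -` D \<inter> space N')" using X' D by (rule measure_distr)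
  also have "\<dots> = measure N (E \<inter> (X -` D \<inter> space N)) / ?p"
   unfolding measure_def[of N'] using em[of "X -` D \<inter> space N"] D p0 by (simp add: sN' measurable_sets[OF X])
  finally show ?thesis .
 qed
 ultimately show ?thesis using p0 by (simp add: field_simps)
qed

context filtered_brownian_motion
begin

text \<open>\<open>exp_step\<close> with constant coefficient \<open>th\<close>; its compensator is
  then deterministic and can be divided out.\<close>

lemma char_increment:
 assumes rt: "0 \<le> r" "r \<le> t" and E: "E \<in> sets (F r)"
 shows "(LINT w|M. indicator E w * exp (\<i> * of_real (th * (B t w - B r w)))) = of_real (prob E * exp (- th\<^sup>2 * (t - r) / 2))"
proof (cases "r = t")
 case True
 have EM: "E \<in> sets M" using sets_F_M[OF E] .
 have "(LINT w|M. (indicator E w :: complex)) = of_real (prob E)"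
  using integral_complex_of_real[of M "indicator E"] EM by (simp add: of_real_indicator Int_absorb2 sets.sets_into_space)
 then show ?thesis using True by simp
next
 case False
 have EM: "E \<in> sets M" using sets_F_M[OF E] .
 have m: "(\<lambda>w. indicator E w :: complex) \<in> borel_measurable (F r)" using E by measurable
 let ?k = "of_real (exp (th\<^sup>2 * (t - r) / 2))"
 have "(LINT w|M. indicator E w * exp (\<i> * of_real (th * (B t w - B r w)) + of_real (th\<^sup>2 * (t - r) / 2))) = (LINT w|M. (indicator E w :: complex))"
  by (rule exp_step[where K = 1 and C = "\<bar>th\<bar>"]) (use rt False m in \<open>auto simp: indicator_def\<close>)
 also have "\<dots> = of_real (prob E)"
  using integral_complex_of_real[of M "indicator E"] EM by (simp add: of_real_indicator Int_absorb2 sets.sets_into_space)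
 finally have "(LINT w|M. indicator E w * exp (\<i> * of_real (th * (B t w - B r w)) + of_real (th\<^sup>2 * (t - r) / 2))) = of_real (prob E)" .
 moreover have "indicator E w * exp (\<i> * of_real (th * (B t w - B r w)) + of_real (th\<^sup>2 * (t - r) / 2)) = ?k * (indicator E w * exp (\<i> * of_real (th * (B t w - B r w))))" for w
  unfolding exp_add exp_of_real by simp
 ultimately have "?k * (LINT w|M. indicator E w * exp (\<i> * of_real (th * (B t w - B r w)))) = of_real (prob E)"
  by (simp only: integral_mult_right_zero)
 then have "(LINT w|M. indicator E w * exp (\<i> * of_real (th * (B t w - B r w)))) = of_real (prob E) / ?k"
  by (simp add: field_simps)
 also have "\<dots> = of_real (prob E * exp (- th\<^sup>2 * (t - r) / 2))"
 proof -
  have e: "exp (- th\<^sup>2 * (t - r) / 2) = inverse (exp (th\<^sup>2 * (t - r) / 2))"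
   unfolding exp_minus[symmetric] by simp
  show ?thesis unfolding e by (simp only: of_real_mult of_real_inverse) (rule divide_inverse)
 qed
 finally show ?thesis .
qed

lemma B_AE: "AE w in M. B 0 w = 0 \<and> continuous_on {0..} (\<lambda>t. B t w)"
 using bm unfolding brownian_motion_def by auto

end

context stopped_ito
begin

text \<open>For almost all pairs this is the path of \<open>B\<close> at \<open>w'\<close>,
  evaluated at time \<open>upto t w\<close>. The limit over dyadic roundings makes joint
  measurability evident.\<close>

definition restart :: "real => 'a \<times> 'a => real" where
 "restart t = (\<lambda>(w, w'). lim (\<lambda>N. B (min t (real (nat \<lfloor>upto t w / t * 2 ^ N\<rfloor>) * (t / 2 ^ N))) w'))"

text \<open>\<open>V\<close> on the first factor, continued by the increments of an independent
  Brownian motion from the moment the clock stops. Before that moment \<open>upto t w = t\<close>,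
  and the second factor contributes nothing.\<close>

definition extended_bm :: "real => 'a \<times> 'a => real" where
 "extended_bm t x = V t (fst x) + (B t (snd x) - restart t x)"

text \<open>Filtrations are indexed by all reals; negative times get the information of time
  \<open>0\<close>.\<close>

definition extended_filtration :: "real => ('a \<times> 'a) measure" where
 "extended_filtration t = past (max 0 t) \<Otimes>\<^sub>M F (max 0 t)"

lemma restart_measurable:
 assumes t: "0 \<le> t" shows "restart t \<in> borel_measurable (past t \<Otimes>\<^sub>M F t)"
 unfolding restart_def case_prod_beta'
proof (rule borel_measurable_lim_metric)
 fix N
 have g: "(\<lambda>x. nat \<lfloor>upto t (fst x) / t * 2 ^ N\<rfloor>) \<in> measurable (past t \<Otimes>\<^sub>M F t) (count_space UNIV)"
  using upto_past[OF t] by measurable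
 show "(\<lambda>x. B (min t (real (nat \<lfloor>upto t (fst x) / t * 2 ^ N\<rfloor>) * (t / 2 ^ N))) (snd x)) \<in> borel_measurable (past t \<Otimes>\<^sub>M F t)"
 proof (rule measurable_compose_countable[OF _ g])
  fix i
  have "B (min t (real i * (t / 2 ^ N))) \<in> borel_measurable (F t)" using t by (intro measurable_F_mono[OF _ B_adapted]) auto
  then show "(\<lambda>x. B (min t (real i * (t / 2 ^ N))) (snd x)) \<in> borel_measurable (past t \<Otimes>\<^sub>M F t)" by measurable
 qed
qed

lemma restart_eq:
 assumes w: "x \<in> G0" and t: "0 \<le> t" and B: "continuous_on {0..} (\<lambda>t. B t x')"
 shows "restart t (x, x') = B (upto t x) x'"
proof (cases "t = 0")
 case True
 then have "upto t x = 0" using upto_props(1,2)[OF w t] by simp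
 then show ?thesis using True by (simp add: restart_def)
next
 case False
 then have t0: "0 < t" using t by simp
 define m where "m = upto t x"
 have m0: "0 \<le> m" "m \<le> t" using upto_props(1,2)[OF w t] by (auto simp: m_def)
 define g where "g = (\<lambda>N::nat. nat \<lfloor>m / t * 2 ^ N\<rfloor>)"
 define r where "r = (\<lambda>N. real (g N) * (t / 2 ^ N))"
 have gr: "real (g N) \<le> m / t * 2 ^ N" "m / t * 2 ^ N < real (g N) + 1" for N
 proof -
  have "0 \<le> m / t * 2 ^ N" using m0 t0 by simp
  then show "real (g N) \<le> m / t * 2 ^ N" "m / t * 2 ^ N < real (g N) + 1" unfolding g_def by linarith+
 qed
 have r: "0 \<le> r N" "r N \<le> m" "m - t / 2 ^ N \<le> r N" for N
 proof -
  show "0 \<le> r N" using t0 by (simp add: r_def)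
  have "r N \<le> m / t * 2 ^ N * (t / 2 ^ N)" unfolding r_def using gr(1)[of N] t0 by (intro mult_right_mono) auto
  also have e: "m / t * 2 ^ N * (t / 2 ^ N) = m" using t0 by simp
  finally show "r N \<le> m" .
  have "m / t * 2 ^ N * (t / 2 ^ N) \<le> (real (g N) + 1) * (t / 2 ^ N)" using gr(2)[of N] t0 by (intro mult_right_mono) auto
  then show "m - t / 2 ^ N \<le> r N" unfolding e r_def by (simp add: distrib_right add_divide_distrib)
 qed
 have "(\<lambda>N. m - t * (1/2) ^ N) \<longlonglongrightarrow> m - t * 0" by (intro tendsto_intros LIMSEQ_realpow_zero) auto
 then have "(\<lambda>N. m - t / 2 ^ N) \<longlonglongrightarrow> m" by (simp add: power_one_over)
 then have "r \<longlonglongrightarrow> m" by (rule tendsto_sandwich[rotated 2, OF _ tendsto_const]) (use r in auto)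
 then have "(\<lambda>N. B (r N) x') \<longlonglongrightarrow> B m x'"
  using m0 r by (intro continuous_on_tendsto_compose[OF B]) auto
 moreover have "min t (r N) = r N" for N using r(2)[of N] m0 by auto
 ultimately have "(\<lambda>N. B (min t (r N)) x') \<longlonglongrightarrow> B m x'" by simp
 moreover have "restart t (x, x') = lim (\<lambda>N. B (min t (r N)) x')"
  by (simp only: restart_def prod.case r_def g_def m_def)
 ultimately show ?thesis by (simp add: limI m_def)
qed

lemma extended_bm_adapted:
 assumes t: "0 \<le> t" shows "extended_bm t \<in> borel_measurable (past t \<Otimes>\<^sub>M F t)"
 unfolding extended_bm_def using V_past[OF t] B_adapted[OF t] restart_measurable[OF t] by measurable

lemma subalgebra_past: "0 \<le> t ==> subalgebra M (past t)"
 unfolding subalgebra_def by (auto simp: space_past sets_past past_sets_def)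

lemma extended_filtered_space: "filtered_space (M \<Otimes>\<^sub>M M) extended_filtration"
 unfolding filtered_space_def
proof (intro conjI allI)
 interpret P: pair_prob_space M M ..
 show "prob_space (M \<Otimes>\<^sub>M M)" by unfold_locales
 show "filtration (space (M \<Otimes>\<^sub>M M)) extended_filtration"
 proof
  show "space (extended_filtration i) = space (M \<Otimes>\<^sub>M M)" for i
   by (simp add: extended_filtration_def space_pair_measure space_past space_F)
  show "sets (extended_filtration i) \<le> sets (extended_filtration j)" if "i \<le> j" for i j
   unfolding extended_filtration_def
   by (rule sets_pair_measure_subset) (use that past_mono[of "max 0 i" "max 0 j"] sets_F_mono[of "max 0 i" "max 0 j"] in \<open>auto simp: space_past space_F sets_past\<close>)
 qed
 show "subalgebra (M \<Otimes>\<^sub>M M) (extended_filtration t)" for t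
  unfolding subalgebra_def extended_filtration_def
  using sets_pair_measure_subset[of "past (max 0 t)" M "F (max 0 t)" M] subalgebra_past[of "max 0 t"] subalg[of "max 0 t"]
  by (auto simp: subalgebra_def space_pair_measure)
qed

text \<open>Integration over the second factor yields the Gaussian factor for the part of
  \<open>[s, t]\<close> after the clock has stopped; \<open>exponential_identity\<close> on the
  first factor accounts for the part before. The two variances add up to
  \<open>t - s\<close>.\<close>

lemma extended_char:
 assumes s: "0 \<le> s" "s < t" and E1: "E1 \<in> past_sets s" and E2: "E2 \<in> sets (F s)"
 shows "(LINT x|(M \<Otimes>\<^sub>M M). indicator (E1 \<times> E2) x * exp (\<i> * complex_of_real (th * (extended_bm t x - extended_bm s x))))
  = complex_of_real (measure (M \<Otimes>\<^sub>M M) (E1 \<times> E2) * exp (- th\<^sup>2 * (t - s) / 2))"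
proof -
 interpret P: pair_prob_space M M ..
 have t: "0 \<le> t" using s by simp
 have E1M [measurable]: "E1 \<in> sets M" using E1 by (simp add: past_sets_def)
 have E2M [measurable]: "E2 \<in> sets M" using sets_F_M[OF E2] .
 have bM [measurable]: "extended_bm u \<in> borel_measurable (M \<Otimes>\<^sub>M M)" if "0 \<le> u" for u
 proof -
  have "subalgebra (M \<Otimes>\<^sub>M M) (past u \<Otimes>\<^sub>M F u)"
   using extended_filtered_space that unfolding filtered_space_def extended_filtration_def by (metis max.absorb2)
  then show ?thesis using measurable_from_subalg extended_bm_adapted[OF that] by blast
 qed
 note [measurable] = bM[OF s(1)] bM[OF t]
 define f where "f = (\<lambda>x. indicator (E1 \<times> E2) x * exp (\<i> * complex_of_real (th * (extended_bm t x - extended_bm s x))))"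
 have fm [measurable]: "f \<in> borel_measurable (M \<Otimes>\<^sub>M M)" unfolding f_def by measurable
 have fi: "integrable (M \<Otimes>\<^sub>M M) f"
  by (rule P.integrable_const_bound[of _ 1]) (auto simp: f_def indicator_def norm_mult)
 have inner: "(LINT y'|M. f (y, y')) = complex_of_real (prob E2 * exp (- th\<^sup>2 * (t - s) / 2)) *
   (indicator E1 y * exp (\<i> * complex_of_real (th * (V t y - V s y)) + complex_of_real (th\<^sup>2 * (upto t y - upto s y) / 2)))"
  if w: "y \<in> G0" for y
 proof -
  \<comment> \<open>The time at which the second factor takes over: the total, moved to the nearer
    end of \<open>[s, t]\<close> if it lies outside.\<close>
  define u where "u = max (upto t y) s"
  have u: "s \<le> u" "u \<le> t" using upto_props(2)[OF w t] s by (auto simp: u_def)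
  have B_inc: "(B t y' - B (upto t y) y') - (B s y' - B (upto s y) y') = B t y' - B u y' \<and> t - u = (t - s) - (upto t y - upto s y)" for y'
  proof (cases "ereal s \<le> total y")
   case True
   then have us: "upto s y = s" by (rule upto_props(4)[OF w s(1)])
   have "s \<le> upto t y"
   proof (cases "ereal t \<le> total y")
    case False
    then obtain L where "total y = ereal L" using total_real[OF w, of t] by (metis linear)
    then show ?thesis using upto_props(5)[OF w t] True s by auto
   qed (use upto_props(4)[OF w t] s in auto)
   then show ?thesis using us by (simp add: u_def)
  next
   case False
   then obtain L where L: "total y = ereal L" "L \<le> s" using total_real[OF w, of s] by (metis linear)
   then have "upto s y = L" "upto t y = L" using upto_props(5)[OF w s(1)] upto_props(5)[OF w t] s by auto
   then show ?thesis using L by (simp add: u_def)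
  qed
  have e2F: "E2 \<in> sets (F u)" using E2 sets_F_mono[OF u(1)] by blast
  have "(LINT y'|M. f (y, y')) = (LINT y'|M. (indicator E1 y * exp (\<i> * complex_of_real (th * (V t y - V s y)))) *
    (indicator E2 y' * exp (\<i> * complex_of_real (th * (B t y' - B u y')))))"
  proof (rule integral_cong_AE)
   have ws: "y \<in> space M" using w G0(1) by auto
   show "(\<lambda>y'. f (y, y')) \<in> borel_measurable M" using measurable_Pair2[OF fm ws] .
   have [measurable]: "B t \<in> borel_measurable M" "B u \<in> borel_measurable M" using u s by (auto intro: B_meas)
   show "(\<lambda>y'. (indicator E1 y * exp (\<i> * complex_of_real (th * (V t y - V s y)))) *
    (indicator E2 y' * exp (\<i> * complex_of_real (th * (B t y' - B u y'))))) \<in> borel_measurable M" by measurable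
   show "AE y' in M. f (y, y') = (indicator E1 y * exp (\<i> * complex_of_real (th * (V t y - V s y)))) *
    (indicator E2 y' * exp (\<i> * complex_of_real (th * (B t y' - B u y'))))"
    using B_AE
   proof eventually_elim
    case (elim y')
    have "extended_bm t (y, y') - extended_bm s (y, y') = (V t y - V s y) + (B t y' - B u y')"
     using B_inc[of y'] restart_eq[OF w t, of y'] restart_eq[OF w s(1), of y'] elim by (simp add: extended_bm_def)
    moreover have "exp (\<i> * complex_of_real (th * (a + b))) = exp (\<i> * complex_of_real (th * a)) * exp (\<i> * complex_of_real (th * b))" for a b :: real
     by (simp add: distrib_left exp_add)
    ultimately show ?case unfolding f_def by (simp only:) (simp add: indicator_def)
   qed
  qed
  also have "\<dots> = (indicator E1 y * exp (\<i> * complex_of_real (th * (V t y - V s y)))) * complex_of_real (prob E2 * exp (- th\<^sup>2 * (t - u) / 2))"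
   unfolding integral_mult_right_zero using char_increment[OF _ u(2) e2F, of th] u s by simp
  also have "- th\<^sup>2 * (t - u) / 2 = - th\<^sup>2 * (t - s) / 2 + th\<^sup>2 * (upto t y - upto s y) / 2"
  proof -
   have tu: "t - u = (t - s) - (upto t y - upto s y)" using B_inc by blast
   show ?thesis unfolding tu by (simp add: field_simps)
  qed
  finally show ?thesis by (simp only: exp_add of_real_mult exp_of_real mult_ac)
 qed
 have "(LINT x|(M \<Otimes>\<^sub>M M). f x) = (LINT y|M. LINT y'|M. f (y, y'))"
  using P.integral_fst'[OF fi] by simp
 also have "\<dots> = (LINT y|M. complex_of_real (prob E2 * exp (- th\<^sup>2 * (t - s) / 2)) *
   (indicator E1 y * exp (\<i> * complex_of_real (th * (V t y - V s y)) + complex_of_real (th\<^sup>2 * (upto t y - upto s y) / 2))))"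
 proof (rule integral_cong_AE)
  have m1: "(\<lambda>y. LINT y'|M. f (y, y')) \<in> borel_measurable M"
   by (intro borel_measurable_lebesgue_integral) (use fm in simp)
  show "(\<lambda>y. LINT y'|M. f (y, y')) \<in> borel_measurable M" by (rule m1)
  show AEi: "AE y in M. (LINT y'|M. f (y, y')) = complex_of_real (prob E2 * exp (- th\<^sup>2 * (t - s) / 2)) *
   (indicator E1 y * exp (\<i> * complex_of_real (th * (V t y - V s y)) + complex_of_real (th\<^sup>2 * (upto t y - upto s y) / 2)))"
   using G0(2) by eventually_elim (rule inner)
  show "(\<lambda>y. complex_of_real (prob E2 * exp (- th\<^sup>2 * (t - s) / 2)) *
   (indicator E1 y * exp (\<i> * complex_of_real (th * (V t y - V s y)) + complex_of_real (th\<^sup>2 * (upto t y - upto s y) / 2)))) \<in> borel_measurable M"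
   by (rule borel_measurable_AE_M[OF m1 AEi])
 qed
 also have "\<dots> = complex_of_real (prob E2 * exp (- th\<^sup>2 * (t - s) / 2)) * complex_of_real (prob E1)"
  unfolding integral_mult_right_zero using exponential_identity[OF s(1) less_imp_le[OF s(2)] E1] by simp
 also have "measure (M \<Otimes>\<^sub>M M) (E1 \<times> E2) = prob E1 * prob E2"
  using emeasure_pair_measure_Times[OF E1M E2M] by (simp add: measure_def enn2real_mult)
 then have "complex_of_real (prob E2 * exp (- th\<^sup>2 * (t - s) / 2)) * complex_of_real (prob E1) = complex_of_real (measure (M \<Otimes>\<^sub>M M) (E1 \<times> E2) * exp (- th\<^sup>2 * (t - s) / 2))"
  by (simp add: mult_ac)
 finally show ?thesis unfolding f_def .
qed

text \<open>Before the total, \<open>V\<close> is \<open>U\<close> composed with the inverse of the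
  strictly increasing \<open>A\<close>. At the total the limit of \<open>U\<close> gives continuity
  from the left, and from there on \<open>V\<close> is constant.\<close>

lemma V_continuous:
 assumes w: "limit_exists y" shows "continuous_on {0..} (\<lambda>s. V s y)"
 unfolding continuous_on_iff
proof (intro ballI allI impI)
 have w0: "y \<in> G0" using w by (simp add: limit_exists_def)
 fix s e :: real assume "s \<in> {0..}" and e: "0 < e"
 then have s: "0 \<le> s" by simp
 show "\<exists>d>0. \<forall>s'\<in>{0..}. dist s' s < d --> dist (V s' y) (V s y) < e"
 proof (cases "ereal s < total y")
  case True
  obtain r where r: "r \<in> J y" "A r y = s" using before_total[OF w0 s True] .
  obtain r2' where r2': "r < r2'" "r2' \<in> J y" using interval_before_extend[OF r(1)] .
  have c: "continuous_on {0..r2'} (\<lambda>t. U t y)" using continuous_on_subset[OF cont(1)[OF w0] interval_before_D[OF r2'(2)]] .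
  have r0: "0 \<le> r" using r by (auto simp: interval_before_def)
  obtain d where d: "d > 0" "\<And>x. x \<in> {0..r2'} ==> dist x r < d ==> dist (U x y) (U r y) < e"
   using c r0 r2' e unfolding continuous_on_iff by (metis atLeastAtMost_iff less_imp_le)
  define r2 where "r2 = min r2' (r + d / 2)"
  define r1 where "r1 = max 0 (r - d / 2)"
  have r12: "r < r2" "r2 \<le> r2'" "0 \<le> r1" "r1 \<le> r" "r2 - r < d" "r - r1 < d" using r2' d r0 by (auto simp: r1_def r2_def)
  have i2: "r2 \<in> J y" using interval_before_D[OF r2'(2)] r12 r0 by auto
  have A2: "s < A r2 y" using A_mono[OF w0 i2 r0 r12(1)] r(2) by simp
  have A1: "r1 = 0 \<or> A r1 y < s"
  proof (cases "r1 = r")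
   case False
   then show ?thesis using A_mono[OF w0 r(1) r12(3)] r12(4) r(2) by auto
  qed (use d r0 in \<open>auto simp: r1_def max_def split: if_splits\<close>)
  \<comment> \<open>Clock readings within \<open>dl\<close> of \<open>s\<close> belong to times in
    \<open>[r1, r2]\<close>. If \<open>r1 = 0\<close>, there is no constraint from below.\<close>
  define dl where "dl = (if r1 = 0 then A r2 y - s else min (A r2 y - s) (s - A r1 y))"
  have dl: "0 < dl" using A1 A2 by (auto simp: dl_def)
  show ?thesis
  proof (intro exI[of _ dl] conjI ballI impI dl)
   fix s' :: real assume s': "s' \<in> {0..}" "dist s' s < dl"
   have lt: "s' < A r2 y" "r1 = 0 \<or> A r1 y < s'" using s' by (auto simp: dl_def dist_real_def split: if_splits)
   have "ereal s' < ereal (A r2 y)" using lt by simp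
   also have "\<dots> < total y" by (rule A_less_total[OF w0 i2])
   finally obtain r' where r': "r' \<in> J y" "A r' y = s'" using before_total[OF w0 _] s' by auto
   have r'0: "0 \<le> r'" using r' by (auto simp: interval_before_def)
   have "r' \<le> r2" using A_mono_le[OF w0 r'(1), of r2] lt r'(2) r12 r0 by force
   moreover have "r1 \<le> r'"
   proof (rule ccontr)
    assume "\<not> r1 \<le> r'"
    moreover have "r1 \<in> J y" using subsetD[OF interval_before_D[OF r(1)], of r1] r12 by auto
    ultimately have "A r' y \<le> A r1 y" "r1 \<noteq> 0" using A_mono_le[OF w0 _ r'0, of r1] r'0 by auto
    then show False using lt r'(2) by auto
   qed
   ultimately have "dist (U r' y) (U r y) < e" using r12 r'0 by (intro d(2)) (auto simp: dist_real_def)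
   then show "dist (V s' y) (V s y) < e"
    using V_before(2)[OF w0 r'(1)] V_before(2)[OF w0 r(1)] r'(2) r(2) by simp
  qed
 next
  case False
  then have ts: "total y \<le> ereal s" by (simp add: not_less)
  obtain L where L: "total y = ereal L" "0 < L" "L \<le> s" using total_real[OF w0 ts] .
  obtain k where k: "\<forall>r\<in>J y. exhaust k y \<le> r --> \<bar>U r y - V s y\<bar> \<le> e / 2"
   using V_lim(2)[OF w s ts, of "e / 2"] e by auto
  let ?a = "A (exhaust k y) y"
  have aL: "?a < L" using A_less_total[OF w0 exhaust_props(3)[OF w0], of k] L(1) by simp
  show ?thesis
  proof (intro exI[of _ "L - ?a"] conjI ballI impI)
   show "0 < L - ?a" using aL by simp
   fix s' :: real assume s': "s' \<in> {0..}" "dist s' s < L - ?a"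
   have "\<bar>V s' y - V s y\<bar> \<le> e / 2"
   proof (cases "ereal s' < total y")
    case True
    obtain r' where r': "r' \<in> J y" "A r' y = s'" using before_total[OF w0 _ True] s' by auto
    have "?a < s'" using s' L by (auto simp: dist_real_def)
    then have "exhaust k y \<le> r'" using A_mono_le[OF w0 exhaust_props(3)[OF w0], of r' k] r' by (force simp: interval_before_def)
    then show ?thesis using k r' V_before(2)[OF w0 r'(1)] by auto
   next
    case out: False
    then have ts': "total y \<le> ereal s'" by (simp add: not_less)
    have "V s' y = V s y"
    proof (rule LIMSEQ_unique)
     have "A (exhaust m y) y < s \<and> A (exhaust m y) y < s'" for m
      using A_less_total[OF w0 exhaust_props(3)[OF w0], of m] ts ts' by (metis ereal_less_eq(3) less_le_trans less_ereal.simps(1))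
     then have "clock s m y = exhaust m y \<and> clock s' m y = exhaust m y" for m
      using clock_cases(4)[OF w0 s, of m] clock_cases(4)[OF w0, of s' m] s' by auto
     then show "(\<lambda>m. U (clock s m y) y) \<longlonglongrightarrow> V s' y" using V_lim(1)[OF w, of s'] s' by simp
     show "(\<lambda>m. U (clock s m y) y) \<longlonglongrightarrow> V s y" by (rule V_lim(1)[OF w s])
    qed
    then show ?thesis using e by simp
   qed
   then show "dist (V s' y) (V s y) < e" using e by (simp add: dist_real_def)
  qed
 qed
qed

lemma upto_continuous:
 assumes w: "x \<in> G0" shows "continuous_on {0..} (\<lambda>s. upto s x)"
proof (cases "\<exists>s. total x \<le> ereal s")
 case True
 then obtain L where "total x = ereal L" using total_real[OF w] by metis
 then have "continuous_on {0..} (\<lambda>s. min s L)" "\<And>s. s \<in> {0..} ==> upto s x = min s L"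
  using upto_props(5)[OF w] by (auto intro!: continuous_intros)
 then show ?thesis by (metis (mono_tags, lifting) continuous_on_eq)
next
 case False
 then have "upto s x = s" for s by (simp add: upto_def) (meson linear)
 then show ?thesis by simp
qed

text \<open>Independence of an increment from the past is checked on rectangles, which are stable
  under intersection and generate the product sigma-algebra. There it is
  \<open>gaussian_given_event\<close>, fed with \<open>extended_char\<close>.\<close>

theorem brownian_motion_before_time_change:
 assumes U0: "\<And>w. w \<in> G0 ==> U 0 w = 0"
  and L: "AE w in M. L w = total w"
  and X: "AE w in M. \<forall>r\<in>J w. X (A r w) w = of_real (U r w)"
 shows "brownian_motion_before M L X"
 unfolding brownian_motion_before_def
proof (intro exI conjI allI impI)
 let ?N = "M \<Otimes>\<^sub>M M"
 interpret P: pair_prob_space M M ..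
 show "filtered_space ?N extended_filtration" by (rule extended_filtered_space)
 show fstm: "fst \<in> measurable ?N M" by simp
 show distr1: "distr ?N M fst = M" by (rule distr_pair_fst)
 have distr2: "distr ?N M snd = M"
 proof (rule measure_eqI)
  fix S assume "S \<in> sets (distr ?N M snd)"
  then have S: "S \<in> sets M" by simp
  have "snd -` S \<inter> space ?N = space M \<times> S"
   using sets.sets_into_space[OF S] by (auto simp: space_pair_measure)
  then show "emeasure (distr ?N M snd) S = emeasure M S"
   using S by (simp add: emeasure_distr emeasure_pair_measure_Times emeasure_space_1)
 qed simp
 have AE1: "AE x in ?N. Pr (fst x)" if "AE w in M. Pr w" for Pr
  using AE_distrD[OF fstm, of Pr] that unfolding distr1 by simp
 have AE2: "AE x in ?N. Pr (snd x)" if "AE w in M. Pr w" for Pr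
  using AE_distrD[of snd ?N M Pr] that unfolding distr2 by simp
 show "{x \<in> space ?N. L (fst x) \<le> ereal t} \<in> sets (extended_filtration t)" if t: "0 \<le> t" for t
 proof -
  have "{w\<in>space M. L w \<le> ereal t} \<in> past_sets t"
  proof (rule past_setsI_total)
   show "AE w in M. w \<in> {w \<in> space M. L w \<le> ereal t} \<longleftrightarrow> total w \<le> ereal t"
    using L AE_space by eventually_elim auto
  qed auto
  then have "{w\<in>space M. L w \<le> ereal t} \<times> space (F t) \<in> sets (past t \<Otimes>\<^sub>M F t)"
   by (intro pair_measureI) (auto simp: sets_past)
  moreover have "{x \<in> space ?N. L (fst x) \<le> ereal t} = {w\<in>space M. L w \<le> ereal t} \<times> space (F t)"
   by (auto simp: space_pair_measure space_F)
  ultimately show ?thesis using t by (simp add: extended_filtration_def max_def)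
 qed
 show "AE x in ?N. \<forall>t\<ge>0. ereal t < L (fst x) --> X t (fst x) = of_real (extended_bm t x)"
  using AE1[OF L] AE1[OF X] AE1[OF G0(2)] AE2[OF B_AE]
 proof eventually_elim
  case (elim x)
  show ?case
  proof (intro allI impI)
   fix t :: real assume t: "0 \<le> t" "ereal t < L (fst x)"
   then obtain r where r: "r \<in> interval_before (\<sigma> (fst x))" "A r (fst x) = t"
    using before_total[OF elim(3) t(1)] elim(1) by auto
   have "upto t (fst x) = t" using t elim(1) by (intro upto_props(4)[OF elim(3) t(1)]) simp
   then have "extended_bm t x = V t (fst x)"
    using restart_eq[OF elim(3) t(1), of "snd x"] elim(4) by (simp add: extended_bm_def)
   then show "X t (fst x) = of_real (extended_bm t x)"
    using elim(2) r V_before(2)[OF elim(3) r(1)] by auto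
  qed
 qed
 show "brownian_motion ?N extended_filtration extended_bm"
  unfolding brownian_motion_def
 proof (intro conjI allI impI)
  show "extended_bm t \<in> borel_measurable (extended_filtration t)" if "0 \<le> t" for t
   using extended_bm_adapted[OF that] that by (simp add: extended_filtration_def max_def)
  show "AE x in ?N. extended_bm 0 x = 0 \<and> continuous_on {0..} (\<lambda>t. extended_bm t x)"
   using AE1[OF AE_limit_exists] AE2[OF B_AE]
  proof eventually_elim
   case (elim x)
   have w0: "fst x \<in> G0" using elim(1) by (simp add: limit_exists_def)
   have Bc: "continuous_on {0..} (\<lambda>t. B t (snd x))" using elim by auto
   have eq: "extended_bm t x = V t (fst x) + (B t (snd x) - B (upto t (fst x)) (snd x))" if "t \<in> {0..}" for t
    using restart_eq[OF w0 _ Bc, of t] that by (simp add: extended_bm_def)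
   have i0: "0 \<in> interval_before (\<sigma> (fst x))" by (rule before_exhaust[OF w0 order_refl exhaust_nonneg])
   have "V 0 (fst x) = 0" using V_before(2)[OF w0 i0] A0[OF w0] U0[OF w0] by simp
   moreover have "upto 0 (fst x) = 0" using upto_props(1,2)[OF w0, of 0] by simp
   ultimately have "extended_bm 0 x = 0" using eq[of 0] by simp
   moreover have "continuous_on {0..} (\<lambda>t. V t (fst x) + (B t (snd x) - B (upto t (fst x)) (snd x)))"
    using upto_props(1)[OF w0]
    by (intro continuous_intros V_continuous elim(1) Bc continuous_on_compose2[OF Bc upto_continuous[OF w0]]) auto
   ultimately show ?case using eq by (metis (mono_tags, lifting) continuous_on_eq)
  qed
  fix s t :: real assume "0 \<le> s \<and> s < t"
  then have s: "0 \<le> s" "s < t" "0 \<le> t" by auto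
  let ?D = "\<lambda>x. extended_bm t x - extended_bm s x"
  let ?G = "density lborel (normal_density 0 (sqrt (t - s)))"
  have bM: "extended_bm u \<in> borel_measurable ?N" if "0 \<le> u" for u
  proof -
   have "subalgebra ?N (past u \<Otimes>\<^sub>M F u)"
    using extended_filtered_space that unfolding filtered_space_def extended_filtration_def by (metis max.absorb2)
   then show ?thesis using measurable_from_subalg extended_bm_adapted[OF that] by blast
  qed
  have Dm [measurable]: "?D \<in> borel_measurable ?N" using bM[of s] bM[of t] s by measurable
  have rect: "P.prob ((E1 \<times> E2) \<inter> (?D -` S \<inter> space ?N)) = P.prob (E1 \<times> E2) * measure ?G S"
   if E: "E1 \<in> past_sets s" "E2 \<in> sets (F s)" and S: "S \<in> sets borel" for E1 E2 S
  proof (rule gaussian_given_event[OF P.prob_space_axioms Dm _ _ _ S])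
   show "E1 \<times> E2 \<in> sets ?N" using E sets_F_M[OF E(2)] by (auto simp: past_sets_def)
   show "0 < t - s" using s by simp
   show "(LINT x|?N. indicator (E1 \<times> E2) x * exp (\<i> * of_real (th * ?D x))) = of_real (P.prob (E1 \<times> E2) * exp (- th\<^sup>2 * (t - s) / 2))" for th
    by (rule extended_char[OF s(1,2) E])
  qed
  have sp: "space M \<in> past_sets s" "space M \<in> sets (F s)"
   using sets.top[of "past s"] sets.top[of "F s"] by (auto simp: sets_past space_past space_F)
  have all: "P.prob (?D -` S \<inter> space ?N) = measure ?G S" if S: "S \<in> sets borel" for S
  proof -
   have "(space M \<times> space M) \<inter> (?D -` S \<inter> space ?N) = ?D -` S \<inter> space ?N" by (auto simp: space_pair_measure)
   then show ?thesis using rect[OF sp S] P.prob_space by (simp add: space_pair_measure)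
  qed
  have "distr ?N borel ?D = ?G"
  proof (rule measure_eqI)
   show "sets (distr ?N borel ?D) = sets ?G" by simp
   fix S assume "S \<in> sets (distr ?N borel ?D)"
   then have S: "S \<in> sets borel" by simp
   interpret G: prob_space ?G using s by (intro prob_space_normal_density) simp
   show "emeasure (distr ?N borel ?D) S = emeasure ?G S"
    using S all[OF S] by (simp add: emeasure_distr P.emeasure_eq_measure G.emeasure_eq_measure)
  qed
  moreover have "distr ?N lborel ?D = distr ?N borel ?D" by (rule distr_cong) auto
  ultimately show "distributed ?N lborel ?D (\<lambda>x. ennreal (normal_density 0 (sqrt (t - s)) x))"
   unfolding distributed_def by auto
  let ?R = "{a \<times> b |a b. a \<in> sets (past s) \<and> b \<in> sets (F s)}"
  let ?VA = "sets (vimage_algebra (space ?N) ?D borel)"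
  have VA: "?VA = {?D -` S \<inter> space ?N |S. S \<in> sets borel}" by (rule sets_vimage_algebra2) auto
  have RN: "?R \<subseteq> sets ?N" using sets_F_M by (auto simp: sets_past past_sets_def)
  have "P.indep_set ?R ?VA"
  proof (rule P.indep_setI)
   show "?R \<subseteq> P.events" by (rule RN)
   show "?VA \<subseteq> P.events" unfolding VA using measurable_sets[OF Dm] by auto
   fix a b assume "a \<in> ?R" "b \<in> ?VA"
   then obtain E1 E2 S where "a = E1 \<times> E2" "E1 \<in> past_sets s" "E2 \<in> sets (F s)" "b = ?D -` S \<inter> space ?N" "S \<in> sets borel"
    unfolding VA by (auto simp: sets_past)
   then show "P.prob (a \<inter> b) = P.prob a * P.prob b" using rect all by simp
  qed
  then have "P.indep_set (sigma_sets (space ?N) ?R) (sigma_sets (space ?N) ?VA)"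
   by (rule P.indep_set_sigma_sets) (auto intro!: Int_stable_pair_measure_generator sets.Int_stable)
  moreover have "sigma_sets (space ?N) ?R = sets (extended_filtration s)"
   using s by (simp add: extended_filtration_def sets_pair_measure space_past space_F space_pair_measure max_def)
  moreover have "sigma_sets (space ?N) ?VA = ?VA"
   using sets.sigma_sets_eq[of "vimage_algebra (space ?N) ?D borel"] by simp
  ultimately show "P.indep_set (sets (extended_filtration s)) ?VA" by simp
 qed
qed

end

section \<open>Schwarz--Christoffel integrands on the closed half-plane\<close>

text \<open>The branch cut is moved to the negative imaginary axis, so that the closed upper half-plane without \<open>0\<close>
lies inside the domain of analyticity.\<close>

definition upper_log :: "complex => complex" where
 "upper_log z = Ln (- \<i> * z) + \<i> * of_real (pi / 2)"

definition slit :: "complex set" where "slit = {z. Re z = 0 \<and> Im z \<le> 0}"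

lemma slit_iff': "\<i> * z \<in> \<real>\<^sub>\<ge>\<^sub>0 \<longleftrightarrow> z \<in> slit"
 by (auto simp: slit_def complex_nonneg_Reals_iff)

lemma upper_log_deriv: "z \<notin> slit ==> (upper_log has_field_derivative 1 / z) (at z)"
proof -
 assume z: "z \<notin> slit"
 then have z0: "z \<noteq> 0" by (auto simp: slit_def)
 have "((\<lambda>z. Ln (- \<i> * z) + \<i> * of_real (pi / 2)) has_field_derivative inverse (- \<i> * z) * (- \<i>) + 0) (at z)"
  using z by (auto intro!: derivative_eq_intros simp: slit_iff')
 also have "inverse (- \<i> * z) * (- \<i>) + 0 = 1 / z" using z0 by (simp add: field_simps)
 finally show ?thesis unfolding upper_log_def .
qed

lemma exp_upper_log: "z \<noteq> 0 ==> exp (upper_log z) = z"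
 using cis_conv_exp[of "pi / 2"] by (simp add: upper_log_def exp_add mult.assoc mult.left_commute[of \<i>])

lemma Re_upper_log: "z \<noteq> 0 ==> Re (upper_log z) = ln (norm z)"
 by (simp add: upper_log_def norm_mult)

text \<open>The strip of imaginary parts between \<open>- pi / 2\<close> and
  \<open>3 * pi / 2\<close> is the range of this branch; other logarithms are recognised through
  it.\<close>

lemma upper_log_unique:
 assumes "exp w = z" "- (pi / 2) < Im w" "Im w \<le> 3 * pi / 2"
 shows "upper_log z = w"
proof -
 have "exp (w - \<i> * of_real (pi / 2)) = - \<i> * z"
  using assms(1) cis_conv_exp[of "pi / 2"] by (simp add: exp_diff)
 moreover have "Ln (exp (w - \<i> * of_real (pi / 2))) = w - \<i> * of_real (pi / 2)"
  using assms by (intro Ln_exp) auto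
 ultimately show ?thesis by (simp add: upper_log_def)
qed

lemma Ln_eq_upper_log:
 assumes "z \<noteq> 0" "0 \<le> Im z" shows "Ln z = upper_log z"
proof (rule upper_log_unique[symmetric])
 show "exp (Ln z) = z" using assms by simp
 show "- (pi / 2) < Im (Ln z)" "Im (Ln z) \<le> 3 * pi / 2"
  using Im_Ln_pos_le[OF assms(1)] assms pi_gt_zero by linarith+
qed

lemma upper_log_of_real: "x \<noteq> 0 ==> upper_log (of_real x) = of_real (ln \<bar>x\<bar>) + (if x < 0 then \<i> * pi else 0)"
 using Ln_eq_upper_log[of "of_real x"] by (auto simp: Ln_of_real Ln_of_real' mult.commute)

definition upper_pow :: "complex => real => complex" where
 "upper_pow z b = exp (of_real b * upper_log z)"

lemma upper_pow_deriv: "z \<notin> slit ==> ((\<lambda>z. upper_pow z b) has_field_derivative b * upper_pow z b / z) (at z)"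
 unfolding upper_pow_def using upper_log_deriv[of z]
 by (auto intro!: derivative_eq_intros simp: field_simps)

lemma upper_pow_nz [simp]: "upper_pow z b \<noteq> 0" by (simp add: upper_pow_def)

lemma powr_eq_upper_pow: "z \<noteq> 0 ==> 0 \<le> Im z ==> z powr of_real b = upper_pow z b"
 by (simp add: powr_def upper_pow_def Ln_eq_upper_log)

lemma norm_upper_pow_le: "z \<noteq> 0 ==> norm (upper_pow z b) = norm z powr b"
 by (simp add: upper_pow_def Re_upper_log powr_def)

lemma upper_pow_of_real:
 "x \<noteq> 0 ==> upper_pow (of_real x) b = of_real (\<bar>x\<bar> powr b) * (if x < 0 then cis (pi * b) else 1)"
 by (auto simp: upper_pow_def upper_log_of_real powr_def exp_add exp_of_real[symmetric] cis_conv_exp distrib_left mult_ac)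

definition slit_integrand :: "nat => (nat => real) => complex => (nat => real) => complex => complex" where
 "slit_integrand n \<beta> c zs \<zeta> = c * (\<Prod>k=1..n. upper_pow (\<zeta> - of_real (zs k)) (- \<beta> k))"

definition slits :: "nat => (nat => real) => complex set" where
 "slits n zs = {z. \<exists>k\<in>{1..n}. Re z = zs k \<and> Im z \<le> 0}"

lemma slits_iff: "z \<in> slits n zs \<longleftrightarrow> (\<exists>k\<in>{1..n}. z - of_real (zs k) \<in> slit)"
 by (auto simp: slits_def slit_def)

lemma field_differentiable_finite_prod:
 assumes "finite S" "\<And>k. k \<in> S ==> f k field_differentiable at x"
 shows "(\<lambda>z. \<Prod>k\<in>S. f k z) field_differentiable at x"
 using assms
proof (induction S rule: finite_induct)
 case (insert y S)
 then show ?case using field_differentiable_mult[of "f y" x UNIV "\<lambda>z. \<Prod>k\<in>S. f k z"] by simp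
qed auto

lemma slit_integrand_field_differentiable:
 "z \<notin> slits n zs ==> slit_integrand n \<beta> c zs field_differentiable (at z)"
proof -
 assume z: "z \<notin> slits n zs"
 have "(\<lambda>z. upper_pow (z - of_real (zs k)) (- \<beta> k)) field_differentiable (at z)" if "k \<in> {1..n}" for k
 proof -
  have "z - of_real (zs k) \<notin> slit" using z that by (auto simp: slits_iff)
  then have "(\<lambda>z. upper_pow z (- \<beta> k)) field_differentiable at (z - of_real (zs k))"
   using upper_pow_deriv field_differentiable_def by blast
  then show ?thesis
   using field_differentiable_compose[of "\<lambda>z. z - of_real (zs k)" z "\<lambda>z. upper_pow z (- \<beta> k)"]
   by (simp add: o_def field_differentiable_diff)
 qed
 then have "(\<lambda>z. \<Prod>k=1..n. upper_pow (z - of_real (zs k)) (- \<beta> k)) field_differentiable (at z)"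
  by (intro field_differentiable_finite_prod) auto
 then show ?thesis unfolding slit_integrand_def by (intro field_differentiable_mult) auto
qed

lemma slit_integrand_continuous_on: "S \<inter> slits n zs = {} ==> continuous_on S (slit_integrand n \<beta> c zs)"
 by (intro continuous_at_imp_continuous_on ballI field_differentiable_imp_continuous_at slit_integrand_field_differentiable) auto

lemma sc_integrand_eq:
 assumes "0 \<le> Im z" "z \<notin> slits n zs"
 shows "sc_integrand n \<beta> c zs z = slit_integrand n \<beta> c zs z"
 unfolding sc_integrand_def slit_integrand_def
proof (intro arg_cong[where f = "\<lambda>x. c * x"] prod.cong refl)
 fix k assume k: "k \<in> {1..n}"
 have "z \<noteq> of_real (zs k)"
  using assms(2) k by (auto simp: slits_def)
 then show "(z - of_real (zs k)) powr of_real (- \<beta> k) = upper_pow (z - of_real (zs k)) (- \<beta> k)"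
  using assms(1) by (intro powr_eq_upper_pow) auto
qed

lemma open_upper_half_plane: "open \<H>"
 unfolding upper_half_plane_def by (rule open_halfspace_Im_gt)

lemma convex_upper_half_plane: "convex \<H>"
 unfolding upper_half_plane_def by (rule convex_halfspace_Im_gt)

text \<open>For \<open>a\<close> different from all \<open>zs k\<close>, this is the component
  containing \<open>a\<close> of the real line without these points. The form by inequalities needs
  no sorting and makes openness and convexity immediate.\<close>

definition free_interval :: "nat => (nat => real) => real => real set" where
 "free_interval n zs a = {x. \<forall>k\<in>{1..n}. (a < zs k --> x < zs k) \<and> (zs k < a --> zs k < x)}"

text \<open>The vertical strip over the free interval turns the real points of the interval into
  interior points. The domain is starlike about \<open>a\<close>, and it avoids the slits when
  \<open>a\<close> is no vertex.\<close>

definition sc_domain :: "nat => (nat => real) => real => complex set" where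
 "sc_domain n zs a = \<H> \<union> {z. Re z \<in> free_interval n zs a}"

lemma free_interval_alt: "free_interval n zs a =
  (\<Inter>k\<in>{1..n::nat}. (if a < zs k then {..<zs k} else UNIV) \<inter> (if zs k < a then {zs k<..} else UNIV))"
proof (rule set_eqI)
 fix x
 show "x \<in> free_interval n zs a \<longleftrightarrow> x \<in> (\<Inter>k\<in>{1..n::nat}. (if a < zs k then {..<zs k} else UNIV) \<inter> (if zs k < a then {zs k<..} else UNIV))"
  unfolding free_interval_def INT_iff mem_Collect_eq by (intro ball_cong) auto
qed

lemma open_free_interval: "open (free_interval n zs a)"
 unfolding free_interval_alt by (intro open_INT) auto

lemma convex_free_interval: "convex (free_interval n zs a)"
 unfolding free_interval_alt by (intro convex_INT convex_Int) auto

lemma free_interval_self: "a \<in> free_interval n zs a"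
 by (auto simp: free_interval_def)

lemma open_sc_domain: "open (sc_domain n zs a)"
proof -
 have "{z. Re z \<in> free_interval n zs a} = Re -` free_interval n zs a" by auto
 moreover have "open (Re -` free_interval n zs a)"
  by (intro open_vimage open_free_interval continuous_intros)
 ultimately show ?thesis unfolding sc_domain_def using open_upper_half_plane by auto
qed

lemma starlike_sc_domain:
 assumes "z \<in> sc_domain n zs a" shows "closed_segment (of_real a) z \<subseteq> sc_domain n zs a"
proof
 fix w assume "w \<in> closed_segment (of_real a) z"
 then obtain u where u: "0 \<le> u" "u \<le> 1" "w = (1 - u) *\<^sub>R of_real a + u *\<^sub>R z"
  by (auto simp: closed_segment_def)
 show "w \<in> sc_domain n zs a"
 proof (cases "Re z \<in> free_interval n zs a")
  case True
  then have "(1 - u) *\<^sub>R a + u *\<^sub>R Re z \<in> free_interval n zs a"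
   using u convexD[OF convex_free_interval free_interval_self, of "Re z"] by auto
  then show ?thesis using u by (auto simp: sc_domain_def)
 next
  case False
  then have "Im z > 0" using assms by (auto simp: sc_domain_def upper_half_plane_def)
  show ?thesis
  proof (cases "u = 0")
   case True then show ?thesis using u free_interval_self by (auto simp: sc_domain_def)
  next
   case False
   then have "Im w > 0" using u \<open>Im z > 0\<close> by simp
   then show ?thesis by (auto simp: sc_domain_def upper_half_plane_def)
  qed
 qed
qed

lemma sc_domain_disjoint:
 assumes "\<And>k. k \<in> {1..n} ==> zs k \<noteq> a" shows "sc_domain n zs a \<inter> slits n zs = {}"
proof -
 have "k \<in> {1..n} ==> zs k \<notin> free_interval n zs a" for k
  using assms[of k] unfolding free_interval_def by (metis (mono_tags, lifting) less_irrefl linorder_neqE_linordered_idom mem_Collect_eq)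
 then show ?thesis
  by (auto simp: sc_domain_def slits_def upper_half_plane_def)
qed

lemma slit_integrand_primitive:
 assumes "\<And>k. k \<in> {1..n} ==> zs k \<noteq> a"
 obtains g where "\<And>z. z \<in> sc_domain n zs a ==> (g has_field_derivative slit_integrand n \<beta> c zs z) (at z)"
proof -
 have "\<exists>g. \<forall>z\<in>sc_domain n zs a. (g has_field_derivative slit_integrand n \<beta> c zs z) (at z)"
 proof (rule holomorphic_starlike_primitive[where k = "{}"])
  show "continuous_on (sc_domain n zs a) (slit_integrand n \<beta> c zs)"
   using sc_domain_disjoint[of n zs a] assms by (intro slit_integrand_continuous_on) auto
  show "starlike (sc_domain n zs a)"
   unfolding starlike_def using starlike_sc_domain free_interval_self
   by (intro bexI[of _ "of_real a"]) (auto simp: sc_domain_def)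
  show "open (sc_domain n zs a)" by (rule open_sc_domain)
  show "slit_integrand n \<beta> c zs field_differentiable at x" if "x \<in> sc_domain n zs a - {}" for x
   using that sc_domain_disjoint[of n zs a] assms by (intro slit_integrand_field_differentiable) auto
 qed auto
 then show ?thesis using that by auto
qed

lemma SC_eq_primitive:
 assumes nz: "\<And>k. k \<in> {1..n} ==> zs k \<noteq> 0"
  and g: "\<And>z. z \<in> sc_domain n zs 0 ==> (g has_field_derivative slit_integrand n \<beta> c zs z) (at z)"
  and z: "z \<in> sc_domain n zs 0" "0 \<le> Im z"
 shows "SC n \<beta> c zs z = g z - g 0"
proof -
 have seg: "closed_segment 0 z \<subseteq> sc_domain n zs 0"
  using starlike_sc_domain[OF z(1)] by simp
 note linepath_0' [simp del] linepath_0 [simp del]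
 have "(slit_integrand n \<beta> c zs has_contour_integral g (pathfinish (linepath 0 z)) - g (pathstart (linepath 0 z))) (linepath 0 z)"
  using seg by (intro contour_integral_primitive[where S = "sc_domain n zs 0"])
   (auto intro: has_field_derivative_at_within g)
 then have "(slit_integrand n \<beta> c zs has_contour_integral g z - g 0) (linepath 0 z)" by simp
 then have "(sc_integrand n \<beta> c zs has_contour_integral g z - g 0) (linepath 0 z)"
 proof (rule has_contour_integral_eq)
  fix x assume x: "x \<in> path_image (linepath 0 z)"
  then have "x \<in> sc_domain n zs 0" using seg by auto
  then have "x \<notin> slits n zs" using sc_domain_disjoint[of n zs 0, OF nz] by blast
  moreover have "0 \<le> Im x" using x z(2) by (auto simp: closed_segment_def)
  ultimately show "slit_integrand n \<beta> c zs x = sc_integrand n \<beta> c zs x" by (simp add: sc_integrand_eq)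
 qed
 then show ?thesis unfolding SC_def by (rule contour_integral_unique)
qed

lemma SC_has_field_derivative:
 assumes nz: "\<And>k. k \<in> {1..n} ==> zs k \<noteq> 0" and z: "z \<in> \<H>"
 shows "(SC n \<beta> c zs has_field_derivative slit_integrand n \<beta> c zs z) (at z)"
proof -
 obtain g where g: "\<And>z. z \<in> sc_domain n zs 0 ==> (g has_field_derivative slit_integrand n \<beta> c zs z) (at z)"
  using slit_integrand_primitive[of n zs 0 \<beta> c] nz by blast
 have "((\<lambda>z. g z - g 0) has_field_derivative slit_integrand n \<beta> c zs z - 0) (at z)"
  using z by (intro derivative_intros g) (auto simp: sc_domain_def)
 then have "((\<lambda>z. g z - g 0) has_field_derivative slit_integrand n \<beta> c zs z) (at z)" by simp
 then show ?thesis
 proof (rule has_field_derivative_transform_within_open[OF _ open_upper_half_plane z])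
  fix x assume "x \<in> \<H>"
  then show "g x - g 0 = SC n \<beta> c zs x"
   using SC_eq_primitive[OF nz g, of x] by (auto simp: sc_domain_def upper_half_plane_def)
 qed
qed

lemma at_real_within_upper_nontrivial [simp]: "at (of_real x) within \<H> \<noteq> bot"
proof -
 have "of_real x islimpt \<H>"
  unfolding islimpt_approachable
 proof (intro allI impI)
  fix e :: real assume "0 < e"
  then show "\<exists>x'\<in>upper_half_plane. x' \<noteq> of_real x \<and> dist x' (of_real x) < e"
   by (intro bexI[of _ "of_real x + \<i> * of_real (e / 2)"])
     (auto simp: upper_half_plane_def dist_norm norm_mult complex_eq_iff)
 qed
 then show ?thesis by (simp add: trivial_limit_within)
qed

lemma boundary_value_eqI:
 "(g \<longlongrightarrow> l) (at (of_real x) within \<H>) ==> boundary_value g x = l"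
 unfolding boundary_value_def by (intro tendsto_Lim) auto

section \<open>Behaviour at the corners\<close>

lemma upper_half_plane_iff: "z \<in> \<H> \<longleftrightarrow> 0 < Im z"
 by (simp add: upper_half_plane_def)

lemma upper_half_plane_not_slit: "z \<in> \<H> ==> z \<notin> slit"
 by (simp add: upper_half_plane_def slit_def)

lemma upper_pow_diff: "z \<noteq> 0 ==> upper_pow z (a - 1) = upper_pow z a / z"
 by (simp add: upper_pow_def algebra_simps exp_diff exp_upper_log)

lemma ev_near_0_upper:
 "0 < dl ==> (\<And>w. w \<in> \<H> ==> norm w < dl ==> P w) ==> \<forall>\<^sub>F w in at 0 within \<H>. P w"
 unfolding eventually_at by (intro exI[of _ dl]) (auto simp: dist_norm)

lemma at_0_upper_nontrivial [simp]: "at 0 within \<H> \<noteq> (bot :: complex filter)"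
 using at_real_within_upper_nontrivial[of 0] by simp

lemma norm_vertical:
 assumes "w \<in> \<H>" "0 \<le> y"
 shows "norm w \<le> norm (w + \<i> * of_real y)" "y \<le> norm (w + \<i> * of_real y)"
  "w + \<i> * of_real y \<in> \<H>"
proof -
 have "(Im w)\<^sup>2 \<le> (Im w + y)\<^sup>2" using assms by (intro power_mono) (auto simp: upper_half_plane_iff)
 then show "norm w \<le> norm (w + \<i> * of_real y)" by (simp add: cmod_def)
 have "y \<le> \<bar>Im (w + \<i> * of_real y)\<bar>" using assms by (auto simp: upper_half_plane_iff)
 also have "\<dots> \<le> norm (w + \<i> * of_real y)" by (rule abs_Im_le_cmod)
 finally show "y \<le> norm (w + \<i> * of_real y)" .
 show "w + \<i> * of_real y \<in> \<H>" using assms by (auto simp: upper_half_plane_iff)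
qed

lemma vertical_has_vector_derivative:
 assumes "(E has_field_derivative d) (at (w + \<i> * of_real y))"
 shows "((\<lambda>y. E (w + \<i> * of_real y)) has_vector_derivative \<i> * d) (at y within S)"
proof -
 have "((\<lambda>y. w + \<i> * of_real y) has_vector_derivative \<i>) (at y within S)"
  by (auto intro!: derivative_eq_intros has_vector_derivative_real_field simp: has_vector_derivative_def scaleR_conv_of_real)
 from field_vector_diff_chain_within[OF this has_field_derivative_at_within[OF assms]]
 show ?thesis by (simp add: o_def)
qed

lemma limit_of_cauchy:
 fixes f :: "complex => complex"
 assumes F: "F \<noteq> bot" and c: "\<And>e. 0 < e ==> \<exists>a. \<forall>\<^sub>F x in F. dist (f x) a < e"
 shows "\<exists>l. (f \<longlongrightarrow> l) F"
proof -
 have "cauchy_filter (filtermap f F)"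
  unfolding cauchy_filter_metric_filtermap
 proof (intro allI impI)
  fix e :: real assume "0 < e"
  then obtain a where a: "\<forall>\<^sub>F x in F. dist (f x) a < e / 2" using c[of "e/2"] by auto
  show "\<exists>P. eventually P F \<and> (\<forall>x y. P x \<and> P y --> dist (f x) (f y) < e)"
   using a by (intro exI[of _ "\<lambda>x. dist (f x) a < e / 2"]) (auto intro: dist_triangle_half_l)
 qed
 then obtain l where "filtermap f F \<le> nhds l"
  using cauchy_filter_complete_converges[of "filtermap f F" UNIV] F
  by (auto simp: filtermap_bot_iff complete_UNIV)
 then show ?thesis unfolding filterlim_def by auto
qed

text \<open>Mean value inequality on a vertical segment. Vertical segments are convenient because
  the modulus of \<open>w + \<i> * y\<close> dominates both \<open>y\<close> and the modulus of
  \<open>w\<close>, which controls negative powers.\<close>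

lemma vertical_bound:
 assumes E: "\<And>w. w \<in> \<H> ==> (E has_field_derivative d w) (at w)" and w: "w \<in> \<H>" and h: "0 < h"
  and g: "continuous_on {0..h} g" "\<And>y. 0 < y ==> y < h ==> (g has_vector_derivative g' y) (at y)"
  and b: "\<And>y. 0 < y ==> y < h ==> norm (d (w + \<i> * of_real y)) \<le> g' y"
 shows "norm (E (w + \<i> * of_real h) - E w) \<le> g h - g 0"
proof -
 let ?v = "\<lambda>y. w + \<i> * of_real y"
 have D: "((\<lambda>y. E (?v y)) has_vector_derivative \<i> * d (?v y)) (at y within S)" if "0 \<le> y" for y S
  by (intro vertical_has_vector_derivative E norm_vertical(3) w that)
 have "norm (E (?v h) - E (?v 0)) \<le> g h - g 0"
 proof (rule differentiable_bound_general[OF h])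
  show "continuous_on {0..h} (\<lambda>y. E (?v y))"
   unfolding continuous_on_eq_continuous_within
   by (intro ballI has_vector_derivative_continuous[OF D]) auto
  fix y assume "0 < y" "y < h"
  then show "((\<lambda>y. E (?v y)) has_vector_derivative \<i> * d (?v y)) (at y)" "norm (\<i> * d (?v y)) \<le> g' y"
   using D b by (auto simp: norm_mult)
 qed (use g in auto)
 then show ?thesis by simp
qed

text \<open>Every \<open>w\<close> near the corner is compared with
  \<open>w + \<i> * \<eta>\<close>. Integrating the derivative upwards costs at most a multiple of
  \<open>\<eta> powr (1 - \<gamma>)\<close>, uniformly in \<open>w\<close>, and
  \<open>w + \<i> * \<eta>\<close> is close to the fixed interior point
  \<open>\<i> * \<eta>\<close>.\<close>

lemma corner_limit_exists:
 assumes b: "\<beta> < 1"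
  and E: "\<And>w. w \<in> \<H> ==> (E has_field_derivative upper_pow w (- \<beta>) * \<phi> w) (at w)"
  and \<phi>: "0 < \<rho>" "\<And>w. w \<in> \<H> ==> norm w < \<rho> ==> norm (\<phi> w) \<le> C"
 shows "\<exists>l. (E \<longlongrightarrow> l) (at 0 within \<H>)"
proof (rule limit_of_cauchy)
 \<comment> \<open>Through \<open>y \<le> norm (w + \<i> * y)\<close> only negative exponents can be
   estimated. So \<open>- \<beta>\<close> is split into \<open>- \<gamma>\<close> and the
   nonnegative \<open>\<gamma> - \<beta>\<close>, whose power is bounded by that of
   \<open>\<rho>\<close>.\<close>
 define \<gamma> where "\<gamma> = max \<beta> 0"
 have \<gamma>: "0 \<le> \<gamma>" "\<gamma> < 1" "0 \<le> \<gamma> - \<beta>" using b by (auto simp: \<gamma>_def)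
 have "\<i> * of_real (\<rho> / 2) \<in> \<H>" "norm (\<i> * of_real (\<rho> / 2)) < \<rho>"
  using \<phi>(1) by (auto simp: upper_half_plane_iff norm_mult)
 from \<phi>(2)[OF this] have C: "0 \<le> C" using norm_ge_zero order_trans by blast
 define C' where "C' = \<rho> powr (\<gamma> - \<beta>) * C"
 have C': "0 \<le> C'" using C by (simp add: C'_def)
 have bound: "norm (E (w + \<i> * of_real \<eta>) - E w) \<le> C' / (1 - \<gamma>) * \<eta> powr (1 - \<gamma>)"
  if w: "w \<in> \<H>" "norm w < \<rho> / 2" and \<eta>: "0 < \<eta>" "\<eta> < \<rho> / 2" for w \<eta>
 proof -
  let ?v = "\<lambda>y. w + \<i> * of_real y"
  have "norm (E (?v \<eta>) - E w) \<le> C' / (1 - \<gamma>) * \<eta> powr (1 - \<gamma>) - C' / (1 - \<gamma>) * 0 powr (1 - \<gamma>)"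
  proof (rule vertical_bound[OF E w(1) \<eta>(1)])
   show "continuous_on {0..\<eta>} (\<lambda>y. C' / (1 - \<gamma>) * y powr (1 - \<gamma>))"
    using \<gamma> by (intro continuous_intros continuous_on_powr') auto
   fix y assume y: "0 < y" "y < \<eta>"
   show "((\<lambda>y. C' / (1 - \<gamma>) * y powr (1 - \<gamma>)) has_vector_derivative C' * y powr (- \<gamma>)) (at y)"
    using y \<gamma> by (auto intro!: derivative_eq_intros simp: has_real_derivative_iff_has_vector_derivative[symmetric])
   have nv: "norm (?v y) < \<rho>"
   proof -
    have "norm (?v y) \<le> norm w + norm (\<i> * of_real y)" by (rule norm_triangle_ineq)
    then show ?thesis using w y \<eta> by (simp add: norm_mult)
   qed
   have vy: "y \<le> norm (?v y)" "?v y \<in> \<H>" using norm_vertical[OF w(1), of y] y by auto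
   have "norm (upper_pow (?v y) (- \<beta>)) = norm (?v y) powr (- \<gamma>) * norm (?v y) powr (\<gamma> - \<beta>)"
    using vy y by (subst norm_upper_pow_le) (auto simp: powr_add[symmetric])
   also have "\<dots> \<le> y powr (- \<gamma>) * \<rho> powr (\<gamma> - \<beta>)"
    using vy y \<gamma> nv by (intro mult_mono powr_mono2' powr_mono2) auto
   finally have "norm (upper_pow (?v y) (- \<beta>)) \<le> y powr (- \<gamma>) * \<rho> powr (\<gamma> - \<beta>)" .
   then have "norm (upper_pow (?v y) (- \<beta>)) * norm (\<phi> (?v y)) \<le> (y powr (- \<gamma>) * \<rho> powr (\<gamma> - \<beta>)) * C"
    using \<phi>(2)[OF vy(2) nv] C by (intro mult_mono) auto
   then show "norm (upper_pow (?v y) (- \<beta>) * \<phi> (?v y)) \<le> C' * y powr (- \<gamma>)"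
    by (simp add: norm_mult C'_def mult_ac)
  qed
  then show ?thesis using \<gamma> by simp
 qed
 fix e :: real assume e: "0 < e"
 have "((\<lambda>\<eta>. C' / (1 - \<gamma>) * \<eta> powr (1 - \<gamma>)) \<longlongrightarrow> C' / (1 - \<gamma>) * 0 powr (1 - \<gamma>)) (at_right 0)"
  using \<gamma> by (intro tendsto_intros tendsto_powr') (auto simp: eventually_at_right_less intro: eventually_at_rightI[of 0 1])
 then have "\<forall>\<^sub>F \<eta> in at_right 0. C' / (1 - \<gamma>) * \<eta> powr (1 - \<gamma>) < e / 2"
  by (rule order_tendstoD) (use e \<gamma> in simp)
 moreover have "\<forall>\<^sub>F \<eta> in at_right 0. 0 < \<eta> \<and> \<eta> < \<rho> / 2"
  using \<phi>(1) by (intro eventually_at_rightI[of 0 "\<rho> / 2"]) auto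
 ultimately have "\<forall>\<^sub>F \<eta> in at_right 0. C' / (1 - \<gamma>) * \<eta> powr (1 - \<gamma>) < e / 2 \<and> 0 < \<eta> \<and> \<eta> < \<rho> / 2"
  by eventually_elim auto
 then obtain \<eta> where \<eta>: "C' / (1 - \<gamma>) * \<eta> powr (1 - \<gamma>) < e / 2" "0 < \<eta>" "\<eta> < \<rho> / 2"
  using eventually_happens'[OF trivial_limit_at_right_real] by blast
 let ?i = "\<i> * of_real \<eta>"
 have "isCont E ?i" using E[of ?i] \<eta> by (auto simp: upper_half_plane_iff intro: DERIV_isCont)
 then obtain dl where dl: "dl > 0" "\<And>w. dist w ?i < dl ==> dist (E w) (E ?i) < e / 2"
  using e unfolding continuous_at_eps_delta by (metis half_gt_zero)
 have "\<forall>\<^sub>F w in at 0 within \<H>. dist (E w) (E ?i) < e"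
 proof (rule ev_near_0_upper[of "min dl (\<rho> / 2)"])
  fix w assume w: "w \<in> \<H>" "norm w < min dl (\<rho> / 2)"
  have "dist (E (w + ?i)) (E ?i) < e / 2" using w by (intro dl(2)) (auto simp: dist_norm)
  moreover have "dist (E w) (E (w + ?i)) < e / 2"
  proof -
   have "dist (E w) (E (w + ?i)) \<le> C' / (1 - \<gamma>) * \<eta> powr (1 - \<gamma>)"
    using bound[of w \<eta>] w \<eta> by (simp add: dist_norm norm_minus_commute)
   then show ?thesis using \<eta>(1) by linarith
  qed
  ultimately show "dist (E w) (E ?i) < e" using dist_triangle[of "E w" "E ?i" "E (w + ?i)"] by linarith
 qed (use dl \<phi> in auto)
 then show "\<exists>a. \<forall>\<^sub>F w in at 0 within \<H>. dist (E w) a < e" by blast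
qed simp

text \<open>The path is the imaginary axis from the corner to \<open>\<i>\<close>, at height
  \<open>v powr p\<close> with \<open>p = 1 / (1 - \<beta>)\<close>. The chain rule produces
  \<open>v powr (p - 1 - p * \<beta>)\<close>, whose exponent is zero. The factor
  \<open>cis (- pi * \<beta> / 2)\<close> is the phase of the power on this axis.\<close>

lemma corner_limit_formula:
 assumes b: "\<beta> < 1"
  and E: "\<And>w. w \<in> \<H> ==> (E has_field_derivative upper_pow w (- \<beta>) * \<phi> w) (at w)"
  and l: "(E \<longlongrightarrow> l) (at 0 within \<H>)"
 shows "((\<lambda>v. \<phi> (\<i> * complex_of_real (v powr (1 / (1 - \<beta>))))) has_integral
   (E \<i> - l) / (\<i> * cis (- pi * \<beta> / 2) / (1 - \<beta>))) {0..1}"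
proof -
 define p where "p = 1 / (1 - \<beta>)"
 have p: "0 < p" "p * (1 - \<beta>) = 1" using b by (auto simp: p_def)
 define k where "k = \<i> * cis (- pi * \<beta> / 2) * complex_of_real p"
 have k0: "k \<noteq> 0" using p by (simp add: k_def)
 define f where "f = (\<lambda>v. if v = 0 then l else E (\<i> * complex_of_real (v powr p)))"
 have up: "upper_pow (\<i> * complex_of_real y) (- \<beta>) = cis (- pi * \<beta> / 2) * complex_of_real (y powr (- \<beta>))" if "0 < y" for y
 proof -
  have "upper_log (\<i> * complex_of_real y) = complex_of_real (ln y) + \<i> * complex_of_real (pi / 2)"
   using that by (simp add: upper_log_def Ln_of_real mult.assoc[symmetric])
  moreover have "complex_of_real (- \<beta>) * (complex_of_real (ln y) + \<i> * complex_of_real (pi / 2)) =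
    \<i> * complex_of_real (- pi * \<beta> / 2) + complex_of_real (- \<beta> * ln y)"
   by (simp add: algebra_simps)
  ultimately have "upper_pow (\<i> * complex_of_real y) (- \<beta>) = cis (- pi * \<beta> / 2) * complex_of_real (exp (- \<beta> * ln y))"
   unfolding upper_pow_def by (simp only: exp_add cis_conv_exp exp_of_real)
  then show ?thesis using that by (simp add: powr_def)
 qed
 have "((\<lambda>v. k * \<phi> (\<i> * complex_of_real (v powr p))) has_integral f 1 - f 0) {0..1}"
 proof (rule fundamental_theorem_of_calculus_interior)
  have D: "(f has_vector_derivative k * \<phi> (\<i> * complex_of_real (v powr p))) (at v)" if v: "0 < v" for v
  proof -
   let ?y = "v powr p"
   have y: "0 < ?y" using v by simp
   have "((\<lambda>y. E (0 + \<i> * complex_of_real y)) has_vector_derivative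
     \<i> * (upper_pow (0 + \<i> * complex_of_real ?y) (- \<beta>) * \<phi> (0 + \<i> * complex_of_real ?y))) (at ?y)"
    using y by (intro vertical_has_vector_derivative E) (auto simp: upper_half_plane_iff)
   moreover have "((\<lambda>v. v powr p) has_vector_derivative p * v powr (p - 1)) (at v)"
    using v by (auto intro!: derivative_eq_intros simp: has_real_derivative_iff_has_vector_derivative[symmetric])
   ultimately have "((\<lambda>y. E (0 + \<i> * complex_of_real y)) \<circ> (\<lambda>v. v powr p) has_vector_derivative
     (p * v powr (p - 1)) *\<^sub>R (\<i> * (upper_pow (0 + \<i> * complex_of_real ?y) (- \<beta>) * \<phi> (0 + \<i> * complex_of_real ?y)))) (at v)"
    by (intro vector_diff_chain_at)
   also have "(p * v powr (p - 1)) *\<^sub>R (\<i> * (upper_pow (0 + \<i> * complex_of_real ?y) (- \<beta>) * \<phi> (0 + \<i> * complex_of_real ?y)))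
     = k * \<phi> (\<i> * complex_of_real ?y)"
   proof -
    have "v powr (p - 1) * ?y powr (- \<beta>) = v powr (p - 1 + p * (- \<beta>))"
     by (simp add: powr_powr powr_add[symmetric])
    also have "p - 1 + p * (- \<beta>) = 0" using p(2) by (simp add: algebra_simps)
    finally have "v powr (p - 1) * ?y powr (- \<beta>) = 1" using v by simp
    then have "complex_of_real (v powr (p - 1)) * complex_of_real (?y powr (- \<beta>)) = 1"
     by (metis of_real_1 of_real_mult)
    then show ?thesis unfolding add_0_left up[OF y] k_def scaleR_conv_of_real of_real_mult
     by (simp add: mult_ac)
   qed
   finally show ?thesis
   proof (rule has_vector_derivative_transform_within_open[of _ _ _ "{0<..}"])
   qed (use v in \<open>auto simp: f_def o_def\<close>)
  qed
  show "continuous_on {0..1} f"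
   unfolding continuous_on_eq_continuous_within
  proof
   fix v :: real assume v: "v \<in> {0..1}"
   show "continuous (at v within {0..1}) f"
   proof (cases "v = 0")
    case False
    then show ?thesis using D[of v] v by (auto intro: has_vector_derivative_continuous continuous_at_imp_continuous_at_within)
   next
    case True
    have "((\<lambda>v. v powr p) \<longlongrightarrow> 0 powr p) (at 0 within {0..1})"
     using p by (intro tendsto_powr') (auto simp: eventually_at_filter)
    then have "((\<lambda>v. \<i> * complex_of_real (v powr p)) \<longlongrightarrow> \<i> * complex_of_real 0) (at 0 within {0..1})"
     using p by (intro tendsto_intros) auto
    moreover have "\<forall>\<^sub>F v in at 0 within {0..1::real}. \<i> * complex_of_real (v powr p) \<in> \<H> - {0}"
     by (auto simp: eventually_at_filter upper_half_plane_iff)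
    ultimately have "filterlim (\<lambda>v. \<i> * complex_of_real (v powr p)) (at 0 within \<H>) (at 0 within {0..1})"
     unfolding filterlim_at by (auto elim: eventually_mono)
    from filterlim_compose[OF l this]
    have "((\<lambda>v. E (\<i> * complex_of_real (v powr p))) \<longlongrightarrow> l) (at 0 within {0..1})" .
    then have "(f \<longlongrightarrow> l) (at 0 within {0..1})"
     by (rule Lim_transform_eventually) (auto simp: eventually_at_filter f_def)
    then show ?thesis using True by (simp add: continuous_within f_def)
   qed
  qed
  show "(f has_vector_derivative k * \<phi> (\<i> * complex_of_real (v powr p))) (at v)" if "v \<in> {0<..<1}" for v
   using D that by auto
 qed simp
 then have "((\<lambda>v. inverse k * (k * \<phi> (\<i> * complex_of_real (v powr p)))) has_integral inverse k * (f 1 - f 0)) {0..1}"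
  by (rule has_integral_mult_right)
 moreover have "inverse k * (f 1 - f 0) = (E \<i> - l) / (\<i> * cis (- pi * \<beta> / 2) / (1 - \<beta>))"
  using k0 by (simp add: f_def k_def p_def field_simps)
 ultimately show ?thesis using k0 by (simp add: p_def mult.assoc[symmetric])
qed

text \<open>The leading part of \<open>E\<close> is \<open>\<phi>0\<close> times a primitive
  \<open>a\<close> of the power, a logarithm if \<open>\<beta> = 1\<close>, and it blows up. The
  derivative of the remainder \<open>E1\<close> has order \<open>norm w powr (1 - \<beta>)\<close>,
  so over a short vertical segment the remainder changes by at most half of the leading
  part.\<close>

lemma corner_infinite:
 assumes b: "1 \<le> \<beta>"
  and E: "\<And>w. w \<in> \<H> ==> (E has_field_derivative upper_pow w (- \<beta>) * \<phi> w) (at w)"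
  and \<phi>: "0 < \<rho>" "\<And>w. w \<in> \<H> ==> norm w < \<rho> ==> norm (\<phi> w - \<phi>0) \<le> C * norm w"
  and \<phi>0: "\<phi>0 \<noteq> 0"
 shows "filterlim E at_infinity (at 0 within \<H>)"
proof -
 let ?F = "at 0 within \<H>"
 have "\<i> * of_real (\<rho> / 2) \<in> \<H>" "norm (\<i> * of_real (\<rho> / 2)) < \<rho>"
  using \<phi>(1) by (auto simp: upper_half_plane_iff norm_mult)
 from order_trans[OF norm_ge_zero \<phi>(2)[OF this]] have "0 \<le> C * (\<rho> / 2)" using \<phi>(1) by (simp add: norm_mult)
 then have C: "0 \<le> C" using \<phi>(1) by (simp add: zero_le_mult_iff)
 define a where "a = (\<lambda>w. if \<beta> = 1 then upper_log w else upper_pow w (1 - \<beta>) / of_real (1 - \<beta>))"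
 have a': "(a has_field_derivative upper_pow w (- \<beta>)) (at w)" if w: "w \<in> \<H>" for w
 proof -
  have w0: "w \<notin> slit" "w \<noteq> 0" using upper_half_plane_not_slit[OF w] by (auto simp: slit_def)
  show ?thesis
  proof (cases "\<beta> = 1")
   case True
   then show ?thesis using upper_log_deriv[OF w0(1)] w0 upper_pow_diff[of w 0]
    by (simp add: a_def upper_pow_def)
  next
   case False
   have "((\<lambda>w. upper_pow w (1 - \<beta>) / of_real (1 - \<beta>)) has_field_derivative
     (of_real (1 - \<beta>) * upper_pow w (1 - \<beta>) / w) / of_real (1 - \<beta>)) (at w)"
    by (intro DERIV_cdivide upper_pow_deriv w0)
   also have "(of_real (1 - \<beta>) * upper_pow w (1 - \<beta>) / w) / of_real (1 - \<beta>) = upper_pow w (- \<beta>)"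
   proof -
    have *: "c * x / w / c = x / w" if "c \<noteq> 0" for c x :: complex using that by simp
    have "of_real (1 - \<beta>) \<noteq> 0" using False by (metis eq_iff_diff_eq_0 of_real_eq_0_iff)
    from *[OF this] show ?thesis using upper_pow_diff[OF w0(2), of "1 - \<beta>"] by simp
   qed
   finally show ?thesis using False by (simp add: a_def)
  qed
 qed
 have N: "filterlim norm (at_right 0) ?F"
  unfolding filterlim_at by (auto intro!: tendsto_norm_zero tendsto_ident_at simp: eventually_at_filter)
 have na: "filterlim (\<lambda>w. norm (a w)) at_top ?F \<and> (\<exists>m>0. \<forall>\<^sub>F w in ?F. m * norm w powr (1 - \<beta>) \<le> norm (a w))"
 proof (cases "\<beta> = 1")
  case True
  have "filterlim (\<lambda>x. - ln x) at_top (at_right (0::real))"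
   using ln_at_0 by (simp add: filterlim_uminus_at_top)
  from filterlim_compose[OF this N] have L: "filterlim (\<lambda>w. - ln (norm w)) at_top ?F" .
  have le: "\<forall>\<^sub>F w in ?F. - ln (norm w) \<le> norm (a w)"
  proof (rule ev_near_0_upper[of 1])
   fix w assume "w \<in> \<H>" "norm w < 1"
   then have "w \<noteq> 0" by (auto simp: upper_half_plane_iff)
   then show "- ln (norm w) \<le> norm (a w)"
    using abs_Re_le_cmod[of "upper_log w"] True by (simp add: a_def Re_upper_log)
  qed auto
  have "\<forall>\<^sub>F w in ?F. 1 * norm w powr (1 - \<beta>) \<le> norm (a w)"
   using L[unfolded filterlim_at_top, rule_format, of 1] le
   by eventually_elim (auto simp: True)
  then show ?thesis using filterlim_at_top_mono[OF L le] zero_less_one by blast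
 next
  case False
  then have b1: "1 < \<beta>" using b by simp
  have na: "\<forall>\<^sub>F w in ?F. norm (a w) = 1 / (\<beta> - 1) * norm w powr (1 - \<beta>)"
  proof (rule ev_near_0_upper[of 1])
   fix w assume "w \<in> \<H>" "norm w < 1"
   then have "w \<noteq> 0" by (auto simp: upper_half_plane_iff)
   then show "norm (a w) = 1 / (\<beta> - 1) * norm w powr (1 - \<beta>)"
    using b1 unfolding a_def norm_divide norm_of_real by (simp add: norm_divide norm_upper_pow_le del: of_real_diff)
  qed auto
  have "filterlim (\<lambda>x::real. 1 / (\<beta> - 1) * x powr (1 - \<beta>)) at_top (at_right 0)"
   using b1 by real_asymp
  from filterlim_compose[OF this N] have L: "filterlim (\<lambda>w. 1 / (\<beta> - 1) * norm w powr (1 - \<beta>)) at_top ?F" .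
  have "filterlim (\<lambda>w. norm (a w)) at_top ?F"
   by (rule filterlim_at_top_mono[OF L]) (use na in \<open>eventually_elim, simp\<close>)
  moreover have "\<exists>m>0. \<forall>\<^sub>F w in ?F. m * norm w powr (1 - \<beta>) \<le> norm (a w)"
   by (intro exI[of _ "1 / (\<beta> - 1)"] conjI) (use b1 na in \<open>auto elim!: eventually_mono\<close>)
  ultimately show ?thesis by simp
 qed
 then obtain m where m: "0 < m" "\<forall>\<^sub>F w in ?F. m * norm w powr (1 - \<beta>) \<le> norm (a w)" by blast
 define E1 where "E1 = (\<lambda>w. E w - \<phi>0 * a w)"
 have E1: "(E1 has_field_derivative upper_pow w (- \<beta>) * (\<phi> w - \<phi>0)) (at w)" if "w \<in> \<H>" for w
  unfolding E1_def using E[OF that] a'[OF that] by (auto intro!: derivative_eq_intros simp: algebra_simps)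
 \<comment> \<open>The length is chosen for \<open>C * \<eta> \<le> norm \<phi>0 * m / 2\<close>,
   where \<open>m\<close> is the constant of the lower bound for \<open>a\<close>;
   \<open>C + 1\<close> avoids a division by zero.\<close>
 define \<eta> where "\<eta> = min (\<rho> / 4) (norm \<phi>0 * m / (2 * (C + 1)))"
 have \<eta>: "0 < \<eta>" "\<eta> < \<rho> / 2" using \<phi>(1) \<phi>0 m C by (auto simp: \<eta>_def)
 have C\<eta>: "C * \<eta> \<le> norm \<phi>0 * m / 2"
 proof -
  have "C * \<eta> \<le> (C + 1) * (norm \<phi>0 * m / (2 * (C + 1)))" using C \<eta> by (intro mult_mono) (auto simp: \<eta>_def)
  also have "\<dots> = norm \<phi>0 * m / 2" using C by (simp add: divide_simps)
  finally show ?thesis .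
 qed
 have bound: "norm (E1 (w + \<i> * of_real \<eta>) - E1 w) \<le> C * norm w powr (1 - \<beta>) * \<eta>"
  if w: "w \<in> \<H>" "norm w < \<rho> / 2" for w
 proof -
  let ?v = "\<lambda>y. w + \<i> * of_real y"
  let ?K = "C * norm w powr (1 - \<beta>)"
  have "norm (E1 (?v \<eta>) - E1 w) \<le> ?K * \<eta> - ?K * 0"
  proof (rule vertical_bound[OF E1 w(1) \<eta>(1)])
   show "continuous_on {0..\<eta>} (\<lambda>y. ?K * y)" by (intro continuous_intros)
   fix y assume y: "0 < y" "y < \<eta>"
   show "((\<lambda>y. ?K * y) has_vector_derivative ?K) (at y)"
    by (auto intro!: derivative_eq_intros simp: has_real_derivative_iff_has_vector_derivative[symmetric])
   have nv: "norm (?v y) < \<rho>"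
   proof -
    have "norm (?v y) \<le> norm w + norm (\<i> * of_real y)" by (rule norm_triangle_ineq)
    then show ?thesis using w y \<eta> by (simp add: norm_mult)
   qed
   have vy: "norm w \<le> norm (?v y)" "?v y \<in> \<H>" using norm_vertical[OF w(1), of y] y by auto
   have w0: "w \<noteq> 0" "?v y \<noteq> 0" using w vy by (auto simp: upper_half_plane_iff)
   have "norm (upper_pow (?v y) (- \<beta>)) * norm (\<phi> (?v y) - \<phi>0) \<le> norm (?v y) powr (- \<beta>) * (C * norm (?v y))"
    using \<phi>(2)[OF vy(2) nv] w0 by (intro mult_mono) (auto simp: norm_upper_pow_le)
   also have "\<dots> = C * norm (?v y) powr (1 - \<beta>)"
    using w0(2) by (simp add: powr_diff powr_minus field_simps)
   also have "\<dots> \<le> ?K" using vy w0 b C by (intro mult_left_mono powr_mono2') auto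
   finally show "norm (upper_pow (?v y) (- \<beta>) * (\<phi> (?v y) - \<phi>0)) \<le> ?K" by (simp add: norm_mult)
  qed
  then show ?thesis by simp
 qed
 let ?i = "\<i> * of_real \<eta>"
 have "isCont E1 ?i" using E1[of ?i] \<eta> by (auto simp: upper_half_plane_iff intro: DERIV_isCont)
 then obtain dl where dl: "dl > 0" "\<And>w. dist w ?i < dl ==> dist (E1 w) (E1 ?i) < 1"
  unfolding continuous_at_eps_delta by (metis zero_less_one)
 define K where "K = norm (E1 ?i) + 1"
 have near: "\<forall>\<^sub>F w in ?F. norm (E1 (w + ?i)) \<le> K \<and> norm (E1 (w + ?i) - E1 w) \<le> C * norm w powr (1 - \<beta>) * \<eta>"
 proof (rule ev_near_0_upper[of "min dl (\<rho> / 2)"])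
  fix w assume w: "w \<in> \<H>" "norm w < min dl (\<rho> / 2)"
  have "dist (E1 (w + ?i)) (E1 ?i) < 1" using w by (intro dl(2)) (auto simp: dist_norm)
  then have "norm (E1 (w + ?i)) \<le> K"
   using norm_triangle_ineq2[of "E1 (w + ?i)" "E1 ?i"] by (simp add: K_def dist_norm)
  then show "norm (E1 (w + ?i)) \<le> K \<and> norm (E1 (w + ?i) - E1 w) \<le> C * norm w powr (1 - \<beta>) * \<eta>"
   using bound[of w] w by auto
 qed (use dl \<phi> in auto)
 have ge: "\<forall>\<^sub>F w in ?F. norm \<phi>0 / 2 * norm (a w) - K \<le> norm (E w)"
  using near m(2)
 proof eventually_elim
  case (elim w)
  have "C * norm w powr (1 - \<beta>) * \<eta> = (C * \<eta>) * norm w powr (1 - \<beta>)" by simp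
  also have "\<dots> \<le> (norm \<phi>0 * m / 2) * norm w powr (1 - \<beta>)" using C\<eta> by (intro mult_right_mono) auto
  also have "\<dots> = norm \<phi>0 / 2 * (m * norm w powr (1 - \<beta>))" by simp
  also have "\<dots> \<le> norm \<phi>0 / 2 * norm (a w)" using elim(2) by (intro mult_left_mono) auto
  finally have 1: "norm (E1 w) \<le> K + norm \<phi>0 / 2 * norm (a w)"
   using elim(1) norm_triangle_ineq2[of "E1 w" "E1 (w + ?i)"] norm_minus_commute[of "E1 w" "E1 (w + ?i)"] by linarith
  have "norm \<phi>0 * norm (a w) = norm (E w - E1 w)" by (simp add: E1_def norm_mult)
  also have "\<dots> \<le> norm (E w) + norm (E1 w)" by (rule norm_triangle_ineq4)
  finally show ?case using 1 by (simp add: field_simps)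
 qed
 have "filterlim (\<lambda>w. norm \<phi>0 / 2 * norm (a w) - K) at_top ?F"
 proof -
  have "filterlim (\<lambda>w. norm \<phi>0 / 2 * norm (a w)) at_top ?F"
   using na \<phi>0 by (intro filterlim_tendsto_pos_mult_at_top[OF tendsto_const]) auto
  then have "filterlim (\<lambda>w. - K + norm \<phi>0 / 2 * norm (a w)) at_top ?F"
   by (intro filterlim_tendsto_add_at_top[OF tendsto_const])
  then show ?thesis by simp
 qed
 then have "filterlim (\<lambda>w. norm (E w)) at_top ?F"
  by (rule filterlim_at_top_mono) (rule ge)
 then show ?thesis by (rule filterlim_norm_at_top_imp_at_infinity)
qed

section \<open>Boundary values and straight edges\<close>

text \<open>A half-disk that controls \<open>g\<close> near \<open>x\<close> also contains the
  interior points near every neighbouring \<open>y\<close>, so the estimate passes to the boundary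
  value at \<open>y\<close>.\<close>

lemma boundary_value_continuous_on:
 assumes "\<And>x. x \<in> S ==> \<exists>l. (g \<longlongrightarrow> l) (at (of_real x) within \<H>)"
 shows "continuous_on S (boundary_value g)"
 unfolding continuous_on_iff
proof (intro ballI allI impI)
 fix x e :: real assume x: "x \<in> S" and e: "0 < e"
 let ?F = "\<lambda>x. at (of_real x) within \<H>"
 have lim: "(g \<longlongrightarrow> boundary_value g y) (?F y)" if "y \<in> S" for y
  using assms[OF that] boundary_value_eqI by blast
 have "\<forall>\<^sub>F z in ?F x. dist (g z) (boundary_value g x) < e / 2"
  using tendstoD[OF lim[OF x], of "e/2"] e by simp
 then obtain d where d: "d > 0" "\<And>z. z \<in> \<H> ==> z \<noteq> of_real x ==> dist z (of_real x) < d ==> dist (g z) (boundary_value g x) < e / 2"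
  unfolding eventually_at by auto
 show "\<exists>d>0. \<forall>x'\<in>S. dist x' x < d --> dist (boundary_value g x') (boundary_value g x) < e"
 proof (intro exI[of _ d] conjI ballI impI)
  fix y assume y: "y \<in> S" "dist y x < d"
  have "dist (boundary_value g y) (boundary_value g x) \<le> e / 2"
  proof (rule tendsto_upperbound[OF tendsto_dist[OF lim[OF y(1)] tendsto_const]])
   show "\<forall>\<^sub>F z in ?F y. dist (g z) (boundary_value g x) \<le> e / 2"
    unfolding eventually_at
   proof (intro exI[of _ "d - dist y x"] conjI ballI impI)
    fix z assume z: "z \<in> \<H>" "z \<noteq> of_real y \<and> dist z (of_real y) < d - dist y x"
    have "dist z (of_real x) < d"
     using z y dist_triangle[of z "of_real x" "of_real y"] by (simp add: dist_of_real)
    moreover have "z \<noteq> of_real x" using z by (auto simp: upper_half_plane_def)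
    ultimately show "dist (g z) (boundary_value g x) \<le> e / 2" using d(2) z by (auto intro: less_imp_le)
   qed (use y in auto)
  qed simp
  then show "dist (boundary_value g y) (boundary_value g x) < e" using e by linarith
 qed (use d in auto)
qed

context
 fixes n :: nat and \<beta> :: "nat => real" and c :: complex and zs :: "nat => real"
 assumes nz: "\<And>k. k \<in> {1..n} ==> zs k \<noteq> 0"
begin

text \<open>Two primitives on the convex half-plane differ by a constant. So \<open>SC\<close>
  extends analytically across every interval between vertices, also across those that do not contain
  the base point \<open>0\<close>.\<close>

lemma SC_local_primitive:
 assumes x: "\<And>k. k \<in> {1..n} ==> zs k \<noteq> x"
 obtains g where "\<And>z. z \<in> sc_domain n zs x ==> (g has_field_derivative slit_integrand n \<beta> c zs z) (at z)"
  "\<And>z. z \<in> \<H> ==> SC n \<beta> c zs z = g z"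
  "\<And>y. y \<in> free_interval n zs x ==> (SC n \<beta> c zs \<longlongrightarrow> g (of_real y)) (at (of_real y) within \<H>)"
proof -
 obtain g where g: "\<And>z. z \<in> sc_domain n zs x ==> (g has_field_derivative slit_integrand n \<beta> c zs z) (at z)"
  using slit_integrand_primitive[of n zs x \<beta> c] x by blast
 have U: "\<H> \<subseteq> sc_domain n zs x" by (auto simp: sc_domain_def)
 have "\<exists>k. \<forall>z\<in>upper_half_plane. SC n \<beta> c zs z - g z = k"
 proof (rule has_field_derivative_zero_constant[OF convex_upper_half_plane])
  fix z assume z: "z \<in> \<H>"
  have "((\<lambda>z. SC n \<beta> c zs z - g z) has_field_derivative slit_integrand n \<beta> c zs z - slit_integrand n \<beta> c zs z) (at z)"
   using z U by (intro DERIV_diff SC_has_field_derivative nz g) auto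
  then show "((\<lambda>z. SC n \<beta> c zs z - g z) has_field_derivative 0) (at z within \<H>)"
   by (auto intro: has_field_derivative_at_within)
 qed
 then obtain k where k: "\<And>z. z \<in> \<H> ==> SC n \<beta> c zs z - g z = k" by blast
 show ?thesis
 proof (rule that[of "\<lambda>z. g z + k"])
  show 1: "((\<lambda>z. g z + k) has_field_derivative slit_integrand n \<beta> c zs z) (at z)" if "z \<in> sc_domain n zs x" for z
   using DERIV_add[OF g[OF that] DERIV_const[of k]] by simp
  show 2: "SC n \<beta> c zs z = g z + k" if "z \<in> \<H>" for z using k[OF that] by (simp add: algebra_simps)
  show "(SC n \<beta> c zs \<longlongrightarrow> g (of_real y) + k) (at (of_real y) within \<H>)"
   if "y \<in> free_interval n zs x" for y
  proof -
   have "of_real y \<in> sc_domain n zs x" using that by (simp add: sc_domain_def)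
   from DERIV_isCont[OF 1[OF this]]
   have "((\<lambda>z. g z + k) \<longlongrightarrow> g (of_real y) + k) (at (of_real y) within \<H>)"
    by (auto simp: isCont_def intro: tendsto_within_subset)
   then show ?thesis
    by (rule Lim_transform_eventually) (auto simp: eventually_at_filter 2)
  qed
 qed
qed

lemma SC_boundary:
 assumes x: "\<And>k. k \<in> {1..n} ==> zs k \<noteq> x"
 shows "\<exists>l. (SC n \<beta> c zs \<longlongrightarrow> l) (at (of_real x) within \<H>)"
  "(boundary_value (SC n \<beta> c zs) has_vector_derivative slit_integrand n \<beta> c zs (of_real x)) (at x)"
  "((\<lambda>z. deriv (SC n \<beta> c zs) z) \<longlongrightarrow> slit_integrand n \<beta> c zs (of_real x)) (at (of_real x) within \<H>)"
proof -
 obtain g where g: "\<And>z. z \<in> sc_domain n zs x ==> (g has_field_derivative slit_integrand n \<beta> c zs z) (at z)"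
  "\<And>z. z \<in> \<H> ==> SC n \<beta> c zs z = g z"
  "\<And>y. y \<in> free_interval n zs x ==> (SC n \<beta> c zs \<longlongrightarrow> g (of_real y)) (at (of_real y) within \<H>)"
  using SC_local_primitive[of x] x by blast
 note xs = free_interval_self[of x n zs]
 show "\<exists>l. (SC n \<beta> c zs \<longlongrightarrow> l) (at (of_real x) within \<H>)" using g(3)[OF xs] by blast
 have D: "of_real x \<in> sc_domain n zs x" using xs by (simp add: sc_domain_def)
 have "((\<lambda>y. g (of_real y)) has_vector_derivative slit_integrand n \<beta> c zs (of_real x)) (at x)"
  using has_vector_derivative_real_field[OF g(1)[OF D]] by (simp add: o_def)
 then show "(boundary_value (SC n \<beta> c zs) has_vector_derivative slit_integrand n \<beta> c zs (of_real x)) (at x)"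
  by (rule has_vector_derivative_transform_within_open[OF _ open_free_interval xs])
    (simp add: boundary_value_eqI[OF g(3)])
 have dv: "deriv (SC n \<beta> c zs) z = slit_integrand n \<beta> c zs z" if "z \<in> \<H>" for z
  by (rule DERIV_imp_deriv[OF SC_has_field_derivative]) (use nz that in auto)
 have "slit_integrand n \<beta> c zs field_differentiable (at (of_real x))"
  using sc_domain_disjoint[of n zs x] x D by (intro slit_integrand_field_differentiable) auto
 then have "isCont (slit_integrand n \<beta> c zs) (of_real x)" by (rule field_differentiable_imp_continuous_at)
 then have "(slit_integrand n \<beta> c zs \<longlongrightarrow> slit_integrand n \<beta> c zs (of_real x)) (at (of_real x) within \<H>)"
  by (auto simp: isCont_def intro: tendsto_within_subset)
 then show "((\<lambda>z. deriv (SC n \<beta> c zs) z) \<longlongrightarrow> slit_integrand n \<beta> c zs (of_real x)) (at (of_real x) within \<H>)"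
  by (rule Lim_transform_eventually) (auto simp: eventually_at_filter dv)
qed

end

text \<open>The constant that separates the integrand at a real \<open>x\<close> from the positive
  \<open>density_fn\<close>. A vertex to the right of \<open>x\<close> contributes the argument of a
  power of a negative number.\<close>

definition phase :: "nat => (nat => real) => complex => (nat => real) => real => complex" where
 "phase n \<beta> c zs x = c * (\<Prod>k=1..n. if x < zs k then cis (- pi * \<beta> k) else 1)"

definition density_fn :: "nat => (nat => real) => (nat => real) => real => real" where
 "density_fn n \<beta> zs x = (\<Prod>k=1..n. \<bar>x - zs k\<bar> powr (- \<beta> k))"

lemma slit_integrand_of_real:
 assumes "\<And>k. k \<in> {1..n} ==> zs k \<noteq> x"
 shows "slit_integrand n \<beta> c zs (of_real x) = phase n \<beta> c zs x * of_real (density_fn n \<beta> zs x)"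
proof -
 have "(\<Prod>k=1..n. upper_pow (of_real x - of_real (zs k)) (- \<beta> k)) =
  (\<Prod>k=1..n. (if x < zs k then cis (- pi * \<beta> k) else 1) * of_real (\<bar>x - zs k\<bar> powr (- \<beta> k)))"
 proof (rule prod.cong[OF refl])
  fix k assume "k \<in> {1..n}"
  then have "x - zs k \<noteq> 0" using assms[of k] by auto
  from upper_pow_of_real[OF this, of "- \<beta> k"]
  show "upper_pow (of_real x - of_real (zs k)) (- \<beta> k) =
   (if x < zs k then cis (- pi * \<beta> k) else 1) * of_real (\<bar>x - zs k\<bar> powr (- \<beta> k))"
   by (simp add: mult.commute)
 qed
 then show ?thesis by (simp add: slit_integrand_def phase_def density_fn_def prod.distrib)
qed

lemma norm_phase: "norm (phase n \<beta> c zs x) = norm c"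
 unfolding phase_def norm_mult prod_norm[symmetric] by (simp add: if_distrib[of norm] cong: if_cong)

lemma density_fn_pos: "(\<And>k. k \<in> {1..n} ==> zs k \<noteq> x) ==> 0 < density_fn n \<beta> zs x"
 unfolding density_fn_def by (intro prod_pos) auto

lemma phase_free_interval: "y \<in> free_interval n zs x ==> (\<And>k. k \<in> {1..n} ==> zs k \<noteq> x) ==> phase n \<beta> c zs y = phase n \<beta> c zs x"
proof -
 assume y: "y \<in> free_interval n zs x" and x: "\<And>k. k \<in> {1..n} ==> zs k \<noteq> x"
 have "y < zs k \<longleftrightarrow> x < zs k" if "k \<in> {1..n}" for k
  using y x[OF that] that unfolding free_interval_def mem_Collect_eq by (metis less_asym linorder_neqE_linordered_idom)
 then show ?thesis unfolding phase_def by (intro arg_cong[where f = "\<lambda>a. c * a"] prod.cong refl if_cong)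
qed

lemma free_interval_not_vertex: "y \<in> free_interval n zs x ==> (\<And>k. k \<in> {1..n} ==> zs k \<noteq> x) ==> k \<in> {1..n} ==> zs k \<noteq> y"
 unfolding free_interval_def by (metis (mono_tags, lifting) less_irrefl linorder_neqE_linordered_idom mem_Collect_eq)

lemma free_intervalI: "(\<And>k. k \<in> {1..n} ==> zs k \<notin> closed_segment x y) ==> y \<in> free_interval n zs x"
proof -
 assume f: "\<And>k. k \<in> {1..n} ==> zs k \<notin> closed_segment x y"
 show ?thesis unfolding free_interval_def mem_Collect_eq
 proof (intro ballI conjI impI)
  fix k assume k: "k \<in> {1..n}"
  show "y < zs k" if "x < zs k"
   using f[OF k] that by (rule_tac ccontr) (simp add: closed_segment_eq_real_ivl)
  show "zs k < y" if "zs k < x"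
   using f[OF k] that by (rule_tac ccontr) (auto simp: closed_segment_eq_real_ivl)
 qed
qed

text \<open>Rotated by the conjugate of the phase, the boundary map has a positive derivative
  between vertices, so differences of its values are positive multiples of one unit vector
  \<open>u\<close>. Convexity then follows from connectedness and collinearity.\<close>

lemma maps_onto_segmentI:
 assumes nz: "\<And>k. k \<in> {1..n} ==> zs k \<noteq> 0" and c: "norm c = 1"
  and lim: "\<And>x. x \<in> E ==> \<exists>l. (SC n \<beta> c zs \<longlongrightarrow> l) (at (of_real x) within \<H>)"
  and conv: "\<And>a b. a \<in> E ==> b \<in> E ==> {a..b} \<subseteq> E"
  and free: "\<And>a b k. a \<in> E ==> b \<in> E ==> k \<in> {1..n} ==> zs k \<notin> {a<..<b}"
 shows "maps_onto_segment (SC n \<beta> c zs) E"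
proof -
 let ?g = "boundary_value (SC n \<beta> c zs)"
 have cont: "continuous_on E ?g" by (rule boundary_value_continuous_on[OF lim])
 have ex: "\<exists>u. norm u = 1 \<and> (\<forall>a\<in>E. \<forall>b\<in>E. a < b --> (\<exists>r>0. ?g b - ?g a = of_real r * u))"
 proof (cases "\<exists>a0\<in>E. \<exists>b0\<in>E. a0 < b0")
  case False
  then show ?thesis by (intro exI[of _ 1]) auto
 next
  case True
  then obtain a0 b0 where ab0: "a0 \<in> E" "b0 \<in> E" "a0 < b0" by auto
  define m where "m = (a0 + b0) / 2"
  define u where "u = phase n \<beta> c zs m"
  have u: "norm u = 1" by (simp add: u_def norm_phase c)
  have m: "a0 < m" "m < b0" using ab0 by (auto simp: m_def)
  have mv: "zs k \<noteq> m" if "k \<in> {1..n}" for k using free[OF ab0(1,2) that] m by auto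
  have ph: "(\<forall>k\<in>{1..n}. zs k \<noteq> x) \<and> phase n \<beta> c zs x = u" if x: "a \<in> E" "b \<in> E" "a < x" "x < b" for a b x
  proof -
   \<comment> \<open>The hull of both intervals is still free of vertices, so \<open>x\<close> and
     \<open>m\<close> have the same phase.\<close>
   have "min a a0 \<in> E" "max b b0 \<in> E" using x ab0 by (auto simp: min_def max_def)
   then have f: "zs k \<notin> {min a a0<..<max b b0}" if "k \<in> {1..n}" for k using free that by blast
   have "x \<in> free_interval n zs m"
   proof (rule free_intervalI)
    fix k assume "k \<in> {1..n}"
    then show "zs k \<notin> closed_segment m x" using f[of k] x m by (auto simp: closed_segment_eq_real_ivl min_def max_def split: if_splits)
   qed
   then show ?thesis unfolding u_def using phase_free_interval[of x n zs m] free_interval_not_vertex[of x n zs m] mv by auto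
  qed
  have "\<exists>r>0. ?g b - ?g a = of_real r * u" if ab: "a \<in> E" "b \<in> E" "a < b" for a b
  proof -
   define f where "f = (\<lambda>x. ?g x * cnj u)"
   have uu: "u * cnj u = 1" using u complex_norm_square[of u] by simp
   have cf: "continuous_on {a..b} f" unfolding f_def
    using conv[OF ab(1,2)] by (intro continuous_intros continuous_on_subset[OF cont])
   have df: "(f has_vector_derivative of_real (density_fn n \<beta> zs x)) (at x)" "0 < density_fn n \<beta> zs x" if x: "a < x" "x < b" for x
   proof -
    have v: "zs k \<noteq> x" if "k \<in> {1..n}" for k using ph[OF ab(1,2) x] that by auto
    have "(f has_vector_derivative slit_integrand n \<beta> c zs (of_real x) * cnj u) (at x)"
     unfolding f_def using SC_boundary(2)[of n zs x \<beta> c] nz v by (intro has_vector_derivative_mult_left) auto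
    also have "slit_integrand n \<beta> c zs (of_real x) * cnj u = (u * cnj u) * of_real (density_fn n \<beta> zs x)"
     using slit_integrand_of_real[of n zs x \<beta> c] v ph[OF ab(1,2) x] by simp
    finally show "(f has_vector_derivative of_real (density_fn n \<beta> zs x)) (at x)" unfolding uu by simp
    show "0 < density_fn n \<beta> zs x" using v by (intro density_fn_pos) auto
   qed
   have re: "((\<lambda>x. Re (f x)) has_real_derivative density_fn n \<beta> zs x) (at x)" if "a < x" "x < b" for x
    using bounded_linear.has_vector_derivative[OF bounded_linear_Re df(1)[OF that]] by (simp add: has_real_derivative_iff_has_vector_derivative)
   have im: "((\<lambda>x. Im (f x)) has_real_derivative 0) (at x)" if "a < x" "x < b" for x
    using bounded_linear.has_vector_derivative[OF bounded_linear_Im df(1)[OF that]] by (simp add: has_real_derivative_iff_has_vector_derivative)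
   have "Re (f a) < Re (f b)"
    using ab(3) re df(2) cf by (intro DERIV_pos_imp_increasing_open[of a b "\<lambda>x. Re (f x)"] continuous_intros) auto
   moreover have "Im (f b) = Im (f a)"
    using ab(3) im cf by (intro DERIV_isconst_end[of a b "\<lambda>x. Im (f x)"] continuous_intros) auto
   ultimately have r: "f b - f a = of_real (Re (f b) - Re (f a))" "0 < Re (f b) - Re (f a)"
    by (auto simp: complex_eq_iff)
   have "?g b - ?g a = (f b - f a) * u"
   proof -
    have "cnj u * u = 1" using uu by (simp add: mult.commute)
    then have "f x * u = ?g x" for x unfolding f_def mult.assoc by simp
    then show ?thesis by (simp add: left_diff_distrib)
   qed
   then show ?thesis using r by (intro exI[of _ "Re (f b) - Re (f a)"]) auto
  qed
  then show ?thesis using u by blast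
 qed
 then obtain u where u: "norm u = 1" "\<And>a b. a \<in> E ==> b \<in> E ==> a < b ==> \<exists>r>0. ?g b - ?g a = of_real r * u" by blast
 have u0: "u \<noteq> 0" using u(1) by auto
 have inj: "inj_on ?g E"
 proof (rule linorder_inj_onI)
  fix a b assume ab: "a < b" "a \<in> E" "b \<in> E"
  obtain r where "r > 0" "?g b - ?g a = of_real r * u" using u(2)[OF ab(2,3,1)] by blast
  then show "?g a \<noteq> ?g b" using u0 by auto
 qed auto
 have col: "collinear (?g ` E)"
  unfolding collinear_def
 proof (intro exI[of _ u] ballI)
  fix x y assume "x \<in> ?g ` E" "y \<in> ?g ` E"
  then obtain a b where ab: "a \<in> E" "b \<in> E" "x = ?g a" "y = ?g b" by auto
  consider "a = b" | "a < b" | "b < a" by linarith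
  then show "\<exists>c. x - y = c *\<^sub>R u"
  proof cases
   case 1 then show ?thesis using ab by (intro exI[of _ 0]) auto
  next
   case 2
   then obtain r where "?g b - ?g a = of_real r * u" using u(2)[OF ab(1,2)] by blast
   then show ?thesis using ab by (intro exI[of _ "- r"]) (auto simp: scaleR_conv_of_real algebra_simps)
  next
   case 3
   then obtain r where "?g a - ?g b = of_real r * u" using u(2)[OF ab(2,1)] by blast
   then show ?thesis using ab by (intro exI[of _ r]) (auto simp: scaleR_conv_of_real)
  qed
 qed
 have conn: "connected (?g ` E)"
 proof (rule connected_continuous_image[OF cont])
  show "connected E" unfolding connected_iff_interval using conv by (meson atLeastAtMost_iff subsetD)
 qed
 have "convex (?g ` E)"
  using convex_connected_collinear[OF col] conn by simp
 then show ?thesis unfolding maps_onto_segment_def using lim cont inj col by blast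
qed

text \<open>The preimages of a convergent sequence accumulate in the compact \<open>[a, b]\<close>.
  The accumulation point belongs to \<open>E\<close>, because near every other point of
  \<open>[a, b]\<close> the boundary values are too large to converge.\<close>

lemma closed_boundary_image:
 assumes lim: "\<And>x. x \<in> E ==> \<exists>l. (g \<longlongrightarrow> l) (at (of_real x) within \<H>)"
  and E: "E \<subseteq> {a..b}"
  and inf: "\<And>x. x \<in> {a..b} - E ==> filterlim g at_infinity (at (of_real x) within \<H>)"
 shows "closed (boundary_value g ` E)"
proof -
 let ?g = "boundary_value g"
 have cont: "continuous_on E ?g" by (rule boundary_value_continuous_on[OF lim])
 have L: "(g \<longlongrightarrow> ?g y) (at (of_real y) within \<H>)" if "y \<in> E" for y
  using lim[OF that] boundary_value_eqI by blast
 show ?thesis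
  unfolding closed_sequential_limits
 proof (intro allI impI)
  fix s l assume "(\<forall>i. s i \<in> ?g ` E) \<and> s \<longlonglongrightarrow> l"
  then have "\<forall>i. \<exists>x. x \<in> E \<and> s i = ?g x" and sl: "s \<longlonglongrightarrow> l" by auto
  then obtain x where x: "\<And>i. x i \<in> E" "\<And>i. s i = ?g (x i)" by metis
  have "\<forall>i. x i \<in> {a..b}" using subsetD[OF E x(1)] by blast
  then obtain y r where y: "y \<in> {a..b}" "strict_mono r" "(x \<circ> r) \<longlonglongrightarrow> y"
   using compact_Icc[of a b] unfolding compact_def by metis
  have sr: "(s \<circ> r) \<longlonglongrightarrow> l" using sl y(2) by (rule LIMSEQ_subseq_LIMSEQ)
  show "l \<in> ?g ` E"
  proof (cases "y \<in> E")
   case True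
   have "(\<lambda>i. ?g (x (r i))) \<longlonglongrightarrow> ?g y"
    using y(3) x(1) True by (intro continuous_on_tendsto_compose[OF cont]) (auto simp: o_def)
   then have "(s \<circ> r) \<longlonglongrightarrow> ?g y" using x(2) by (simp add: o_def)
   then show ?thesis using sr True LIMSEQ_unique by blast
  next
   case False
   have "Bseq s" using sl convergent_imp_Bseq convergentI by blast
   then obtain K where K: "K > 0" "\<And>i. norm (s i) \<le> K" unfolding Bseq_def by auto
   have "\<forall>\<^sub>F z in at (of_real y) within \<H>. K + 1 \<le> norm (g z)"
    using inf[of y] y False filterlim_at_infinity[of 0 g] K by auto
   then obtain d where d: "d > 0" "\<And>z. z \<in> \<H> ==> z \<noteq> of_real y ==> dist z (of_real y) < d ==> K + 1 \<le> norm (g z)"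
    unfolding eventually_at by auto
   obtain i where i: "dist (x (r i)) y < d" using y(3) d(1) unfolding lim_sequentially o_def by auto
   have "K + 1 \<le> norm (?g (x (r i)))"
   proof (rule tendsto_lowerbound[OF tendsto_norm[OF L[OF x(1)]]])
    show "\<forall>\<^sub>F z in at (of_real (x (r i))) within \<H>. K + 1 \<le> norm (g z)"
     unfolding eventually_at
    proof (intro exI[of _ "d - dist (x (r i)) y"] conjI ballI impI)
     fix z assume z: "z \<in> \<H>" "z \<noteq> of_real (x (r i)) \<and> dist z (of_real (x (r i))) < d - dist (x (r i)) y"
     have "dist z (of_real y) < d"
      using z dist_triangle[of z "of_real y" "of_real (x (r i))"] by (simp add: dist_of_real)
     moreover have "z \<noteq> of_real y" using z by (auto simp: upper_half_plane_def)
     ultimately show "K + 1 \<le> norm (g z)" using d(2) z by auto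
    qed (use i in auto)
   qed simp
   then show ?thesis using K(2)[of "r i"] x(2)[of "r i"] by simp
  qed
 qed
qed

section \<open>Corners at the vertices\<close>

lemma lipschitz_at_of_derivative:
 fixes f :: "complex => complex"
 assumes "(f has_field_derivative d) (at 0)"
 obtains \<rho> C where "0 < \<rho>" "\<And>w::complex. norm w < \<rho> ==> norm (f w - f 0) \<le> C * norm w"
proof -
 have "((\<lambda>w. (f w - f 0) / w) \<longlongrightarrow> d) (at 0)"
  using assms by (simp add: has_field_derivative_iff)
 then have "\<forall>\<^sub>F w in at 0. dist ((f w - f 0) / w) d < 1" by (rule tendstoD) simp
 then obtain \<rho> where r: "0 < \<rho>" "\<And>w. w \<noteq> 0 ==> norm w < \<rho> ==> dist ((f w - f 0) / w) d < 1"
  unfolding eventually_at by auto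
 show ?thesis
 proof (rule that[OF r(1)])
  fix w :: complex assume w: "norm w < \<rho>"
  show "norm (f w - f 0) \<le> (norm d + 1) * norm w"
  proof (cases "w = 0")
   case False
   have "norm ((f w - f 0) / w) \<le> norm d + 1"
    using r(2)[OF False w] norm_triangle_ineq2[of "(f w - f 0) / w" d] by (simp add: dist_norm)
   then show ?thesis using False by (simp add: norm_divide field_simps)
  qed simp
 qed
qed

text \<open>\<open>\<phi>i\<close> is a convenient form of the regular factor along the substituted
  path; vertices and infinity use different ones.\<close>

lemma corner_behaviour:
 assumes E: "\<And>w. w \<in> \<H> ==> (E has_field_derivative upper_pow w (- \<beta>) * \<phi> w) (at w)"
  and \<phi>: "(\<phi> has_field_derivative d) (at 0)" "\<phi> 0 \<noteq> 0"
 shows "\<beta> < 1 ==> \<phi>i integrable_on {0..1} ==> (\<And>v. v \<in> {0..1} ==> \<phi> (\<i> * of_real (v powr (1 / (1 - \<beta>)))) = \<phi>i v) ==>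
   (E \<longlongrightarrow> E \<i> - \<i> * cis (- pi * \<beta> / 2) / of_real (1 - \<beta>) * integral {0..1} \<phi>i) (at 0 within \<H>)"
  "1 \<le> \<beta> ==> filterlim E at_infinity (at 0 within \<H>)"
proof -
 obtain \<rho> C where r: "0 < \<rho>" "\<And>w. norm w < \<rho> ==> norm (\<phi> w - \<phi> 0) \<le> C * norm w"
  using lipschitz_at_of_derivative[OF \<phi>(1)] by blast
 show "filterlim E at_infinity (at 0 within \<H>)" if "1 \<le> \<beta>"
  by (rule corner_infinite[OF that E r(1) r(2) \<phi>(2)])
 assume b: "\<beta> < 1" and i: "\<phi>i integrable_on {0..1}" and eq: "\<And>v. v \<in> {0..1} ==> \<phi> (\<i> * of_real (v powr (1 / (1 - \<beta>)))) = \<phi>i v"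
 have "norm (\<phi> w) \<le> norm (\<phi> 0) + \<bar>C\<bar> * \<rho>" if "norm w < \<rho>" for w
 proof -
  have "norm (\<phi> w) \<le> norm (\<phi> 0) + norm (\<phi> w - \<phi> 0)" using norm_triangle_ineq[of "\<phi> 0" "\<phi> w - \<phi> 0"] by simp
  also have "norm (\<phi> w - \<phi> 0) \<le> \<bar>C\<bar> * norm w" using r(2)[OF that] by (smt (verit) mult_right_mono norm_ge_zero)
  also have "\<bar>C\<bar> * norm w \<le> \<bar>C\<bar> * \<rho>" using that by (intro mult_left_mono) auto
  finally show ?thesis by simp
 qed
 then obtain l where l: "(E \<longlongrightarrow> l) (at 0 within \<H>)"
  using corner_limit_exists[OF b E r(1)] by blast
 have k0: "\<i> * cis (- pi * \<beta> / 2) / (1 - of_real \<beta>) \<noteq> 0"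
 proof -
  have "of_real (1 - \<beta>) \<noteq> 0" using b by simp
  then have "1 - of_real \<beta> \<noteq> 0" by simp
  then show ?thesis by (simp add: cis_neq_zero)
 qed
 from corner_limit_formula[OF b E l]
 have "(\<phi>i has_integral (E \<i> - l) / (\<i> * cis (- pi * \<beta> / 2) / (1 - \<beta>))) {0..1}"
  by (rule has_integral_eq[rotated]) (use eq in auto)
 then have "integral {0..1} \<phi>i = (E \<i> - l) / (\<i> * cis (- pi * \<beta> / 2) / (1 - \<beta>))" by (rule integral_unique)
 then have "l = E \<i> - \<i> * cis (- pi * \<beta> / 2) / of_real (1 - \<beta>) * integral {0..1} \<phi>i"
  using k0 by simp
 then show "(E \<longlongrightarrow> E \<i> - \<i> * cis (- pi * \<beta> / 2) / of_real (1 - \<beta>) * integral {0..1} \<phi>i) (at 0 within \<H>)"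
  using l by simp
qed

lemma filterlim_shift_upper:
 "filterlim (\<lambda>z. z - of_real a) (at 0 within \<H>) (at (of_real a) within \<H>)"
proof -
 have "((\<lambda>z. z - of_real a) \<longlongrightarrow> of_real a - of_real a) (at (of_real a) within \<H>)"
  by (intro tendsto_intros)
 then show ?thesis unfolding filterlim_at by (auto simp: eventually_at_filter upper_half_plane_def)
qed

text \<open>What is left of the integrand, in the local coordinate \<open>w\<close>, once the
  singular power at vertex \<open>k\<close> is split off. For distinct vertices and
  \<open>c \<noteq> 0\<close> it is analytic and nonzero near \<open>w = 0\<close>.\<close>

definition corner_factor :: "nat => (nat => real) => complex => (nat => real) => nat => complex => complex" where
 "corner_factor n \<beta> c zs k w = c * (\<Prod>j\<in>{1..n} - {k}. upper_pow (w + of_real (zs k - zs j)) (- \<beta> j))"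

lemma slit_integrand_at_corner:
 assumes "k \<in> {1..n}"
 shows "slit_integrand n \<beta> c zs (of_real (zs k) + w) = upper_pow w (- \<beta> k) * corner_factor n \<beta> c zs k w"
proof -
 have "(\<Prod>j=1..n. upper_pow (of_real (zs k) + w - of_real (zs j)) (- \<beta> j)) =
  upper_pow w (- \<beta> k) * (\<Prod>j\<in>{1..n} - {k}. upper_pow (of_real (zs k) + w - of_real (zs j)) (- \<beta> j))"
  using assms by (subst prod.remove[of _ k]) auto
 then show ?thesis by (simp add: slit_integrand_def corner_factor_def algebra_simps)
qed

lemma upper_pow_compose_field_differentiable:
 assumes "f field_differentiable (at z)" "f z \<notin> slit"
 shows "(\<lambda>z. upper_pow (f z) b) field_differentiable (at z)"
proof -
 have "(\<lambda>z. upper_pow z b) field_differentiable at (f z)"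
  using upper_pow_deriv[OF assms(2)] field_differentiable_def by blast
 then show ?thesis using field_differentiable_compose[OF assms(1)] by (simp add: o_def)
qed

lemma SC_corner:
 assumes nz: "\<And>j. j \<in> {1..n} ==> zs j \<noteq> 0" and inj: "inj_on zs {1..n}" and k: "k \<in> {1..n}" and c: "c \<noteq> 0"
 shows "\<beta> k < 1 ==> \<phi>i integrable_on {0..1} ==> (\<And>v. v \<in> {0..1} ==> corner_factor n \<beta> c zs k (\<i> * of_real (v powr (1 / (1 - \<beta> k)))) = \<phi>i v) ==>
   (SC n \<beta> c zs \<longlongrightarrow> SC n \<beta> c zs (of_real (zs k) + \<i>) - \<i> * cis (- pi * \<beta> k / 2) / of_real (1 - \<beta> k) * integral {0..1} \<phi>i)
    (at (of_real (zs k)) within \<H>)"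
  "1 \<le> \<beta> k ==> filterlim (SC n \<beta> c zs) at_infinity (at (of_real (zs k)) within \<H>)"
proof -
 define E where "E = (\<lambda>w. SC n \<beta> c zs (of_real (zs k) + w))"
 have E: "(E has_field_derivative upper_pow w (- \<beta> k) * corner_factor n \<beta> c zs k w) (at w)" if "w \<in> \<H>" for w
 proof -
  have "of_real (zs k) + w \<in> \<H>" using that by (simp add: upper_half_plane_def)
  from SC_has_field_derivative[of n zs _ \<beta> c, OF nz this]
  have "(SC n \<beta> c zs has_field_derivative upper_pow w (- \<beta> k) * corner_factor n \<beta> c zs k w) (at (of_real (zs k) + w))"
   by (simp add: slit_integrand_at_corner[OF k])
  then have "((\<lambda>w. SC n \<beta> c zs (of_real (zs k) + w)) has_field_derivative upper_pow w (- \<beta> k) * corner_factor n \<beta> c zs k w * 1) (at w)"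
   by (rule DERIV_chain2[where g = "\<lambda>w. of_real (zs k) + w"]) (auto intro!: derivative_eq_intros)
  then show ?thesis unfolding E_def by simp
 qed
 have "corner_factor n \<beta> c zs k field_differentiable (at 0)"
  unfolding corner_factor_def
 proof (intro field_differentiable_mult field_differentiable_const field_differentiable_finite_prod upper_pow_compose_field_differentiable)
  fix j assume j: "j \<in> {1..n} - {k}"
  then have "zs k \<noteq> zs j" using inj k by (auto dest: inj_onD)
  then show "0 + of_real (zs k - zs j) \<notin> slit" by (simp add: slit_def)
  show "(\<lambda>w. w + of_real (zs k - zs j)) field_differentiable (at 0)" by (intro derivative_intros)
 qed auto
 then obtain d where d: "(corner_factor n \<beta> c zs k has_field_derivative d) (at 0)" unfolding field_differentiable_def by blast
 have 0: "corner_factor n \<beta> c zs k 0 \<noteq> 0" unfolding corner_factor_def using c by auto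
 have Esh: "E (z - of_real (zs k)) = SC n \<beta> c zs z" for z by (simp add: E_def)
 have CB1: "(E \<longlongrightarrow> E \<i> - \<i> * cis (- pi * \<beta> k / 2) / of_real (1 - \<beta> k) * integral {0..1} \<phi>i) (at 0 within \<H>)"
  if "\<beta> k < 1" "\<phi>i integrable_on {0..1}" "\<And>v. v \<in> {0..1} ==> corner_factor n \<beta> c zs k (\<i> * of_real (v powr (1 / (1 - \<beta> k)))) = \<phi>i v"
  by (rule corner_behaviour(1)[OF E d 0 that(1) that(2)]) (use that(3) in auto)
 have CB2: "filterlim E at_infinity (at 0 within \<H>)" if "1 \<le> \<beta> k"
  by (rule corner_behaviour(2)[OF E d 0 that]) auto
 show "(SC n \<beta> c zs \<longlongrightarrow> SC n \<beta> c zs (of_real (zs k) + \<i>) - \<i> * cis (- pi * \<beta> k / 2) / of_real (1 - \<beta> k) * integral {0..1} \<phi>i)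
    (at (of_real (zs k)) within \<H>)"
  if "\<beta> k < 1" "\<phi>i integrable_on {0..1}" "\<And>v. v \<in> {0..1} ==> corner_factor n \<beta> c zs k (\<i> * of_real (v powr (1 / (1 - \<beta> k)))) = \<phi>i v"
  using filterlim_compose[OF CB1[OF that] filterlim_shift_upper[of "zs k"]] by (simp add: Esh) (simp add: E_def)
 show "filterlim (SC n \<beta> c zs) at_infinity (at (of_real (zs k)) within \<H>)" if "1 \<le> \<beta> k"
  using filterlim_compose[OF CB2[OF that] filterlim_shift_upper[of "zs k"]] by (simp add: Esh)
qed

section \<open>The corner at infinity in the coordinate \<open>- 1 / w\<close>\<close>

lemma minus_inverse_upper: "w \<in> \<H> ==> - 1 / w \<in> \<H>"
 by (auto simp: upper_half_plane_def Im_divide complex_eq_iff power2_eq_square intro!: divide_pos_pos add_nonneg_pos)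

lemma Im_upper_log_upper: "w \<in> \<H> ==> 0 < Im (upper_log w) \<and> Im (upper_log w) < pi"
 using Im_Ln_pos_lt[of w] Ln_eq_upper_log[of w] by (cases "w = 0") (auto simp: upper_half_plane_def)

text \<open>\<open>w\<close> and \<open>- 1 / w\<close> have reciprocal moduli, and their angles add
  up to \<open>pi\<close>.\<close>

lemma upper_log_minus_inverse:
 assumes w: "w \<in> \<H>" shows "upper_log (- 1 / w) = \<i> * pi - upper_log w"
proof (rule upper_log_unique)
 have "w \<noteq> 0" using w by (auto simp: upper_half_plane_def)
 then show "exp (\<i> * of_real pi - upper_log w) = - 1 / w" by (simp add: exp_diff exp_upper_log)
 show "- (pi / 2) < Im (\<i> * of_real pi - upper_log w)" "Im (\<i> * of_real pi - upper_log w) \<le> 3 * pi / 2"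
  using Im_upper_log_upper[OF w] pi_gt_zero by auto
qed

lemma Ln_eq_upper_log_Re: "0 < Re z ==> Ln z = upper_log z"
proof (rule upper_log_unique[symmetric])
 assume z: "0 < Re z"
 then have "z \<noteq> 0" by auto
 then show "exp (Ln z) = z" by simp
 have "\<bar>Im (Ln z)\<bar> < pi / 2" using Re_Ln_pos_lt[OF \<open>z \<noteq> 0\<close>] z by simp
 then show "- (pi / 2) < Im (Ln z)" "Im (Ln z) \<le> 3 * pi / 2" using pi_gt_zero by auto
qed

lemma one_plus_not_nonpos: "w \<in> \<H> ==> 1 + of_real a * w \<notin> \<real>\<^sub>\<le>\<^sub>0"
 by (cases "a = 0") (auto simp: complex_nonpos_Reals_iff upper_half_plane_def)

text \<open>Both sides have the same derivative on the half-plane and agree at \<open>\<i>\<close>.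
  The gain is that the second summand is analytic at \<open>w = 0\<close>, so the singularity sits
  in \<open>upper_log (- 1 / w)\<close> alone.\<close>

lemma upper_log_at_infinity:
 assumes w: "w \<in> \<H>"
 shows "upper_log (- 1 / w - of_real a) = upper_log (- 1 / w) + Ln (1 + of_real a * w)"
proof -
 define D where "D = (\<lambda>w. upper_log (- 1 / w - of_real a) - upper_log (- 1 / w) - Ln (1 + of_real a * w))"
 have "\<exists>k. \<forall>w\<in>upper_half_plane. D w = k"
 proof (rule has_field_derivative_zero_constant[OF convex_upper_half_plane])
  fix w assume w: "w \<in> \<H>"
  have w0: "w \<noteq> 0" "1 + of_real a * w \<noteq> 0" using w one_plus_not_nonpos[OF w, of a] by (auto simp: upper_half_plane_def)
  have i: "- 1 / w \<in> \<H>" "- 1 / w - of_real a \<in> \<H>"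
   using minus_inverse_upper[OF w] by (auto simp: upper_half_plane_def)
  have e: "- 1 / w - of_real a = - (1 + of_real a * w) / w" using w0 by (simp add: field_simps)
  have inv: "((\<lambda>w. - 1 / w) has_field_derivative 1 / w\<^sup>2) (at w)" using w0 by (auto intro!: derivative_eq_intros simp: power2_eq_square)
  have d1: "((\<lambda>w. upper_log (- 1 / w)) has_field_derivative 1 / (- 1 / w) * (1 / w\<^sup>2)) (at w)"
   by (rule DERIV_chain2[OF upper_log_deriv[OF upper_half_plane_not_slit[OF i(1)]] inv])
  have inv2: "((\<lambda>w. - 1 / w - of_real a) has_field_derivative 1 / w\<^sup>2) (at w)"
   using DERIV_diff[OF inv DERIV_const[of "of_real a"]] by simp
  have d2: "((\<lambda>w. upper_log (- 1 / w - of_real a)) has_field_derivative 1 / (- 1 / w - of_real a) * (1 / w\<^sup>2)) (at w)"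
   by (rule DERIV_chain2[OF upper_log_deriv[OF upper_half_plane_not_slit[OF i(2)]] inv2])
  have d3: "((\<lambda>w. Ln (1 + of_real a * w)) has_field_derivative of_real a / (1 + of_real a * w)) (at w)"
   using one_plus_not_nonpos[OF w, of a] by (auto intro!: derivative_eq_intros simp: divide_inverse)
  have "(D has_field_derivative 1 / (- 1 / w - of_real a) * (1 / w\<^sup>2) - 1 / (- 1 / w) * (1 / w\<^sup>2) - of_real a / (1 + of_real a * w)) (at w)"
   unfolding D_def by (intro DERIV_diff d1 d2 d3)
  also have "1 / (- 1 / w - of_real a) * (1 / w\<^sup>2) - 1 / (- 1 / w) * (1 / w\<^sup>2) - of_real a / (1 + of_real a * w) = 0"
  proof -
   let ?y = "1 + of_real a * w"
   have "1 / (- y / w) * (1 / w\<^sup>2) = - 1 / (y * w)" for y using w0(1) by (simp add: power2_eq_square)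
   from this[of ?y] have "1 / (- ?y / w) * (1 / w\<^sup>2) = - 1 / (?y * w)" .
   moreover have "1 / (- 1 / w) * (1 / w\<^sup>2) = - 1 / w" using w0 by (simp add: power2_eq_square)
   moreover have "- 1 / (?y * w) + 1 / w - of_real a / ?y = 0"
   proof -
    have "- 1 / (y * w) + 1 / w - b / y = (y - 1 - b * w) / (y * w)" if "y \<noteq> 0" for y b :: complex
     using that w0 by (simp add: field_simps)
    from this[OF w0(2)] show ?thesis by simp
   qed
   ultimately show ?thesis unfolding e by simp
  qed
  finally show "(D has_field_derivative 0) (at w within \<H>)" by (rule has_field_derivative_at_within)
 qed
 then obtain k where k: "\<And>w. w \<in> \<H> ==> D w = k" by blast
 have iU: "\<i> \<in> \<H>" by (simp add: upper_half_plane_def)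
 have "D \<i> = 0"
 proof -
  have "upper_log (- 1 / \<i> - of_real a) = upper_log (- 1 / \<i>) + Ln (1 + of_real a * \<i>)"
  proof (rule upper_log_unique)
   \<comment> \<open>\<open>?u\<close> has real part \<open>1\<close>, so its argument lies between
     \<open>- pi / 2\<close> and \<open>pi / 2\<close>; added to an angle between \<open>0\<close>
     and \<open>pi\<close> it stays in the range of \<open>upper_log\<close>.\<close>
   let ?u = "1 + of_real a * \<i>"
   have u: "?u \<noteq> 0" "0 < Re ?u" by (auto simp: complex_eq_iff)
   have "exp (upper_log (- 1 / \<i>) + Ln ?u) = (- 1 / \<i>) * ?u" using u(1) by (simp add: exp_add exp_upper_log)
   also have "\<dots> = - 1 / \<i> - of_real a" by (simp add: field_simps)
   finally show "exp (upper_log (- 1 / \<i>) + Ln ?u) = - 1 / \<i> - of_real a" .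
   have "\<bar>Im (Ln ?u)\<bar> < pi / 2" using Re_Ln_pos_lt[OF u(1)] u(2) by simp
   then show "- (pi / 2) < Im (upper_log (- 1 / \<i>) + Ln ?u)" "Im (upper_log (- 1 / \<i>) + Ln ?u) \<le> 3 * pi / 2"
    using Im_upper_log_upper[OF minus_inverse_upper[OF iU]] by auto
  qed
  then show ?thesis by (simp add: D_def)
 qed
 then have "D w = 0" using k[OF w] k[OF iU] by simp
 then show ?thesis by (simp add: D_def algebra_simps)
qed

definition infinity_factor :: "nat => (nat => real) => complex => (nat => real) => complex => complex" where
 "infinity_factor n \<beta> c zs w = c * cis (- pi * (\<Sum>k=1..n. \<beta> k)) * (\<Prod>k=1..n. exp (of_real (- \<beta> k) * Ln (1 + of_real (zs k) * w)))"

text \<open>The derivative \<open>1 / w^2\<close> of \<open>- 1 / w\<close> contributes the exponent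
  \<open>-2\<close>, the vertices together contribute the sum of the \<open>\<beta> k\<close>. Hence
  infinity behaves like a vertex whose exponent is \<open>2\<close> minus this sum, with regular
  factor \<open>infinity_factor\<close>.\<close>

lemma slit_integrand_at_infinity:
 assumes w: "w \<in> \<H>"
 shows "slit_integrand n \<beta> c zs (- 1 / w) * (1 / w\<^sup>2) = upper_pow w (- (2 - (\<Sum>k=1..n. \<beta> k))) * infinity_factor n \<beta> c zs w"
proof -
 let ?B = "\<Sum>k=1..n. \<beta> k"
 have w0: "w \<noteq> 0" using w by (auto simp: upper_half_plane_def)
 have "(\<Prod>k=1..n. upper_pow (- 1 / w - of_real (zs k)) (- \<beta> k)) =
  (\<Prod>k=1..n. exp (- of_real (\<beta> k) * (\<i> * pi - upper_log w)) * exp (of_real (- \<beta> k) * Ln (1 + of_real (zs k) * w)))"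
  by (intro prod.cong refl) (simp only: upper_pow_def upper_log_at_infinity[OF w] upper_log_minus_inverse[OF w] distrib_left exp_add of_real_minus)
 also have "\<dots> = (\<Prod>k=1..n. exp (- of_real (\<beta> k) * (\<i> * pi - upper_log w))) * (\<Prod>k=1..n. exp (of_real (- \<beta> k) * Ln (1 + of_real (zs k) * w)))"
  by (rule prod.distrib)
 also have "(\<Prod>k=1..n. exp (- of_real (\<beta> k) * (\<i> * pi - upper_log w))) = exp (- of_real ?B * (\<i> * pi - upper_log w))"
  by (simp add: exp_sum[symmetric] sum_negf sum_distrib_right)
 also have "\<dots> = cis (- pi * ?B) * exp (of_real ?B * upper_log w)"
  by (simp add: cis_conv_exp exp_add[symmetric] algebra_simps)
 finally have p: "(\<Prod>k=1..n. upper_pow (- 1 / w - of_real (zs k)) (- \<beta> k)) = cis (- pi * ?B) * exp (of_real ?B * upper_log w) * (\<Prod>k=1..n. exp (of_real (- \<beta> k) * Ln (1 + of_real (zs k) * w)))" .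
 have "upper_pow w (- (2 - ?B)) = exp (of_real ?B * upper_log w) / (exp (upper_log w))\<^sup>2"
  by (simp add: upper_pow_def exp_double[symmetric] exp_diff[symmetric] algebra_simps)
 also have "exp (upper_log w) = w" using w0 by (rule exp_upper_log)
 finally have q: "upper_pow w (- (2 - ?B)) = exp (of_real ?B * upper_log w) / w\<^sup>2" .
 show ?thesis unfolding slit_integrand_def p q infinity_factor_def by simp
qed

lemma half_plane_infinity_eventually:
 "eventually P half_plane_infinity \<longleftrightarrow> (\<exists>b. \<forall>z\<in>upper_half_plane. b \<le> norm z --> P z)"
 unfolding half_plane_infinity_def eventually_inf_principal eventually_at_infinity by auto

lemma filterlim_minus_inverse:
 "filterlim (\<lambda>z. - 1 / z) (at 0 within \<H>) half_plane_infinity"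
 unfolding filterlim_at
proof (intro conjI)
 show "\<forall>\<^sub>F z in half_plane_infinity. - 1 / z \<in> \<H> \<and> - 1 / z \<noteq> 0"
  unfolding half_plane_infinity_eventually
  using minus_inverse_upper by (intro exI[of _ 0]) (auto simp: upper_half_plane_def)
 show "((\<lambda>z. - 1 / z) \<longlongrightarrow> 0) half_plane_infinity"
 proof -
  have "((\<lambda>z::complex. - 1 / z) \<longlongrightarrow> 0) at_infinity"
   by (intro tendsto_divide_0[OF tendsto_const] filterlim_ident)
  then show ?thesis unfolding half_plane_infinity_def by (rule tendsto_mono[rotated]) simp
 qed
qed

lemma half_plane_infinity_nontrivial [simp]: "half_plane_infinity \<noteq> bot"
proof
 assume "half_plane_infinity = bot"
 then have "eventually (\<lambda>_. False) half_plane_infinity" by simp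
 then obtain b where b: "\<And>z. z \<in> \<H> ==> b \<le> norm z ==> False"
  unfolding half_plane_infinity_eventually by auto
 show False by (rule b[of "\<i> * of_real (\<bar>b\<bar> + 1)"]) (auto simp: upper_half_plane_def norm_mult simp del: of_real_add)
qed

lemma SC_infinity:
 fixes \<beta> :: "nat => real"
 assumes nz: "\<And>j. j \<in> {1..n} ==> zs j \<noteq> 0" and c: "c \<noteq> 0"
 defines "\<gamma> \<equiv> 2 - (\<Sum>k=1..n. \<beta> k)"
 shows "\<gamma> < 1 ==> \<phi>i integrable_on {0..1} ==> (\<And>v. v \<in> {0..1} ==> infinity_factor n \<beta> c zs (\<i> * of_real (v powr (1 / (1 - \<gamma>)))) = \<phi>i v) ==>
   (SC n \<beta> c zs \<longlongrightarrow> SC n \<beta> c zs \<i> - \<i> * cis (- pi * \<gamma> / 2) / of_real (1 - \<gamma>) * integral {0..1} \<phi>i) half_plane_infinity"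
  "1 \<le> \<gamma> ==> filterlim (SC n \<beta> c zs) at_infinity half_plane_infinity"
proof -
 define E where "E = (\<lambda>w. SC n \<beta> c zs (- 1 / w))"
 have E: "(E has_field_derivative upper_pow w (- \<gamma>) * infinity_factor n \<beta> c zs w) (at w)" if w: "w \<in> \<H>" for w
 proof -
  have "w \<noteq> 0" using w by (auto simp: upper_half_plane_def)
  then have inv: "((\<lambda>w. - 1 / w) has_field_derivative 1 / w\<^sup>2) (at w)" by (auto intro!: derivative_eq_intros simp: power2_eq_square)
  from DERIV_chain2[OF SC_has_field_derivative[of n zs _ \<beta> c, OF nz minus_inverse_upper[OF w]] inv]
  show ?thesis unfolding E_def slit_integrand_at_infinity[OF w] \<gamma>_def by simp
 qed
 have ln: "(\<lambda>w. Ln (1 + of_real a * w)) field_differentiable (at 0)" for a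
  unfolding field_differentiable_def by (rule exI) (auto intro!: derivative_eq_intros)
 have fd: "(\<lambda>w. exp (of_real (- \<beta> k) * Ln (1 + of_real (zs k) * w))) field_differentiable (at 0)" for k
  unfolding field_differentiable_def by (rule exI) (auto intro!: derivative_eq_intros)
 have "infinity_factor n \<beta> c zs field_differentiable (at 0)"
  unfolding infinity_factor_def
 proof (rule field_differentiable_mult[OF field_differentiable_const])
  show "(\<lambda>w. \<Prod>k=1..n. exp (of_real (- \<beta> k) * Ln (1 + of_real (zs k) * w))) field_differentiable (at 0)"
   by (rule field_differentiable_finite_prod) (simp, rule fd)
 qed
 then obtain d where d: "(infinity_factor n \<beta> c zs has_field_derivative d) (at 0)" unfolding field_differentiable_def by blast
 have 0: "infinity_factor n \<beta> c zs 0 \<noteq> 0" unfolding infinity_factor_def using c by auto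
 have CB1: "(E \<longlongrightarrow> E \<i> - \<i> * cis (- pi * \<gamma> / 2) / of_real (1 - \<gamma>) * integral {0..1} \<phi>i) (at 0 within \<H>)"
  if "\<gamma> < 1" "\<phi>i integrable_on {0..1}" "\<And>v. v \<in> {0..1} ==> infinity_factor n \<beta> c zs (\<i> * of_real (v powr (1 / (1 - \<gamma>)))) = \<phi>i v"
  by (rule corner_behaviour(1)[OF E d 0 that(1) that(2)]) (use that(3) in auto)
 have CB2: "filterlim E at_infinity (at 0 within \<H>)" if "1 \<le> \<gamma>"
  by (rule corner_behaviour(2)[OF E d 0 that]) auto
 have Einv: "E (- 1 / z) = SC n \<beta> c zs z" for z by (simp add: E_def)
 have Ei: "E \<i> = SC n \<beta> c zs \<i>" by (simp add: E_def divide_i)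
 show "(SC n \<beta> c zs \<longlongrightarrow> SC n \<beta> c zs \<i> - \<i> * cis (- pi * \<gamma> / 2) / of_real (1 - \<gamma>) * integral {0..1} \<phi>i) half_plane_infinity"
  if "\<gamma> < 1" "\<phi>i integrable_on {0..1}" "\<And>v. v \<in> {0..1} ==> infinity_factor n \<beta> c zs (\<i> * of_real (v powr (1 / (1 - \<gamma>)))) = \<phi>i v"
  using filterlim_compose[OF CB1[OF that] filterlim_minus_inverse] unfolding Einv Ei .
 show "filterlim (SC n \<beta> c zs) at_infinity half_plane_infinity" if "1 \<le> \<gamma>"
  using filterlim_compose[OF CB2[OF that] filterlim_minus_inverse] unfolding Einv .
qed

section \<open>The flow of the Schwarz--Christoffel maps\<close>

lemma upper_pow_path_derivative:
 assumes "(a has_vector_derivative a') (at r within S)" "a r \<notin> slit"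
 shows "((\<lambda>r. upper_pow (a r) b) has_vector_derivative upper_pow (a r) b * (b * a' / a r)) (at r within S)"
proof -
 have "((\<lambda>z. upper_pow z b) has_field_derivative b * upper_pow (a r) b / a r) (at (a r) within a ` S)"
  by (rule has_field_derivative_at_within[OF upper_pow_deriv[OF assms(2)]])
 from field_vector_diff_chain_within[OF assms(1) this] show ?thesis by (simp add: o_def mult_ac)
qed

lemma prod_log_derivative:
 fixes f :: "'i => real => 'b::real_normed_field"
 assumes "finite J" "\<And>j. j \<in> J ==> (f j has_vector_derivative f j r * l j) (at r within S)"
 shows "((\<lambda>r. \<Prod>j\<in>J. f j r) has_vector_derivative (\<Prod>j\<in>J. f j r) * (\<Sum>j\<in>J. l j)) (at r within S)"
 using assms
proof (induction J rule: finite_induct)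
 case empty
 then show ?case by simp
next
 case (insert j J)
 have "((\<lambda>r. f j r * (\<Prod>i\<in>J. f i r)) has_vector_derivative f j r * ((\<Prod>i\<in>J. f i r) * (\<Sum>i\<in>J. l i)) + f j r * l j * (\<Prod>i\<in>J. f i r)) (at r within S)"
  using insert by (intro has_vector_derivative_mult) auto
 then show ?case using insert by (simp add: algebra_simps)
qed

lemma upper_pow_continuous_on:
 assumes "continuous_on S a" "\<And>p. p \<in> S ==> a p \<notin> slit"
 shows "continuous_on S (\<lambda>p. upper_pow (a p) b)"
proof -
 have "continuous_on (- slit) (\<lambda>z. upper_pow z b)"
  using upper_pow_deriv by (intro continuous_at_imp_continuous_on) (auto intro: DERIV_isCont)
 then show ?thesis by (rule continuous_on_compose2[OF _ assms(1)]) (use assms(2) in auto)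
qed

lemma not_slit_nonzero: "z \<notin> slit ==> z \<noteq> 0"
 by (auto simp: slit_def)

text \<open>Differentiation under the integral sign; bases that stay off the slit keep the powers
  smooth. The time derivatives of all explicit corner formulas come from it.\<close>

lemma parametric_integral_derivative:
 fixes a a' :: "'i => real => real => complex" and b :: "'i => real"
 assumes J: "finite J" and U: "convex U" "r0 \<in> U"
  and slit: "\<And>j r y. j \<in> J ==> r \<in> U ==> y \<in> {0..1} ==> a j r y \<notin> slit"
  and d: "\<And>j r y. j \<in> J ==> r \<in> U ==> y \<in> {0..1} ==> ((\<lambda>r. a j r y) has_vector_derivative a' j r y) (at r within U)"
  and c: "\<And>j. j \<in> J ==> continuous_on (U \<times> {0..1}) (\<lambda>(r, y). a j r y)"
  and c': "\<And>j. j \<in> J ==> continuous_on (U \<times> {0..1}) (\<lambda>(r, y). a' j r y)"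
 shows "\<exists>d. ((\<lambda>r. integral {0..1} (\<lambda>y. \<Prod>j\<in>J. upper_pow (a j r y) (b j))) has_vector_derivative d) (at r0 within U)"
proof -
 have cp: "continuous_on (U \<times> {0..1}) (\<lambda>(r, y). \<Prod>j\<in>J. upper_pow (a j r y) (b j))"
  unfolding case_prod_beta'
  by (intro continuous_on_prod upper_pow_continuous_on) (use c slit in \<open>auto simp: case_prod_beta'\<close>)
 have int: "(\<lambda>y. \<Prod>j\<in>J. upper_pow (a j r y) (b j)) integrable_on {0..1}" if "r \<in> U" for r
 proof (rule integrable_continuous_interval)
  show "continuous_on {0..1} (\<lambda>y. \<Prod>j\<in>J. upper_pow (a j r y) (b j))"
  proof -
   have "continuous_on {0..1} (\<lambda>y. (\<lambda>p. \<Prod>j\<in>J. upper_pow (a j (fst p) (snd p)) (b j)) (r, y))"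
    by (rule continuous_on_compose2[OF cp[unfolded case_prod_beta']]) (use \<open>r \<in> U\<close> in \<open>auto intro: continuous_on_Pair continuous_on_const continuous_on_id\<close>)
   then show ?thesis by simp
  qed
 qed
 have "((\<lambda>r. integral (cbox 0 1) (\<lambda>y. \<Prod>j\<in>J. upper_pow (a j r y) (b j))) has_vector_derivative
   integral (cbox 0 1) ((\<lambda>r y. (\<Prod>j\<in>J. upper_pow (a j r y) (b j)) * (\<Sum>j\<in>J. b j * a' j r y / a j r y)) r0)) (at r0 within U)"
 proof (rule leibniz_rule_vector_derivative[OF _ _ _ U(2,1)])
  fix r y :: real assume ry: "r \<in> U" "y \<in> cbox 0 1"
  show "((\<lambda>r. \<Prod>j\<in>J. upper_pow (a j r y) (b j)) has_vector_derivative (\<Prod>j\<in>J. upper_pow (a j r y) (b j)) * (\<Sum>j\<in>J. b j * a' j r y / a j r y)) (at r within U)"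
   by (intro prod_log_derivative[OF J] upper_pow_path_derivative d slit) (use ry in auto)
 next
  show "(\<lambda>y. \<Prod>j\<in>J. upper_pow (a j r y) (b j)) integrable_on cbox 0 1" if "r \<in> U" for r using int[OF that] by simp
  show "continuous_on (U \<times> cbox 0 1) (\<lambda>(r, y). (\<Prod>j\<in>J. upper_pow (a j r y) (b j)) * (\<Sum>j\<in>J. b j * a' j r y / a j r y))"
   unfolding case_prod_beta'
   by (intro continuous_on_mult continuous_on_sum continuous_on_divide continuous_on_const cp[unfolded case_prod_beta', folded box_real(2)]
      c[unfolded case_prod_beta', folded box_real(2)] c'[unfolded case_prod_beta', folded box_real(2)])
     (use slit not_slit_nonzero in fastforce)+
 qed
 then show ?thesis unfolding box_real by (rule exI[where x = "integral _ _"])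
qed

text \<open>Scaling away the end point leaves the fixed interval \<open>[0, 1]\<close>, over which
  parameters can be differentiated.\<close>

lemma SC_eq_integral:
 assumes nz: "\<And>k. k \<in> {1..n} ==> zs k \<noteq> 0" and z: "z \<in> sc_domain n zs 0" "0 \<le> Im z"
 shows "SC n \<beta> c zs z = c * z * integral {0..1} (\<lambda>y. \<Prod>k=1..n. upper_pow (of_real y * z - of_real (zs k)) (- \<beta> k))"
proof -
 obtain g where g: "\<And>z. z \<in> sc_domain n zs 0 ==> (g has_field_derivative slit_integrand n \<beta> c zs z) (at z)"
  using slit_integrand_primitive[of n zs 0 \<beta> c] nz by blast
 have seg: "closed_segment 0 z \<subseteq> sc_domain n zs 0" using starlike_sc_domain[OF z(1)] by simp
 have "(slit_integrand n \<beta> c zs has_contour_integral g (pathfinish (linepath 0 z)) - g (pathstart (linepath 0 z))) (linepath 0 z)"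
  using seg by (intro contour_integral_primitive[where S = "sc_domain n zs 0"] valid_path_linepath)
   (auto intro: has_field_derivative_at_within g simp del: linepath_0)
 then have "(slit_integrand n \<beta> c zs has_contour_integral SC n \<beta> c zs z) (linepath 0 z)"
  using SC_eq_primitive[OF nz g z] by simp
 then have "((\<lambda>y. slit_integrand n \<beta> c zs (of_real y * z) * z) has_integral SC n \<beta> c zs z) {0..1}"
  unfolding has_contour_integral_linepath by (simp add: linepath_def scaleR_conv_of_real)
 then have "integral {0..1} (\<lambda>y. slit_integrand n \<beta> c zs (of_real y * z) * z) = SC n \<beta> c zs z"
  by (rule integral_unique)
 moreover have "(\<lambda>y. slit_integrand n \<beta> c zs (of_real y * z) * z) = (\<lambda>y. (c * z) * (\<Prod>k=1..n. upper_pow (of_real y * z - of_real (zs k)) (- \<beta> k)))"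
  by (simp add: slit_integrand_def mult_ac)
 ultimately show ?thesis by simp
qed

text \<open>Derivatives are computed on compact intervals before the lifetime, whereas the
  definitions ask for them within \<open>[0, \<infinity>)\<close>; near an inner point, or near
  \<open>0\<close> for intervals that start there, the two sets agree.\<close>

lemma at_within_subinterval:
 fixes s :: real
 assumes "s < b" "0 \<le> a" "a \<le> s" "a = 0 \<or> a < s"
 shows "at s within {a..b} = at s within {0..}"
proof (rule at_within_nhd[of _ "if a = 0 then {..<b} else {a<..<b}"])
 show "s \<in> (if a = 0 then {..<b} else {a<..<b})" using assms by auto
 show "{a..b} \<inter> (if a = 0 then {..<b} else {a<..<b}) - {s} = {0..} \<inter> (if a = 0 then {..<b} else {a<..<b}) - {s}"
  using assms by auto
qed auto

text \<open>One path before its collision time, as far as only the flow of the vertices is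
  concerned; the noise and \<open>\<kappa>\<close> come with \<open>sle_flow\<close>.\<close>

locale sc_flow =
 fixes n :: nat and \<beta> :: "nat => real" and c :: complex and W :: "real => real" and Z :: "nat => real => real" and \<sigma> :: ereal
 assumes c: "norm c = 1" and W0: "W 0 = 0" and \<sigma>0: "0 < \<sigma>"
  and W_cont: "continuous_on (interval_before \<sigma>) W"
  and Z_cont: "\<And>k. k \<in> {1..n} ==> continuous_on (interval_before \<sigma>) (Z k)"
  and Z_ne_W: "\<And>k t. k \<in> {1..n} ==> t \<in> interval_before \<sigma> ==> Z k t \<noteq> W t"
  and Z_inj: "\<And>t. t \<in> interval_before \<sigma> ==> inj_on (\<lambda>k. Z k t) {1..n}"
  and Z_eq: "\<And>k t. k \<in> {1..n} ==> t \<in> interval_before \<sigma> ==> Z k t = Z k 0 + integral {0..t} (\<lambda>s. 2 / (Z k s - W s))"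
begin

abbreviation I where "I \<equiv> interval_before \<sigma>"
abbreviation Zs where "Zs t \<equiv> (\<lambda>k. Z k t)"
abbreviation Zd where "Zd k t \<equiv> 2 / (Z k t - W t)"

lemma I0: "0 \<in> I"
 using \<sigma>0 by (simp add: interval_before_def zero_ereal_def[symmetric])

lemma I_sub: "t \<in> I ==> {0..t} \<subseteq> I" and I_nonneg: "t \<in> I ==> 0 \<le> t"
 by (auto simp: interval_before_def intro: order_le_less_trans[of "ereal _" "ereal t"])

lemma I_extend: "s \<in> I ==> \<exists>s'>s. s' \<in> I"
proof -
 assume s: "s \<in> I"
 have "ereal s < \<sigma>" "0 \<le> s" using s by (auto simp: interval_before_def)
 then obtain r where r: "ereal s < r" "r < \<sigma>" using dense by blast
 then obtain s' where "r = ereal s'" by (cases r) auto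
 then show ?thesis using r \<open>0 \<le> s\<close> by (auto simp: interval_before_def intro!: exI[of _ s'])
qed

lemma Zd_cont: "k \<in> {1..n} ==> continuous_on I (\<lambda>t. Zd k t)"
 using Z_ne_W by (intro continuous_intros Z_cont W_cont) auto

lemma Z_deriv:
 assumes k: "k \<in> {1..n}" and b: "b \<in> I" and t: "t \<in> {0..b}" and S: "S \<subseteq> {0..b}"
 shows "(Z k has_vector_derivative Zd k t) (at t within S)"
proof -
 have "((\<lambda>t. integral {0..t} (\<lambda>s. Zd k s)) has_vector_derivative Zd k t) (at t within {0..b})"
  by (rule integral_has_vector_derivative[OF continuous_on_subset[OF Zd_cont[OF k] I_sub[OF b]] t])
 then have "((\<lambda>t. Z k 0 + integral {0..t} (\<lambda>s. Zd k s)) has_vector_derivative Zd k t) (at t within {0..b})"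
  by (auto intro!: derivative_eq_intros)
 then have "(Z k has_vector_derivative Zd k t) (at t within {0..b})"
 proof (rule has_vector_derivative_transform[OF t, rotated])
  show "Z k x = Z k 0 + integral {0..x} (\<lambda>s. Zd k s)" if "x \<in> {0..b}" for x
   using Z_eq[OF k] I_sub[OF b] that by auto
 qed
 then show ?thesis using S by (rule has_vector_derivative_within_subset)
qed

text \<open>A change of sides would force \<open>Z k = W\<close> at some earlier time.\<close>

lemma Z_side:
 assumes k: "k \<in> {1..n}" and t: "t \<in> I"
 shows "0 < Z k 0 ==> W t < Z k t" "Z k 0 < 0 ==> Z k t < W t"
proof -
 have c: "continuous_on {0..t} (\<lambda>s. Z k s - W s)"
  using I_sub[OF t] by (intro continuous_intros continuous_on_subset[OF Z_cont[OF k]] continuous_on_subset[OF W_cont])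
 have nz: "s \<in> {0..t} ==> Z k s - W s \<noteq> 0" for s using Z_ne_W[OF k] I_sub[OF t] by auto
 note t0 = I_nonneg[OF t]
 show "W t < Z k t" if "0 < Z k 0"
 proof (rule ccontr)
  assume "\<not> W t < Z k t"
  then have "\<exists>s\<ge>0. s \<le> t \<and> Z k s - W s = 0" using that W0 t0 c by (intro IVT2') auto
  then show False using nz by auto
 qed
 show "Z k t < W t" if "Z k 0 < 0"
 proof (rule ccontr)
  assume "\<not> Z k t < W t"
  then have "\<exists>s\<ge>0. s \<le> t \<and> Z k s - W s = 0" using that W0 t0 c by (intro IVT') auto
  then show False using nz by auto
 qed
qed

lemma Z0_ne: "k \<in> {1..n} ==> Z k 0 \<noteq> 0"
 using Z_ne_W[OF _ I0] W0 by auto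

text \<open>The sign of the velocity \<open>2 / (Z k - W)\<close> tells on which side of
  \<open>W\<close> the vertex lies.\<close>

lemma Z_mono:
 assumes k: "k \<in> {1..n}" and t: "t \<in> I" and s: "0 \<le> s" "s \<le> t"
 shows "0 < Z k 0 ==> Z k s \<le> Z k t" "Z k 0 < 0 ==> Z k t \<le> Z k s"
proof -
 have d: "(Z k has_real_derivative Zd k x) (at x within {s..t})" if "x \<in> {s..t}" for x
  using Z_deriv[OF k t, of x "{s..t}"] that s by (auto simp: has_real_derivative_iff_has_vector_derivative)
 have sd: "x \<in> I" if "x \<in> {s..t}" for x using that s I_sub[OF t] by auto
 show "Z k s \<le> Z k t" if p: "0 < Z k 0"
 proof (rule DERIV_nonneg_imp_increasing_open[OF s(2)])
  show "\<exists>y. DERIV (Z k) x :> y \<and> 0 \<le> y" if "s < x" "x < t" for x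
   using d[of x] that Z_side(1)[OF k sd[of x] p] by (intro exI[of _ "Zd k x"]) (auto simp: at_within_Icc_at)
  show "continuous_on {s..t} (Z k)" using sd by (intro continuous_on_subset[OF Z_cont[OF k]]) auto
 qed
 show "Z k t \<le> Z k s" if p: "Z k 0 < 0"
 proof (rule DERIV_nonpos_imp_decreasing_open[OF s(2)])
  show "\<exists>y. DERIV (Z k) x :> y \<and> y \<le> 0" if "s < x" "x < t" for x
   using d[of x] that Z_side(2)[OF k sd[of x] p] by (intro exI[of _ "Zd k x"]) (auto simp: at_within_Icc_at divide_nonneg_neg)
  show "continuous_on {s..t} (Z k)" using sd by (intro continuous_on_subset[OF Z_cont[OF k]]) auto
 qed
qed

text \<open>Vertices move away from \<open>0\<close> and never reach it, so the base point of the
  integral is admissible at all times.\<close>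

lemma Z_sign: assumes k: "k \<in> {1..n}" and t: "t \<in> I" shows "0 < Z k t \<longleftrightarrow> 0 < Z k 0" "Z k t \<noteq> 0"
proof -
 consider "0 < Z k 0" | "Z k 0 < 0" using Z0_ne[OF k] by linarith
 then have "(0 < Z k t \<longleftrightarrow> 0 < Z k 0) \<and> Z k t \<noteq> 0"
  using Z_mono[OF k t order_refl I_nonneg[OF t]] by cases auto
 then show "0 < Z k t \<longleftrightarrow> 0 < Z k 0" "Z k t \<noteq> 0" by auto
qed

lemma W_free: "t \<in> I ==> W t \<in> free_interval n (Zs t) 0"
 unfolding free_interval_def mem_Collect_eq
proof (intro ballI conjI impI)
 fix k assume t: "t \<in> I" and k: "k \<in> {1..n}"
 show "0 < Z k t ==> W t < Z k t" using Z_sign(1)[OF k t] Z_side(1)[OF k t] by auto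
 show "Z k t < 0 ==> Z k t < W t" using Z_sign(1)[OF k t] Z_side(2)[OF k t] Z0_ne[OF k] by (cases "0 < Z k 0") auto
qed

text \<open>The vertices recede from \<open>0\<close>. Therefore earlier positions of
  \<open>W\<close> remain admissible arguments of \<open>SC\<close> at later times, and the
  expansion of \<open>U\<close> makes use of that.\<close>

lemma free_mono:
 assumes t: "t \<in> I" and s: "0 \<le> s" "s \<le> t" shows "free_interval n (Zs s) 0 \<subseteq> free_interval n (Zs t) 0"
proof
 fix x assume x: "x \<in> free_interval n (Zs s) 0"
 have sI: "s \<in> I" using I_sub[OF t] s by auto
 show "x \<in> free_interval n (Zs t) 0"
  unfolding free_interval_def mem_Collect_eq
 proof (intro ballI conjI impI)
  fix k assume k: "k \<in> {1..n}"
  show "x < Z k t" if "0 < Z k t"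
  proof -
   have "0 < Z k 0" using that Z_sign(1)[OF k t] by simp
   then have "Z k s \<le> Z k t" "0 < Z k s" using Z_mono(1)[OF k t s] Z_sign(1)[OF k sI] by auto
   then show ?thesis using x k by (auto simp: free_interval_def)
  qed
  show "Z k t < x" if "Z k t < 0"
  proof -
   have "Z k 0 < 0" using that Z_sign(1)[OF k t] Z0_ne[OF k] by (cases "0 < Z k 0") auto
   moreover have "Z k s < 0" using calculation Z_sign[OF k sI] by (metis linorder_neqE_linordered_idom order_less_asym)
   ultimately have "Z k t \<le> Z k s" "Z k s < 0" using Z_mono(2)[OF k t s] by auto
   then show ?thesis using x k by (auto simp: free_interval_def)
  qed
 qed
qed

lemma Z_of_real_derivative:
 assumes "k \<in> {1..n}" "b \<in> I" "t \<in> {0..b}"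
 shows "((\<lambda>r. complex_of_real (Z k r)) has_vector_derivative complex_of_real (Zd k t)) (at t within {0..b})"
 using Z_deriv[OF assms(1-3) order_refl]
 by (intro has_vector_derivative_of_real) (simp add: has_real_derivative_iff_has_vector_derivative)

lemma Z_continuous_upto:
 assumes "k \<in> {1..n}" "b \<in> I"
 shows "continuous_on ({0..b} \<times> S) (\<lambda>p. Z k (fst p))" "continuous_on ({0..b} \<times> S) (\<lambda>p. Zd k (fst p))"
proof -
 have 1: "fst ` ({0..b} \<times> S) \<subseteq> I" using I_sub[OF assms(2)] by auto
 show "continuous_on ({0..b} \<times> S) (\<lambda>p. Z k (fst p))" by (rule continuous_on_compose2[OF Z_cont[OF assms(1)] _ 1]) (intro continuous_intros)
 show "continuous_on ({0..b} \<times> S) (\<lambda>p. Zd k (fst p))" by (rule continuous_on_compose2[OF Zd_cont[OF assms(1)] _ 1]) (intro continuous_intros)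
qed

lemma SC_path_derivative:
 assumes b: "b \<in> I" and r0: "r0 \<in> {0..b}"
  and \<zeta>: "\<And>r. r \<in> {0..b} ==> \<zeta> r \<in> sc_domain n (Zs r) 0 \<and> 0 \<le> Im (\<zeta> r)"
  and d: "\<And>r. r \<in> {0..b} ==> (\<zeta> has_vector_derivative \<zeta>' r) (at r within {0..b})" and c': "continuous_on {0..b} \<zeta>'"
 shows "\<exists>x. ((\<lambda>r. SC n \<beta> c (Zs r) (\<zeta> r)) has_vector_derivative x) (at r0 within {0..b})"
proof -
 let ?P = "\<lambda>r. integral {0..1} (\<lambda>y. \<Prod>k=1..n. upper_pow (of_real y * \<zeta> r - of_real (Z k r)) (- \<beta> k))"
 note bI = subsetD[OF I_sub[OF b]]
 have \<zeta>c: "continuous_on {0..b} \<zeta>" unfolding continuous_on_eq_continuous_within by (intro ballI has_vector_derivative_continuous[OF d])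
 have "\<exists>x. (?P has_vector_derivative x) (at r0 within {0..b})"
 proof (rule parametric_integral_derivative[where a' = "\<lambda>k r y. of_real y * \<zeta>' r - of_real (Zd k r)"])
  show "convex {0..b}" "r0 \<in> {0..b}" "finite {1..n}" using r0 by auto
  fix k assume k: "k \<in> {1..n}"
  show "of_real y * \<zeta> r - of_real (Z k r) \<notin> slit" if r: "r \<in> {0..b}" and y: "y \<in> {0..1}" for r y
  proof -
   have "of_real y * \<zeta> r \<in> closed_segment 0 (\<zeta> r)"
    using y by (auto simp: closed_segment_def scaleR_conv_of_real intro!: exI[of _ y])
   then have "of_real y * \<zeta> r \<in> sc_domain n (Zs r) 0" using starlike_sc_domain[of "\<zeta> r" n "Zs r" 0] \<zeta>[OF r] by auto
   then have "of_real y * \<zeta> r \<notin> slits n (Zs r)" using sc_domain_disjoint[of n "Zs r" 0] Z_sign(2)[OF _ bI[OF r]] by blast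
   then show ?thesis using k by (auto simp: slits_iff)
  qed
  show "((\<lambda>r. of_real y * \<zeta> r - of_real (Z k r)) has_vector_derivative of_real y * \<zeta>' r - of_real (Zd k r)) (at r within {0..b})"
   if r: "r \<in> {0..b}" for r y
   by (intro has_vector_derivative_diff has_vector_derivative_mult_right d[OF r] Z_of_real_derivative[OF k b r])
  have zc: "continuous_on ({0..b} \<times> {0..1::real}) (\<lambda>x. \<zeta> (fst x))" "continuous_on ({0..b} \<times> {0..1::real}) (\<lambda>x. \<zeta>' (fst x))"
   by (auto intro!: continuous_on_compose2[OF \<zeta>c] continuous_on_compose2[OF c'] continuous_on_fst continuous_on_id)
  show "continuous_on ({0..b} \<times> {0..1}) (\<lambda>(r, y). of_real y * \<zeta> r - of_real (Z k r))"
   "continuous_on ({0..b} \<times> {0..1}) (\<lambda>(r, y). of_real y * \<zeta>' r - of_real (Zd k r))"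
   unfolding case_prod_beta' by (intro continuous_intros zc Z_continuous_upto[OF k b])+
 qed
 then obtain x where x: "(?P has_vector_derivative x) (at r0 within {0..b})" ..
 have "((\<lambda>r. c * \<zeta> r * ?P r) has_vector_derivative c * \<zeta> r0 * x + c * \<zeta>' r0 * ?P r0) (at r0 within {0..b})"
  by (intro has_vector_derivative_mult x has_vector_derivative_mult_right d r0)
 then have "((\<lambda>r. SC n \<beta> c (Zs r) (\<zeta> r)) has_vector_derivative c * \<zeta> r0 * x + c * \<zeta>' r0 * ?P r0) (at r0 within {0..b})"
  by (rule has_vector_derivative_transform[OF r0, rotated])
    (use SC_eq_integral[of n "Zs _" _ \<beta> c] Z_sign(2)[OF _ bI] \<zeta> in auto)
 then show ?thesis ..
qed

end

section \<open>The real form of the maps around the base point\<close>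

lemma abs_powr_derivative:
 fixes x b :: real
 assumes "x \<noteq> 0"
 shows "((\<lambda>x. \<bar>x\<bar> powr b) has_real_derivative \<bar>x\<bar> powr b * (b / x)) (at x)"
proof (cases "0 < x")
 case True
 have "((\<lambda>x. x powr b) has_real_derivative b * x powr (b - 1)) (at x)"
  using True by (rule has_real_derivative_powr)
 then have "((\<lambda>x. x powr b) has_real_derivative \<bar>x\<bar> powr b * (b / x)) (at x)"
  using True by (simp add: powr_diff mult_ac)
 then show ?thesis
  by (rule has_field_derivative_transform_within_open[of _ _ _ "{0<..}"]) (use True in auto)
next
 case False
 then have x: "x < 0" using assms by simp
 have "((\<lambda>x. (- x) powr b) has_real_derivative b * (- x) powr (b - 1) * (- 1)) (at x)"
  by (rule DERIV_chain2[OF has_real_derivative_powr]) (use x in \<open>auto intro!: derivative_eq_intros\<close>)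
 then have "((\<lambda>x. (- x) powr b) has_real_derivative \<bar>x\<bar> powr b * (b / x)) (at x)"
  using x by (simp add: powr_diff divide_simps mult_ac)
 then show ?thesis
  by (rule has_field_derivative_transform_within_open[of _ _ _ "{..<0}"]) (use x in auto)
qed

text \<open>The rate of change of the density when each difference \<open>x - zs k\<close> moves
  with velocity \<open>v k\<close>: all \<open>v k = 1\<close> give the derivative in space, the
  negative velocities of the vertices give the derivative in time.\<close>

definition density_log :: "nat => (nat => real) => (nat => real) => (nat => real) => real => real" where
 "density_log n \<beta> zs v x = density_fn n \<beta> zs x * (\<Sum>k=1..n. - \<beta> k * v k / (x - zs k))"

lemma density_fn_path_derivative:
 assumes \<zeta>: "(\<zeta> has_vector_derivative \<zeta>') (at r within U)"
  and Zp: "\<And>k. k \<in> {1..n} ==> (Zp k has_vector_derivative Zp' k) (at r within U)"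
  and ne: "\<And>k. k \<in> {1..n} ==> Zp k r \<noteq> \<zeta> r"
 shows "((\<lambda>r. density_fn n \<beta> (\<lambda>k. Zp k r) (\<zeta> r)) has_vector_derivative
   density_log n \<beta> (\<lambda>k. Zp k r) (\<lambda>k. \<zeta>' - Zp' k) (\<zeta> r)) (at r within U)"
 unfolding density_fn_def density_log_def
proof (rule prod_log_derivative)
 fix k assume k: "k \<in> {1..n}"
 have ne': "\<zeta> r - Zp k r \<noteq> 0" using ne[OF k] by simp
 have d: "((\<lambda>r. \<zeta> r - Zp k r) has_vector_derivative \<zeta>' - Zp' k) (at r within U)"
  by (intro has_vector_derivative_diff \<zeta> Zp k)
 show "((\<lambda>r. \<bar>\<zeta> r - Zp k r\<bar> powr (- \<beta> k)) has_vector_derivative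
   \<bar>\<zeta> r - Zp k r\<bar> powr (- \<beta> k) * (- \<beta> k * (\<zeta>' - Zp' k) / (\<zeta> r - Zp k r))) (at r within U)"
  using DERIV_chain2[OF abs_powr_derivative[OF ne', of "- \<beta> k"] d[folded has_real_derivative_iff_has_vector_derivative]]
  by (simp add: has_real_derivative_iff_has_vector_derivative[symmetric] mult_ac)
qed simp

lemma density_fn_continuous_on:
 assumes "continuous_on S \<zeta>" "\<And>k. k \<in> {1..n} ==> continuous_on S (Zp k)"
  and "\<And>p k. p \<in> S ==> k \<in> {1..n} ==> Zp k p \<noteq> \<zeta> p"
 shows "continuous_on S (\<lambda>p. density_fn n \<beta> (\<lambda>k. Zp k p) (\<zeta> p))"
 unfolding density_fn_def
 by (intro continuous_on_prod continuous_on_powr continuous_on_rabs continuous_on_diff continuous_on_const assms ballI) (use assms(3) in fastforce)+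

lemma density_log_continuous_on:
 assumes "continuous_on S \<zeta>" "\<And>k. k \<in> {1..n} ==> continuous_on S (Zp k)" "\<And>k. k \<in> {1..n} ==> continuous_on S (v k)"
  and "\<And>p k. p \<in> S ==> k \<in> {1..n} ==> Zp k p \<noteq> \<zeta> p"
 shows "continuous_on S (\<lambda>p. density_log n \<beta> (\<lambda>k. Zp k p) (\<lambda>k. v k p) (\<zeta> p))"
 unfolding density_log_def
 by (intro continuous_on_mult density_fn_continuous_on continuous_on_sum continuous_on_divide continuous_on_const continuous_on_diff assms ballI) (use assms(4) in fastforce)+

text \<open>\<open>SC\<close> without its phase: the integral of the density from \<open>0\<close>
  to \<open>x\<close>, scaled to \<open>[0, 1]\<close>.\<close>

definition real_sc :: "nat => (nat => real) => (nat => real) => real => real" where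
 "real_sc n \<beta> zs x = x * integral {0..1} (\<lambda>y. density_fn n \<beta> zs (y * x))"

lemma free_interval_scale:
 assumes "x \<in> free_interval n zs 0" "y \<in> {0..1::real}" shows "y * x \<in> free_interval n zs 0"
proof -
 have "(1 - y) *\<^sub>R 0 + y *\<^sub>R x \<in> free_interval n zs 0"
  using assms by (intro convexD[OF convex_free_interval free_interval_self]) auto
 then show ?thesis by simp
qed

lemma SC_real:
 assumes nz: "\<And>k. k \<in> {1..n} ==> zs k \<noteq> 0" and x: "x \<in> free_interval n zs 0"
 shows "boundary_value (SC n \<beta> c zs) x = phase n \<beta> c zs 0 * complex_of_real (real_sc n \<beta> zs x)"
proof -
 obtain g where g: "\<And>z. z \<in> sc_domain n zs 0 ==> (g has_field_derivative slit_integrand n \<beta> c zs z) (at z)"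
  "\<And>z. z \<in> \<H> ==> SC n \<beta> c zs z = g z"
  "\<And>y. y \<in> free_interval n zs 0 ==> (SC n \<beta> c zs \<longlongrightarrow> g (complex_of_real y)) (at (complex_of_real y) within \<H>)"
  using SC_local_primitive[of n zs 0 \<beta> c] nz by metis
 have i: "\<i> \<in> \<H>" by (simp add: upper_half_plane_def)
 have "SC n \<beta> c zs \<i> = g \<i> - g 0"
  by (rule SC_eq_primitive[OF nz g(1)]) (use i in \<open>auto simp: sc_domain_def upper_half_plane_def\<close>)
 then have g0: "g 0 = 0" using g(2)[OF i] by simp
 have xd: "complex_of_real x \<in> sc_domain n zs 0" using x by (simp add: sc_domain_def)
 have "boundary_value (SC n \<beta> c zs) x = g (complex_of_real x)" by (rule boundary_value_eqI[OF g(3)[OF x]])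
 also have "\<dots> = SC n \<beta> c zs (complex_of_real x)" using SC_eq_primitive[OF nz g(1) xd] g0 by simp
 also have "\<dots> = complex_of_real x * integral {0..1} (\<lambda>y. slit_integrand n \<beta> c zs (complex_of_real (y * x)))"
  by (subst SC_eq_integral[OF nz xd]) (auto simp: slit_integrand_def)
 also have "integral {0..1} (\<lambda>y. slit_integrand n \<beta> c zs (complex_of_real (y * x))) =
   integral {0..1} (\<lambda>y. phase n \<beta> c zs 0 * complex_of_real (density_fn n \<beta> zs (y * x)))"
  using x nz by (intro integral_cong) (metis (no_types) slit_integrand_of_real phase_free_interval free_interval_not_vertex free_interval_scale)
 also have "\<dots> = phase n \<beta> c zs 0 * complex_of_real (integral {0..1} (\<lambda>y. density_fn n \<beta> zs (y * x)))"
 proof -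
  have "(\<lambda>y. density_fn n \<beta> zs (y * x)) integrable_on {0..1}"
  proof (rule integrable_continuous_interval)
   show "continuous_on {0..1} (\<lambda>y. density_fn n \<beta> zs (y * x))"
    using free_interval_scale[OF x] free_interval_not_vertex[of _ n zs 0] nz
    by (intro density_fn_continuous_on continuous_intros) metis
  qed
  then have "((\<lambda>y. complex_of_real (density_fn n \<beta> zs (y * x))) has_integral complex_of_real (integral {0..1} (\<lambda>y. density_fn n \<beta> zs (y * x)))) {0..1}"
   by (intro has_integral_of_real integrable_integral)
  then show ?thesis by (intro integral_unique has_integral_mult_right)
 qed
 finally show ?thesis by (simp add: real_sc_def mult_ac)
qed

text \<open>Taken over from the complex boundary derivative with \<open>c = 1\<close>;
  multiplication by the conjugate removes the unimodular phase.\<close>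

lemma real_sc_derivative:
 assumes nz: "\<And>k. k \<in> {1..n} ==> zs k \<noteq> 0" and x: "x \<in> free_interval n zs 0"
 shows "(real_sc n \<beta> zs has_real_derivative density_fn n \<beta> zs x) (at x)"
proof -
 have xv: "\<And>k. k \<in> {1..n} ==> zs k \<noteq> x" using free_interval_not_vertex[OF x] nz by auto
 define C where "C = phase n \<beta> 1 zs 0"
 have C: "norm C = 1" by (simp add: C_def norm_phase)
 have "phase n \<beta> 1 zs x = C" unfolding C_def by (rule phase_free_interval[OF x nz])
 then have "(boundary_value (SC n \<beta> 1 zs) has_vector_derivative C * complex_of_real (density_fn n \<beta> zs x)) (at x)"
  using SC_boundary(2)[of n zs x \<beta> 1, OF nz xv] slit_integrand_of_real[of n zs x \<beta> 1, OF xv] by simp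
 then have "((\<lambda>y. C * complex_of_real (real_sc n \<beta> zs y)) has_vector_derivative C * complex_of_real (density_fn n \<beta> zs x)) (at x)"
  by (rule has_vector_derivative_transform_within_open[of _ _ _ "free_interval n zs 0"])
    (use x SC_real[of n zs _ \<beta> 1, OF nz] C_def in \<open>auto simp: open_free_interval\<close>)
 then have "((\<lambda>y. cnj C * (C * complex_of_real (real_sc n \<beta> zs y))) has_vector_derivative cnj C * (C * complex_of_real (density_fn n \<beta> zs x))) (at x)"
  by (rule has_vector_derivative_mult_right)
 moreover have "cnj C * (C * w) = w" for w
  using C by (metis complex_norm_square mult.assoc mult.commute mult_1 of_real_1 one_power2)
 ultimately have "((\<lambda>y. complex_of_real (real_sc n \<beta> zs y)) has_vector_derivative complex_of_real (density_fn n \<beta> zs x)) (at x)" by simp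
 from bounded_linear.has_vector_derivative[OF bounded_linear_Re this]
 show ?thesis by (simp add: has_real_derivative_iff_has_vector_derivative)
qed

context sc_flow
begin

text \<open>The common phase of all maps on the interval around \<open>W\<close>; it is constant in
  time because no vertex crosses \<open>0\<close>.\<close>

definition C where "C = phase n \<beta> c (Zs 0) 0"
text \<open>The region of space-time on which \<open>SC\<close> is real up to the factor
  \<open>C\<close>. By \<open>free_mono\<close>, a point stays in it at all later times before
  \<open>\<sigma>\<close>.\<close>

definition D where "D = (SIGMA s:I. free_interval n (Zs s) 0)"
text \<open>The time derivative of \<open>real_sc\<close> at the fixed point
  \<open>x\<close>.\<close>

definition Gs where "Gs s x = x * integral {0..1} (\<lambda>y. density_log n \<beta> (Zs s) (\<lambda>k. - Zd k s) (y * x))"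

lemma D_iff: "(s, x) \<in> D \<longleftrightarrow> s \<in> I \<and> x \<in> free_interval n (Zs s) 0" by (simp add: D_def)

lemma D_not_vertex: "(s, x) \<in> D ==> k \<in> {1..n} ==> Z k s \<noteq> x"
 using free_interval_not_vertex[of x n "Zs s" 0 k] Z_sign(2) by (auto simp: D_iff)

lemma D_scale: "(s, x) \<in> D ==> y \<in> {0..1} ==> (s, y * x) \<in> D"
 using free_interval_scale by (auto simp: D_iff)

lemma D_mono: "(s, x) \<in> D ==> s \<le> t ==> t \<in> I ==> (t, x) \<in> D"
 using free_mono[of t s] I_nonneg by (auto simp: D_iff)

lemma D_W: "s \<in> I ==> (s, W s) \<in> D"
 using W_free by (simp add: D_iff)

lemma D_convex: "(s, x) \<in> D ==> (s, y) \<in> D ==> closed_segment x y \<subseteq> Pair s -` D"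
proof -
 assume a: "(s, x) \<in> D" "(s, y) \<in> D"
 have "closed_segment x y \<subseteq> free_interval n (Zs s) 0"
  by (rule closed_segment_subset[OF _ _ convex_free_interval]) (use a in \<open>simp_all only: D_iff\<close>)
 then show "closed_segment x y \<subseteq> Pair s -` D" using a by (auto simp only: D_iff vimage_def)
qed

lemma phase_0_const: "s \<in> I ==> phase n \<beta> c (Zs s) 0 = C"
 unfolding C_def phase_def using Z_sign(1) by (intro arg_cong2[of _ _ _ _ "(*)"] prod.cong) auto

lemma phase_const: "(s, x) \<in> D ==> phase n \<beta> c (Zs s) x = C"
 using phase_free_interval[of x n "Zs s" 0] phase_0_const Z_sign(2) by (auto simp: D_iff)

lemma boundary_value_SC: "(s, x) \<in> D ==> boundary_value (SC n \<beta> c (Zs s)) x = C * of_real (real_sc n \<beta> (Zs s) x)"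
 using SC_real[of n "Zs s" x \<beta> c] phase_0_const Z_sign(2) by (auto simp: D_iff)

lemma D_integrand_continuous:
 shows "continuous_on (D \<times> {0..1}) (\<lambda>(p, y). density_log n \<beta> (Zs (fst p)) (\<lambda>k. - Zd k (fst p)) (y * snd p))"
proof -
 have 1: "fst ` fst ` (D \<times> {0..1::real}) \<subseteq> I" by (auto simp: D_def)
 show ?thesis unfolding case_prod_beta'
 proof (rule density_log_continuous_on)
  fix k assume k: "k \<in> {1..n}"
  show "continuous_on (D \<times> {0..1}) (\<lambda>x. Z k (fst (fst x)))"
   by (rule continuous_on_compose2[OF Z_cont[OF k]]) (use 1 in \<open>auto intro!: continuous_intros\<close>)
  show "continuous_on (D \<times> {0..1}) (\<lambda>x. - Zd k (fst (fst x)))"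
   by (rule continuous_on_minus, rule continuous_on_compose2[OF Zd_cont[OF k]]) (use 1 in \<open>auto intro!: continuous_intros\<close>)
  show "\<And>p. p \<in> D \<times> {0..1} ==> Z k (fst (fst p)) \<noteq> snd p * snd (fst p)"
   using D_not_vertex[OF D_scale k] by auto
 qed (auto intro!: continuous_intros)
qed

lemma Gs_continuous: "continuous_on D (\<lambda>p. Gs (fst p) (snd p))"
proof -
 have "continuous_on D (\<lambda>p. integral (cbox 0 1) (\<lambda>y. density_log n \<beta> (Zs (fst p)) (\<lambda>k. - Zd k (fst p)) (y * snd p)))"
  by (rule integral_continuous_on_param) (use D_integrand_continuous in simp)
 then show ?thesis unfolding Gs_def by (auto intro!: continuous_intros)
qed

lemma real_sc_time_derivative:
 assumes b: "b \<in> I" and x: "(a, x) \<in> D" and s: "s \<in> {a..b}"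
 shows "((\<lambda>s. real_sc n \<beta> (Zs s) x) has_vector_derivative Gs s x) (at s within {a..b})"
proof -
 have a: "0 \<le> a" using x I_nonneg by (auto simp: D_iff)
 have DD: "(r, y * x) \<in> D" if "r \<in> {a..b}" "y \<in> {0..1}" for r y
  using that a I_sub[OF b] by (intro D_scale D_mono[OF x]) auto
 have DD1: "(r, x) \<in> D" if "r \<in> {a..b}" for r using DD[OF that, of 1] by simp
 have cd: "continuous_on ({a..b} \<times> cbox 0 1) (\<lambda>(r, y). density_log n \<beta> (Zs r) (\<lambda>k. - Zd k r) (y * x))"
 proof -
  have "continuous_on ({a..b} \<times> cbox 0 1) (\<lambda>p. ((fst p, x), snd p :: real))" by (intro continuous_intros)
  moreover have "(\<lambda>p. ((fst p, x), snd p)) ` ({a..b} \<times> cbox 0 (1::real)) \<subseteq> D \<times> {0..1}" using DD1 by (auto simp: cbox_interval)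
  ultimately show ?thesis using continuous_on_compose2[OF D_integrand_continuous] by (fastforce simp: case_prod_beta')
 qed
 have "((\<lambda>r. integral (cbox 0 1) (\<lambda>y. density_fn n \<beta> (Zs r) (y * x))) has_vector_derivative
   integral (cbox 0 1) ((\<lambda>r y. density_log n \<beta> (Zs r) (\<lambda>k. - Zd k r) (y * x)) s)) (at s within {a..b})"
 proof (rule leibniz_rule_vector_derivative[OF _ _ _ s])
  fix r y :: real assume ry: "r \<in> {a..b}" "y \<in> cbox 0 1"
  have "(Z k has_vector_derivative Zd k r) (at r within {a..b})" if "k \<in> {1..n}" for k
   by (rule Z_deriv[OF that b]) (use ry a in auto)
  then have "((\<lambda>r. density_fn n \<beta> (Zs r) (y * x)) has_vector_derivative density_log n \<beta> (Zs r) (\<lambda>k. 0 - Zd k r) (y * x)) (at r within {a..b})"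
   using D_not_vertex[OF DD] ry by (intro density_fn_path_derivative has_vector_derivative_const) auto
  then show "((\<lambda>r. density_fn n \<beta> (Zs r) (y * x)) has_vector_derivative density_log n \<beta> (Zs r) (\<lambda>k. - Zd k r) (y * x)) (at r within {a..b})"
   by simp
 next
  fix r assume r: "r \<in> {a..b}"
  show "(\<lambda>y. density_fn n \<beta> (Zs r) (y * x)) integrable_on cbox 0 1"
   unfolding box_real using D_not_vertex[OF DD[OF r]]
   by (intro integrable_continuous_interval density_fn_continuous_on continuous_intros) auto
 qed (use cd in auto)
 then show ?thesis unfolding real_sc_def Gs_def box_real
  by (rule has_vector_derivative_mult_right)
qed

lemma real_sc_time_integral:
 assumes v: "v \<in> I" and x: "(u, x) \<in> D" and uv: "u \<le> v"
 shows "((\<lambda>s. Gs s x) has_integral real_sc n \<beta> (Zs v) x - real_sc n \<beta> (Zs u) x) {u..v}"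
 by (rule fundamental_theorem_of_calculus[OF uv real_sc_time_derivative[OF v x]])

text \<open>\<open>free_mono\<close> only looks forward in time. For a derivative at
  \<open>s > 0\<close>, the point \<open>x\<close> must also be admissible shortly before
  \<open>s\<close>, which holds by continuity of the finitely many vertices.\<close>

lemma D_backwards:
 assumes "(s, x) \<in> D"
 obtains a where "0 \<le> a" "a \<le> s" "a = 0 \<or> a < s" "(a, x) \<in> D"
proof (cases "s = 0")
 case True
 then show ?thesis using that[of 0] assms by auto
next
 case False
 have sI: "s \<in> I" using assms by (simp add: D_iff)
 have s: "0 < s" using False I_nonneg[OF sI] by simp
 have "\<forall>k\<in>{1..n}. \<forall>\<^sub>F r in at s within {0..<s}. (0 < Z k s --> x < Z k r) \<and> (Z k s < 0 --> Z k r < x)"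
 proof
  fix k assume k: "k \<in> {1..n}"
  have sub: "{0..<s} \<subseteq> I" using I_sub[OF sI] by auto
  have "(Z k \<longlongrightarrow> Z k s) (at s within {0..<s})"
   using Z_cont[OF k] sI sub by (meson continuous_on_def tendsto_within_subset)
  then have e: "x < Z k s --> (\<forall>\<^sub>F r in at s within {0..<s}. x < Z k r)" "Z k s < x --> (\<forall>\<^sub>F r in at s within {0..<s}. Z k r < x)"
   by (auto dest: order_tendstoD)
  have "(0 < Z k s --> x < Z k s) \<and> (Z k s < 0 --> Z k s < x)" "Z k s \<noteq> 0"
   using assms k Z_sign(2)[OF k sI] by (auto simp: D_iff free_interval_def)
  then show "\<forall>\<^sub>F r in at s within {0..<s}. (0 < Z k s --> x < Z k r) \<and> (Z k s < 0 --> Z k r < x)"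
   using e by (cases "0 < Z k s") auto
 qed
 then have ev: "\<forall>\<^sub>F r in at s within {0..<s}. \<forall>k\<in>{1..n}. (0 < Z k s --> x < Z k r) \<and> (Z k s < 0 --> Z k r < x)"
  by (simp add: eventually_ball_finite_distrib)
 have "\<forall>\<^sub>F r in at s within {0..<s}. r \<in> {0..<s}" by (simp add: eventually_at_filter)
 moreover have "at s within {0..<s} \<noteq> bot"
  using s by (simp add: trivial_limit_within islimpt_Ico)
 ultimately obtain r where r: "r \<in> {0..<s}" "\<forall>k\<in>{1..n}. (0 < Z k s --> x < Z k r) \<and> (Z k s < 0 --> Z k r < x)"
  using eventually_happens[OF eventually_conj[OF ev]] by blast
 have rI: "r \<in> I" using r(1) I_sub[OF sI] by auto
 have "(r, x) \<in> D" unfolding D_iff free_interval_def mem_Collect_eq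
 proof (intro conjI ballI rI)
  fix k assume k: "k \<in> {1..n}"
  show "0 < Z k r --> x < Z k r" "Z k r < 0 --> Z k r < x"
   using r(2) k Z_sign[OF k rI] Z_sign[OF k sI] by (metis linorder_neqE_linordered_idom order_less_asym)+
 qed
 then show ?thesis using that[of r] r(1) by auto
qed

lemma SC_time_derivative_eq:
 assumes "(s, x) \<in> D" shows "SC_time_derivative n \<beta> c Z s x = C * of_real (Gs s x)"
proof -
 obtain a where a: "0 \<le> a" "a \<le> s" "a = 0 \<or> a < s" "(a, x) \<in> D" using D_backwards[OF assms] .
 have sI: "s \<in> I" using assms by (simp add: D_iff)
 obtain b where b: "s < b" "b \<in> I" using I_extend[OF sI] by blast
 have w: "at s within {a..b} = at s within {0..}" by (rule at_within_subinterval) (use a b in auto)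
 have "((\<lambda>s. C * of_real (real_sc n \<beta> (Zs s) x)) has_vector_derivative C * of_real (Gs s x)) (at s within {a..b})"
  using real_sc_time_derivative[OF b(2) a(4), of s] a b
  by (intro has_vector_derivative_mult_right has_vector_derivative_of_real) (simp add: has_real_derivative_iff_has_vector_derivative)
 then have "((\<lambda>r. boundary_value (SC n \<beta> c (Zs r)) x) has_vector_derivative C * of_real (Gs s x)) (at s within {a..b})"
 proof (rule has_vector_derivative_transform[rotated 2])
  show "boundary_value (SC n \<beta> c (Zs r)) x = C * of_real (real_sc n \<beta> (Zs r) x)" if "r \<in> {a..b}" for r
   using that I_sub[OF b(2)] a(1) by (intro boundary_value_SC D_mono[OF a(4)]) auto
 qed (use a b in auto)
 moreover have "at s within {0..} \<noteq> bot"
 proof -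
  have "{0..} \<noteq> {y}" for y :: real
  proof
   assume "{0..} = {y}"
   then have "\<bar>y\<bar> + 1 \<in> {y}" by (metis abs_ge_zero atLeast_iff add_nonneg_nonneg zero_le_one)
   then show False by auto
  qed
  then show ?thesis
   using connected_imp_perfect[of "{0..}" s] I_nonneg[OF sI] by (auto simp: trivial_limit_within)
 qed
 ultimately show ?thesis unfolding SC_time_derivative_def w by (intro vector_derivative_within)
qed

lemma Gs_W_continuous: "continuous_on I (\<lambda>s. Gs s (W s))"
 by (rule continuous_on_compose2[OF Gs_continuous, of I "\<lambda>s. (s, W s)", simplified])
   (auto intro!: continuous_on_Pair continuous_on_id W_cont D_W)

text \<open>The boundary value of \<open>f_map\<close> at \<open>W t\<close>, divided by
  \<open>C\<close>; thus a real process.\<close>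

definition U where "U t = real_sc n \<beta> (Zs t) (W t) - integral {0..t} (\<lambda>s. Gs s (W s))"

lemma f_map_eq:
 assumes t: "t \<in> I"
 shows "f_map n \<beta> c W Z t = (\<lambda>z. SC n \<beta> c (Zs t) z - C * of_real (integral {0..t} (\<lambda>s. Gs s (W s))))"
proof
 fix z
 have "integral {0..t} (\<lambda>s. SC_time_derivative n \<beta> c Z s (W s)) = integral {0..t} (\<lambda>s. C * of_real (Gs s (W s)))"
  using I_sub[OF t] by (intro integral_cong SC_time_derivative_eq D_W) auto
 also have "\<dots> = C * of_real (integral {0..t} (\<lambda>s. Gs s (W s)))"
  by (intro integral_unique has_integral_mult_right has_integral_of_real integrable_integral integrable_continuous_interval
     continuous_on_subset[OF Gs_W_continuous I_sub[OF t]])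
 finally show "f_map n \<beta> c W Z t z = SC n \<beta> c (Zs t) z - C * of_real (integral {0..t} (\<lambda>s. Gs s (W s)))"
  by (simp add: f_map_def)
qed

lemma boundary_value_f_map:
 assumes t: "t \<in> I" shows "boundary_value (f_map n \<beta> c W Z t) (W t) = C * of_real (U t)"
proof (rule boundary_value_eqI)
 obtain l where l: "(SC n \<beta> c (Zs t) \<longlongrightarrow> l) (at (of_real (W t)) within \<H>)"
  using SC_boundary(1)[of n "Zs t" "W t" \<beta> c, OF Z_sign(2)[OF _ t] Z_ne_W[OF _ t]] by auto
 have "l = C * of_real (real_sc n \<beta> (Zs t) (W t))"
  using boundary_value_eqI[OF l] boundary_value_SC[OF D_W[OF t]] by simp
 with l show "(f_map n \<beta> c W Z t \<longlongrightarrow> C * of_real (U t)) (at (of_real (W t)) within \<H>)"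
  unfolding f_map_eq[OF t] U_def of_real_diff right_diff_distrib by (simp add: tendsto_diff)
qed

lemma boundary_value_deriv_SC:
 assumes t: "t \<in> I" shows "boundary_value (deriv (SC n \<beta> c (Zs t))) (W t) = C * of_real (density_fn n \<beta> (Zs t) (W t))"
proof (rule boundary_value_eqI)
 have "slit_integrand n \<beta> c (Zs t) (of_real (W t)) = C * of_real (density_fn n \<beta> (Zs t) (W t))"
  using slit_integrand_of_real[of n "Zs t" "W t"] phase_const[OF D_W[OF t]] Z_ne_W t by auto
 then show "(deriv (SC n \<beta> c (Zs t)) \<longlongrightarrow> C * of_real (density_fn n \<beta> (Zs t) (W t))) (at (of_real (W t)) within \<H>)"
  using SC_boundary(3)[of n "Zs t" "W t" \<beta> c, OF Z_sign(2)[OF _ t] Z_ne_W[OF _ t]] by auto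
qed

end

section \<open>The second-order expansion along the driving path\<close>

text \<open>Bookkeeping over one time step \<open>t\<close>. \<open>gu\<close> and \<open>gv\<close>
  are the densities at the old point at the two times, \<open>g1\<close> and \<open>\<xi>\<close>
  are space derivatives of the density, \<open>D\<close> is the integrated drift and
  \<open>E1\<close> the mismatch of time derivatives. Because of
  \<open>gu * d = - \<kappa> / 2 * g1\<close>, the drift cancels against the mean of
  \<open>\<kappa> / 2 * g1 * db^2\<close>, and only errors with a factor \<open>e\<close>
  remain.\<close>

lemma ito_arithmetic:
 fixes t :: real
 assumes dW: "dW = r * db + D" and dU: "dU = gv * dW + \<xi> / 2 * dW\<^sup>2 + E1"
  and b: "\<bar>gv - gu\<bar> \<le> L * t" "\<bar>D - d * t\<bar> \<le> e * t" "\<bar>D\<bar> \<le> Dm * t" "\<bar>dW\<bar> \<le> e" "\<bar>\<xi> - g1\<bar> \<le> e" "\<bar>\<xi>\<bar> \<le> M1"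
   "\<bar>gu\<bar> \<le> Mg" "t \<le> e" "\<bar>E1\<bar> \<le> e * t" "0 \<le> t"
  and drift: "gu * d = - \<kappa> / 2 * g1" and r: "r\<^sup>2 = \<kappa>" and pos: "0 \<le> Dm" "0 \<le> L"
 shows "\<bar>dU - (r * gu * db + \<kappa> / 2 * g1 * (db\<^sup>2 - t))\<bar> \<le> e * (1 + Mg + L + M1 * Dm * (2 + Dm) / 2 + \<kappa> / 2) * (t + db\<^sup>2)"
proof -
 have e: "0 \<le> e" using order_trans[OF abs_ge_zero b(4)] .
 have \<kappa>: "0 \<le> \<kappa>" using r by (metis zero_le_power2)
 \<comment> \<open>An exact identity; each summand on the right is small for a reason of its own,
   treated in \<open>m1\<close> to \<open>m4\<close> and by the bound on \<open>E1\<close>.\<close>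
 have 1: "dU - (r * gu * db + \<kappa> / 2 * g1 * (db\<^sup>2 - t)) =
   E1 + gu * (D - d * t) + (gv - gu) * dW + \<xi> / 2 * (D * (2 * dW - D)) + (\<xi> - g1) / 2 * (\<kappa> * db\<^sup>2)"
 proof -
  have sq: "dW\<^sup>2 = \<kappa> * db\<^sup>2 + D * (2 * dW - D)"
   using dW r by (simp add: power2_eq_square algebra_simps)
  have "gu * d * t = - \<kappa> / 2 * g1 * t" using drift by simp
  then have "gu * dW = r * gu * db + gu * (D - d * t) - \<kappa> / 2 * g1 * t" using dW by (simp add: algebra_simps)
  then have "gv * dW = r * gu * db + gu * (D - d * t) - \<kappa> / 2 * g1 * t + (gv - gu) * dW" by (simp add: algebra_simps)
  then show ?thesis unfolding dU sq by (simp add: algebra_simps diff_divide_distrib add_divide_distrib)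
 qed
 have M: "0 \<le> M1" "0 \<le> Mg" using order_trans[OF abs_ge_zero b(6)] order_trans[OF abs_ge_zero b(7)] .
 have m1: "\<bar>gu * (D - d * t)\<bar> \<le> Mg * (e * t)" unfolding abs_mult by (intro mult_mono b M abs_ge_zero)
 have m2: "\<bar>(gv - gu) * dW\<bar> \<le> L * t * e" unfolding abs_mult by (intro mult_mono b mult_nonneg_nonneg pos abs_ge_zero)
 have "\<bar>2 * dW - D\<bar> \<le> 2 * e + Dm * e"
  using b(3,4) mult_left_mono[OF b(8) pos(1)] by linarith
 then have "\<bar>D * (2 * dW - D)\<bar> \<le> Dm * t * (2 * e + Dm * e)"
  unfolding abs_mult[of D] by (intro mult_mono b(3)) (use b(10) pos in simp_all)
 note X = this
 have m3: "\<bar>\<xi> / 2 * (D * (2 * dW - D))\<bar> \<le> M1 / 2 * (Dm * t * (2 * e + Dm * e))"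
  unfolding abs_mult[of "\<xi> / 2"] by (intro mult_mono) (use X b(6) M in simp_all)
 have m4: "\<bar>(\<xi> - g1) / 2 * (\<kappa> * db\<^sup>2)\<bar> \<le> e / 2 * (\<kappa> * db\<^sup>2)"
  unfolding abs_mult[of "(\<xi> - g1) / 2"] by (rule mult_mono) (use b(5) \<kappa> e in \<open>simp_all add: abs_mult\<close>)
 have "\<bar>dU - (r * gu * db + \<kappa> / 2 * g1 * (db\<^sup>2 - t))\<bar> \<le> e * t + Mg * (e * t) + L * t * e + M1 / 2 * (Dm * t * (2 * e + Dm * e)) + e / 2 * (\<kappa> * db\<^sup>2)"
  unfolding 1 using b(9) m1 m2 m3 m4 by linarith
 also have "\<dots> = e * (1 + Mg + L + M1 * Dm * (2 + Dm) / 2) * t + e * (\<kappa> / 2) * db\<^sup>2" by (simp add: algebra_simps)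
 also have "\<dots> \<le> e * (1 + Mg + L + M1 * Dm * (2 + Dm) / 2 + \<kappa> / 2) * t + e * (1 + Mg + L + M1 * Dm * (2 + Dm) / 2 + \<kappa> / 2) * db\<^sup>2"
 proof -
  have X: "0 \<le> 1 + Mg + L + M1 * Dm * (2 + Dm) / 2" using M pos by (intro add_nonneg_nonneg divide_nonneg_nonneg mult_nonneg_nonneg) auto
  show ?thesis
   by (rule add_mono; intro mult_right_mono mult_left_mono) (use X e b(10) \<kappa> in auto)
 qed
 finally show ?thesis by (simp only: distrib_left[of _ t "db\<^sup>2"])
qed

lemma integral_first_order:
 fixes f :: "real => real"
 assumes f: "continuous_on {0..T} f" and e: "0 < e"
 shows "\<exists>dl>0. \<forall>u v. 0 \<le> u \<and> u \<le> v \<and> v \<le> T \<and> v - u < dl --> \<bar>integral {u..v} f - f u * (v - u)\<bar> \<le> e * (v - u)"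
proof -
 have "uniformly_continuous_on {0..T} f" by (rule compact_uniformly_continuous[OF f]) simp
 then obtain dl where dl: "0 < dl" "\<And>x y. x \<in> {0..T} ==> y \<in> {0..T} ==> dist y x < dl ==> dist (f y) (f x) < e"
  using e unfolding uniformly_continuous_on_def by metis
 have "\<bar>integral {u..v} f - f u * (v - u)\<bar> \<le> e * (v - u)" if u: "0 \<le> u" "u \<le> v" "v \<le> T" "v - u < dl" for u v
 proof -
  have sub: "{u..v} \<subseteq> {0..T}" using u by auto
  have i: "f integrable_on {u..v}" by (rule integrable_continuous_interval[OF continuous_on_subset[OF f sub]])
  have "norm (integral {u..v} (\<lambda>s. f s - f u)) \<le> e * (v - u)"
  proof (rule integral_bound[OF u(2)])
   show "continuous_on {u..v} (\<lambda>s. f s - f u)" by (intro continuous_on_diff continuous_on_const continuous_on_subset[OF f sub])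
   fix s assume s: "s \<in> {u..v}"
   have "dist (f s) (f u) < e" by (rule dl(2)) (use s sub u in \<open>auto simp: dist_real_def\<close>)
   then show "norm (f s - f u) \<le> e" by (simp add: dist_real_def)
  qed
  moreover have "integral {u..v} (\<lambda>s. f s - f u) = integral {u..v} f - f u * (v - u)"
   using integral_diff[OF i integrable_const_ivl[of "f u"]] u by (simp add: mult.commute)
  ultimately show ?thesis by simp
 qed
 then show ?thesis using dl(1) by blast
qed

locale sle_flow = sc_flow +
 fixes \<kappa> :: real and b :: "real => real"
 assumes \<kappa>: "0 < \<kappa>" and b_cont: "continuous_on {0..} b"
  and W_eq: "\<And>t. t \<in> I ==> W t = sqrt \<kappa> * b t + integral {0..t} (\<lambda>s. \<Sum>k=1..n. \<kappa> / 2 * \<beta> k / (W s - Z k s))"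
begin

definition drift where "drift s = (\<Sum>k=1..n. \<kappa> / 2 * \<beta> k / (W s - Z k s))"
definition h where "h t = sqrt \<kappa> * density_fn n \<beta> (Zs t) (W t)"
definition q where "q t = \<kappa> / 2 * density_log n \<beta> (Zs t) (\<lambda>_. 1) (W t)"
definition A where "A t = integral {0..t} (\<lambda>s. (h s)\<^sup>2)"

lemma drift_cont: "continuous_on I drift"
proof -
 have "W t - Z k t \<noteq> 0" if "k \<in> {1..n}" "t \<in> I" for k t using Z_ne_W[OF that] by simp
 then show ?thesis unfolding drift_def[abs_def]
  by (intro continuous_on_sum continuous_on_divide continuous_on_diff continuous_on_const W_cont Z_cont) auto
qed

lemma h_cont: "continuous_on I h"
 unfolding h_def using Z_ne_W by (intro continuous_on_mult continuous_on_const density_fn_continuous_on W_cont Z_cont Z_ne_W)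

lemma h_pos: "t \<in> I ==> 0 < h t"
 unfolding h_def using \<kappa> by (intro mult_pos_pos density_fn_pos Z_ne_W) auto

text \<open>For the weights \<open>\<kappa> / 2 * \<beta> k\<close> the drift is a multiple of the
  logarithmic derivative of the density. This is the cancellation that \<open>ito_arithmetic\<close>
  assumes.\<close>

lemma density_drift: "density_fn n \<beta> (Zs t) (W t) * drift t = - \<kappa> / 2 * density_log n \<beta> (Zs t) (\<lambda>_. 1) (W t)"
proof -
 have "drift t = - \<kappa> / 2 * (\<Sum>k=1..n. - \<beta> k / (W t - Z k t))"
  unfolding drift_def sum_distrib_left by (intro sum.cong) auto
 then show ?thesis by (simp add: density_log_def mult_ac)
qed

lemma W_increment:
 assumes v: "v \<in> I" and u: "0 \<le> u" "u \<le> v"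
 shows "W v - W u = sqrt \<kappa> * (b v - b u) + integral {u..v} drift"
proof -
 have uI: "u \<in> I" using u I_sub[OF v] by auto
 have "integral {0..u} drift + integral {u..v} drift = integral {0..v} drift"
  by (rule Henstock_Kurzweil_Integration.integral_combine[OF u integrable_continuous_interval[OF continuous_on_subset[OF drift_cont I_sub[OF v]]]])
 then show ?thesis using W_eq[OF v] W_eq[OF uI] by (simp add: drift_def[abs_def] algebra_simps)
qed

lemma A_increment:
 assumes v: "v \<in> I" and u: "0 \<le> u" "u \<le> v"
 shows "A v - A u = integral {u..v} (\<lambda>s. (h s)\<^sup>2)"
proof -
 have "integral {0..u} (\<lambda>s. (h s)\<^sup>2) + integral {u..v} (\<lambda>s. (h s)\<^sup>2) = integral {0..v} (\<lambda>s. (h s)\<^sup>2)"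
  by (rule Henstock_Kurzweil_Integration.integral_combine[OF u])
    (intro integrable_continuous_interval continuous_on_power continuous_on_subset[OF h_cont I_sub[OF v]])
 then show ?thesis by (simp add: A_def)
qed

lemma A_strict_mono:
 assumes v: "v \<in> I" and u: "0 \<le> u" "u < v" shows "A u < A v"
proof -
 have sub: "{u..v} \<subseteq> I" using I_sub[OF v] u by auto
 obtain s where s: "s \<in> {u..v}" "\<And>x. x \<in> {u..v} ==> h s \<le> h x"
  using continuous_attains_inf[of "{u..v}" h] continuous_on_subset[OF h_cont sub] u by auto
 have hs: "0 < h s" using s(1) sub h_pos by auto
 have "integral {u..v} (\<lambda>x. (h s)\<^sup>2) \<le> integral {u..v} (\<lambda>x. (h x)\<^sup>2)"
  using s(2) hs by (intro integral_le integrable_continuous_interval continuous_on_power continuous_on_subset[OF h_cont sub] continuous_on_const power_mono) auto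
 moreover have "0 < (v - u) * (h s)\<^sup>2" using hs u by simp
 ultimately show ?thesis using A_increment[OF v u(1) less_imp_le[OF u(2)]] u by simp
qed

lemma A_cont: "continuous_on I A"
 and U_cont: "continuous_on I U"
proof -
 have 1: "continuous_on I (\<lambda>t. integral {0..t} f)" if f: "continuous_on I f" for f :: "real => real"
 proof (rule continuous_on_eq_continuous_within[THEN iffD2], intro ballI)
  fix t assume t: "t \<in> I"
  obtain t' where t': "t < t'" "t' \<in> I" using I_extend[OF t] by blast
  have "continuous_on {0..t'} (\<lambda>t. integral {0..t} f)"
   by (intro indefinite_integral_continuous_1 integrable_continuous_interval continuous_on_subset[OF f I_sub[OF t'(2)]])
  then have "continuous (at t within {0..t'}) (\<lambda>t. integral {0..t} f)"
   using t' I_nonneg[OF t] by (auto simp: continuous_on_eq_continuous_within)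
  moreover have "at t within {0..t'} = at t within I"
   by (rule at_within_nhd[of _ "{..<t'}"]) (use t' I_sub[OF t'(2)] I_nonneg in auto)
  ultimately show "continuous (at t within I) (\<lambda>t. integral {0..t} f)" by (simp add: continuous_within)
 qed
 show "continuous_on I A" unfolding A_def by (intro 1 continuous_on_power h_cont)
 have "continuous_on I (\<lambda>t. integral {0..1} (\<lambda>y. density_fn n \<beta> (Zs t) (y * W t)))"
 proof -
  have "continuous_on (I \<times> cbox 0 1) (\<lambda>(t, y). density_fn n \<beta> (Zs t) (y * W t))"
   unfolding case_prod_beta'
  proof (rule density_fn_continuous_on)
   show "\<And>p k. p \<in> I \<times> cbox 0 1 ==> k \<in> {1..n} ==> Z k (fst p) \<noteq> snd p * W (fst p)"
    using D_not_vertex[OF D_scale[OF D_W]] by (auto simp: cbox_interval)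
  qed (auto intro!: continuous_intros continuous_on_compose2[OF W_cont] continuous_on_compose2[OF Z_cont])
  from integral_continuous_on_param[OF this] show ?thesis by simp
 qed
 then show "continuous_on I U" unfolding U_def real_sc_def
  by (intro continuous_on_diff continuous_on_mult W_cont 1 Gs_W_continuous)
qed

lemma real_sc_taylor:
 assumes x: "(v, x) \<in> D" and y: "(v, y) \<in> D"
 obtains \<xi> where "\<xi> \<in> closed_segment x y"
  "real_sc n \<beta> (Zs v) y - real_sc n \<beta> (Zs v) x = density_fn n \<beta> (Zs v) x * (y - x) + density_log n \<beta> (Zs v) (\<lambda>_. 1) \<xi> / 2 * (y - x)\<^sup>2"
proof (cases "x = y")
 case True
 then show ?thesis using that[of x] by simp
next
 case False
 define df where "df = (\<lambda>m::nat. if m = 0 then real_sc n \<beta> (Zs v) else if m = 1 then density_fn n \<beta> (Zs v) else density_log n \<beta> (Zs v) (\<lambda>_. 1))"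
 have vI: "v \<in> I" using x by (simp add: D_iff)
 have zD: "(v, z) \<in> D" if "min x y \<le> z" "z \<le> max x y" for z
  using D_convex[OF x y] that by (auto simp: closed_segment_eq_real_ivl min_def max_def split: if_splits)
 have d1: "(density_fn n \<beta> (Zs v) has_real_derivative density_log n \<beta> (Zs v) (\<lambda>_. 1) z) (at z)" if "(v, z) \<in> D" for z
  using density_fn_path_derivative[of "\<lambda>z. z" 1 z UNIV n "\<lambda>k _. Z k v" "\<lambda>_. 0" \<beta>] D_not_vertex[OF that]
  by (simp add: has_real_derivative_iff_has_vector_derivative)
 have "\<exists>t. (if y < x then y < t \<and> t < x else x < t \<and> t < y) \<and>
   real_sc n \<beta> (Zs v) y = (\<Sum>m<2. df m x / fact m * (y - x) ^ m) + df 2 t / fact 2 * (y - x) ^ 2"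
 proof (rule Taylor[of 2 df _ "min x y" "max x y"])
  show "\<forall>m t. m < 2 \<and> min x y \<le> t \<and> t \<le> max x y --> (df m has_real_derivative df (Suc m) t) (at t)"
  proof (intro allI impI)
   fix m :: nat and t assume m: "m < 2 \<and> min x y \<le> t \<and> t \<le> max x y"
   then have tD: "(v, t) \<in> D" using zD by auto
   consider "m = 0" | "m = 1" using m by linarith
   then show "(df m has_real_derivative df (Suc m) t) (at t)"
   proof cases
    case 1
    then show ?thesis using real_sc_derivative[of n "Zs v" t \<beta>] tD Z_sign(2) by (auto simp: df_def D_iff)
   next
    case 2
    then show ?thesis using d1[OF tD] by (simp add: df_def)
   qed
  qed
 qed (use False in \<open>auto simp: df_def\<close>)
 then obtain t where t: "if y < x then y < t \<and> t < x else x < t \<and> t < y"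
  "real_sc n \<beta> (Zs v) y = (\<Sum>m<2. df m x / fact m * (y - x) ^ m) + df 2 t / fact 2 * (y - x) ^ 2" by blast
 show ?thesis
 proof (rule that[of t])
  show "t \<in> closed_segment x y" using t(1) by (auto simp: closed_segment_eq_real_ivl split: if_splits)
  show "real_sc n \<beta> (Zs v) y - real_sc n \<beta> (Zs v) x = density_fn n \<beta> (Zs v) x * (y - x) + density_log n \<beta> (Zs v) (\<lambda>_. 1) t / 2 * (y - x)\<^sup>2"
   using t(2) by (simp add: df_def numeral_2_eq_2)
 qed
qed

lemma D_density_continuous: "continuous_on D (\<lambda>p. density_fn n \<beta> (Zs (fst p)) (snd p))"
 and D_density_log_continuous: "continuous_on D (\<lambda>p. density_log n \<beta> (Zs (fst p)) (\<lambda>_. 1) (snd p))"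
 and D_density_time_continuous: "continuous_on D (\<lambda>p. density_log n \<beta> (Zs (fst p)) (\<lambda>k. - Zd k (fst p)) (snd p))"
proof -
 have 1: "fst ` D \<subseteq> I" by (auto simp: D_def)
 have 2: "continuous_on D (\<lambda>p. Z k (fst p))" "continuous_on D (\<lambda>p. - Zd k (fst p))" if k: "k \<in> {1..n}" for k
 proof -
  show "continuous_on D (\<lambda>p. Z k (fst p))" by (rule continuous_on_compose2[OF Z_cont[OF k] _ 1]) (intro continuous_intros)
  show "continuous_on D (\<lambda>p. - Zd k (fst p))" by (rule continuous_on_minus, rule continuous_on_compose2[OF Zd_cont[OF k] _ 1]) (intro continuous_intros)
 qed
 have 3: "\<And>p k. p \<in> D ==> k \<in> {1..n} ==> Z k (fst p) \<noteq> snd p" using D_not_vertex by (metis prod.collapse)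
 show "continuous_on D (\<lambda>p. density_fn n \<beta> (Zs (fst p)) (snd p))"
  "continuous_on D (\<lambda>p. density_log n \<beta> (Zs (fst p)) (\<lambda>_. 1) (snd p))"
  "continuous_on D (\<lambda>p. density_log n \<beta> (Zs (fst p)) (\<lambda>k. - Zd k (fst p)) (snd p))"
  by (intro density_fn_continuous_on density_log_continuous_on 2 3 continuous_intros; assumption)+
qed

text \<open>Points between earlier values of \<open>W\<close> are admissible by
  \<open>D_mono\<close> and convexity. They lie in the image of a compact box, so that continuous
  functions on \<open>D\<close> are bounded and uniformly continuous there.\<close>

lemma past_hull_compact:
 assumes T: "T \<in> I"
 obtains K where "compact K" "K \<subseteq> D"
  "\<And>s u u' x. u \<in> {0..s} ==> u' \<in> {0..s} ==> s \<le> T ==> x \<in> closed_segment (W u) (W u') ==> (s, x) \<in> K"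
proof -
 \<comment> \<open>The minima cut the two earlier times down to the current time, so that the whole
   box is mapped into \<open>D\<close>.\<close>
 define f where "f = (\<lambda>p. (fst (fst p), (1 - snd (snd p)) * W (min (fst (fst p)) (snd (fst p))) + snd (snd p) * W (min (fst (fst p)) (fst (snd p)))))"
 define S where "S = ({0..T} \<times> {0..T}) \<times> ({0..T} \<times> {0..1::real})"
 have Tsub: "{0..T} \<subseteq> I" by (rule I_sub[OF T])
 have "compact S" unfolding S_def by (intro compact_Times compact_Icc)
 moreover have "continuous_on S f" unfolding f_def
  by (intro continuous_on_Pair continuous_on_add continuous_on_mult continuous_on_compose2[OF W_cont] continuous_intros)
    (use Tsub in \<open>auto simp: S_def min_def\<close>)
 ultimately have c: "compact (f ` S)" by (rule compact_continuous_image[rotated])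
 have sub: "f ` S \<subseteq> D"
 proof
  fix p assume "p \<in> f ` S"
  then obtain s u u' l where p: "p = (s, (1 - l) * W (min s u) + l * W (min s u'))" and r: "s \<in> {0..T}" "u \<in> {0..T}" "u' \<in> {0..T}" "l \<in> {0..1}"
   by (auto simp: f_def S_def)
  have sI: "s \<in> I" using r Tsub by auto
  have "(s, W (min s u)) \<in> D" "(s, W (min s u')) \<in> D"
   using r Tsub by (auto intro!: D_mono[OF D_W] sI simp: min_def)
  from D_convex[OF this] have "(s, (1 - l) *\<^sub>R W (min s u) + l *\<^sub>R W (min s u')) \<in> D"
   using r(4) unfolding closed_segment_def by auto
  then show "p \<in> D" using p by simp
 qed
 have m: "(s, x) \<in> f ` S" if "u \<in> {0..s}" "u' \<in> {0..s}" "s \<le> T" and x: "x \<in> closed_segment (W u) (W u')" for s u u' x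
 proof -
  obtain l where l: "0 \<le> l" "l \<le> 1" "x = (1 - l) * W u + l * W u'" using x by (auto simp: closed_segment_def)
  have "f ((s, u), (u', l)) = (s, x)" using that l by (simp add: f_def min_absorb2)
  moreover have "((s, u), (u', l)) \<in> S" using that l by (auto simp: S_def)
  ultimately show ?thesis by (metis imageI)
 qed
 show ?thesis by (rule that[OF c sub m])
qed

lemma compact_bound:
 fixes f :: "'x::topological_space => real"
 assumes "compact K" "continuous_on K f"
 obtains M where "0 < M" "\<And>x. x \<in> K ==> \<bar>f x\<bar> \<le> M"
proof -
 have "bounded (f ` K)" using assms by (intro compact_imp_bounded compact_continuous_image)
 then show ?thesis using that by (auto simp: bounded_pos)
qed

lemma expansion_A:
 assumes T: "T \<in> I" and e: "0 < e"
 shows "\<exists>dl>0. \<forall>u v. 0 \<le> u \<and> u \<le> v \<and> v \<le> T \<and> v - u < dl --> \<bar>A v - A u - (h u)\<^sup>2 * (v - u)\<bar> \<le> e * (v - u)"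
proof -
 obtain dl where dl: "0 < dl" "\<forall>u v. 0 \<le> u \<and> u \<le> v \<and> v \<le> T \<and> v - u < dl --> \<bar>integral {u..v} (\<lambda>s. (h s)\<^sup>2) - (h u)\<^sup>2 * (v - u)\<bar> \<le> e * (v - u)"
  using integral_first_order[OF continuous_on_power[OF continuous_on_subset[OF h_cont I_sub[OF T]]] e, of 2] by blast
 then show ?thesis using A_increment I_sub[OF T] by (intro exI[of _ dl]) (auto simp: subset_iff)
qed

text \<open>The increment splits into a step in space at the later time \<open>v\<close>, expanded
  by Taylor's formula, and a step in time at the earlier point \<open>W u\<close>. The latter is
  compensated, up to a small error, by the integral subtracted in \<open>U\<close>.\<close>

lemma expansion_U:
 assumes T: "T \<in> I" and eps: "0 < eps"
 shows "\<exists>dl>0. \<forall>u v. 0 \<le> u \<and> u \<le> v \<and> v \<le> T \<and> v - u < dl -->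
   \<bar>U v - U u - (h u * (b v - b u) + q u * ((b v - b u)\<^sup>2 - (v - u)))\<bar> \<le> eps * ((v - u) + (b v - b u)\<^sup>2)"
proof -
 obtain K where K: "compact K" "K \<subseteq> D"
  and KI: "\<And>s u u' x. u \<in> {0..s} ==> u' \<in> {0..s} ==> s \<le> T ==> x \<in> closed_segment (W u) (W u') ==> (s, x) \<in> K"
  using past_hull_compact[OF T] by blast
 have Tsub: "{0..T} \<subseteq> I" by (rule I_sub[OF T])
 obtain Mg where Mg: "0 < Mg" "\<And>p. p \<in> K ==> \<bar>density_fn n \<beta> (Zs (fst p)) (snd p)\<bar> \<le> Mg"
  using compact_bound[OF K(1) continuous_on_subset[OF D_density_continuous K(2)]] by blast
 obtain M1 where M1: "0 < M1" "\<And>p. p \<in> K ==> \<bar>density_log n \<beta> (Zs (fst p)) (\<lambda>_. 1) (snd p)\<bar> \<le> M1"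
  using compact_bound[OF K(1) continuous_on_subset[OF D_density_log_continuous K(2)]] by blast
 obtain L where L: "0 < L" "\<And>p. p \<in> K ==> \<bar>density_log n \<beta> (Zs (fst p)) (\<lambda>k. - Zd k (fst p)) (snd p)\<bar> \<le> L"
  using compact_bound[OF K(1) continuous_on_subset[OF D_density_time_continuous K(2)]] by blast
 have driftT: "continuous_on {0..T} drift" by (rule continuous_on_subset[OF drift_cont Tsub])
 obtain Dm where Dm: "0 < Dm" "\<And>s. s \<in> {0..T} ==> \<bar>drift s\<bar> \<le> Dm"
  using compact_bound[OF compact_Icc driftT] by blast
 \<comment> \<open>The factor in the bound of \<open>ito_arithmetic\<close>; with
   \<open>e = eps / K'\<close> that bound becomes \<open>eps\<close>.\<close>
 define K' where "K' = 1 + Mg + L + M1 * Dm * (2 + Dm) / 2 + \<kappa> / 2"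
 have K': "0 < K'" unfolding K'_def using Mg(1) L(1) M1(1) Dm(1) \<kappa> by (intro add_pos_pos divide_pos_pos mult_pos_pos) auto
 define e where "e = eps / K'"
 have e: "0 < e" using eps K' by (simp add: e_def)
 obtain d1 where d1: "0 < d1" "\<And>p p'. p \<in> K ==> p' \<in> K ==> dist p' p < d1 ==> dist (Gs (fst p') (snd p')) (Gs (fst p) (snd p)) < e"
  using compact_uniformly_continuous[OF continuous_on_subset[OF Gs_continuous K(2)] K(1)] e unfolding uniformly_continuous_on_def by metis
 obtain d2 where d2: "0 < d2" "\<And>p p'. p \<in> K ==> p' \<in> K ==> dist p' p < d2 ==>
   dist (density_log n \<beta> (Zs (fst p')) (\<lambda>_. 1) (snd p')) (density_log n \<beta> (Zs (fst p)) (\<lambda>_. 1) (snd p)) < e"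
  using compact_uniformly_continuous[OF continuous_on_subset[OF D_density_log_continuous K(2)] K(1)] e unfolding uniformly_continuous_on_def by metis
 \<comment> \<open>\<open>d2\<close> is halved because time and space each contribute to the
   distance of the two points.\<close>
 define e' where "e' = Min {e, d1, d2 / 2}"
 have e': "0 < e'" "e' \<le> e" "e' \<le> d1" "e' \<le> d2 / 2" using e d1 d2 by (auto simp: e'_def)
 obtain d3 where d3: "0 < d3" "\<And>s s'. s \<in> {0..T} ==> s' \<in> {0..T} ==> dist s' s < d3 ==> dist (W s') (W s) < e'"
  using compact_uniformly_continuous[OF continuous_on_subset[OF W_cont Tsub] compact_Icc] e'(1) unfolding uniformly_continuous_on_def by metis
 obtain d4 where d4: "0 < d4" "\<forall>u v. 0 \<le> u \<and> u \<le> v \<and> v \<le> T \<and> v - u < d4 --> \<bar>integral {u..v} drift - drift u * (v - u)\<bar> \<le> e * (v - u)"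
  using integral_first_order[OF driftT e] by blast
 define dl where "dl = Min {e', d3, d4}"
 have dl: "0 < dl" "dl \<le> e'" "dl \<le> d3" "dl \<le> d4" using e' d3 d4 by (auto simp: dl_def)
 have "\<bar>U v - U u - (h u * (b v - b u) + q u * ((b v - b u)\<^sup>2 - (v - u)))\<bar> \<le> eps * ((v - u) + (b v - b u)\<^sup>2)"
  if uv: "0 \<le> u" "u \<le> v" "v \<le> T" "v - u < dl" for u v
 proof -
  have vI: "v \<in> I" and uI: "u \<in> I" using uv Tsub by auto
  have Ws: "\<bar>W s - W u\<bar> < e'" if "s \<in> {u..v}" for s
   using d3(2)[of u s] that uv dl by (auto simp: dist_real_def)
  have vu: "(v, W u) \<in> D" by (rule D_mono[OF D_W[OF uI] uv(2) vI])
  obtain \<xi> where \<xi>: "\<xi> \<in> closed_segment (W u) (W v)"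
   and ty: "real_sc n \<beta> (Zs v) (W v) - real_sc n \<beta> (Zs v) (W u) = density_fn n \<beta> (Zs v) (W u) * (W v - W u) + density_log n \<beta> (Zs v) (\<lambda>_. 1) \<xi> / 2 * (W v - W u)\<^sup>2"
   using real_sc_taylor[OF vu D_W[OF vI]] by blast
  have Kp: "(v, \<xi>) \<in> K" "(u, W u) \<in> K" "(v, W u) \<in> K"
   using KI[of u v v \<xi>] KI[of u u u "W u"] KI[of u v u "W u"] \<xi> uv by auto
  have GsW: "(\<lambda>s. Gs s (W s)) integrable_on {0..v}" by (intro integrable_continuous_interval continuous_on_subset[OF Gs_W_continuous I_sub[OF vI]])
  have GsW': "continuous_on {u..v} (\<lambda>s. Gs s (W s))" by (rule continuous_on_subset[OF Gs_W_continuous]) (use I_sub[OF vI] uv in auto)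
  have Gsu: "continuous_on {u..v} (\<lambda>s. Gs s (W u))"
  proof -
   have "(\<lambda>s. (s, W u)) ` {u..v} \<subseteq> D"
    by (intro image_subsetI D_mono[OF D_W[OF uI]]) (use I_sub[OF vI] uv in auto)
   from continuous_on_compose2[OF Gs_continuous _ this] show ?thesis by (simp add: continuous_on_Pair continuous_on_id)
  qed
  have "integral {0..u} (\<lambda>s. Gs s (W s)) + integral {u..v} (\<lambda>s. Gs s (W s)) = integral {0..v} (\<lambda>s. Gs s (W s))"
   by (rule Henstock_Kurzweil_Integration.integral_combine[OF uv(1,2) GsW])
  moreover have "real_sc n \<beta> (Zs v) (W u) - real_sc n \<beta> (Zs u) (W u) = integral {u..v} (\<lambda>s. Gs s (W u))"
   using real_sc_time_integral[OF vI D_W[OF uI] uv(2)] by (simp add: integral_unique)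
  moreover have "integral {u..v} (\<lambda>s. Gs s (W u) - Gs s (W s)) = integral {u..v} (\<lambda>s. Gs s (W u)) - integral {u..v} (\<lambda>s. Gs s (W s))"
   by (intro integral_diff integrable_continuous_interval Gsu GsW')
  ultimately have dU: "U v - U u = density_fn n \<beta> (Zs v) (W u) * (W v - W u) + density_log n \<beta> (Zs v) (\<lambda>_. 1) \<xi> / 2 * (W v - W u)\<^sup>2
    + integral {u..v} (\<lambda>s. Gs s (W u) - Gs s (W s))"
   using ty by (simp add: U_def)
  have E1: "\<bar>integral {u..v} (\<lambda>s. Gs s (W u) - Gs s (W s))\<bar> \<le> e * (v - u)"
  proof -
   have "norm (Gs s (W u) - Gs s (W s)) \<le> e" if s: "s \<in> {u..v}" for s
   proof -
    have "(s, W s) \<in> K" "(s, W u) \<in> K" using KI[of s s s "W s"] KI[of u s u "W u"] s uv by auto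
    moreover have "dist (s, W u) (s, W s) < d1" using Ws[OF s] e' by (simp add: dist_Pair_Pair dist_real_def)
    ultimately have "dist (Gs s (W u)) (Gs s (W s)) < e" using d1(2)[of "(s, W s)" "(s, W u)"] by simp
    then show ?thesis by (simp add: dist_real_def)
   qed
   then show ?thesis using integral_bound[OF uv(2) continuous_on_diff[OF Gsu GsW']] by fastforce
  qed
  have gvu: "\<bar>density_fn n \<beta> (Zs v) (W u) - density_fn n \<beta> (Zs u) (W u)\<bar> \<le> L * (v - u)"
  proof -
   have "norm (density_fn n \<beta> (Zs v) (W u) - density_fn n \<beta> (Zs u) (W u)) \<le> L * norm (v - u)"
   proof (rule differentiable_bound[of "{u..v}" "\<lambda>s. density_fn n \<beta> (Zs s) (W u)" "\<lambda>s x. x * density_log n \<beta> (Zs s) (\<lambda>k. - Zd k s) (W u)"])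
    fix s assume s: "s \<in> {u..v}"
    have "(s, W u) \<in> D" by (rule D_mono[OF D_W[OF uI]]) (use s I_sub[OF vI] uv in auto)
    then have "((\<lambda>s. density_fn n \<beta> (Zs s) (W u)) has_vector_derivative density_log n \<beta> (Zs s) (\<lambda>k. 0 - Zd k s) (W u)) (at s within {u..v})"
     by (intro density_fn_path_derivative has_vector_derivative_const D_not_vertex Z_deriv[OF _ vI]) (use s uv in auto)
    then show "((\<lambda>s. density_fn n \<beta> (Zs s) (W u)) has_derivative (\<lambda>x. x * density_log n \<beta> (Zs s) (\<lambda>k. - Zd k s) (W u))) (at s within {u..v})"
     by (simp add: has_vector_derivative_def)
    have "(s, W u) \<in> K" using KI[of u s u "W u"] s uv by auto
    from L(2)[OF this] show "onorm (\<lambda>x. x * density_log n \<beta> (Zs s) (\<lambda>k. - Zd k s) (W u)) \<le> L"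
     by (intro onorm_le) (auto simp: abs_mult mult.commute[of L] intro: mult_left_mono)
   qed (use uv in auto)
   then show ?thesis using uv by simp
  qed
  have D: "\<bar>integral {u..v} drift\<bar> \<le> Dm * (v - u)"
   using integral_bound[OF uv(2) continuous_on_subset[OF driftT], of Dm] Dm(2) uv by auto
  have \<xi>1: "\<bar>density_log n \<beta> (Zs v) (\<lambda>_. 1) \<xi> - density_log n \<beta> (Zs u) (\<lambda>_. 1) (W u)\<bar> \<le> e"
  proof -
   have "\<bar>\<xi> - W u\<bar> \<le> \<bar>W v - W u\<bar>" using \<xi> by (auto simp: closed_segment_eq_real_ivl split: if_splits)
   then have "\<bar>\<xi> - W u\<bar> < e'" using Ws[of v] uv by auto
   moreover have "dist (v, \<xi>) (u, W u) \<le> \<bar>v - u\<bar> + \<bar>\<xi> - W u\<bar>"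
    by (simp add: dist_Pair_Pair dist_real_def sqrt_sum_squares_le_sum_abs)
   ultimately have "dist (v, \<xi>) (u, W u) < d2" using uv dl e' by auto
   from d2(2)[OF Kp(2,1) this] show ?thesis by (simp add: dist_real_def)
  qed
  have "\<bar>U v - U u - (sqrt \<kappa> * density_fn n \<beta> (Zs u) (W u) * (b v - b u) + \<kappa> / 2 * density_log n \<beta> (Zs u) (\<lambda>_. 1) (W u) * ((b v - b u)\<^sup>2 - (v - u)))\<bar>
    \<le> e * (1 + Mg + L + M1 * Dm * (2 + Dm) / 2 + \<kappa> / 2) * ((v - u) + (b v - b u)\<^sup>2)"
  proof (rule ito_arithmetic[OF W_increment[OF vI uv(1,2)] dU gvu _ D _ \<xi>1 _ _ _ E1 _ density_drift])
   show "\<bar>integral {u..v} drift - drift u * (v - u)\<bar> \<le> e * (v - u)" using d4(2) uv dl by auto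
   show "\<bar>W v - W u\<bar> \<le> e" using Ws[of v] uv e' by auto
   show "\<bar>density_log n \<beta> (Zs v) (\<lambda>_. 1) \<xi>\<bar> \<le> M1" using M1(2)[OF Kp(1)] by simp
   show "\<bar>density_fn n \<beta> (Zs u) (W u)\<bar> \<le> Mg" using Mg(2)[OF Kp(2)] by simp
  qed (use uv dl e' \<kappa> Dm L in auto)
  also have "e * (1 + Mg + L + M1 * Dm * (2 + Dm) / 2 + \<kappa> / 2) = eps" using K' by (simp add: e_def K'_def[symmetric])
  finally show ?thesis by (simp add: h_def q_def)
 qed
 then show ?thesis using dl(1) by blast
qed

end

section \<open>Edges and the differentiable motion of the corners\<close>

lemma continuous_on_powr_unit:
 fixes p :: real shows "0 < p ==> continuous_on {0..1} (\<lambda>v::real. v powr p)"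
 by (intro continuous_on_powr') (auto intro!: continuous_intros)

lemma nonzero_Re_not_slit: "Re z \<noteq> 0 ==> z \<notin> slit"
 by (simp add: slit_def)

lemma corner_factor_path_integrable:
 assumes inj: "inj_on zs {1..n}" and k: "k \<in> {1..n}" and p: "0 < p"
 shows "(\<lambda>v. corner_factor n \<beta> c zs k (\<i> * of_real (v powr p))) integrable_on {0..1}"
 unfolding corner_factor_def
proof (intro integrable_continuous_interval continuous_on_mult continuous_on_const continuous_on_prod upper_pow_continuous_on)
 fix j v assume j: "j \<in> {1..n} - {k}"
 then have "zs k \<noteq> zs j" using inj k by (auto dest: inj_onD)
 then show "\<i> * of_real (v powr p) + of_real (zs k - zs j) \<notin> slit"
  by (intro nonzero_Re_not_slit) simp
qed (intro continuous_intros continuous_on_powr_unit[OF p])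

lemma SC_corner_limit:
 assumes nz: "\<And>j. j \<in> {1..n} ==> zs j \<noteq> 0" and inj: "inj_on zs {1..n}" and k: "k \<in> {1..n}" and c: "c \<noteq> 0" and b: "\<beta> k < 1"
 shows "(SC n \<beta> c zs \<longlongrightarrow> SC n \<beta> c zs (of_real (zs k) + \<i>) - \<i> * cis (- pi * \<beta> k / 2) / of_real (1 - \<beta> k) *
    integral {0..1} (\<lambda>v. corner_factor n \<beta> c zs k (\<i> * of_real (v powr (1 / (1 - \<beta> k)))))) (at (of_real (zs k)) within \<H>)"
proof (rule SC_corner(1)[of n zs k c \<beta>, OF nz inj k c b])
 show "(\<lambda>v. corner_factor n \<beta> c zs k (\<i> * of_real (v powr (1 / (1 - \<beta> k))))) integrable_on {0..1}"
  by (rule corner_factor_path_integrable[OF inj k]) (use b in simp)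
qed auto

lemma edges_straight_SC:
 assumes nz: "\<And>k. k \<in> {1..n} ==> zs k \<noteq> 0" and inj: "inj_on zs {1..n}" and c: "norm c = 1"
 shows "edges_straight n \<beta> zs (SC n \<beta> c zs)"
proof -
 have c0: "c \<noteq> 0" using c by auto
 define V where "V = zs ` {1..n}"
 define P where "P = zs ` {k \<in> {1..n}. \<beta> k \<ge> 1}"
 have lim: "\<exists>l. (SC n \<beta> c zs \<longlongrightarrow> l) (at (of_real x) within \<H>)" if "x \<notin> P" for x
 proof (cases "x \<in> V")
  case True
  then obtain k where k: "k \<in> {1..n}" "x = zs k" by (auto simp: V_def)
  then have "\<beta> k < 1" using that by (force simp: P_def)
  then show ?thesis using SC_corner_limit[of n zs k c \<beta>, OF nz inj k(1) c0] k(2) by blast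
 next
  case False
  then show ?thesis using SC_boundary(1)[of n zs x \<beta> c, OF nz] by (metis V_def imageI)
 qed
 have inf: "filterlim (SC n \<beta> c zs) at_infinity (at (of_real x) within \<H>)" if "x \<in> P" for x
  using that SC_corner(2)[of n zs _ c \<beta>, OF nz inj _ c0] by (auto simp: P_def)
 have seg: "maps_onto_segment (SC n \<beta> c zs) (E - P)" if "P \<subseteq> V" "\<And>a b. a \<in> E ==> b \<in> E ==> {a..b} \<subseteq> E"
   "\<And>a b. a \<in> E ==> b \<in> E ==> {a<..<b} \<inter> V = {}" for E
 proof (rule maps_onto_segmentI[OF nz c])
  fix a b assume ab: "a \<in> E - P" "b \<in> E - P"
  show "{a..b} \<subseteq> E - P"
  proof
   fix x assume x: "x \<in> {a..b}"
   then have "x \<in> E" using that(2)[of a b] ab by auto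
   moreover have "x \<notin> P"
   proof
    assume xP: "x \<in> P"
    then have "x \<noteq> a" "x \<noteq> b" "x \<in> V" using ab that(1) by auto
    then have "x \<in> {a<..<b} \<inter> V" using x by auto
    then show False using that(3)[of a b] ab by auto
   qed
   ultimately show "x \<in> E - P" by simp
  qed
  show "zs k \<notin> {a<..<b}" if "k \<in> {1..n}" for k
   using \<open>\<And>a b. a \<in> E ==> b \<in> E ==> {a<..<b} \<inter> V = {}\<close>[of a b] ab that by (auto simp: V_def)
 qed (use lim in auto)
 have PV: "P \<subseteq> V" by (auto simp: P_def V_def)
 show ?thesis unfolding edges_straight_def Let_def V_def[symmetric] P_def[symmetric]
 proof (intro conjI ballI impI)
  fix x y assume xy: "x \<in> V" "y \<in> V" "x < y \<and> {x<..<y} \<inter> V = {}"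
  show "maps_onto_segment (SC n \<beta> c zs) ({x..y} - P)"
  proof (rule seg[OF PV])
   fix a b assume "a \<in> {x..y}" "b \<in> {x..y}"
   then have "{a..b} \<subseteq> {x..y}" "{a<..<b} \<subseteq> {x<..<y}" by auto
   then show "{a..b} \<subseteq> {x..y}" and "{a<..<b} \<inter> V = {}" using xy by blast+
  qed
  show "closed (boundary_value (SC n \<beta> c zs) ` ({x..y} - P))"
   by (rule closed_boundary_image[where a = x and b = y]) (use lim inf in auto)
 next
  fix x assume x: "x \<in> V" "{x<..} \<inter> V = {}"
  show "maps_onto_segment (SC n \<beta> c zs) ({x..} - P)"
  proof (rule seg[OF PV])
   fix a b assume "a \<in> {x..}" "b \<in> {x..}"
   then have "{a..b} \<subseteq> {x..}" "{a<..<b} \<subseteq> {x<..}" by auto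
   then show "{a..b} \<subseteq> {x..}" and "{a<..<b} \<inter> V = {}" using x by blast+
  qed
 next
  fix x assume x: "x \<in> V" "{..<x} \<inter> V = {}"
  show "maps_onto_segment (SC n \<beta> c zs) ({..x} - P)"
  proof (rule seg[OF PV])
   fix a b assume "a \<in> {..x}" "b \<in> {..x}"
   then have "{a..b} \<subseteq> {..x}" "{a<..<b} \<subseteq> {..<x}" by auto
   then show "{a..b} \<subseteq> {..x}" and "{a<..<b} \<inter> V = {}" using x by blast+
  qed
 qed
qed

lemma at_infinity_diff_const:
 fixes f :: "'a => complex"
 assumes "filterlim f at_infinity F" shows "filterlim (\<lambda>z. f z - a) at_infinity F"
 using tendsto_add_filterlim_at_infinity'[OF assms tendsto_const[of "- a"]] by simp

context sc_flow
begin

lemma Icc_derivative_differentiable: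
 fixes f :: "real => complex"
 assumes "b \<in> I" "t < b" "t \<in> I" "(f has_vector_derivative f') (at t within {0..b})"
 shows "f differentiable (at t within {0..})"
 using assms I_nonneg at_within_subinterval[of t b 0] by (auto intro: differentiableI_vector)

lemma Gs_integral_derivative:
 assumes b: "b \<in> I" and t: "t \<in> {0..b}"
 shows "((\<lambda>r. C * of_real (integral {0..r} (\<lambda>s. Gs s (W s)))) has_vector_derivative C * of_real (Gs t (W t))) (at t within {0..b})"
proof -
 have "((\<lambda>r. integral {0..r} (\<lambda>s. Gs s (W s))) has_vector_derivative Gs t (W t)) (at t within {0..b})"
  by (rule integral_has_vector_derivative[OF continuous_on_subset[OF Gs_W_continuous I_sub[OF b]] t])
 then show ?thesis
  by (intro has_vector_derivative_mult_right has_vector_derivative_of_real) (simp add: has_real_derivative_iff_has_vector_derivative)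
qed

text \<open>The corner is reached from the point one unit above the vertex: the value of
  \<open>SC\<close> there, minus the regularised integral down to the vertex, minus the correction
  in \<open>f_map\<close>. Each of the three is differentiable in time, the second because distinct
  vertices keep the bases off the slit.\<close>

lemma finite_corner_motion:
 assumes k: "k \<in> {1..n}" and b1: "\<beta> k < 1" and t: "t \<in> I"
 shows "(\<lambda>r. boundary_value (f_map n \<beta> c W Z r) (Z k r)) differentiable (at t within {0..})"
  "\<exists>l. (f_map n \<beta> c W Z t \<longlongrightarrow> l) (at (complex_of_real (Z k t)) within \<H>)"
proof -
 define p where "p = 1 / (1 - \<beta> k)"
 have p: "0 < p" using b1 by (simp add: p_def)
 obtain b where b: "t < b" "b \<in> I" using I_extend[OF t] by blast
 have t0b: "t \<in> {0..b}" using b I_nonneg[OF t] by auto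
 have bs: "{0..b} \<subseteq> I" by (rule I_sub[OF b(2)])
 have c0: "c \<noteq> 0" using c by auto
 define P where "P = (\<lambda>r v. \<Prod>j\<in>{1..n} - {k}. upper_pow (\<i> * complex_of_real (v powr p) + (complex_of_real (Z k r) - complex_of_real (Z j r))) (- \<beta> j))"
 define l where "l = (\<lambda>r. SC n \<beta> c (Zs r) (complex_of_real (Z k r) + \<i>) - \<i> * cis (- pi * \<beta> k / 2) / complex_of_real (1 - \<beta> k) *
    (c * integral {0..1} (P r)) - C * complex_of_real (integral {0..r} (\<lambda>s. Gs s (W s))))"
 have lim: "(f_map n \<beta> c W Z r \<longlongrightarrow> l r) (at (complex_of_real (Z k r)) within \<H>)" if r: "r \<in> I" for r
 proof -
  have "(\<lambda>v. corner_factor n \<beta> c (Zs r) k (\<i> * complex_of_real (v powr (1 / (1 - \<beta> k))))) = (\<lambda>v. c * P r v)"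
   by (simp add: corner_factor_def P_def p_def)
  then show ?thesis using SC_corner_limit[of n "Zs r" k c \<beta>, OF Z_sign(2)[OF _ r] Z_inj[OF r] k c0 b1]
   unfolding f_map_eq[OF r] l_def by (intro tendsto_diff tendsto_const) (simp_all only: integral_mult_right)
 qed
 show "\<exists>l. (f_map n \<beta> c W Z t \<longlongrightarrow> l) (at (complex_of_real (Z k t)) within \<H>)" using lim[OF t] by blast
 have "\<exists>x. ((\<lambda>r. SC n \<beta> c (Zs r) (complex_of_real (Z k r) + \<i>)) has_vector_derivative x) (at t within {0..b})"
 proof (rule SC_path_derivative[OF b(2) t0b])
   show "complex_of_real (Z k r) + \<i> \<in> sc_domain n (Zs r) 0 \<and> 0 \<le> Im (complex_of_real (Z k r) + \<i>)" for r
    by (simp add: sc_domain_def upper_half_plane_def)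
   show "((\<lambda>r. complex_of_real (Z k r) + \<i>) has_vector_derivative complex_of_real (Zd k r)) (at r within {0..b})" if "r \<in> {0..b}" for r
    using has_vector_derivative_add[OF Z_of_real_derivative[OF k b(2) that] has_vector_derivative_const[of \<i>]] by simp
   show "continuous_on {0..b} (\<lambda>r. complex_of_real (Zd k r))"
    by (intro continuous_on_of_real continuous_on_subset[OF Zd_cont[OF k] bs])
  qed
 then obtain x1 where d1: "((\<lambda>r. SC n \<beta> c (Zs r) (complex_of_real (Z k r) + \<i>)) has_vector_derivative x1) (at t within {0..b})" ..
 have "\<exists>x. ((\<lambda>r. integral {0..1} (P r)) has_vector_derivative x) (at t within {0..b})" unfolding P_def
 proof (rule parametric_integral_derivative[where a' = "\<lambda>j r v. complex_of_real (Zd k r) - complex_of_real (Zd j r)"])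
   fix j assume j: "j \<in> {1..n} - {k}"
   then have j1: "j \<in> {1..n}" by simp
   show "\<i> * complex_of_real (v powr p) + (complex_of_real (Z k r) - complex_of_real (Z j r)) \<notin> slit" if "r \<in> {0..b}" for r v
   proof -
    have "r \<in> I" using bs that by auto
    then have "Z k r \<noteq> Z j r" using inj_onD[OF Z_inj _ k j1] j by auto
    then show ?thesis by (intro nonzero_Re_not_slit) simp
   qed
   show "((\<lambda>r. \<i> * complex_of_real (v powr p) + (complex_of_real (Z k r) - complex_of_real (Z j r))) has_vector_derivative complex_of_real (Zd k r) - complex_of_real (Zd j r)) (at r within {0..b})"
    if r: "r \<in> {0..b}" for r v
    using has_vector_derivative_add[OF has_vector_derivative_const has_vector_derivative_diff[OF Z_of_real_derivative[OF k b(2) r] Z_of_real_derivative[OF j1 b(2) r]]] by simp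
   have v: "continuous_on ({0..b} \<times> {0..1::real}) (\<lambda>x. snd x powr p)"
    by (rule continuous_on_compose2[OF continuous_on_powr_unit[OF p]]) (auto intro: continuous_intros)
   show "continuous_on ({0..b} \<times> {0..1}) (\<lambda>(r, v). \<i> * complex_of_real (v powr p) + (complex_of_real (Z k r) - complex_of_real (Z j r)))"
    "continuous_on ({0..b} \<times> {0..1::real}) (\<lambda>(r, v). complex_of_real (Zd k r) - complex_of_real (Zd j r))"
    unfolding case_prod_beta'
    by (intro continuous_on_add continuous_on_mult continuous_on_diff continuous_on_of_real continuous_on_const v Z_continuous_upto[OF k b(2)] Z_continuous_upto[OF j1 b(2)])+
  qed (use t0b in auto)
 then obtain x2 where d2: "((\<lambda>r. integral {0..1} (P r)) has_vector_derivative x2) (at t within {0..b})" ..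
 note ll = has_vector_derivative_diff[OF has_vector_derivative_diff[OF d1 has_vector_derivative_mult_right[OF has_vector_derivative_mult_right[OF d2]]] Gs_integral_derivative[OF b(2) t0b]]
 have "\<exists>l'. (l has_vector_derivative l') (at t within {0..b})" unfolding l_def by (rule exI, rule ll)
 then obtain l' where l': "(l has_vector_derivative l') (at t within {0..b})" by blast
 have "((\<lambda>r. boundary_value (f_map n \<beta> c W Z r) (Z k r)) has_vector_derivative l') (at t within {0..b})"
  by (rule has_vector_derivative_transform[OF t0b _ l']) (use boundary_value_eqI[OF lim] bs in auto)
 then show "(\<lambda>r. boundary_value (f_map n \<beta> c W Z r) (Z k r)) differentiable (at t within {0..})"
  by (rule Icc_derivative_differentiable[OF b(2,1) t])
qed

lemma corner_at_infinity:
 assumes k: "k \<in> {1..n}" and b1: "1 \<le> \<beta> k" and t: "t \<in> I"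
 shows "filterlim (f_map n \<beta> c W Z t) at_infinity (at (of_real (Z k t)) within \<H>)"
proof -
 have c0: "c \<noteq> 0" using c by auto
 show ?thesis unfolding f_map_eq[OF t]
  by (rule at_infinity_diff_const[OF SC_corner(2)[of n "Zs t" k c \<beta>, OF Z_sign(2)[OF _ t] Z_inj[OF t] k c0 b1]])
qed

text \<open>The same with the path from \<open>\<i>\<close> up to infinity. There the bases
  \<open>1 + Z j r * \<i> * v powr p\<close> have real part \<open>1\<close> and so stay off the
  slit.\<close>

lemma infinity_corner_motion:
 assumes b1: "(\<Sum>k=1..n. \<beta> k) > 1" and t: "t \<in> I"
 shows "(\<lambda>r. Lim half_plane_infinity (f_map n \<beta> c W Z r)) differentiable (at t within {0..})"
  "\<exists>l. (f_map n \<beta> c W Z t \<longlongrightarrow> l) half_plane_infinity"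
proof -
 define \<gamma> where "\<gamma> = 2 - (\<Sum>k=1..n. \<beta> k)"
 have \<gamma>: "\<gamma> < 1" using b1 by (simp add: \<gamma>_def)
 define p where "p = 1 / (1 - \<gamma>)"
 have p: "0 < p" using \<gamma> by (simp add: p_def)
 obtain b where b: "t < b" "b \<in> I" using I_extend[OF t] by blast
 have t0b: "t \<in> {0..b}" using b I_nonneg[OF t] by auto
 have bs: "{0..b} \<subseteq> I" by (rule I_sub[OF b(2)])
 have c0: "c \<noteq> 0" using c by auto
 define e where "e = c * cis (- pi * (\<Sum>k=1..n. \<beta> k))"
 define P where "P = (\<lambda>r v. \<Prod>j=1..n. upper_pow (1 + complex_of_real (Z j r) * (\<i> * complex_of_real (v powr p))) (- \<beta> j))"
 define l where "l = (\<lambda>r. SC n \<beta> c (Zs r) \<i> - \<i> * cis (- pi * \<gamma> / 2) / complex_of_real (1 - \<gamma>) *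
    (e * integral {0..1} (P r)) - C * complex_of_real (integral {0..r} (\<lambda>s. Gs s (W s))))"
 have v: "continuous_on ({0..b} \<times> {0..1::real}) (\<lambda>x. snd x powr p)"
  by (rule continuous_on_compose2[OF continuous_on_powr_unit[OF p]]) (auto intro: continuous_intros)
 have slit: "1 + complex_of_real x * (\<i> * complex_of_real y) \<notin> slit" for x y by (intro nonzero_Re_not_slit) simp
 have "\<exists>x. ((\<lambda>r. integral {0..1} (P r)) has_vector_derivative x) (at t within {0..b})" unfolding P_def
 proof (rule parametric_integral_derivative[where a' = "\<lambda>j r v. complex_of_real (Zd j r) * (\<i> * complex_of_real (v powr p))"])
   fix j assume j: "j \<in> {1..n}"
   show "((\<lambda>r. 1 + complex_of_real (Z j r) * (\<i> * complex_of_real (v powr p))) has_vector_derivative complex_of_real (Zd j r) * (\<i> * complex_of_real (v powr p))) (at r within {0..b})"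
    if r: "r \<in> {0..b}" for r v
    using has_vector_derivative_add[OF has_vector_derivative_const[of 1] has_vector_derivative_mult_left[OF Z_of_real_derivative[OF j b(2) r]]] by simp
   show "continuous_on ({0..b} \<times> {0..1}) (\<lambda>(r, v). 1 + complex_of_real (Z j r) * (\<i> * complex_of_real (v powr p)))"
    "continuous_on ({0..b} \<times> {0..1::real}) (\<lambda>(r, v). complex_of_real (Zd j r) * (\<i> * complex_of_real (v powr p)))"
    unfolding case_prod_beta'
    by (intro continuous_on_add continuous_on_mult continuous_on_diff continuous_on_of_real continuous_on_const v Z_continuous_upto[OF j b(2)])+
  qed (use t0b slit in auto)
 then obtain x2 where d: "((\<lambda>r. integral {0..1} (P r)) has_vector_derivative x2) (at t within {0..b})" ..
 have int: "P r integrable_on {0..1}" for r unfolding P_def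
  by (intro integrable_continuous_interval continuous_on_prod upper_pow_continuous_on continuous_on_add continuous_on_mult continuous_on_of_real
     continuous_on_const continuous_on_powr_unit[OF p] slit)
 have lim: "(f_map n \<beta> c W Z r \<longlongrightarrow> l r) half_plane_infinity" if r: "r \<in> I" for r
 proof -
  have "infinity_factor n \<beta> c (Zs r) (\<i> * complex_of_real (v powr (1 / (1 - \<gamma>)))) = e * P r v" for v
   unfolding infinity_factor_def P_def e_def p_def upper_pow_def
   by (intro arg_cong2[of _ _ _ _ "(*)"] prod.cong refl) (subst Ln_eq_upper_log_Re; simp)
  then have "(SC n \<beta> c (Zs r) \<longlongrightarrow> SC n \<beta> c (Zs r) \<i> - \<i> * cis (- pi * \<gamma> / 2) / complex_of_real (1 - \<gamma>) * integral {0..1} (\<lambda>v. e * P r v)) half_plane_infinity"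
   using SC_infinity(1)[of n "Zs r" c \<beta> "\<lambda>v. e * P r v", OF Z_sign(2)[OF _ r] c0] \<gamma> integrable_on_mult_right[OF int] by (auto simp: \<gamma>_def)
  then show ?thesis
   unfolding f_map_eq[OF r] l_def by (intro tendsto_diff tendsto_const) (simp_all only: integral_mult_right)
 qed
 show "\<exists>l. (f_map n \<beta> c W Z t \<longlongrightarrow> l) half_plane_infinity" using lim[OF t] by blast
 obtain x1 where d1: "((\<lambda>r. SC n \<beta> c (Zs r) \<i>) has_vector_derivative x1) (at t within {0..b})"
  using SC_path_derivative[OF b(2) t0b, of "\<lambda>_. \<i>" "\<lambda>_. 0"] by (auto simp: sc_domain_def upper_half_plane_def)
 note ll = has_vector_derivative_diff[OF has_vector_derivative_diff[OF d1 has_vector_derivative_mult_right[OF has_vector_derivative_mult_right[OF d]]] Gs_integral_derivative[OF b(2) t0b]]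
 have "\<exists>l'. (l has_vector_derivative l') (at t within {0..b})" unfolding l_def by (rule exI, rule ll)
 then obtain l' where l': "(l has_vector_derivative l') (at t within {0..b})" by blast
 have "Lim half_plane_infinity (f_map n \<beta> c W Z r) = l r" if "r \<in> {0..b}" for r
  by (rule tendsto_Lim[OF half_plane_infinity_nontrivial lim]) (use bs that in auto)
 then have "((\<lambda>r. Lim half_plane_infinity (f_map n \<beta> c W Z r)) has_vector_derivative l') (at t within {0..b})"
  by (intro has_vector_derivative_transform[OF t0b _ l']) auto
 then show "(\<lambda>r. Lim half_plane_infinity (f_map n \<beta> c W Z r)) differentiable (at t within {0..})"
  by (rule Icc_derivative_differentiable[OF b(2,1) t])
qed

lemma corner_at_infinity':
 assumes b1: "(\<Sum>k=1..n. \<beta> k) \<le> 1" and t: "t \<in> I"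
 shows "filterlim (f_map n \<beta> c W Z t) at_infinity half_plane_infinity"
proof -
 have c0: "c \<noteq> 0" using c by auto
 show ?thesis unfolding f_map_eq[OF t]
  by (rule at_infinity_diff_const[OF SC_infinity(2)[of n "Zs t" c \<beta>, OF Z_sign(2)[OF _ t] c0]]) (use b1 in auto)
qed

end

text \<open>Beyond the lifetime the paths are arbitrary and may fail to be integrable. As a limit of sums, the integral
has a version that is adapted at all times.\<close>

definition riemann :: "(real => real) => real" where
 "riemann f = lim (\<lambda>m. \<Sum>i<m. f (real i / real m) / real m)"

lemma measurable_riemann:
 assumes "\<And>y. y \<in> {0..1} ==> (\<lambda>w. f w y) \<in> borel_measurable N"
 shows "(\<lambda>w. riemann (f w)) \<in> borel_measurable N"
 unfolding riemann_def
proof (rule borel_measurable_lim_metric)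
 fix m
 have "(\<lambda>w. f w (real i / real m) / real m) \<in> borel_measurable N" if "i < m" for i
  using that by (intro borel_measurable_divide assms borel_measurable_const) (auto simp: field_simps)
 then show "(\<lambda>w. \<Sum>i<m. f w (real i / real m) / real m) \<in> borel_measurable N"
  by (intro borel_measurable_sum) auto
qed

lemma riemann_eq_integral:
 assumes f: "continuous_on {0..1} f" shows "riemann f = integral {0..1} f"
 unfolding riemann_def
proof (rule limI, rule LIMSEQ_I)
 fix r :: real assume r: "0 < r"
 obtain dl where dl: "0 < dl" "\<And>u v. 0 \<le> u ==> u \<le> v ==> v \<le> 1 ==> v - u < dl ==> \<bar>integral {u..v} f - f u * (v - u)\<bar> \<le> r / 2 * (v - u)"
  using integral_first_order[OF f, of "r / 2"] r by auto
 obtain m0 :: nat where m0: "0 < m0" "1 / real m0 < dl" using dl(1) by (metis nat_approx_posE of_nat_0_less_iff zero_less_Suc)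
 have "norm ((\<Sum>i<m. f (real i / real m) / real m) - integral {0..1} f) < r" if m: "m \<ge> m0" for m
 proof -
  have mp: "0 < real m" using m m0 by simp
  have "1 / real m \<le> 1 / real m0" using m m0 by (intro divide_left_mono) auto
  then have md: "1 / real m < dl" using m0 by simp
  have "\<bar>(\<Sum>i<j. f (real i / real m) / real m) - integral {0..real j / real m} f\<bar> \<le> r / 2 * (real j / real m)" if "j \<le> m" for j
   using that
  proof (induction j)
   case 0
   then show ?case by simp
  next
   case (Suc j)
   let ?u = "real j / real m" and ?v = "real (Suc j) / real m"
   have uv: "0 \<le> ?u" "?u \<le> ?v" "?v \<le> 1" "?v - ?u = 1 / real m" using Suc.prems mp by (auto simp: field_simps)
   have "f integrable_on {0..?v}" by (intro integrable_continuous_interval continuous_on_subset[OF f]) (use uv in auto)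
   then have "integral {0..?u} f + integral {?u..?v} f = integral {0..?v} f"
    by (rule Henstock_Kurzweil_Integration.integral_combine[OF uv(1,2)])
   moreover have "\<bar>integral {?u..?v} f - f ?u / real m\<bar> \<le> r / 2 * (1 / real m)"
    using dl(2)[OF uv(1-3)] uv(4) md by simp
   moreover have "r / 2 * ?v = r / 2 * ?u + r / 2 * (1 / real m)" using uv(4) by (simp add: algebra_simps add_divide_distrib)
   ultimately show ?case using Suc by simp
  qed
  from this[of m] show ?thesis using mp r by simp
 qed
 then show "\<exists>no. \<forall>m\<ge>no. norm ((\<Sum>i<m. f (real i / real m) / real m) - integral {0..1} f) < r" by blast
qed

text \<open>The samples are taken at times \<open>t * y\<close> with \<open>y \<le> 1\<close>, hence
  never after \<open>t\<close>; this keeps the version adapted.\<close>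

lemma riemann_scaled:
 assumes f: "continuous_on {0..t} f" and t: "0 \<le> t"
 shows "t * riemann (\<lambda>y. f (t * y)) = integral {0..t} f"
proof (cases "t = 0")
 case False
 then have t: "0 < t" using t by simp
 have "continuous_on {0..1} (\<lambda>y. f (t * y))"
  by (rule continuous_on_compose2[OF f]) (use t in \<open>auto intro!: continuous_intros mult_left_le\<close>)
 moreover have "((\<lambda>x. f (t * x)) has_integral (1 / \<bar>t\<bar>) *\<^sub>R integral {0..t} f) ((\<lambda>x. x / t) ` {0..t})"
  using t by (intro has_integral_stretch_real integrable_integral integrable_continuous_interval f) auto
 moreover have "(\<lambda>x. x / t) ` {0..t} = {0..1}" using t by simp
 ultimately show ?thesis using t by (simp add: riemann_eq_integral integral_unique)
qed simp

section \<open>Explosion at a finite collision time\<close>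

text \<open>A bounded integrand makes the integral Lipschitz in its upper end, so it extends
  continuously to \<open>s\<close>.\<close>

lemma integral_has_left_limit:
 fixes f :: "real => real"
 assumes f: "continuous_on {0..<s} f" and M: "\<And>t. t \<in> {0..<s} ==> \<bar>f t\<bar> \<le> M" and s: "0 < s"
 shows "\<exists>l. ((\<lambda>t. integral {0..t} f) \<longlongrightarrow> l) (at s within {0..<s})"
proof -
 have *: "\<bar>integral {0..v} f - integral {0..u} f\<bar> \<le> M * \<bar>v - u\<bar>" if u: "0 \<le> u" "u \<le> v" "v < s" for u v
 proof -
  have "f integrable_on {0..v}" by (intro integrable_continuous_interval continuous_on_subset[OF f]) (use u in auto)
  then have "integral {0..u} f + integral {u..v} f = integral {0..v} f"
   by (rule Henstock_Kurzweil_Integration.integral_combine[OF u(1,2)])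
  moreover have "norm (integral {u..v} f) \<le> M * (v - u)"
   by (rule integral_bound[OF u(2) continuous_on_subset[OF f]]) (use u M in auto)
  ultimately show ?thesis using u by simp
 qed
 have "M-lipschitz_on {0..<s} (\<lambda>t. integral {0..t} f)"
 proof (rule lipschitz_onI)
  fix x y assume "x \<in> {0..<s}" "y \<in> {0..<s}"
  then show "dist (integral {0..x} f) (integral {0..y} f) \<le> M * dist x y"
   using *[of x y] *[of y x] by (cases "x \<le> y") (auto simp: dist_real_def abs_minus_commute)
 next
  show "0 \<le> M" using M[of 0] s by auto
 qed
 then have "uniformly_continuous_on {0..<s} (\<lambda>t. integral {0..t} f)" by (rule lipschitz_on_uniformly_continuous)
 moreover have "s \<in> closure {0..<s}" using s by simp
 ultimately show ?thesis using uniformly_continuous_on_extension_at_closure by blast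
qed

lemma at_left_within_nontrivial: "0 < (s::real) ==> at s within {0..<s} \<noteq> bot"
 by (simp add: trivial_limit_within islimpt_Ico)

context sle_flow
begin

lemma q_cont: "continuous_on I q"
 unfolding q_def by (intro continuous_on_mult continuous_on_const density_log_continuous_on W_cont Z_cont Z_ne_W)

text \<open>The difference of two vertices changes at the rate
  \<open>- 2 * (Z j - Z k) / ((Z j - W) * (Z k - W))\<close>, and the modulus of the denominator is
  at least \<open>1 / K^2\<close>. So the squared difference decays no faster than
  \<open>exp (- 4 * K^2 * t)\<close>.\<close>

lemma vertices_stay_apart:
 assumes j: "j \<in> {1..n}" and k: "k \<in> {1..n}" and t: "t \<in> I"
  and K: "\<And>i r. i \<in> {1..n} ==> r \<in> I ==> 1 / \<bar>W r - Z i r\<bar> \<le> K"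
 shows "(Z j 0 - Z k 0)\<^sup>2 * exp (- 4 * K\<^sup>2 * t) \<le> (Z j t - Z k t)\<^sup>2"
proof -
 define f where "f r = (Z j r - Z k r)\<^sup>2 * exp (4 * K\<^sup>2 * r)" for r
 have "f 0 \<le> f t"
 proof (rule DERIV_nonneg_imp_increasing_open[OF I_nonneg[OF t]])
  fix x assume x: "0 < x" "x < t"
  then have xI: "x \<in> I" using I_sub[OF t] by auto
  have d: "(Z i has_real_derivative Zd i x) (at x)" if "i \<in> {1..n}" for i
   using Z_deriv[OF that t, of x "{0..t}"] x by (simp add: has_real_derivative_iff_has_vector_derivative at_within_Icc_at)
  let ?a = "Z j x - W x" and ?b = "Z k x - W x"
  have ne: "?a \<noteq> 0" "?b \<noteq> 0" using Z_ne_W[OF j xI] Z_ne_W[OF k xI] by auto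
  obtain dj dk where dd: "dj = Zd j x" "dk = Zd k x" by blast
  have "(f has_real_derivative exp (4 * K\<^sup>2 * x) * (2 * (Z j x - Z k x) * (dj - dk) + 4 * K\<^sup>2 * (Z j x - Z k x)\<^sup>2)) (at x)"
   unfolding f_def by (rule derivative_eq_intros d[OF j, folded dd] d[OF k, folded dd] refl)+ (simp add: algebra_simps)
  note df = this[unfolded dd]
  have dZ: "Zd j x - Zd k x = - 2 * (Z j x - Z k x) * (1 / ?a * (1 / ?b))"
   using ne by (simp add: divide_simps)
  have "1 / ?a * (1 / ?b) \<le> K\<^sup>2"
  proof -
   have "\<bar>1 / ?a\<bar> \<le> K" "\<bar>1 / ?b\<bar> \<le> K" using K[OF j xI] K[OF k xI] by (simp_all add: abs_minus_commute)
   then have "\<bar>1 / ?a\<bar> * \<bar>1 / ?b\<bar> \<le> K * K" by (intro mult_mono order_trans[OF abs_ge_zero] abs_ge_zero)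
   then show ?thesis unfolding power2_eq_square abs_mult[symmetric] by linarith
  qed
  then have nn: "0 \<le> 4 * (Z j x - Z k x)\<^sup>2 * (K\<^sup>2 - 1 / ?a * (1 / ?b))" by (intro mult_nonneg_nonneg) auto
  have "2 * (Z j x - Z k x) * (Zd j x - Zd k x) + 4 * K\<^sup>2 * (Z j x - Z k x)\<^sup>2 = 4 * (Z j x - Z k x)\<^sup>2 * (K\<^sup>2 - 1 / ?a * (1 / ?b))"
  proof -
   obtain m where m: "m = 1 / ?a * (1 / ?b)" by blast
   show ?thesis unfolding dZ m[symmetric] by (simp add: power2_eq_square algebra_simps)
  qed
  then have "(f has_real_derivative exp (4 * K\<^sup>2 * x) * (4 * (Z j x - Z k x)\<^sup>2 * (K\<^sup>2 - 1 / ?a * (1 / ?b)))) (at x)"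
   using df by simp
  then show "\<exists>y. (f has_real_derivative y) (at x) \<and> 0 \<le> y"
   using nn by (intro exI conjI) (assumption, intro mult_nonneg_nonneg[of "exp _"] exp_ge_zero)
 next
  show "continuous_on {0..t} f" unfolding f_def
   by (intro continuous_intros continuous_on_subset[OF Z_cont[OF j] I_sub[OF t]] continuous_on_subset[OF Z_cont[OF k] I_sub[OF t]])
 qed
 then have "(Z j 0 - Z k 0)\<^sup>2 * exp (- 4 * K\<^sup>2 * t) \<le> (Z j t - Z k t)\<^sup>2 * exp (4 * K\<^sup>2 * t) * exp (- 4 * K\<^sup>2 * t)"
  by (intro mult_right_mono) (auto simp: f_def)
 also have "\<dots> = (Z j t - Z k t)\<^sup>2" by (simp add: mult.assoc exp_add[symmetric])
 finally show ?thesis .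
qed

text \<open>Bounded reciprocals bound the drift and the velocities of the vertices, so all paths
  have limits. The bound itself keeps the limits of the vertices away from that of \<open>W\<close>,
  and \<open>vertices_stay_apart\<close> keeps them apart from each other.\<close>

lemma bounded_continuable:
 assumes \<sigma>s: "\<sigma> = ereal s" and K: "\<And>k t. k \<in> {1..n} ==> t \<in> I ==> 1 / \<bar>W t - Z k t\<bar> \<le> K"
 shows "\<exists>w' zs. all_distinct n w' zs \<and> (W \<longlongrightarrow> w') (at s within {0..<s}) \<and> (\<forall>k\<in>{1..n}. (Z k \<longlongrightarrow> zs k) (at s within {0..<s}))"
proof -
 have Is: "I = {0..<s}" by (auto simp: interval_before_def \<sigma>s)
 have s: "0 < s" using I0 Is by auto
 note nt = at_left_within_nontrivial[OF s]
 have ev: "\<forall>\<^sub>F t in at s within {0..<s}. t \<in> I" by (simp add: Is eventually_at_filter)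
 have "\<bar>drift t\<bar> \<le> (\<Sum>k=1..n. \<bar>\<kappa> / 2 * \<beta> k\<bar> * K)" if t: "t \<in> I" for t
 proof -
  have "\<bar>drift t\<bar> \<le> (\<Sum>k=1..n. \<bar>\<kappa> / 2 * \<beta> k / (W t - Z k t)\<bar>)" unfolding drift_def by (rule sum_abs)
  also have "\<dots> \<le> (\<Sum>k=1..n. \<bar>\<kappa> / 2 * \<beta> k\<bar> * K)"
  proof (rule sum_mono)
   fix k assume "k \<in> {1..n}"
   from mult_left_mono[OF K[OF this t], of "\<bar>\<kappa> / 2 * \<beta> k\<bar>"]
   show "\<bar>\<kappa> / 2 * \<beta> k / (W t - Z k t)\<bar> \<le> \<bar>\<kappa> / 2 * \<beta> k\<bar> * K"
    by (simp only: abs_divide[of "\<kappa> / 2 * \<beta> k"] times_divide_eq_right mult_1_right)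
  qed
  finally show ?thesis .
 qed
 then obtain l where l: "((\<lambda>t. integral {0..t} drift) \<longlongrightarrow> l) (at s within {0..<s})"
  using integral_has_left_limit[OF drift_cont[unfolded Is] _ s] Is by blast
 have "(b \<longlongrightarrow> b s) (at s within {0..<s})"
  by (rule tendsto_within_subset[of _ _ _ "{0..}"]) (use b_cont s in \<open>auto simp: continuous_on_def\<close>)
 then have "((\<lambda>t. sqrt \<kappa> * b t + integral {0..t} drift) \<longlongrightarrow> sqrt \<kappa> * b s + l) (at s within {0..<s})"
  by (intro tendsto_intros l)
 moreover have "\<forall>\<^sub>F t in at s within {0..<s}. sqrt \<kappa> * b t + integral {0..t} drift = W t"
  using ev by eventually_elim (use W_eq in \<open>simp add: drift_def[abs_def]\<close>)
 ultimately have w: "(W \<longlongrightarrow> sqrt \<kappa> * b s + l) (at s within {0..<s})"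
  using Lim_transform_eventually by blast
 have "\<exists>x. (Z k \<longlongrightarrow> x) (at s within {0..<s})" if k: "k \<in> {1..n}" for k
 proof -
  have "\<bar>Zd k t\<bar> \<le> 2 * K" if "t \<in> I" for t using K[OF k that] by (simp add: abs_minus_commute)
  then obtain l where l: "((\<lambda>t. integral {0..t} (Zd k)) \<longlongrightarrow> l) (at s within {0..<s})"
   using integral_has_left_limit[OF Zd_cont[OF k, unfolded Is] _ s] Is by blast
  have "((\<lambda>t. Z k 0 + integral {0..t} (Zd k)) \<longlongrightarrow> Z k 0 + l) (at s within {0..<s})"
   by (intro tendsto_intros l)
  moreover have "\<forall>\<^sub>F t in at s within {0..<s}. Z k 0 + integral {0..t} (Zd k) = Z k t"
   using ev by eventually_elim (use Z_eq[OF k] in simp)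
  ultimately show ?thesis using Lim_transform_eventually by blast
 qed
 then obtain zs where zs: "\<And>k. k \<in> {1..n} ==> (Z k \<longlongrightarrow> zs k) (at s within {0..<s})" by metis
 have "all_distinct n (sqrt \<kappa> * b s + l) zs" unfolding all_distinct_def
 proof (intro conjI inj_onI ballI)
  fix k assume k: "k \<in> {1..n}"
  have K0: "0 < K" using K[OF k I0] Z_ne_W[OF k I0] by (smt (verit) zero_less_divide_1_iff)
  have "1 / K \<le> \<bar>(sqrt \<kappa> * b s + l) - zs k\<bar>"
  proof (rule tendsto_lowerbound[OF _ _ nt])
   show "((\<lambda>t. \<bar>W t - Z k t\<bar>) \<longlongrightarrow> \<bar>(sqrt \<kappa> * b s + l) - zs k\<bar>) (at s within {0..<s})" by (intro tendsto_intros w zs k)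
   show "\<forall>\<^sub>F t in at s within {0..<s}. 1 / K \<le> \<bar>W t - Z k t\<bar>"
    using ev
   proof eventually_elim
    case (elim t)
    have "0 < \<bar>W t - Z k t\<bar>" using Z_ne_W[OF k elim] by simp
    then show ?case using K[OF k elim] K0 by (simp add: field_simps)
   qed
  qed
  moreover have "0 < 1 / K" using K0 by simp
  ultimately show "zs k \<noteq> sqrt \<kappa> * b s + l" by linarith
 next
  fix j k assume jk: "j \<in> {1..n}" "k \<in> {1..n}" "zs j = zs k"
  have "(Z j 0 - Z k 0)\<^sup>2 * exp (- 4 * K\<^sup>2 * s) \<le> (zs j - zs k)\<^sup>2"
  proof (rule tendsto_le[OF nt])
   show "((\<lambda>t. (Z j t - Z k t)\<^sup>2) \<longlongrightarrow> (zs j - zs k)\<^sup>2) (at s within {0..<s})" by (intro tendsto_intros zs jk)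
   show "((\<lambda>t. (Z j 0 - Z k 0)\<^sup>2 * exp (- 4 * K\<^sup>2 * t)) \<longlongrightarrow> (Z j 0 - Z k 0)\<^sup>2 * exp (- 4 * K\<^sup>2 * s)) (at s within {0..<s})"
    by (intro tendsto_intros)
   show "\<forall>\<^sub>F t in at s within {0..<s}. (Z j 0 - Z k 0)\<^sup>2 * exp (- 4 * K\<^sup>2 * t) \<le> (Z j t - Z k t)\<^sup>2"
    using ev by eventually_elim (rule vertices_stay_apart[OF jk(1,2) _ K])
  qed
  then have "(Z j 0 - Z k 0)\<^sup>2 \<le> 0" using jk(3) by (simp add: mult_le_0_iff)
  then have "Z j 0 = Z k 0" by simp
  then show "j = k" using inj_onD[OF Z_inj[OF I0] _ jk(1,2)] by simp
 qed
 then show ?thesis using w zs by blast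
qed

end

lemma all_distinct_before_collision:
 assumes "t \<in> interval_before (collision_time n w Z)"
 shows "all_distinct n (w t) (\<lambda>k. Z k t)"
proof -
 have "ereal t < Sup {ereal t | t. 0 \<le> t \<and> (\<forall>s\<in>{0..t}. all_distinct n (w s) (\<lambda>k. Z k s))}" "0 \<le> t"
  using assms by (auto simp: interval_before_def collision_time_def)
 then obtain t' where "ereal t < ereal t'" "\<forall>s\<in>{0..t'}. all_distinct n (w s) (\<lambda>k. Z k s)"
  by (auto simp: less_Sup_iff)
 then show ?thesis using \<open>0 \<le> t\<close> by auto
qed

lemma sle_flowI:
 assumes path: "sle_path \<kappa> n (\<lambda>k. \<kappa> / 2 * \<beta> k) z b w Z" and nc: "not_continuable n w Z"
  and \<kappa>: "0 < \<kappa>" and c: "norm c = 1" and b: "continuous_on {0..} b"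
  and z: "inj_on z {1..n}" "\<And>k. k \<in> {1..n} ==> z k \<noteq> 0"
 shows "sle_flow n \<beta> c w Z (collision_time n w Z) \<kappa> b"
proof -
 note p = path[unfolded sle_path_def]
 have p0: "w 0 = 0" "\<And>k. k \<in> {1..n} ==> Z k 0 = z k" using p by auto
 have d0: "all_distinct n (w 0) (\<lambda>k. Z k 0)"
  unfolding all_distinct_def using inj_on_cong[OF p0(2), of "{1..n}"] z p0 by simp
 then have "ereal 0 \<le> collision_time n w Z" unfolding collision_time_def by (intro Sup_upper) auto
 \<comment> \<open>At collision time \<open>0\<close> the filter in \<open>not_continuable\<close>
   is trivial, so the initial configuration itself would count as a continuation.\<close>
 moreover have "collision_time n w Z \<noteq> ereal 0"
  using nc d0 unfolding not_continuable_def by auto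
 ultimately have pos: "0 < collision_time n w Z" by (simp add: zero_ereal_def)
 have ad: "\<And>k t. k \<in> {1..n} ==> t \<in> interval_before (collision_time n w Z) ==> Z k t \<noteq> w t"
  "\<And>t. t \<in> interval_before (collision_time n w Z) ==> inj_on (\<lambda>k. Z k t) {1..n}"
  using all_distinct_before_collision unfolding all_distinct_def by blast+
 show ?thesis
  by unfold_locales (use p p0 c \<kappa> b pos ad in auto)
qed

section \<open>The SLE system\<close>

lemma density_fn_cong: "(\<And>k. k \<in> {1..n} ==> zs k = zs' k) ==> density_fn n \<beta> zs x = density_fn n \<beta> zs' x"
 unfolding density_fn_def by (intro prod.cong) auto

lemma phase_cong: "(\<And>k. k \<in> {1..n} ==> zs k = zs' k) ==> phase n \<beta> c zs x = phase n \<beta> c zs' x"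
 unfolding phase_def by (intro arg_cong2[of _ _ _ _ "(*)"] prod.cong) auto

lemma density_log_cong:
 "(\<And>k. k \<in> {1..n} ==> zs k = zs' k) ==> density_log n \<beta> zs v x = density_log n \<beta> zs' v x"
 unfolding density_log_def by (intro arg_cong2[of _ _ _ _ "(*)"] density_fn_cong sum.cong) auto

lemma measurable_density_fn:
 assumes "\<And>k. k \<in> {1..n} ==> zs k \<in> borel_measurable N" "x \<in> borel_measurable N"
 shows "(\<lambda>w. density_fn n \<beta> (\<lambda>k. zs k w) (x w)) \<in> borel_measurable N"
 unfolding density_fn_def
 by (intro borel_measurable_prod powr_real_measurable borel_measurable_abs borel_measurable_diff assms borel_measurable_const)

lemma measurable_density_log:
 assumes "\<And>k. k \<in> {1..n} ==> zs k \<in> borel_measurable N" "x \<in> borel_measurable N" "\<And>k. k \<in> {1..n} ==> v k \<in> borel_measurable N"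
 shows "(\<lambda>w. density_log n \<beta> (\<lambda>k. zs k w) (\<lambda>k. v k w) (x w)) \<in> borel_measurable N"
 unfolding density_log_def
 by (intro borel_measurable_times measurable_density_fn borel_measurable_sum borel_measurable_divide borel_measurable_diff assms borel_measurable_const)

locale sle_solution = filtered_brownian_motion M F B
 for M :: "'a measure" and F :: "real => 'a measure" and B :: "real => 'a => real" +
 fixes \<kappa> :: real and n :: nat and c :: complex and \<beta> z :: "nat => real"
  and W :: "real => 'a => real" and Z :: "nat => real => 'a => real"
 assumes \<kappa>: "0 < \<kappa>" and c: "norm c = 1"
  and z: "inj_on z {1..n}" "\<And>k. k \<in> {1..n} ==> z k \<noteq> 0"
  and sle: "sle_kappa_rho M F B \<kappa> n (\<lambda>k. \<kappa> / 2 * \<beta> k) z W Z"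
begin

abbreviation \<sigma> where "\<sigma> \<equiv> sle_lifetime n W Z"
abbreviation J where "J w \<equiv> interval_before (\<sigma> w)"

definition good :: "'a set" where
 "good = {w \<in> space M. sle_path \<kappa> n (\<lambda>k. \<kappa> / 2 * \<beta> k) z (\<lambda>t. B t w) (\<lambda>t. W t w) (\<lambda>k t. Z k t w) \<and>
   not_continuable n (\<lambda>t. W t w) (\<lambda>k t. Z k t w) \<and> continuous_on {0..} (\<lambda>t. B t w)}"

lemma AE_good: "AE w in M. w \<in> good"
proof -
 have "AE w in M. sle_path \<kappa> n (\<lambda>k. \<kappa> / 2 * \<beta> k) z (\<lambda>t. B t w) (\<lambda>t. W t w) (\<lambda>k t. Z k t w) \<and>
         not_continuable n (\<lambda>t. W t w) (\<lambda>k t. Z k t w)"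
  using sle by (simp add: sle_kappa_rho_def)
 then show ?thesis using B_AE AE_space by eventually_elim (simp add: good_def)
qed

lemma flow: "w \<in> good ==> sle_flow n \<beta> c (\<lambda>t. W t w) (\<lambda>k t. Z k t w) (\<sigma> w) \<kappa> (\<lambda>t. B t w)"
 unfolding sle_lifetime_def good_def by (rule sle_flowI) (use \<kappa> c z in auto)

lemma initial: "w \<in> good ==> W 0 w = 0" "w \<in> good ==> k \<in> {1..n} ==> Z k 0 w = z k"
 unfolding good_def sle_path_def by blast+

lemma measurable_WZ:
 assumes "0 \<le> s" "s \<le> t"
 shows "W s \<in> borel_measurable (F t)" "k \<in> {1..n} ==> Z k s \<in> borel_measurable (F t)"
proof -
 have "W s \<in> borel_measurable (F s)" "\<forall>k\<in>{1..n}. Z k s \<in> borel_measurable (F s)"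
  using sle assms(1) unfolding sle_kappa_rho_def by blast+
 then show "W s \<in> borel_measurable (F t)" "k \<in> {1..n} ==> Z k s \<in> borel_measurable (F t)"
  using measurable_F_mono[OF assms(2)] by blast+
qed

definition h where "h t w = sqrt \<kappa> * density_fn n \<beta> (\<lambda>k. Z k t w) (W t w)"
definition q where "q t w = \<kappa> / 2 * density_log n \<beta> (\<lambda>k. Z k t w) (\<lambda>_. 1) (W t w)"
definition A where "A t w = t * riemann (\<lambda>y. (h (t * y) w)\<^sup>2)"
definition rate where "rate s w = W s w * riemann (\<lambda>y. density_log n \<beta> (\<lambda>k. Z k s w) (\<lambda>k. - (2 / (Z k s w - W s w))) (y * W s w))"
definition U where "U t w = W t w * riemann (\<lambda>y. density_fn n \<beta> (\<lambda>k. Z k t w) (y * W t w)) - t * riemann (\<lambda>y. rate (t * y) w)"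
text \<open>The reciprocals make \<open>R\<close> explode at a finite collision time; the other
  terms make it dominate the processes that have to be bounded.\<close>

definition R where "R t w = (\<Sum>k=1..n. 1 / \<bar>W t w - Z k t w\<bar>) + \<bar>h t w\<bar> + \<bar>q t w\<bar> + \<bar>U t w\<bar> + \<bar>A t w\<bar>"

lemma adapted_mono:
 assumes st: "0 \<le> s" "s \<le> t"
 shows "h s \<in> borel_measurable (F t)" "rate s \<in> borel_measurable (F t)"
proof -
 note m = measurable_WZ[OF st]
 show "h s \<in> borel_measurable (F t)" unfolding h_def[abs_def]
  by (intro borel_measurable_times borel_measurable_const measurable_density_fn m)
 show "rate s \<in> borel_measurable (F t)" unfolding rate_def[abs_def]
  by (intro borel_measurable_times borel_measurable_const measurable_density_log m measurable_riemann borel_measurable_uminus borel_measurable_divide borel_measurable_diff)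
qed

lemma adapted:
 assumes t: "0 \<le> t"
 shows "h t \<in> borel_measurable (F t)" "q t \<in> borel_measurable (F t)" "A t \<in> borel_measurable (F t)"
  "U t \<in> borel_measurable (F t)" "R t \<in> borel_measurable (F t)"
proof -
 note m = measurable_WZ[OF t order_refl]
 show h: "h t \<in> borel_measurable (F t)" by (rule adapted_mono[OF t order_refl])
 show q: "q t \<in> borel_measurable (F t)" unfolding q_def[abs_def]
  by (intro borel_measurable_times borel_measurable_const measurable_density_log m)
 have ty: "0 \<le> t * y \<and> t * y \<le> t" if "y \<in> {0..1}" for y using that t by (auto intro: mult_left_le)
 show A: "A t \<in> borel_measurable (F t)" unfolding A_def[abs_def]
  by (intro borel_measurable_times borel_measurable_const measurable_riemann borel_measurable_power adapted_mono) (use ty in auto)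
 show U: "U t \<in> borel_measurable (F t)" unfolding U_def[abs_def]
  by (intro borel_measurable_diff borel_measurable_times borel_measurable_const measurable_riemann measurable_density_fn adapted_mono m) (use ty in auto)
 show "R t \<in> borel_measurable (F t)" unfolding R_def[abs_def]
  by (intro borel_measurable_add borel_measurable_sum borel_measurable_divide borel_measurable_const borel_measurable_abs borel_measurable_diff m h q A U)
qed

lemma processes_eq:
 assumes w: "w \<in> good" and t: "t \<in> J w"
 shows "h t w = sle_flow.h n \<beta> (\<lambda>t. W t w) (\<lambda>k t. Z k t w) \<kappa> t"
  "q t w = sle_flow.q n \<beta> (\<lambda>t. W t w) (\<lambda>k t. Z k t w) \<kappa> t"
  "A t w = sle_flow.A n \<beta> (\<lambda>t. W t w) (\<lambda>k t. Z k t w) \<kappa> t"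
  "U t w = sc_flow.U n \<beta> (\<lambda>t. W t w) (\<lambda>k t. Z k t w) t"
proof -
 interpret fl: sle_flow n \<beta> c "\<lambda>t. W t w" "\<lambda>k t. Z k t w" "\<sigma> w" \<kappa> "\<lambda>t. B t w" by (rule flow[OF w])
 note t0 = fl.I_nonneg[OF t] and sub = fl.I_sub[OF t]
 have heq: "h s w = fl.h s" for s by (simp add: h_def fl.h_def)
 show "h t w = fl.h t" by (rule heq)
 show "q t w = fl.q t" by (simp add: q_def fl.q_def)
 show "A t w = fl.A t" unfolding A_def fl.A_def heq
  by (rule riemann_scaled[OF continuous_on_power[OF continuous_on_subset[OF fl.h_cont sub]] t0])
 have rate: "rate s w = fl.Gs s (W s w)" if s: "s \<in> J w" for s
  unfolding rate_def fl.Gs_def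
 proof (subst riemann_eq_integral)
  show "continuous_on {0..1} (\<lambda>y. density_log n \<beta> (\<lambda>k. Z k s w) (\<lambda>k. - (2 / (Z k s w - W s w))) (y * W s w))"
   by (intro density_log_continuous_on continuous_intros) (use fl.D_not_vertex[OF fl.D_scale[OF fl.D_W[OF s]]] in auto)
 qed simp
 have "t * riemann (\<lambda>y. rate (t * y) w) = integral {0..t} (\<lambda>s. rate s w)"
 proof (rule riemann_scaled[OF _ t0])
  show "continuous_on {0..t} (\<lambda>s. rate s w)"
   by (rule continuous_on_eq[OF continuous_on_subset[OF fl.Gs_W_continuous sub]]) (use rate sub in auto)
 qed
 also have "\<dots> = integral {0..t} (\<lambda>s. fl.Gs s (W s w))" by (intro integral_cong rate) (use sub in auto)
 finally have 1: "t * riemann (\<lambda>y. rate (t * y) w) = integral {0..t} (\<lambda>s. fl.Gs s (W s w))" .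
 have "riemann (\<lambda>y. density_fn n \<beta> (\<lambda>k. Z k t w) (y * W t w)) = integral {0..1} (\<lambda>y. density_fn n \<beta> (\<lambda>k. Z k t w) (y * W t w))"
  by (intro riemann_eq_integral density_fn_continuous_on continuous_intros) (use fl.D_not_vertex[OF fl.D_scale[OF fl.D_W[OF t]]] in auto)
 then show "U t w = fl.U t" unfolding U_def fl.U_def real_sc_def 1 by simp
qed

lemma continuous_processes:
 assumes w: "w \<in> good"
 shows "continuous_on (J w) (\<lambda>t. U t w)" "continuous_on (J w) (\<lambda>t. A t w)"
  "continuous_on (J w) (\<lambda>t. R t w)"
proof -
 interpret fl: sle_flow n \<beta> c "\<lambda>t. W t w" "\<lambda>k t. Z k t w" "\<sigma> w" \<kappa> "\<lambda>t. B t w" by (rule flow[OF w])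
 note eq = processes_eq[OF w]
 show U: "continuous_on (J w) (\<lambda>t. U t w)"
  by (rule continuous_on_eq[OF fl.U_cont]) (simp add: eq)
 show A: "continuous_on (J w) (\<lambda>t. A t w)"
  by (rule continuous_on_eq[OF fl.A_cont]) (simp add: eq)
 have h: "continuous_on (J w) (\<lambda>t. h t w)"
  by (rule continuous_on_eq[OF fl.h_cont]) (simp add: eq)
 have q: "continuous_on (J w) (\<lambda>t. q t w)"
  by (rule continuous_on_eq[OF fl.q_cont]) (simp add: eq)
 have ne: "\<bar>W t w - Z k t w\<bar> \<noteq> 0" if "k \<in> {1..n}" "t \<in> J w" for k t
  using fl.Z_ne_W[OF that] by simp
 show "continuous_on (J w) (\<lambda>t. R t w)" unfolding R_def
  by (intro continuous_on_add continuous_on_sum continuous_on_divide continuous_on_rabs continuous_on_diff continuous_on_const fl.W_cont fl.Z_cont h q U A)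
    (use ne in auto)
qed

text \<open>A bounded \<open>R\<close> bounds all reciprocal distances, and then the path could be
  continued.\<close>

lemma explosion:
 assumes w: "w \<in> good" and s: "\<sigma> w = ereal s"
 shows "\<exists>t\<in>J w. K \<le> R t w"
proof (rule ccontr)
 assume n: "\<not> (\<exists>t\<in>J w. K \<le> R t w)"
 interpret fl: sle_flow n \<beta> c "\<lambda>t. W t w" "\<lambda>k t. Z k t w" "\<sigma> w" \<kappa> "\<lambda>t. B t w" by (rule flow[OF w])
 have "1 / \<bar>W t w - Z k t w\<bar> \<le> K" if k: "k \<in> {1..n}" and t: "t \<in> J w" for k t
 proof -
  have "1 / \<bar>W t w - Z k t w\<bar> \<le> (\<Sum>k=1..n. 1 / \<bar>W t w - Z k t w\<bar>)" by (rule member_le_sum[OF k]) auto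
  also have "\<dots> \<le> R t w" by (simp add: R_def)
  also have "\<dots> \<le> K" using n t by (auto simp: not_le intro: less_imp_le)
  finally show ?thesis .
 qed
 from fl.bounded_continuable[OF s this]
 show False using w s by (auto simp: good_def not_continuable_def sle_lifetime_def)
qed

text \<open>The sign \<open>e\<close> prepares for a phase that is real, hence \<open>1\<close> or
  \<open>-1\<close>; it scales \<open>U\<close>, \<open>h\<close> and \<open>q\<close> and leaves
  the clock unchanged. The constant is the initial value of \<open>R\<close>, where \<open>U\<close>
  and \<open>A\<close> vanish.\<close>

lemma stopped_ito:
 assumes e: "\<bar>e\<bar> = 1"
 shows "stopped_ito M F B \<sigma> (\<lambda>t w. e * U t w) (\<lambda>t w. e * h t w) (\<lambda>t w. e * q t w) A R
   ((\<Sum>k=1..n. 1 / \<bar>z k\<bar>) + \<bar>sqrt \<kappa> * density_fn n \<beta> z 0\<bar> + \<bar>\<kappa> / 2 * density_log n \<beta> z (\<lambda>_. 1) 0\<bar>) good"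
proof (unfold_locales, goal_cases)
 case 1
 then show ?case by (auto simp: good_def)
next
 case 2
 then show ?case by (rule AE_good)
next
 case (3 t)
 then show ?case by (intro borel_measurable_times borel_measurable_const adapted)
next
 case (4 t)
 then show ?case by (intro borel_measurable_times borel_measurable_const adapted)
next
 case (5 t)
 then show ?case by (intro borel_measurable_times borel_measurable_const adapted)
next
 case (6 t)
 then show ?case by (rule adapted)
next
 case (7 t)
 then show ?case by (rule adapted)
next
 case (8 w)
 then interpret fl: sle_flow n \<beta> c "\<lambda>t. W t w" "\<lambda>k t. Z k t w" "\<sigma> w" \<kappa> "\<lambda>t. B t w" by (rule flow)
 show ?case by (rule fl.\<sigma>0)
next
 case (9 w)
 then show ?case by (intro continuous_on_mult continuous_on_const continuous_processes)
next
 case (10 w)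
 then show ?case by (rule continuous_processes)
next
 case (11 w)
 then show ?case by (rule continuous_processes)
next
 case (12 w t)
 then show ?case using e by (auto simp: R_def abs_mult sum_nonneg intro!: add_increasing add_nonneg_nonneg)
next
 case (13 w)
 have A0: "A 0 w = 0" by (simp add: A_def)
 have U0: "U 0 w = 0" by (simp add: U_def initial[OF 13])
 have "density_fn n \<beta> (\<lambda>k. Z k 0 w) 0 = density_fn n \<beta> z 0" "density_log n \<beta> (\<lambda>k. Z k 0 w) (\<lambda>_. 1) 0 = density_log n \<beta> z (\<lambda>_. 1) 0"
  using initial(2)[OF 13] by (auto intro: density_fn_cong density_log_cong)
 then show ?case unfolding R_def h_def q_def A0 U0 using initial[OF 13] by simp
next
 case 14
 then show ?case by (intro add_nonneg_nonneg sum_nonneg) auto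
next
 case (15 w s K)
 then show ?case by (rule explosion)
next
 case (16 w)
 show ?case by (simp add: A_def)
next
 case (17 w s t)
 interpret fl: sle_flow n \<beta> c "\<lambda>t. W t w" "\<lambda>k t. Z k t w" "\<sigma> w" \<kappa> "\<lambda>t. B t w" by (rule flow[OF 17(1)])
 have "s \<in> J w" using 17 fl.I_sub[of t] by auto
 then show ?case using fl.A_strict_mono[of t s] 17 processes_eq(3)[OF 17(1)] by simp
next
 case (18 w eps T)
 interpret fl: sle_flow n \<beta> c "\<lambda>t. W t w" "\<lambda>k t. Z k t w" "\<sigma> w" \<kappa> "\<lambda>t. B t w" by (rule flow[OF 18(1)])
 obtain dl where dl: "0 < dl" "\<And>u v. 0 \<le> u ==> u \<le> v ==> v \<le> T ==> v - u < dl ==>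
   \<bar>fl.U v - fl.U u - (fl.h u * (B v w - B u w) + fl.q u * ((B v w - B u w)\<^sup>2 - (v - u)))\<bar> \<le> eps * ((v - u) + (B v w - B u w)\<^sup>2)"
  using fl.expansion_U[OF 18(2,3)] by blast
 show ?case
 proof (intro exI[of _ dl] conjI allI impI dl(1))
  fix u v assume uv: "0 \<le> u \<and> u \<le> v \<and> v \<le> T \<and> v - u < dl"
  then have uI: "u \<in> J w" and vI: "v \<in> J w" using fl.I_sub[OF 18(2)] by auto
  have "e * U v w - e * U u w - (e * h u w * (B v w - B u w) + e * q u w * ((B v w - B u w)\<^sup>2 - (v - u)))
    = e * (fl.U v - fl.U u - (fl.h u * (B v w - B u w) + fl.q u * ((B v w - B u w)\<^sup>2 - (v - u))))"
   unfolding processes_eq[OF 18(1) uI] processes_eq[OF 18(1) vI] by (simp add: algebra_simps)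
  then show "\<bar>e * U v w - e * U u w - (e * h u w * (B v w - B u w) + e * q u w * ((B v w - B u w)\<^sup>2 - (v - u)))\<bar>
    \<le> eps * ((v - u) + (B v w - B u w)\<^sup>2)" using dl(2)[of u v] uv e by (simp add: abs_mult)
 qed
next
 case (19 w eps T)
 interpret fl: sle_flow n \<beta> c "\<lambda>t. W t w" "\<lambda>k t. Z k t w" "\<sigma> w" \<kappa> "\<lambda>t. B t w" by (rule flow[OF 19(1)])
 obtain dl where dl: "0 < dl" "\<And>u v. 0 \<le> u ==> u \<le> v ==> v \<le> T ==> v - u < dl ==>
   \<bar>fl.A v - fl.A u - (fl.h u)\<^sup>2 * (v - u)\<bar> \<le> eps * (v - u)"
  using fl.expansion_A[OF 19(2,3)] by blast
 have e2: "e\<^sup>2 = 1" using e by (metis power2_abs one_power2)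
 show ?case
 proof (intro exI[of _ dl] conjI allI impI dl(1))
  fix u v assume uv: "0 \<le> u \<and> u \<le> v \<and> v \<le> T \<and> v - u < dl"
  then have uI: "u \<in> J w" and vI: "v \<in> J w" using fl.I_sub[OF 19(2)] by auto
  have "\<bar>A v w - A u w - (e * h u w)\<^sup>2 * (v - u)\<bar> \<le> eps * (v - u)"
   unfolding processes_eq[OF 19(1) uI] processes_eq[OF 19(1) vI] power_mult_distrib e2 using dl(2)[of u v] uv by simp
  also have "\<dots> \<le> eps * ((v - u) + (B v w - B u w)\<^sup>2)" using 19(3) by (intro mult_left_mono) auto
  finally show "\<bar>A v w - A u w - (e * h u w)\<^sup>2 * (v - u)\<bar> \<le> eps * ((v - u) + (B v w - B u w)\<^sup>2)" .
 qed
qed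

lemma U_process_eq:
 assumes w: "w \<in> good" and t: "t \<in> J w"
 shows "U_process n \<beta> c W Z t w = phase n \<beta> c z 0 * of_real (U t w)"
proof -
 interpret fl: sle_flow n \<beta> c "\<lambda>t. W t w" "\<lambda>k t. Z k t w" "\<sigma> w" \<kappa> "\<lambda>t. B t w" by (rule flow[OF w])
 have "phase n \<beta> c z 0 = fl.C" unfolding fl.C_def by (rule phase_cong) (simp add: initial[OF w])
 then show ?thesis unfolding U_process_def using fl.boundary_value_f_map[OF t] processes_eq(4)[OF w t] by simp
qed

text \<open>The complex phase is carried along as a constant factor of the real process
  \<open>U\<close>.\<close>

theorem martingale_U: "martingale_before M F \<sigma> (U_process n \<beta> c W Z)"
proof -
 interpret si: stopped_ito M F B \<sigma> "\<lambda>t w. 1 * U t w" "\<lambda>t w. 1 * h t w" "\<lambda>t w. 1 * q t w" A R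
  "(\<Sum>k=1..n. 1 / \<bar>z k\<bar>) + \<bar>sqrt \<kappa> * density_fn n \<beta> z 0\<bar> + \<bar>\<kappa> / 2 * density_log n \<beta> z (\<lambda>_. 1) 0\<bar>" good
  by (rule stopped_ito) simp
 show ?thesis
  by (rule si.martingale_before_stopped[where c = "phase n \<beta> c z 0"]) (use AE_good in \<open>eventually_elim, simp add: U_process_eq\<close>, simp)
qed

lemma A_process_eq:
 assumes w: "w \<in> good" and t: "t \<in> J w" and ph: "(phase n \<beta> c z 0)\<^sup>2 = 1"
 shows "A_process \<kappa> n \<beta> c W Z t w = complex_of_real (A t w)"
proof -
 interpret fl: sle_flow n \<beta> c "\<lambda>t. W t w" "\<lambda>k t. Z k t w" "\<sigma> w" \<kappa> "\<lambda>t. B t w" by (rule flow[OF w])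
 have C: "phase n \<beta> c z 0 = fl.C" unfolding fl.C_def by (rule phase_cong) (simp add: initial[OF w])
 have sub: "{0..t} \<subseteq> J w" by (rule fl.I_sub[OF t])
 have i: "(\<lambda>s. (fl.h s)\<^sup>2) integrable_on {0..t}"
  by (intro integrable_continuous_interval continuous_on_power continuous_on_subset[OF fl.h_cont sub])
 have "((\<lambda>s. (boundary_value (deriv (SC n \<beta> c (\<lambda>k. Z k s w))) (W s w))\<^sup>2) has_integral complex_of_real (fl.A t / \<kappa>)) {0..t}"
 proof (rule has_integral_eq[rotated])
  show "((\<lambda>s. complex_of_real ((fl.h s)\<^sup>2 / \<kappa>)) has_integral complex_of_real (fl.A t / \<kappa>)) {0..t}"
   unfolding fl.A_def by (intro has_integral_of_real has_integral_divide integrable_integral i)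
  fix s assume s: "s \<in> {0..t}"
  then have sI: "s \<in> J w" using sub by auto
  show "complex_of_real ((fl.h s)\<^sup>2 / \<kappa>) = (boundary_value (deriv (SC n \<beta> c (\<lambda>k. Z k s w))) (W s w))\<^sup>2"
   unfolding fl.boundary_value_deriv_SC[OF sI] power_mult_distrib ph[unfolded C] fl.h_def using \<kappa> by simp
 qed
 from integral_unique[OF this] show ?thesis
  unfolding A_process_def processes_eq(3)[OF w t] using \<kappa> by simp
qed

text \<open>The phase is unimodular and the density is positive, so a real derivative at
  \<open>0\<close> leaves only the phases \<open>1\<close> and \<open>-1\<close>.\<close>

lemma real_branch_phase:
 assumes "real_branch n \<beta> c z"
 obtains e where "\<bar>e\<bar> = 1" "phase n \<beta> c z 0 = of_real e"
proof -
 have nz: "\<And>k. k \<in> {1..n} ==> z k \<noteq> 0" by (rule z)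
 have "boundary_value (deriv (SC n \<beta> c z)) 0 = phase n \<beta> c z 0 * of_real (density_fn n \<beta> z 0)"
  using boundary_value_eqI[of "deriv (SC n \<beta> c z)" _ 0] SC_boundary(3)[of n z 0 \<beta> c, OF nz nz] slit_integrand_of_real[of n z 0 \<beta> c, OF nz] by simp
 then have "phase n \<beta> c z 0 * of_real (density_fn n \<beta> z 0) / of_real (density_fn n \<beta> z 0) \<in> \<real>"
  using assms unfolding real_branch_def by (intro Reals_divide) auto
 then have "phase n \<beta> c z 0 \<in> \<real>" using density_fn_pos[of n z 0 \<beta>, OF nz] by simp
 then obtain e where e: "phase n \<beta> c z 0 = of_real e" by (auto elim: Reals_cases)
 then have "\<bar>e\<bar> = 1" using norm_phase[of n \<beta> c z 0] c by simp
 then show ?thesis using e that by blast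
qed

text \<open>The square of the phase is \<open>1\<close>, so the complex clock is the real
  \<open>A\<close>. The sign goes into \<open>e * U\<close>, to which the time change is
  applied.\<close>

theorem brownian_motion_U:
 assumes rb: "real_branch n \<beta> c z"
 shows "brownian_motion_before M (A_total \<kappa> n \<beta> c W Z) (\<lambda>t w. U_process n \<beta> c W Z (tau_process \<kappa> n \<beta> c W Z t w) w)"
proof -
 obtain e where e: "\<bar>e\<bar> = 1" "phase n \<beta> c z 0 = of_real e" using real_branch_phase[OF rb] .
 have ph: "(phase n \<beta> c z 0)\<^sup>2 = 1"
 proof -
  have "e\<^sup>2 = 1" using e(1) by (metis power2_abs one_power2)
  then show ?thesis unfolding e(2) by (metis of_real_1 of_real_power)
 qed
 interpret si: stopped_ito M F B \<sigma> "\<lambda>t w. e * U t w" "\<lambda>t w. e * h t w" "\<lambda>t w. e * q t w" A R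
  "(\<Sum>k=1..n. 1 / \<bar>z k\<bar>) + \<bar>sqrt \<kappa> * density_fn n \<beta> z 0\<bar> + \<bar>\<kappa> / 2 * density_log n \<beta> z (\<lambda>_. 1) 0\<bar>" good
  by (rule stopped_ito[OF e(1)])
 show ?thesis
 proof (rule si.brownian_motion_before_time_change)
  show "e * U 0 w = 0" if "w \<in> good" for w by (simp add: U_def initial[OF that])
  show "AE w in M. A_total \<kappa> n \<beta> c W Z w = si.total w"
   using AE_good
  proof eventually_elim
   case (elim w)
   have "(\<lambda>t. ereal (Re (A_process \<kappa> n \<beta> c W Z t w))) ` J w = (\<lambda>t. ereal (A t w)) ` J w"
    using A_process_eq[OF elim _ ph] by (intro image_cong) auto
   then show ?case unfolding A_total_def si.total_def by simp
  qed
  show "AE w in M. \<forall>r\<in>J w. U_process n \<beta> c W Z (tau_process \<kappa> n \<beta> c W Z (A r w) w) w = of_real (e * U r w)"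
   using AE_good
  proof eventually_elim
   case (elim w)
   show ?case
   proof
    fix r assume r: "r \<in> J w"
    have "tau_process \<kappa> n \<beta> c W Z (A r w) w = r" unfolding tau_process_def
    proof (rule the_equality)
     show "r \<in> J w \<and> A_process \<kappa> n \<beta> c W Z r w = of_real (A r w)"
      using r A_process_eq[OF elim r ph] by simp
     fix s assume s: "s \<in> J w \<and> A_process \<kappa> n \<beta> c W Z s w = of_real (A r w)"
     then have "A s w = A r w" using A_process_eq[OF elim _ ph] by auto
     then show "s = r" using si.A_mono[OF elim, of s r] si.A_mono[OF elim, of r s] s r
      by (cases s r rule: linorder_cases) (auto simp: interval_before_def)
    qed
    then show "U_process n \<beta> c W Z (tau_process \<kappa> n \<beta> c W Z (A r w) w) w = of_real (e * U r w)"
     using U_process_eq[OF elim r] e(2) by simp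
   qed
  qed
 qed
qed

theorem AE_corners:
 "AE w in M. (\<forall>k\<in>{1..n}. corner_motion_differentiable n \<beta> c (\<lambda>t. W t w) (\<lambda>k t. Z k t w) k) \<and>
   infinity_corner_motion_differentiable n \<beta> c (\<lambda>t. W t w) (\<lambda>k t. Z k t w) \<and>
   (\<forall>t\<in>J w. edges_straight n \<beta> (\<lambda>k. Z k t w) (SC n \<beta> c (\<lambda>k. Z k t w)))"
 using AE_good
proof eventually_elim
 case (elim w)
 interpret fl: sle_flow n \<beta> c "\<lambda>t. W t w" "\<lambda>k t. Z k t w" "\<sigma> w" \<kappa> "\<lambda>t. B t w" by (rule flow[OF elim])
 show ?case
 proof (intro conjI ballI)
  fix k assume k: "k \<in> {1..n}"
  show "corner_motion_differentiable n \<beta> c (\<lambda>t. W t w) (\<lambda>k t. Z k t w) k"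
   unfolding corner_motion_differentiable_def sle_lifetime_def[symmetric]
   using fl.finite_corner_motion[OF k] fl.corner_at_infinity[OF k] by auto
 next
  show "infinity_corner_motion_differentiable n \<beta> c (\<lambda>t. W t w) (\<lambda>k t. Z k t w)"
   unfolding infinity_corner_motion_differentiable_def sle_lifetime_def[symmetric]
   using fl.infinity_corner_motion fl.corner_at_infinity' by auto
 next
  fix t assume t: "t \<in> J w"
  show "edges_straight n \<beta> (\<lambda>k. Z k t w) (SC n \<beta> c (\<lambda>k. Z k t w))"
   by (rule edges_straight_SC[OF fl.Z_sign(2)[OF _ t] fl.Z_inj[OF t] c])
 qed
qed

end

lemma sle_kappa_rho_cong:
 assumes "\<And>k. k \<in> {1..n} ==> \<rho> k = \<rho>' k" "sle_kappa_rho M F B \<kappa> n \<rho> z W Z"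
 shows "sle_kappa_rho M F B \<kappa> n \<rho>' z W Z"
proof -
 have "(\<Sum>k=1..n. \<rho> k / x k) = (\<Sum>k=1..n. \<rho>' k / x k)" for x :: "nat => real"
  by (intro sum.cong) (use assms(1) in auto)
 then show ?thesis using assms(2) unfolding sle_kappa_rho_def sle_path_def by simp
qed

text \<open>The rotation that sends \<open>i\<close> to \<open>Suc ((m + i) mod n)\<close> runs
  through all indices, and \<open>z\<close> increases strictly along it.\<close>

lemma positive_cyclic_order_inj_on:
 assumes "positive_cyclic_order n z" shows "inj_on z {1..n}"
proof (cases "n = 0")
 case False
 obtain m where m: "\<And>i j. i < j ==> j < n ==> z (Suc ((m + i) mod n)) < z (Suc ((m + j) mod n))"
  using assms by (auto simp: positive_cyclic_order_def)
 have ex: "\<exists>i<n. a = Suc ((m + i) mod n)" if "a \<in> {1..n}" for a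
 proof (intro exI conjI)
  show "(a - 1 + (n - m mod n)) mod n < n" using False by simp
  \<comment> \<open>The witness is \<open>a - 1 - m\<close> modulo \<open>n\<close>, with
    \<open>n\<close> added to keep the subtraction within the natural numbers.\<close>
  have "(m + (a - 1 + (n - m mod n)) mod n) mod n = (m mod n + (n - m mod n) + (a - 1)) mod n"
   by (simp add: mod_simps algebra_simps)
  also have "m mod n + (n - m mod n) = n" using False by (simp add: less_imp_le)
  finally show "a = Suc ((m + (a - 1 + (n - m mod n)) mod n) mod n)" using that by auto
 qed
 show ?thesis
 proof (rule inj_onI)
  fix a b assume ab: "a \<in> {1..n}" "b \<in> {1..n}" "z a = z b"
  obtain i j where ij: "i < n" "a = Suc ((m + i) mod n)" "j < n" "b = Suc ((m + j) mod n)"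
   using ex[OF ab(1)] ex[OF ab(2)] by blast
  then show "a = b" using m[of i j] m[of j i] ab(3) by (cases i j rule: linorder_cases) auto
 qed
qed simp

text \<open>Both halves are instances of \<open>sle_solution\<close>. For a polygon the cyclic order
  makes the points distinct; for arbitrary weights
  \<open>\<beta> k = 2 * \<rho> k / \<kappa>\<close> is solved for \<open>\<rho> k\<close>.\<close>

theorem mainTheorem2:
  fixes M :: "'a measure" and F :: "real \<Rightarrow> 'a measure" and B :: "real \<Rightarrow> 'a \<Rightarrow> real"
    and \<kappa> :: real and n :: nat and c :: complex
  assumes "\<kappa> > 0"
    and "complete_filtered_space M F"
    and "brownian_motion M F B"
    and "norm c = 1"
  shows
    "(\<comment> \<open>the system associated with a polygon\<close>
      \<forall>D p \<beta> \<phi> z \<rho> W Z.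
       polygon_with_corners D n p \<beta> \<and>
       conformal_onto_half_plane D \<phi> \<and>
       (\<forall>k\<in>{1..n}. prime_end_image \<phi> (p k) (z k) \<and> z k \<noteq> 0) \<and>
       positive_cyclic_order n z \<and>
       (\<forall>k\<in>{1..n}. \<rho> k = \<kappa> / 2 * \<beta> k) \<and>
       sle_kappa_rho M F B \<kappa> n \<rho> z W Z \<longrightarrow>
         martingale_before M F (sle_lifetime n W Z) (U_process n \<beta> c W Z) \<and>
         (real_branch n \<beta> c z \<longrightarrow>
            brownian_motion_before M (A_total \<kappa> n \<beta> c W Z)
              (\<lambda>t \<omega>. U_process n \<beta> c W Z (tau_process \<kappa> n \<beta> c W Z t \<omega>) \<omega>)) \<and>
         (AE \<omega> in M. \<forall>k\<in>{1..n}.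
            corner_motion_differentiable n \<beta> c (\<lambda>t. W t \<omega>) (\<lambda>k t. Z k t \<omega>) k)) \<and>
     (\<comment> \<open>arbitrary points and weights\<close>
      \<forall>\<beta> z \<rho> W Z.
       inj_on z {1..n} \<and> (\<forall>k\<in>{1..n}. z k \<noteq> 0) \<and>
       (\<forall>k\<in>{1..n}. \<beta> k = 2 * \<rho> k / \<kappa>) \<and>
       sle_kappa_rho M F B \<kappa> n \<rho> z W Z \<longrightarrow>
         martingale_before M F (sle_lifetime n W Z) (U_process n \<beta> c W Z) \<and>
         (real_branch n \<beta> c z \<longrightarrow>
            brownian_motion_before M (A_total \<kappa> n \<beta> c W Z)
              (\<lambda>t \<omega>. U_process n \<beta> c W Z (tau_process \<kappa> n \<beta> c W Z t \<omega>) \<omega>)) \<and>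
         (AE \<omega> in M.
            (\<forall>k\<in>{1..n}.
               corner_motion_differentiable n \<beta> c (\<lambda>t. W t \<omega>) (\<lambda>k t. Z k t \<omega>) k) \<and>
            ((\<Sum>k=1..n. \<beta> k) \<noteq> 2 \<longrightarrow>
               infinity_corner_motion_differentiable n \<beta> c (\<lambda>t. W t \<omega>) (\<lambda>k t. Z k t \<omega>)) \<and>
            (\<forall>t\<in>interval_before (sle_lifetime n W Z \<omega>).
               edges_straight n \<beta> (\<lambda>k. Z k t \<omega>) (SC n \<beta> c (\<lambda>k. Z k t \<omega>)))))"
proof -
 have sol: "sle_solution M F B \<kappa> n c \<beta> z W Z"
  if "inj_on z {1..n}" "\<forall>k\<in>{1..n}. z k \<noteq> 0" "\<forall>k\<in>{1..n}. \<rho> k = \<kappa> / 2 * \<beta> k" "sle_kappa_rho M F B \<kappa> n \<rho> z W Z" for \<beta> z \<rho> W Z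
 proof -
  have "sle_kappa_rho M F B \<kappa> n (\<lambda>k. \<kappa> / 2 * \<beta> k) z W Z" by (rule sle_kappa_rho_cong[OF _ that(4)]) (use that(3) in auto)
  then show ?thesis using assms that by unfold_locales auto
 qed
 show ?thesis
 proof (intro conjI allI impI; (elim conjE)?)
  fix D p \<beta> \<phi> z \<rho> W Z
  assume "\<forall>k\<in>{1..n}. prime_end_image \<phi> (p k) (z k) \<and> z k \<noteq> 0" "positive_cyclic_order n z"
   "\<forall>k\<in>{1..n}. \<rho> k = \<kappa> / 2 * \<beta> k" "sle_kappa_rho M F B \<kappa> n \<rho> z W Z"
  then interpret sle_solution M F B \<kappa> n c \<beta> z W Z
   by (intro sol positive_cyclic_order_inj_on) auto
  show "martingale_before M F (sle_lifetime n W Z) (U_process n \<beta> c W Z)" by (rule martingale_U)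
  show "brownian_motion_before M (A_total \<kappa> n \<beta> c W Z)
       (\<lambda>t w. U_process n \<beta> c W Z (tau_process \<kappa> n \<beta> c W Z t w) w)" if "real_branch n \<beta> c z"
   by (rule brownian_motion_U[OF that])
  show "AE w in M. \<forall>k\<in>{1..n}. corner_motion_differentiable n \<beta> c (\<lambda>t. W t w) (\<lambda>k t. Z k t w) k"
   using AE_corners by eventually_elim blast
 next
  fix \<beta> z \<rho> W Z
  assume a: "inj_on z {1..n}" "\<forall>k\<in>{1..n}. z k \<noteq> 0" "\<forall>k\<in>{1..n}. \<beta> k = 2 * \<rho> k / \<kappa>" "sle_kappa_rho M F B \<kappa> n \<rho> z W Z"
  have "\<forall>k\<in>{1..n}. \<rho> k = \<kappa> / 2 * \<beta> k" using a(3) assms(1) by simp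
  then interpret sle_solution M F B \<kappa> n c \<beta> z W Z by (rule sol[OF a(1,2) _ a(4)])
  show "martingale_before M F (sle_lifetime n W Z) (U_process n \<beta> c W Z)" by (rule martingale_U)
  show "brownian_motion_before M (A_total \<kappa> n \<beta> c W Z)
       (\<lambda>t w. U_process n \<beta> c W Z (tau_process \<kappa> n \<beta> c W Z t w) w)" if "real_branch n \<beta> c z"
   by (rule brownian_motion_U[OF that])
  show "AE w in M.
      (\<forall>k\<in>{1..n}.
        corner_motion_differentiable n \<beta> c (\<lambda>t. W t w) (\<lambda>k t. Z k t w) k) \<and>
      ((\<Sum>k=1..n. \<beta> k) \<noteq> 2 -->
        infinity_corner_motion_differentiable n \<beta> c (\<lambda>t. W t w) (\<lambda>k t. Z k t w)) \<and>
      (\<forall>t\<in>interval_before (sle_lifetime n W Z w).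
        edges_straight n \<beta> (\<lambda>k. Z k t w) (SC n \<beta> c (\<lambda>k. Z k t w)))"
   using AE_corners by eventually_elim blast
 qed
qed

end
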